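(* Let $\Lambda=KQ/I$ be a quadratic Nakayama algebra. Let $P_1,\dots,P_t$ be the indecomposable projective-injective $\Lambda$-modules (up to isomorphism), of lengths $n_1,\dots,n_t$; let $\mathcal G=\mathrm{gen}(D\Lambda)\cap\mathrm{cogen}(\Lambda)$; let $g$ be the number of simple $\Lambda$-modules in $\mathcal G$ (equivalently, the number of simple modules which occur as the socle of some $P_i$ and the top of some $P_j$); and let $k_i$ be $2$ if $\mathrm{soc}\,P_i$ and $\mathrm{top}\,P_i$ are both in $\mathcal G$, $1$ if only one of them is in $\mathcal G$, and $0$ otherwise. Then the number of basic faithfully balanced $\Lambda$-modules (up to isomorphism) is $$2^g\,N_{k_1}(n_1)\cdots N_{k_t}(n_t).$$
   Context: $K$ is a field. A quadratic Nakayama algebra here is an algebra of the form $KQ/I$ where $Q$ is a linearly oriented quiver of type $A_n$ or $\tilde A_n$ (in the latter case, an oriented cycle), and $I$ is an admissible ideal generated by paths of length $2$. Modules are finitely generated left modules. $D$ is the $K$-dual, so $D\Lambda$ is the injective cogenerator. $\mathrm{gen}(M)$ is the category of quotients of finite direct sums of copies of $M$; $\mathrm{cogen}(M)$ is the category of modules embeddable in finite direct sums of copies of $M$. A module $M$ is faithfully balanced if the natural map $\Lambda\to\mathrm{End}_E(M)$, where $E=\mathrm{End}_\Lambda(M)$, is bijective; it is basic if its indecomposable summands occur with multiplicity one. With $[m]_2!:=\prod_{i=1}^m(2^i-1)$ (so $[0]_2!=1$), define for $n\ge1$: $$N_0(n)=[n]_2!,\qquad N_1(n)=2^{n-1}[n-1]_2!,\qquad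 N_2(n)=\begin{cases}1&(n\le2)\\2^{n-3}(2^n-1)[n-2]_2!&(n\ge3).\end{cases}$$
   Formalization: The quiver Q is assumed to have at least one arrow, which excludes only Λ = K (type A_1): there g = 1, k_1 = 2, n_1 = 1, so the formula gives 2, while K is the only basic faithfully balanced module. *)

theory Defs
  imports
    "HOL-Algebra.Module"
    "HOL-Algebra.QuotRing"
    "HOL-Algebra.Ideal_Product"
    "HOL-Library.FuncSet"
    "Graph_Theory.Arc_Walk"
begin

section \<open>Path algebras of quivers\<close>

text \<open>
  A quiver is a \<open>pre_digraph\<close> (\<open>tail\<close> is the source and \<open>head\<close> the target of an arrow).
  A path is a pair of its starting vertex and its list of arrows, in the order in which they are
  traversed; the trivial path at \<open>u\<close> is \<open>(u, [])\<close>.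
\<close>

type_synonym ('v, 'e) qpath = "'v \<times> 'e list"

definition paths :: "('v, 'e) pre_digraph \<Rightarrow> ('v, 'e) qpath set" where
  "paths Q = {(u, p). \<exists>v. pre_digraph.awalk Q u p v}"

definition path_elem :: "('v, 'e) qpath \<Rightarrow> ('v, 'e) qpath \<Rightarrow> 'k::field" where
  "path_elem x = (\<lambda>y. if y = x then 1 else 0)"

text \<open>
  Elements of \<open>KQ\<close> are the finitely supported functions on the paths of \<open>Q\<close>. Paths are composed
  like functions: the product \<open>q p\<close> of two paths is "first \<open>p\<close>, then \<open>q\<close>" if \<open>p\<close> ends where \<open>q\<close>
  starts, and 0 otherwise. Hence the coefficient of a path in \<open>f g\<close> is a sum over all its
  decompositions into an initial segment (evaluated by \<open>g\<close>) and a final segment (evaluated by \<open>f\<close>).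
\<close>

definition path_algebra :: "('v, 'e) pre_digraph \<Rightarrow> (('v, 'e) qpath \<Rightarrow> 'k::field) ring" where
  "path_algebra Q =
    \<lparr>carrier = {f. finite {x. f x \<noteq> 0} \<and> {x. f x \<noteq> 0} \<subseteq> paths Q},
     mult = (\<lambda>f g (u, p). \<Sum>i\<le>length p.
        f (last (pre_digraph.awalk_verts Q u (take i p)), drop i p) * g (u, take i p)),
     one = (\<lambda>(u, p). if u \<in> verts Q \<and> p = [] then 1 else 0),
     zero = (\<lambda>x. 0),
     add = (\<lambda>f g x. f x + g x)\<rparr>"

text \<open>The structure map \<open>K \<rightarrow> KQ/I\<close>, sending a scalar \<open>c\<close> to the class of \<open>c \<cdot> 1\<close>.\<close>

definition scalar ::
  "('v, 'e) pre_digraph \<Rightarrow> (('v, 'e) qpath \<Rightarrow> 'k::field) set \<Rightarrow> 'k \<Rightarrow> (('v, 'e) qpath \<Rightarrow> 'k) set"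
  where "scalar Q I c = I +>\<^bsub>path_algebra Q\<^esub> (\<lambda>x. c * \<one>\<^bsub>path_algebra Q\<^esub> x)"

definition arrow_ideal :: "('v, 'e) pre_digraph \<Rightarrow> (('v, 'e) qpath \<Rightarrow> 'k::field) set" where
  "arrow_ideal Q =
    Idl\<^bsub>path_algebra Q\<^esub> (path_elem ` {x \<in> paths Q. length (snd x) = 1})"

definition arrow_ideal_power ::
  "('v, 'e) pre_digraph \<Rightarrow> nat \<Rightarrow> (('v, 'e) qpath \<Rightarrow> 'k::field) set" where
  "arrow_ideal_power Q m =
    (ideal_prod (path_algebra Q) (arrow_ideal Q) ^^ m) (carrier (path_algebra Q))"

definition admissible :: "('v, 'e) pre_digraph \<Rightarrow> (('v, 'e) qpath \<Rightarrow> 'k::field) set \<Rightarrow> bool" where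
  "admissible Q I \<longleftrightarrow> ideal I (path_algebra Q) \<and>
    (\<exists>m\<ge>2. arrow_ideal_power Q m \<subseteq> I \<and> I \<subseteq> arrow_ideal_power Q 2)"

text \<open>
  The linearly oriented quiver of type \<open>A\<^sub>n\<close>, and the oriented cycle with \<open>n\<close> vertices
  (a single loop if \<open>n = 1\<close>).
\<close>

definition linear_quiver :: "nat \<Rightarrow> (nat, nat) pre_digraph" where
  "linear_quiver n = \<lparr>verts = {i. i < n}, arcs = {i. Suc i < n}, tail = (\<lambda>i. i), head = Suc\<rparr>"

definition cyclic_quiver :: "nat \<Rightarrow> (nat, nat) pre_digraph" where
  "cyclic_quiver n =
    \<lparr>verts = {i. i < n}, arcs = {i. i < n}, tail = (\<lambda>i. i), head = (\<lambda>i. Suc i mod n)\<rparr>"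

definition quadratic_nakayama ::
  "(nat, nat) pre_digraph \<Rightarrow> ((nat, nat) qpath \<Rightarrow> 'k::field) set \<Rightarrow> bool" where
  "quadratic_nakayama Q I \<longleftrightarrow>
    (\<exists>n\<ge>1. Q = linear_quiver n \<or> Q = cyclic_quiver n) \<and>
    admissible Q I \<and>
    (\<exists>S \<subseteq> {x \<in> paths Q. length (snd x) = 2}. I = Idl\<^bsub>path_algebra Q\<^esub> (path_elem ` S))"


section \<open>Left modules over a ring\<close>

text \<open>
  The library locale \<open>module\<close> requires a commutative ring. As there, modules are records of type
  \<open>('a, 'm) module\<close>, whose multiplicative fields \<open>mult\<close> and \<open>one\<close> are irrelevant.
\<close>

locale left_module = R?: ring R + M?: abelian_group M
  for R :: "('a, 'c) ring_scheme" (structure) and M :: "('a, 'm) module" (structure) +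
  assumes smult_closed: "\<lbrakk>a \<in> carrier R; x \<in> carrier M\<rbrakk> \<Longrightarrow> a \<odot>\<^bsub>M\<^esub> x \<in> carrier M"
    and smult_l_distr: "\<lbrakk>a \<in> carrier R; b \<in> carrier R; x \<in> carrier M\<rbrakk> \<Longrightarrow>
      (a \<oplus>\<^bsub>R\<^esub> b) \<odot>\<^bsub>M\<^esub> x = a \<odot>\<^bsub>M\<^esub> x \<oplus>\<^bsub>M\<^esub> b \<odot>\<^bsub>M\<^esub> x"
    and smult_r_distr: "\<lbrakk>a \<in> carrier R; x \<in> carrier M; y \<in> carrier M\<rbrakk> \<Longrightarrow>
      a \<odot>\<^bsub>M\<^esub> (x \<oplus>\<^bsub>M\<^esub> y) = a \<odot>\<^bsub>M\<^esub> x \<oplus>\<^bsub>M\<^esub> a \<odot>\<^bsub>M\<^esub> y"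
    and smult_assoc1: "\<lbrakk>a \<in> carrier R; b \<in> carrier R; x \<in> carrier M\<rbrakk> \<Longrightarrow>
      (a \<otimes>\<^bsub>R\<^esub> b) \<odot>\<^bsub>M\<^esub> x = a \<odot>\<^bsub>M\<^esub> (b \<odot>\<^bsub>M\<^esub> x)"
    and smult_one: "x \<in> carrier M \<Longrightarrow> \<one>\<^bsub>R\<^esub> \<odot>\<^bsub>M\<^esub> x = x"

definition fg_module :: "('a, 'c) ring_scheme \<Rightarrow> ('a, 'm) module \<Rightarrow> bool" where
  "fg_module A M \<longleftrightarrow> left_module A M \<and>
    (\<exists>X. finite X \<and> X \<subseteq> carrier M \<and> (\<forall>U. submodule U A M \<and> X \<subseteq> U \<longrightarrow> U = carrier M))"

text \<open>Homomorphisms are extensional, i.e. \<open>undefined\<close> off the carrier.\<close>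

definition mod_hom ::
  "('a, 'c) ring_scheme \<Rightarrow> ('a, 'm) module \<Rightarrow> ('a, 'n) module \<Rightarrow> ('m \<Rightarrow> 'n) set" where
  "mod_hom A M N = {f \<in> carrier M \<rightarrow>\<^sub>E carrier N.
    (\<forall>x\<in>carrier M. \<forall>y\<in>carrier M. f (x \<oplus>\<^bsub>M\<^esub> y) = f x \<oplus>\<^bsub>N\<^esub> f y) \<and>
    (\<forall>a\<in>carrier A. \<forall>x\<in>carrier M. f (a \<odot>\<^bsub>M\<^esub> x) = a \<odot>\<^bsub>N\<^esub> f x)}"

definition mod_iso :: "('a, 'c) ring_scheme \<Rightarrow> ('a, 'm) module \<Rightarrow> ('a, 'n) module \<Rightarrow> bool" where
  "mod_iso A M N \<longleftrightarrow> (\<exists>f\<in>mod_hom A M N. bij_betw f (carrier M) (carrier N))"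

definition iso_classes ::
  "('a, 'c) ring_scheme \<Rightarrow> ('a, 'm) module set \<Rightarrow> ('a, 'm) module set set" where
  "iso_classes A C = C // {(M, N). M \<in> C \<and> N \<in> C \<and> mod_iso A M N}"

definition quotient_module :: "('a, 'm) module \<Rightarrow> 'm set \<Rightarrow> ('a, 'm set) module" where
  "quotient_module M U =
    \<lparr>carrier = a_rcosets\<^bsub>M\<^esub> U, mult = undefined, one = undefined, zero = U, add = set_add M,
     smult = (\<lambda>a X. U <+>\<^bsub>M\<^esub> (\<lambda>x. a \<odot>\<^bsub>M\<^esub> x) ` X)\<rparr>"

definition power_module :: "nat \<Rightarrow> ('a, 'm) module \<Rightarrow> ('a, nat \<Rightarrow> 'm) module" where
  "power_module n M =
    \<lparr>carrier = {..<n} \<rightarrow>\<^sub>E carrier M, mult = undefined, one = undefined,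
     zero = (\<lambda>i\<in>{..<n}. \<zero>\<^bsub>M\<^esub>),
     add = (\<lambda>x y. \<lambda>i\<in>{..<n}. x i \<oplus>\<^bsub>M\<^esub> y i),
     smult = (\<lambda>a x. \<lambda>i\<in>{..<n}. a \<odot>\<^bsub>M\<^esub> x i)\<rparr>"

definition in_gen :: "('a, 'c) ring_scheme \<Rightarrow> ('a, 'x) module \<Rightarrow> ('a, 'm) module \<Rightarrow> bool" where
  "in_gen A X M \<longleftrightarrow>
    (\<exists>n. \<exists>f\<in>mod_hom A (power_module n X) M. f ` carrier (power_module n X) = carrier M)"

definition in_cogen :: "('a, 'c) ring_scheme \<Rightarrow> ('a, 'x) module \<Rightarrow> ('a, 'm) module \<Rightarrow> bool" where
  "in_cogen A X M \<longleftrightarrow> (\<exists>n. \<exists>f\<in>mod_hom A M (power_module n X). inj_on f (carrier M))"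

definition simple_module :: "('a, 'c) ring_scheme \<Rightarrow> ('a, 'm) module \<Rightarrow> bool" where
  "simple_module A M \<longleftrightarrow> carrier M \<noteq> {\<zero>\<^bsub>M\<^esub>} \<and>
    (\<forall>U. submodule U A M \<longrightarrow> U = {\<zero>\<^bsub>M\<^esub>} \<or> U = carrier M)"

definition indecomposable :: "('a, 'c) ring_scheme \<Rightarrow> ('a, 'm) module \<Rightarrow> bool" where
  "indecomposable A M \<longleftrightarrow> carrier M \<noteq> {\<zero>\<^bsub>M\<^esub>} \<and>
    (\<forall>U V. submodule U A M \<and> submodule V A M \<and>
       U \<inter> V = {\<zero>\<^bsub>M\<^esub>} \<and> U <+>\<^bsub>M\<^esub> V = carrier M \<longrightarrow> U = {\<zero>\<^bsub>M\<^esub>} \<or> V = {\<zero>\<^bsub>M\<^esub>})"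

text \<open>
  A submodule \<open>U\<close> of \<open>M\<close> is regarded as a module by \<open>M\<lparr>carrier := U\<rparr>\<close>.
  The last conjunct says that \<open>M\<close> is the internal direct sum of the \<open>U i\<close>.
\<close>

definition basic_module :: "('a, 'c) ring_scheme \<Rightarrow> ('a, 'm) module \<Rightarrow> bool" where
  "basic_module A M \<longleftrightarrow> (\<exists>(m::nat) U.
    (\<forall>i<m. submodule (U i) A M \<and> indecomposable A (M\<lparr>carrier := U i\<rparr>)) \<and>
    (\<forall>i<m. \<forall>j<m. i \<noteq> j \<longrightarrow> \<not> mod_iso A (M\<lparr>carrier := U i\<rparr>) (M\<lparr>carrier := U j\<rparr>)) \<and>
    (\<forall>x\<in>carrier M. \<exists>!y. y \<in> (\<Pi>\<^sub>E i\<in>{..<m}. U i) \<and> x = (\<Oplus>\<^bsub>M\<^esub>i\<in>{..<m}. y i)))"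

text \<open>
  Projectivity and injectivity are taken in the category of finitely generated modules. The test
  modules have the same carrier type \<open>'m\<close> as the module, so this type has to be large
  enough to accommodate every finitely generated module up to isomorphism; for a
  finite-dimensional algebra over a field \<open>'k\<close>, the type \<open>nat \<Rightarrow> 'k\<close> is.
\<close>

definition projective_module :: "('a, 'c) ring_scheme \<Rightarrow> ('a, 'm) module \<Rightarrow> bool" where
  "projective_module A P \<longleftrightarrow> (\<forall>(M::('a, 'm) module) (N::('a, 'm) module).
    \<forall>f\<in>mod_hom A M N. \<forall>h\<in>mod_hom A P N.
    fg_module A M \<and> fg_module A N \<and> f ` carrier M = carrier N \<longrightarrow>
    (\<exists>l\<in>mod_hom A P M. \<forall>x\<in>carrier P. f (l x) = h x))"

definition injective_module :: "('a, 'c) ring_scheme \<Rightarrow> ('a, 'm) module \<Rightarrow> bool" where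
  "injective_module A J \<longleftrightarrow> (\<forall>(M::('a, 'm) module) (N::('a, 'm) module).
    \<forall>f\<in>mod_hom A M N. \<forall>h\<in>mod_hom A M J.
    fg_module A M \<and> fg_module A N \<and> inj_on f (carrier M) \<longrightarrow>
    (\<exists>l\<in>mod_hom A N J. \<forall>x\<in>carrier M. l (f x) = h x))"

definition composition_series ::
  "('a, 'c) ring_scheme \<Rightarrow> ('a, 'm) module \<Rightarrow> nat \<Rightarrow> (nat \<Rightarrow> 'm set) \<Rightarrow> bool" where
  "composition_series A M l U \<longleftrightarrow> U 0 = {\<zero>\<^bsub>M\<^esub>} \<and> U l = carrier M \<and>
    (\<forall>i\<le>l. submodule (U i) A M) \<and>
    (\<forall>i<l. U i \<subseteq> U (Suc i) \<and>
       simple_module A (quotient_module (M\<lparr>carrier := U (Suc i)\<rparr>) (U i)))"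

text \<open>By the Jordan-Hoelder theorem, all composition series have the same length.\<close>

definition module_length :: "('a, 'c) ring_scheme \<Rightarrow> ('a, 'm) module \<Rightarrow> nat" where
  "module_length A M = (LEAST l. \<exists>U. composition_series A M l U)"

text \<open>The socle is the sum of (i.e. the submodule generated by) all simple submodules.\<close>

definition socle :: "('a, 'c) ring_scheme \<Rightarrow> ('a, 'm) module \<Rightarrow> ('a, 'm) module" where
  "socle A M = M\<lparr>carrier := \<Inter>{V. submodule V A M \<and>
    (\<forall>U. submodule U A M \<and> simple_module A (M\<lparr>carrier := U\<rparr>) \<longrightarrow> U \<subseteq> V)}\<rparr>"

definition radical :: "('a, 'c) ring_scheme \<Rightarrow> ('a, 'm) module \<Rightarrow> 'm set" where
  "radical A M = carrier M \<inter> \<Inter>{V. submodule V A M \<and> V \<noteq> carrier M \<and>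
    (\<forall>U. submodule U A M \<and> V \<subseteq> U \<longrightarrow> U = V \<or> U = carrier M)}"

definition top_module :: "('a, 'c) ring_scheme \<Rightarrow> ('a, 'm) module \<Rightarrow> ('a, 'm set) module" where
  "top_module A M = quotient_module M (radical A M)"

definition End_ring :: "('a, 'c) ring_scheme \<Rightarrow> ('a, 'm) module \<Rightarrow> ('m \<Rightarrow> 'm) ring" where
  "End_ring A M =
    \<lparr>carrier = mod_hom A M M, mult = compose (carrier M), one = (\<lambda>x\<in>carrier M. x),
     zero = (\<lambda>x\<in>carrier M. \<zero>\<^bsub>M\<^esub>), add = (\<lambda>f g. \<lambda>x\<in>carrier M. f x \<oplus>\<^bsub>M\<^esub> g x)\<rparr>"

definition End_module :: "('a, 'm) module \<Rightarrow> ('m \<Rightarrow> 'm, 'm) module" where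
  "End_module M =
    \<lparr>carrier = carrier M, mult = undefined, one = undefined, zero = \<zero>\<^bsub>M\<^esub>, add = add M,
     smult = (\<lambda>f x. f x)\<rparr>"

definition faithfully_balanced :: "('a, 'c) ring_scheme \<Rightarrow> ('a, 'm) module \<Rightarrow> bool" where
  "faithfully_balanced A M \<longleftrightarrow>
    bij_betw (\<lambda>a. \<lambda>x\<in>carrier M. a \<odot>\<^bsub>M\<^esub> x) (carrier A)
      (carrier (End_ring (End_ring A M) (End_module M)))"

definition regular_module :: "('a, 'c) ring_scheme \<Rightarrow> ('a, 'a) module" where
  "regular_module A =
    \<lparr>carrier = carrier A, mult = undefined, one = undefined, zero = \<zero>\<^bsub>A\<^esub>, add = add A,
     smult = mult A\<rparr>"

text \<open>
  The left module \<open>D A = Hom\<^sub>K (A, K)\<close>, with \<open>(a f) x = f (x a)\<close>, for a \<open>K\<close>-algebra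
  \<open>A\<close> with structure map \<open>s :: K \<rightarrow> A\<close>.
\<close>

definition dual_module :: "('k::field \<Rightarrow> 'a) \<Rightarrow> ('a, 'c) ring_scheme \<Rightarrow> ('a, 'a \<Rightarrow> 'k) module" where
  "dual_module s A =
    \<lparr>carrier = {f \<in> extensional (carrier A).
       (\<forall>x\<in>carrier A. \<forall>y\<in>carrier A. f (x \<oplus>\<^bsub>A\<^esub> y) = f x + f y) \<and>
       (\<forall>c. \<forall>x\<in>carrier A. f (s c \<otimes>\<^bsub>A\<^esub> x) = c * f x)},
     mult = undefined, one = undefined, zero = (\<lambda>x\<in>carrier A. 0),
     add = (\<lambda>f g. \<lambda>x\<in>carrier A. f x + g x),
     smult = (\<lambda>a f. \<lambda>x\<in>carrier A. f (x \<otimes>\<^bsub>A\<^esub> a))\<rparr>"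

text \<open>Membership in \<open>gen (D \<Lambda>) \<inter> cogen \<Lambda>\<close> for \<open>\<Lambda> = KQ/I\<close>.\<close>

definition in_G :: "('v, 'e) pre_digraph \<Rightarrow> (('v, 'e) qpath \<Rightarrow> 'k::field) set \<Rightarrow>
    ((('v, 'e) qpath \<Rightarrow> 'k) set, 'm) module \<Rightarrow> bool" where
  "in_G Q I M \<longleftrightarrow>
    in_gen (path_algebra Q Quot I) (dual_module (scalar Q I) (path_algebra Q Quot I)) M \<and>
    in_cogen (path_algebra Q Quot I) (regular_module (path_algebra Q Quot I)) M"


section \<open>The numbers \<open>N\<^sub>k(n)\<close>\<close>

text \<open>
  Pitfall: for \<open>\<Lambda> = K\<close>, i.e. \<open>Q = linear_quiver 1\<close>, the product formula would give
  \<open>2\<close> (one projective-injective module, which is simple, with \<open>g = 1\<close>, \<open>k = 2\<close> and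
  \<open>N2 1 = 1\<close>), although \<open>K\<close> is the only basic faithfully balanced module.
  So the formula needs a quiver with at least one arrow.
\<close>

definition qfact2 :: "nat \<Rightarrow> nat" where
  "qfact2 m = (\<Prod>i=1..m. 2 ^ i - 1)"

definition N0 :: "nat \<Rightarrow> nat" where
  "N0 n = qfact2 n"

definition N1 :: "nat \<Rightarrow> nat" where
  "N1 n = 2 ^ (n - 1) * qfact2 (n - 1)"

definition N2 :: "nat \<Rightarrow> nat" where
  "N2 n = (if n \<le> 2 then 1 else 2 ^ (n - 3) * (2 ^ n - 1) * qfact2 (n - 2))"

definition Nk :: "nat \<Rightarrow> nat \<Rightarrow> nat" where
  "Nk k n = (if k = 0 then N0 n else if k = 1 then N1 n else N2 n)"

end

(*
  A nonzero path determines a uniserial module, whose basis consists of the initial segments of the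
  path, and every indecomposable module over a quadratic Nakayama algebra is of this form. So a basic
  module is a set S of nonzero paths. Using the homomorphisms between the uniserial modules, one finds
  that it is faithfully balanced iff S contains all maximal paths (the projective-injective modules),
  every other member of S has the same top or the same socle as a longer member, and for every arrow
  u -> v some member of S has top v or socle u.
  Distinct maximal paths meet at most in their ends, because the relations have length 2. Hence this
  condition says nothing about the simple modules at the vertices that are both the end and the start
  of maximal paths, which gives the factor 2^g, and otherwise it is a separate condition for each
  maximal path. For one maximal path one counts sets of intervals of a finite linear order, by
  recursively removing all intervals that start at the first point.
*)

theory Submission
  imports Defs
begin

section \<open>Counting sets of intervals\<close>

text \<open>The recursion on the first point does not stay inside the problem: the removed intervals
  leave endpoints behind on which later intervals may rely. Carrying the set \<open>C\<close> of
  these endpoints along repairs this, and the count still factors, with \<open>2 ^ (L - i)\<close>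
  or \<open>2 ^ (L - i) - 1\<close> for the point \<open>i\<close> according to its membership in
  \<open>C\<close>. A shared end needs no new recursion: the count with it is the mean of the counts
  without it for two consecutive lengths, which is the origin of \<open>N1\<close> and
  \<open>N2\<close>. That balanced sets suffice is seen on matrices. A biendomorphism preserves
  every summand, the hooks identify its blocks on short summands with blocks of its matrix on a
  maximal path, and the arrow condition makes that matrix triangular; its entries are then the
  coefficients of an algebra element. Conversely, a missing maximal path gives a nonzero
  annihilator, and failure of either other clause an explicit biendomorphism that is not a
  multiplication. The classification of indecomposables rests on splitting off an interval module of
  the largest possible length.\<close>

text \<open>
  A pair \<open>(x, y)\<close> stands for the interval from \<open>x\<close> to \<open>y\<close>. The set \<open>C\<close> collects the endpoints of
  the intervals starting before \<open>a\<close> that have already been removed. Removing the intervals that start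
  at \<open>a\<close> and adding their endpoints to \<open>C\<close> leads from \<open>a\<close> to \<open>a + 1\<close>.
\<close>

lemma sum_Pow_insert:
  assumes "finite A" "x \<notin> A"
  shows "(\<Sum>N\<in>Pow (insert x A). f N) = (\<Sum>N\<in>Pow A. f N) + (\<Sum>N\<in>Pow A. f (insert x N))"
proof -
  have inj: "inj_on (insert x) (Pow A)"
    using assms(2) by (auto simp: inj_on_def)
  have "Pow A \<inter> insert x ` Pow A = {}"
    using assms(2) by auto
  then show ?thesis
    using assms(1) by (simp add: Pow_insert sum.union_disjoint sum.reindex[OF inj])
qed

definition hooked_graphs :: "nat \<Rightarrow> nat \<Rightarrow> nat set \<Rightarrow> (nat \<times> nat) set set" where
  "hooked_graphs L a C = {T. T \<subseteq> {(x, y). a \<le> x \<and> x < y \<and> y \<le> L} \<and>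
     (\<forall>x y. (x, y) \<in> T \<longrightarrow> (\<exists>y'>y. (x, y') \<in> T) \<or> (\<exists>x'<x. (x', y) \<in> T) \<or> y \<in> C) \<and>
     (\<forall>h. a \<le> h \<longrightarrow> h < L \<longrightarrow> h \<in> C \<or> (\<exists>y. (h, y) \<in> T) \<or> (\<exists>x. (x, h) \<in> T))}"

text \<open>The possible sets of endpoints of the intervals starting at \<open>a\<close>. The
  longest such interval has nothing to its left and nothing beyond it, so only \<open>C\<close> can
  excuse it; if there is none, then no interval touches \<open>a\<close> and \<open>a\<close> itself
  must lie in \<open>C\<close>.\<close>

definition first_nbhds :: "nat \<Rightarrow> nat \<Rightarrow> nat set \<Rightarrow> nat set set" where
  "first_nbhds L a C = {N. N \<subseteq> {a<..L} \<and> (if N = {} then a \<in> C else Max N \<in> C)}"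

lemma finite_hooked_graphs: "finite (hooked_graphs L a C)"
proof (rule finite_subset)
  show "hooked_graphs L a C \<subseteq> Pow ({..L} \<times> {..L})"
    unfolding hooked_graphs_def by auto
qed simp

lemma finite_first_nbhds: "finite (first_nbhds L a C)"
  unfolding first_nbhds_def by (rule finite_subset[of _ "Pow {a<..L}"]) (blast, simp)

text \<open>An endpoint \<open>y\<close> in \<open>N\<close> excuses every later interval ending at
  \<open>y\<close>, because \<open>(a, y)\<close> starts earlier, and it also covers the point
  \<open>y\<close>. Both effects survive the removal of the intervals at \<open>a\<close> if
  \<open>N\<close> is added to \<open>C\<close>.\<close>

lemma hooked_graphs_split:
  assumes "a < L"
  shows "bij_betw (\<lambda>(N, T). Pair a ` N \<union> T)
     (SIGMA N:first_nbhds L a C. hooked_graphs L (Suc a) (C \<union> N)) (hooked_graphs L a C)"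
    (is "bij_betw ?f ?A ?B")
proof (rule bij_betw_byWitness[where f' = "\<lambda>T. ({y. (a, y) \<in> T}, {(x, y) \<in> T. x \<noteq> a})"])
  show "\<forall>z\<in>?A. ({y. (a, y) \<in> ?f z}, {(x, y) \<in> ?f z. x \<noteq> a}) = z"
    unfolding hooked_graphs_def by (fastforce simp: image_iff)
  show "\<forall>T\<in>?B. ?f ({y. (a, y) \<in> T}, {(x, y) \<in> T. x \<noteq> a}) = T"
    by auto
  show "?f ` ?A \<subseteq> ?B"
  proof clarify
    fix N T assume N: "N \<in> first_nbhds L a C" and T: "T \<in> hooked_graphs L (Suc a) (C \<union> N)"
    let ?U = "Pair a ` N \<union> T"
    have NL: "N \<subseteq> {a<..L}" and NC: "N = {} \<Longrightarrow> a \<in> C" "N \<noteq> {} \<Longrightarrow> Max N \<in> C"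
      using N by (auto simp: first_nbhds_def split: if_splits)
    have finN: "finite N" using NL finite_subset by blast
    have TL: "T \<subseteq> {(x, y). Suc a \<le> x \<and> x < y \<and> y \<le> L}"
      and T1: "\<And>x y. (x, y) \<in> T \<Longrightarrow> (\<exists>y'>y. (x, y') \<in> T) \<or> (\<exists>x'<x. (x', y) \<in> T) \<or> y \<in> C \<union> N"
      and T2: "\<And>h. Suc a \<le> h \<Longrightarrow> h < L \<Longrightarrow> h \<in> C \<union> N \<or> (\<exists>y. (h, y) \<in> T) \<or> (\<exists>x. (x, h) \<in> T)"
      using T unfolding hooked_graphs_def by auto
    have "?U \<subseteq> {(x, y). a \<le> x \<and> x < y \<and> y \<le> L}"
      using NL TL by fastforce
    moreover have "(\<exists>y'>y. (x, y') \<in> ?U) \<or> (\<exists>x'<x. (x', y) \<in> ?U) \<or> y \<in> C" if "(x, y) \<in> ?U" for x y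
    proof (cases "(x, y) \<in> T")
      case True
      then have "a < x" using TL by auto
      then show ?thesis using T1[OF True] by blast
    next
      case False
      then have x: "x = a" and y: "y \<in> N" using that by auto
      show ?thesis
      proof (cases "y = Max N")
        case True
        then show ?thesis using NC(2) y by auto
      next
        case False
        then have "y < Max N" "Max N \<in> N"
          using y Max_ge[OF finN y] Max_in[OF finN] by (auto simp: order_less_le)
        then show ?thesis using x by blast
      qed
    qed
    moreover have "h \<in> C \<or> (\<exists>y. (h, y) \<in> ?U) \<or> (\<exists>x. (x, h) \<in> ?U)" if "a \<le> h" "h < L" for h
    proof (cases "h = a")
      case True
      then show ?thesis using NC(1) by blast
    next
      case False
      then show ?thesis using T2[of h] that by auto
    qed
    ultimately show "?U \<in> hooked_graphs L a C"
      unfolding hooked_graphs_def by blast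
  qed
  show "(\<lambda>T. ({y. (a, y) \<in> T}, {(x, y) \<in> T. x \<noteq> a})) ` ?B \<subseteq> ?A"
  proof (rule image_subsetI)
    fix T assume T: "T \<in> hooked_graphs L a C"
    let ?N = "{y. (a, y) \<in> T}" and ?U = "{(x, y) \<in> T. x \<noteq> a}"
    have TL: "T \<subseteq> {(x, y). a \<le> x \<and> x < y \<and> y \<le> L}"
      and T1: "\<And>x y. (x, y) \<in> T \<Longrightarrow> (\<exists>y'>y. (x, y') \<in> T) \<or> (\<exists>x'<x. (x', y) \<in> T) \<or> y \<in> C"
      and T2: "\<And>h. a \<le> h \<Longrightarrow> h < L \<Longrightarrow> h \<in> C \<or> (\<exists>y. (h, y) \<in> T) \<or> (\<exists>x. (x, h) \<in> T)"
      using T unfolding hooked_graphs_def by auto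
    have NL: "?N \<subseteq> {a<..L}" using TL by auto
    then have finN: "finite ?N" using finite_subset by blast
    have "if ?N = {} then a \<in> C else Max ?N \<in> C"
    proof (cases "?N = {}")
      case True
      then show ?thesis using T2[of a] assms TL by fastforce
    next
      case False
      then have "(a, Max ?N) \<in> T" using Max_in[OF finN False] by simp
      moreover have "\<not> (\<exists>y'>Max ?N. (a, y') \<in> T)"
        using Max_ge[OF finN] by fastforce
      moreover have "\<not> (\<exists>x'<a. (x', Max ?N) \<in> T)" using TL by fastforce
      ultimately have "Max ?N \<in> C" using T1[of a "Max ?N"] by blast
      then show ?thesis by (subst if_not_P[OF False])
    qed
    then have "?N \<in> first_nbhds L a C"
      using NL unfolding first_nbhds_def by blast
    moreover have "?U \<in> hooked_graphs L (Suc a) (C \<union> ?N)"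
    proof -
      have "?U \<subseteq> {(x, y). Suc a \<le> x \<and> x < y \<and> y \<le> L}" using TL by fastforce
      moreover have "(\<exists>y'>y. (x, y') \<in> ?U) \<or> (\<exists>x'<x. (x', y) \<in> ?U) \<or> y \<in> C \<union> ?N"
        if "(x, y) \<in> ?U" for x y
        using T1[of x y] that by blast
      moreover have "h \<in> C \<union> ?N \<or> (\<exists>y. (h, y) \<in> ?U) \<or> (\<exists>x. (x, h) \<in> ?U)"
        if "Suc a \<le> h" "h < L" for h
        using T2[of h] that by auto
      ultimately show ?thesis unfolding hooked_graphs_def by blast
    qed
    ultimately show "(?N, ?U) \<in> ?A" by blast
  qed
qed

text \<open>Formally the number of all subsets of \<open>{i<..L}\<close>, or of the nonempty ones if
  \<open>i\<close> is outside \<open>C\<close>. The recursion restricts the choices at a point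
  differently; only the total comes out as the product of these numbers.\<close>

definition hook_weight :: "nat \<Rightarrow> nat set \<Rightarrow> nat \<Rightarrow> int" where
  "hook_weight L C i = 2 ^ (L - i) - (if i \<in> C then 0 else 1)"

text \<open>The recursion uses the case \<open>k = L\<close>, where the correction term disappears
  with its factor \<open>2 ^ 0 - 1\<close>; smaller \<open>k\<close> are there for the induction. In
  its step the sets \<open>N\<close> are split by membership of \<open>Suc k\<close>: if present, it
  is the maximum, its weight becomes the pure power \<open>y\<close>, and the weights of smaller
  points do not change.\<close>

lemma sum_nbhds:
  assumes "L \<in> C" "a \<le> k" "k \<le> L"
  shows "(\<Sum>N\<in>Pow {a<..k}. if N \<noteq> {} \<and> Max N \<in> C then \<Prod>i\<in>{a<..k}. hook_weight L (C \<union> N) i else 0)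
    = (2 ^ (L - a) - 1) * (\<Prod>i\<in>{a<..k}. hook_weight L C i)
      - (2 ^ (L - k) - 1) * (\<Sum>N\<in>Pow {a<..k}. \<Prod>i\<in>{a<..k}. hook_weight L (C \<union> N) i)"
  using assms(2,3)
proof (induction k rule: dec_induct)
  case base
  then show ?case by simp
next
  case (step k)
  let ?k = "Suc k"
  have ins: "{a<..?k} = insert ?k {a<..k}" using step by auto
  have notin: "?k \<notin> {a<..k}" by simp
  define w where "w C' = (\<Prod>i\<in>{a<..k}. hook_weight L C' i)" for C'
  define Z where "Z = (\<Sum>N\<in>Pow {a<..k}. w (C \<union> N))"
  define A where "A = (\<Sum>N\<in>Pow {a<..k}. if N \<noteq> {} \<and> Max N \<in> C then w (C \<union> N) else 0)"
  define y :: int where "y = 2 ^ (L - ?k)"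
  have IH: "A = (2 ^ (L - a) - 1) * w C - (2 ^ (L - k) - 1) * Z"
    using step unfolding A_def Z_def w_def by simp
  have y2: "(2::int) ^ (L - k) = 2 * y"
    unfolding y_def using step by (simp flip: power_Suc add: Suc_diff_Suc)
  have prod: "(\<Prod>i\<in>{a<..?k}. hook_weight L C' i) = hook_weight L C' ?k * w C'" for C'
    unfolding ins w_def by simp
  have w_ins: "w (C \<union> insert ?k N) = w (C \<union> N)" for N
    unfolding w_def hook_weight_def by (intro prod.cong) auto
  have hw: "hook_weight L (C \<union> N) ?k = hook_weight L C ?k" if "N \<subseteq> {a<..k}" for N
    using that unfolding hook_weight_def by auto
  have hw': "hook_weight L (C \<union> insert ?k N) ?k = y" for N
    unfolding hook_weight_def y_def by simp
  have maxi: "Max (insert ?k N) = ?k" if "N \<subseteq> {a<..k}" for N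
  proof (rule Max_eqI)
    show "finite (insert ?k N)" using that finite_subset by blast
  qed (use that in force)+
  have Z': "(\<Sum>N\<in>Pow {a<..?k}. \<Prod>i\<in>{a<..?k}. hook_weight L (C \<union> N) i) = (hook_weight L C ?k + y) * Z"
    unfolding prod unfolding ins sum_Pow_insert[OF finite_greaterThanAtMost notin]
    unfolding hw' w_ins Z_def distrib_right sum_distrib_left sum.distrib
    by (intro arg_cong2[where f = "(+)"] sum.cong refl) (simp add: hw)
  have A': "(\<Sum>N\<in>Pow {a<..?k}. if N \<noteq> {} \<and> Max N \<in> C then \<Prod>i\<in>{a<..?k}. hook_weight L (C \<union> N) i else 0)
    = hook_weight L C ?k * A + (if ?k \<in> C then y * Z else 0)"
  proof -
    have 1: "(\<Sum>N\<in>Pow {a<..k}. if N \<noteq> {} \<and> Max N \<in> C then hook_weight L (C \<union> N) ?k * w (C \<union> N) else 0)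
      = hook_weight L C ?k * A"
      unfolding A_def sum_distrib_left by (intro sum.cong) (auto simp: hw)
    have 2: "(\<Sum>N\<in>Pow {a<..k}. if insert ?k N \<noteq> {} \<and> Max (insert ?k N) \<in> C
        then hook_weight L (C \<union> insert ?k N) ?k * w (C \<union> insert ?k N) else 0)
      = (if ?k \<in> C then y * Z else 0)"
      unfolding hw' w_ins Z_def sum_distrib_left by (auto simp: maxi intro!: sum.cong sum.neutral)
    show ?thesis
      unfolding prod unfolding ins sum_Pow_insert[OF finite_greaterThanAtMost notin] 1 2 ..
  qed
  \<comment> \<open>With \<open>h = hook_weight L C ?k\<close> this comes down to \<open>(2 * y - 1)
    * h - (if ?k \<in> C then y else 0) = (y - 1) * (h + y)\<close>, which holds both for
    \<open>h = y\<close> (inside \<open>C\<close>) and for \<open>h = y - 1\<close>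
    (outside).\<close>
  show ?case
    unfolding A' Z' unfolding prod IH y2 y_def[symmetric]
    by (simp add: hook_weight_def y_def[symmetric] algebra_simps)
qed

text \<open>Induction on \<open>L - a\<close> with \<open>C\<close> arbitrary, since
  \<open>C\<close> grows on the way. The integers accommodate the subtraction in
  \<open>sum_nbhds\<close>.\<close>

lemma card_hooked_graphs_int:
  assumes "a \<le> L" "L \<in> C"
  shows "int (card (hooked_graphs L a C)) = (\<Prod>i\<in>{a..<L}. hook_weight L C i)"
  using assms
proof (induction "L - a" arbitrary: a C)
  case 0
  then have "a = L" by simp
  then have "hooked_graphs L a C = {{}}"
    unfolding hooked_graphs_def by auto
  then show ?case using \<open>a = L\<close> by simp
next
  case (Suc n)
  then have aL: "a < L" by simp
  have "card (hooked_graphs L a C) = (\<Sum>N\<in>first_nbhds L a C. card (hooked_graphs L (Suc a) (C \<union> N)))"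
    using bij_betw_same_card[OF hooked_graphs_split[OF aL, of C]]
    by (simp add: finite_first_nbhds finite_hooked_graphs)
  also have "int \<dots> = (\<Sum>N\<in>first_nbhds L a C. \<Prod>i\<in>{a<..L}. hook_weight L (C \<union> N) i)"
  proof -
    have "int (card (hooked_graphs L (Suc a) (C \<union> N))) = (\<Prod>i\<in>{a<..L}. hook_weight L (C \<union> N) i)" for N
    proof -
      have "int (card (hooked_graphs L (Suc a) (C \<union> N))) = (\<Prod>i\<in>{Suc a..<L}. hook_weight L (C \<union> N) i)"
        using Suc by (intro Suc.hyps(1)) auto
      \<comment> \<open>The additional factor at \<open>L\<close> is \<open>2 ^ 0 = 1\<close>
        because \<open>L \<in> C\<close>; it adjusts the index set to the range from which
        \<open>N\<close> is drawn.\<close>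
      also have "\<dots> = (\<Prod>i\<in>insert L {Suc a..<L}. hook_weight L (C \<union> N) i)"
        using Suc.prems by (simp add: hook_weight_def)
      also have "insert L {Suc a..<L} = {a<..L}" using aL by auto
      finally show ?thesis .
    qed
    then show ?thesis by simp
  qed
  also have "\<dots> = (\<Sum>N\<in>Pow {a<..L}. if (if N = {} then a \<in> C else Max N \<in> C)
      then \<Prod>i\<in>{a<..L}. hook_weight L (C \<union> N) i else 0)"
    unfolding first_nbhds_def by (rule sum.mono_neutral_cong_left) auto
  \<comment> \<open>The empty \<open>N\<close> depends on \<open>a\<close> instead of a maximum and
    is split off. Its contribution turns the factor \<open>2 ^ (L - a) - 1\<close> of the nonempty
    sets into \<open>hook_weight L C a\<close>.\<close>
  also have "\<dots> = (\<Sum>N\<in>Pow {a<..L}. (if N \<noteq> {} \<and> Max N \<in> C then \<Prod>i\<in>{a<..L}. hook_weight L (C \<union> N) i else 0)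
      + (if N = {} then if a \<in> C then \<Prod>i\<in>{a<..L}. hook_weight L C i else 0 else 0))"
    by (rule sum.cong) auto
  also have "\<dots> = (2 ^ (L - a) - 1) * (\<Prod>i\<in>{a<..L}. hook_weight L C i)
      + (if a \<in> C then \<Prod>i\<in>{a<..L}. hook_weight L C i else 0)"
    unfolding sum.distrib using sum_nbhds[of L C a L] Suc.prems aL by (simp add: sum.delta)
  also have "\<dots> = hook_weight L C a * (\<Prod>i\<in>insert L {Suc a..<L}. hook_weight L C i)"
  proof -
    have "insert L {Suc a..<L} = {a<..L}" using aL by auto
    then show ?thesis by (simp add: hook_weight_def algebra_simps)
  qed
  also have "\<dots> = (\<Prod>i\<in>{a..<L}. hook_weight L C i)"
  proof -
    have "{a..<L} = insert a {Suc a..<L}" using aL by auto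
    then show ?thesis using Suc.prems by (simp add: hook_weight_def)
  qed
  finally show ?case .
qed

text \<open>
  The points \<open>0, \<dots>, L - 1\<close> are the vertices of a maximal path, and \<open>(x, y)\<close> stands for the module with
  composition factors \<open>x, \<dots>, y - 1\<close>. The flags \<open>\<alpha>\<close> and \<open>\<beta>\<close> tell whether the first and the last vertex
  also belong to another maximal path; the simple modules \<open>(0, 1)\<close> and \<open>(L - 1, L)\<close> at such vertices are
  counted separately.
\<close>

definition arc_graphs :: "nat \<Rightarrow> bool \<Rightarrow> bool \<Rightarrow> (nat \<times> nat) set set" where
  "arc_graphs L \<alpha> \<beta> = {T. T \<subseteq> {(x, y). x < y \<and> y \<le> L} \<and> (0, L) \<in> T \<and>
     (\<forall>x y. (x, y) \<in> T \<longrightarrow> (x, y) = (0, L) \<or> (\<exists>y'>y. (x, y') \<in> T) \<or> (\<exists>x'<x. (x', y) \<in> T)) \<and>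
     (\<forall>h. 0 < h \<longrightarrow> h < L \<longrightarrow> \<alpha> \<and> h = 1 \<or> \<beta> \<and> Suc h = L \<or> (\<exists>y. (h, y) \<in> T) \<or> (\<exists>x. (x, h) \<in> T)) \<and>
     (\<alpha> \<longrightarrow> (0, 1) \<notin> T) \<and> (\<forall>h. \<beta> \<longrightarrow> Suc h = L \<longrightarrow> (h, L) \<notin> T)}"

lemma arc_graphsI:
  assumes "T \<subseteq> {(x, y). x < y \<and> y \<le> L}" "(0, L) \<in> T"
    and "\<And>x y. (x, y) \<in> T \<Longrightarrow> (x, y) = (0, L) \<or> (\<exists>y'>y. (x, y') \<in> T) \<or> (\<exists>x'<x. (x', y) \<in> T)"
    and "\<And>h. 0 < h \<Longrightarrow> h < L \<Longrightarrow> \<alpha> \<and> h = 1 \<or> \<beta> \<and> Suc h = L \<or> (\<exists>y. (h, y) \<in> T) \<or> (\<exists>x. (x, h) \<in> T)"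
    and "\<alpha> \<Longrightarrow> (0, 1) \<notin> T" "\<And>h. \<beta> \<Longrightarrow> Suc h = L \<Longrightarrow> (h, L) \<notin> T"
  shows "T \<in> arc_graphs L \<alpha> \<beta>"
  unfolding arc_graphs_def mem_Collect_eq by (intro conjI allI impI assms; assumption)

lemma arc_graphsD:
  assumes "T \<in> arc_graphs L \<alpha> \<beta>"
  shows "T \<subseteq> {(x, y). x < y \<and> y \<le> L}" "(0, L) \<in> T"
    and "\<And>x y. (x, y) \<in> T \<Longrightarrow> (x, y) = (0, L) \<or> (\<exists>y'>y. (x, y') \<in> T) \<or> (\<exists>x'<x. (x', y) \<in> T)"
    and "\<And>h. 0 < h \<Longrightarrow> h < L \<Longrightarrow> \<alpha> \<and> h = 1 \<or> \<beta> \<and> Suc h = L \<or> (\<exists>y. (h, y) \<in> T) \<or> (\<exists>x. (x, h) \<in> T)"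
    and "\<alpha> \<Longrightarrow> (0, 1) \<notin> T" "\<And>h. \<beta> \<Longrightarrow> Suc h = L \<Longrightarrow> (h, L) \<notin> T"
  using assms unfolding arc_graphs_def mem_Collect_eq by (elim conjE; simp)+

lemma finite_arc_graphs: "finite (arc_graphs L \<alpha> \<beta>)"
  by (rule finite_subset[of _ "Pow ({..L} \<times> {..L})"]) (use arc_graphsD(1) in fastforce, simp)

text \<open>With \<open>C = {L}\<close> some interval must start at \<open>0\<close>, and the
  longest one can only be excused by ending at \<open>L\<close>, so \<open>(0, L)\<close> is forced.
  Conversely \<open>(0, L)\<close> starts before every other interval ending at \<open>L\<close> and
  excuses it.\<close>

lemma arc_graphs_hooked:
  assumes "1 \<le> L"
  shows "arc_graphs L False False = hooked_graphs L 0 {L}"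
proof (rule equalityI; rule subsetI)
  fix T assume T: "T \<in> arc_graphs L False False"
  have "(\<exists>y'>y. (x, y') \<in> T) \<or> (\<exists>x'<x. (x', y) \<in> T) \<or> y \<in> {L}" if "(x, y) \<in> T" for x y
    using T that unfolding arc_graphs_def by blast
  moreover have "h \<in> {L} \<or> (\<exists>y. (h, y) \<in> T) \<or> (\<exists>x. (x, h) \<in> T)" if "h < L" for h
    using T that unfolding arc_graphs_def by (cases "h = 0") auto
  ultimately show "T \<in> hooked_graphs L 0 {L}"
    using arc_graphsD(1)[OF T] unfolding hooked_graphs_def by simp
next
  fix T assume T: "T \<in> hooked_graphs L 0 {L}"
  then have TL: "T \<subseteq> {(x, y). x < y \<and> y \<le> L}"
    and T1: "\<And>x y. (x, y) \<in> T \<Longrightarrow> (\<exists>y'>y. (x, y') \<in> T) \<or> (\<exists>x'<x. (x', y) \<in> T) \<or> y \<in> {L}"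
    and T2: "\<And>h. h < L \<Longrightarrow> h \<in> {L} \<or> (\<exists>y. (h, y) \<in> T) \<or> (\<exists>x. (x, h) \<in> T)"
    unfolding hooked_graphs_def by auto
  have 0: "(0, L) \<in> T"
  proof -
    let ?N = "{y. (0, y) \<in> T}"
    have finN: "finite ?N" by (rule finite_subset[of _ "{..L}"]) (use TL in auto)
    have ne: "?N \<noteq> {}" using T2[of 0] TL assms by fastforce
    define M where "M = Max ?N"
    have M: "(0, M) \<in> T" using Max_in[OF finN ne] unfolding M_def by simp
    moreover have "\<not> (\<exists>y'>M. (0, y') \<in> T)" using Max_ge[OF finN] unfolding M_def by fastforce
    ultimately have "M \<in> {L}" using T1[OF M] by blast
    then show ?thesis using M by simp
  qed
  have "(x, y) = (0, L) \<or> (\<exists>y'>y. (x, y') \<in> T) \<or> (\<exists>x'<x. (x', y) \<in> T)" if "(x, y) \<in> T" for x y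
    using T1[OF that] 0 by (cases "x = 0") auto
  then show "T \<in> arc_graphs L False False"
    using TL
  proof (intro arc_graphsI)
    show "False \<and> h = 1 \<or> False \<and> Suc h = L \<or> (\<exists>y. (h, y) \<in> T) \<or> (\<exists>x. (x, h) \<in> T)" if "h < L" for h
      using T2[OF that] that by blast
  qed (use 0 in simp_all)
qed

lemma card_arc_graphs_FF:
  assumes "1 \<le> L"
  shows "card (arc_graphs L False False) = qfact2 L"
proof -
  have "int (card (arc_graphs L False False)) = (\<Prod>i\<in>{0..<L}. hook_weight L {L} i)"
    unfolding arc_graphs_hooked[OF assms] by (rule card_hooked_graphs_int) auto
  also have "\<dots> = (\<Prod>i\<in>{1..L}. 2 ^ i - 1)"
    by (rule prod.reindex_bij_witness[of _ "\<lambda>i. L - i" "\<lambda>i. L - i"]) (auto simp: hook_weight_def)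
  also have "\<dots> = int (qfact2 L)"
    unfolding qfact2_def by (simp add: of_nat_diff)
  finally show ?thesis by simp
qed

text \<open>Reflection of \<open>{0..L}\<close> exchanges the two kinds of hooks, the two ways of
  covering a point, and the two flags. So a recursion for the flag at the first vertex is
  enough.\<close>

lemma card_arc_graphs_reverse: "card (arc_graphs L \<alpha> \<beta>) = card (arc_graphs L \<beta> \<alpha>)"
proof -
  let ?r = "\<lambda>(x, y). (L - y, L - x)"
  have inv: "?r ` ?r ` T = T" if "T \<in> arc_graphs L \<alpha> \<beta>" for T \<alpha> \<beta>
  proof -
    have "(case ?r z of (x, y) \<Rightarrow> (L - y, L - x)) = z" if "z \<in> T" for z
      using that \<open>T \<in> arc_graphs L \<alpha> \<beta>\<close> unfolding arc_graphs_def by force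
    then show ?thesis unfolding image_image by simp
  qed
  have mem: "(x, y) \<in> ?r ` T \<longleftrightarrow> (L - y, L - x) \<in> T" if "x \<le> L" "y \<le> L" "T \<in> arc_graphs L \<alpha> \<beta>" for x y T \<alpha> \<beta>
  proof
    assume "(x, y) \<in> ?r ` T"
    then obtain a b where "(a, b) \<in> T" "x = L - b" "y = L - a" by auto
    moreover have "a < b" "b \<le> L" using \<open>(a, b) \<in> T\<close> that(3) unfolding arc_graphs_def by auto
    ultimately show "(L - y, L - x) \<in> T" by simp
  qed (use that in force)
  have sub: "?r ` T \<in> arc_graphs L \<beta> \<alpha>" if T: "T \<in> arc_graphs L \<alpha> \<beta>" for T \<alpha> \<beta>
  proof -
    note TL = arc_graphsD(1)[OF T] and T0 = arc_graphsD(2)[OF T] and T1 = arc_graphsD(3)[OF T]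
      and T2 = arc_graphsD(4)[OF T] and T3 = arc_graphsD(5,6)[OF T]
    note mem' = mem[OF _ _ T]
    have rL: "?r ` T \<subseteq> {(x, y). x < y \<and> y \<le> L}" using TL by force
    have g0: "(0, L) \<in> ?r ` T" using T0 by force
    have g1: "(x, y) = (0, L) \<or> (\<exists>y'>y. (x, y') \<in> ?r ` T) \<or> (\<exists>x'<x. (x', y) \<in> ?r ` T)"
      if xy: "(x, y) \<in> ?r ` T" for x y
    proof -
      obtain a b where ab: "(a, b) \<in> T" "x = L - b" "y = L - a" "a < b" "b \<le> L"
        using xy TL by auto
      from T1[OF ab(1)] show ?thesis
      proof (elim disjE exE conjE)
        fix b' assume b': "b < b'" "(a, b') \<in> T"
        then have "b' \<le> L" using TL by auto
        then have "L - b' < x" using b'(1) ab by simp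
        then show ?thesis using b'(2) ab(3) by force
      next
        fix a' assume a': "a' < a" "(a', b) \<in> T"
        then have "y < L - a'" using ab by simp
        then show ?thesis using a'(2) ab(2) by force
      qed (use ab in auto)
    qed
    have g2: "\<beta> \<and> h = 1 \<or> \<alpha> \<and> Suc h = L \<or> (\<exists>y. (h, y) \<in> ?r ` T) \<or> (\<exists>x. (x, h) \<in> ?r ` T)"
      if h: "0 < h" "h < L" for h
    proof -
      have "0 < L - h" "L - h < L" using h by auto
      from T2[OF this] show ?thesis
      proof (elim disjE exE conjE)
        fix y assume "(L - h, y) \<in> T"
        then have "(L - y, h) \<in> ?r ` T" using h by force
        then show ?thesis by blast
      next
        fix x assume "(x, L - h) \<in> T"
        then have "(h, L - x) \<in> ?r ` T" using h by force
        then show ?thesis by blast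
      qed (use h in auto)
    qed
    have g3: "(0, 1) \<notin> ?r ` T" if \<beta>
    proof
      assume "(0, 1) \<in> ?r ` T"
      then obtain a b where "(a, b) \<in> T" "0 = L - b" "1 = L - a" by auto
      moreover from this have "a < b" "b \<le> L" using TL by auto
      ultimately have "Suc a = L" "b = L" by auto
      then show False using T3(2)[OF that] \<open>(a, b) \<in> T\<close> by simp
    qed
    have g4: "(h, L) \<notin> ?r ` T" if \<alpha> "Suc h = L" for h
    proof -
      have "L - h = 1" "h \<le> L" using that by auto
      then show ?thesis using T3(1)[OF that(1)] mem'[of h L] by simp
    qed
    show ?thesis using rL g0 g1 g2 g3 g4 by (rule arc_graphsI)
  qed
  have "bij_betw ((`) ?r) (arc_graphs L \<alpha> \<beta>) (arc_graphs L \<beta> \<alpha>)"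
    by (rule bij_betw_byWitness[where f' = "(`) ?r"]) (intro ballI inv image_subsetI sub; assumption)+
  then show ?thesis by (rule bij_betw_same_card)
qed


text \<open>The flagged sets \<open>?X\<close> are split by whether an interval starts at
  \<open>1\<close>. Those with one (\<open>?Non\<close>) are precisely the unflagged sets without
  \<open>(0, 1)\<close>. Those with none (\<open>?Iso\<close>) do not touch the point
  \<open>1\<close> at all, and deleting it leaves the unflagged sets for \<open>L\<close>. The
  unflagged sets containing \<open>(0, 1)\<close> arise from \<open>?X\<close> by inserting it: it
  hooks onto \<open>(0, Suc L)\<close> and covers \<open>1\<close>. The claim is the sum of these
  equations. Under \<beta>, the bound \<open>2 \<le> L\<close> keeps the point \<open>1\<close>
  apart from the last vertex.\<close>

lemma card_arc_graphs_first:
  assumes "1 \<le> L" "\<beta> \<Longrightarrow> 2 \<le> L"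
  shows "card (arc_graphs (Suc L) False \<beta>) + card (arc_graphs L False \<beta>) = 2 * card (arc_graphs (Suc L) True \<beta>)"
proof -
  let ?X = "arc_graphs (Suc L) True \<beta>"
  let ?Non = "{T \<in> ?X. \<exists>y. (1, y) \<in> T}" and ?Iso = "{T \<in> ?X. \<forall>y. (1, y) \<notin> T}"
  have L: "(0::nat, 1::nat) \<noteq> (0, Suc L)" and L': "\<And>h. \<beta> \<Longrightarrow> Suc h = Suc L \<Longrightarrow> h \<noteq> 0 \<and> h \<noteq> 1"
    using assms by auto
  have ins: "insert (0, 1) T \<in> arc_graphs (Suc L) False \<beta>" if T: "T \<in> ?X" for T
  proof (rule arc_graphsI)
    show "insert (0, 1) T \<subseteq> {(x, y). x < y \<and> y \<le> Suc L}" "(0, Suc L) \<in> insert (0, 1) T"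
      using arc_graphsD(1,2)[OF T] by auto
    fix x y assume "(x, y) \<in> insert (0, 1) T"
    then show "(x, y) = (0, Suc L) \<or> (\<exists>y'>y. (x, y') \<in> insert (0, 1) T) \<or> (\<exists>x'<x. (x', y) \<in> insert (0, 1) T)"
      using arc_graphsD(3)[OF T, of x y] arc_graphsD(2)[OF T] assms(1)
      by (cases "(x, y) = (0, 1)") (simp, use less_Suc_eq_le in blast, blast)
  next
    fix h assume "0 < h" "h < Suc L"
    then show "False \<and> h = 1 \<or> \<beta> \<and> Suc h = Suc L \<or> (\<exists>y. (h, y) \<in> insert (0, 1) T) \<or> (\<exists>x. (x, h) \<in> insert (0, 1) T)"
      using arc_graphsD(4)[OF T, of h] by auto
  next
    fix h assume "\<beta>" "Suc h = Suc L"
    then show "(h, Suc L) \<notin> insert (0, 1) T"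
      using arc_graphsD(6)[OF T, of h] L' assms(1) by auto
  qed simp
  have X1: "?Non = {T \<in> arc_graphs (Suc L) False \<beta>. (0, 1) \<notin> T}"
  proof (rule equalityI; rule subsetI)
    fix T assume "T \<in> ?Non"
    then have T: "T \<in> ?X" and y: "\<exists>y. (1, y) \<in> T" by auto
    have "T \<in> arc_graphs (Suc L) False \<beta>"
      using arc_graphsD(1,2)[OF T] arc_graphsD(3)[OF T]
    proof (rule arc_graphsI)
      fix h assume "0 < h" "h < Suc L"
      then show "False \<and> h = 1 \<or> \<beta> \<and> Suc h = Suc L \<or> (\<exists>y. (h, y) \<in> T) \<or> (\<exists>x. (x, h) \<in> T)"
        using arc_graphsD(4)[OF T, of h] y by auto
    qed (use arc_graphsD(6)[OF T] in auto)
    then show "T \<in> {T \<in> arc_graphs (Suc L) False \<beta>. (0, 1) \<notin> T}"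
      using arc_graphsD(5)[OF T] by auto
  next
    fix T assume "T \<in> {T \<in> arc_graphs (Suc L) False \<beta>. (0, 1) \<notin> T}"
    then have T: "T \<in> arc_graphs (Suc L) False \<beta>" and 01: "(0, 1) \<notin> T" by auto
    have y: "\<exists>y. (1, y) \<in> T"
    proof -
      have "\<not> (\<beta> \<and> Suc 1 = Suc L)" using assms(2) by auto
      then have "(\<exists>y. (1, y) \<in> T) \<or> (\<exists>x. (x, 1) \<in> T)"
        using arc_graphsD(4)[OF T, of 1] assms(1) by auto
      then show ?thesis using arc_graphsD(1)[OF T] 01 by fastforce
    qed
    have "T \<in> ?X"
      using arc_graphsD(1,2)[OF T] arc_graphsD(3)[OF T]
    proof (rule arc_graphsI)
      fix h assume "0 < h" "h < Suc L"
      then show "True \<and> h = 1 \<or> \<beta> \<and> Suc h = Suc L \<or> (\<exists>y. (h, y) \<in> T) \<or> (\<exists>x. (x, h) \<in> T)"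
        using arc_graphsD(4)[OF T, of h] by auto
    qed (use arc_graphsD(6)[OF T] 01 in auto)
    then show "T \<in> ?Non" using y by simp
  qed
  have "bij_betw (insert (0, 1)) ?X {T \<in> arc_graphs (Suc L) False \<beta>. (0, 1) \<in> T}"
  proof (rule bij_betw_byWitness[where f' = "\<lambda>T. T - {(0, 1)}"])
    show "\<forall>T\<in>?X. insert (0, 1) T - {(0, 1)} = T"
      using arc_graphsD(5) by (metis Diff_insert_absorb)
    show "insert (0, 1) ` ?X \<subseteq> {T \<in> arc_graphs (Suc L) False \<beta>. (0, 1) \<in> T}"
      using ins by auto
    show "(\<lambda>T. T - {(0, 1)}) ` {T \<in> arc_graphs (Suc L) False \<beta>. (0, 1) \<in> T} \<subseteq> ?X"
    proof (rule image_subsetI)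
      fix T assume "T \<in> {T \<in> arc_graphs (Suc L) False \<beta>. (0, 1) \<in> T}"
      then have T: "T \<in> arc_graphs (Suc L) False \<beta>" by simp
      note TL = arc_graphsD(1)[OF T]
      let ?U = "T - {(0, 1)}"
      show "?U \<in> ?X"
      proof (rule arc_graphsI)
        show "?U \<subseteq> {(x, y). x < y \<and> y \<le> Suc L}" "(0, Suc L) \<in> ?U"
          using arc_graphsD(1,2)[OF T] L by auto
        fix x y assume xy: "(x, y) \<in> ?U"
        then have "x < y" using TL by auto
        then show "(x, y) = (0, Suc L) \<or> (\<exists>y'>y. (x, y') \<in> ?U) \<or> (\<exists>x'<x. (x', y) \<in> ?U)"
          using arc_graphsD(3)[OF T, of x y] xy by auto
      next
        fix h assume h: "0 < h" "h < Suc L"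
        then show "True \<and> h = 1 \<or> \<beta> \<and> Suc h = Suc L \<or> (\<exists>y. (h, y) \<in> ?U) \<or> (\<exists>x. (x, h) \<in> ?U)"
          using arc_graphsD(4)[OF T, of h] by (cases "h = 1") auto
      qed (use arc_graphsD(6)[OF T] in auto)
    qed
  qed auto
  then have c1: "card ?X = card {T \<in> arc_graphs (Suc L) False \<beta>. (0, 1) \<in> T}"
    by (rule bij_betw_same_card)
  have c2: "card (arc_graphs (Suc L) False \<beta>) = card ?Non + card ?X"
    unfolding c1 X1 by (subst card_Un_disjoint[symmetric]) (auto simp: finite_arc_graphs intro!: arg_cong[where f = card])
  \<comment> \<open>The order embedding of the points for \<open>L\<close> into those for
    \<open>Suc L\<close> that skips the point \<open>1\<close>.\<close>
  define s :: "nat \<Rightarrow> nat" where "s h = (if h = 0 then 0 else Suc h)" for h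
  let ?s = "\<lambda>(x, y). (s x, s y)"
  have s_less: "s x < s y \<longleftrightarrow> x < y" and s_eq: "s x = s y \<longleftrightarrow> x = y" and s_1: "s x \<noteq> 1" for x y
    unfolding s_def by auto
  have s_ran: "\<exists>x'. x = s x'" if "x \<noteq> 1" for x
    unfolding s_def using that by (intro exI[of _ "x - 1"]) auto
  have s_L: "s y \<le> Suc L \<longleftrightarrow> y \<le> L" "s 0 = 0" "s L = Suc L" for y
    unfolding s_def using assms(1) by auto
  have s_Suc: "Suc (s h) = Suc L \<longleftrightarrow> Suc h = L" if "L \<ge> 2" for h
    unfolding s_def using that by auto
  have s_mem: "(s x, s y) \<in> ?s ` T \<longleftrightarrow> (x, y) \<in> T" for x y T
    using s_eq by force
  have s_not1: "(1, y) \<notin> ?s ` T" "(x, 1) \<notin> ?s ` T" for x y T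
    using s_1 by (force dest: sym)+
  have "bij_betw ((`) ?s) (arc_graphs L False \<beta>) ?Iso"
  proof (rule bij_betw_byWitness[where f' = "\<lambda>T. {(x, y). (s x, s y) \<in> T}"])
    show "\<forall>T\<in>arc_graphs L False \<beta>. {(x, y). (s x, s y) \<in> ?s ` T} = T"
      using s_mem by auto
    \<comment> \<open>The only interval that could end at \<open>1\<close> is \<open>(0, 1)\<close>,
      which the flag forbids.\<close>
    have no1: "x \<noteq> 1 \<and> y \<noteq> 1" if "T \<in> ?Iso" "(x, y) \<in> T" for T x y
    proof -
      have "(0, 1) \<notin> T" "T \<subseteq> {(x, y). x < y \<and> y \<le> Suc L}"
        using that arc_graphsD[of T] by auto
      then show ?thesis using that by (cases "x = 0") auto
    qed
    show "\<forall>T\<in>?Iso. ?s ` {(x, y). (s x, s y) \<in> T} = T"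
    proof
      fix T assume T: "T \<in> ?Iso"
      show "?s ` {(x, y). (s x, s y) \<in> T} = T"
      proof (rule equalityI; rule subsetI)
        fix z assume z: "z \<in> T"
        obtain x y where xy: "z = (x, y)" by (cases z)
        obtain x' y' where "x = s x'" "y = s y'" using no1[OF T] z s_ran unfolding xy by metis
        then show "z \<in> ?s ` {(x, y). (s x, s y) \<in> T}" using z xy by auto
      qed auto
    qed
    show "(`) ?s ` arc_graphs L False \<beta> \<subseteq> ?Iso"
    proof (rule image_subsetI)
      fix T assume T: "T \<in> arc_graphs L False \<beta>"
      note TL = arc_graphsD(1)[OF T]
      have "?s ` T \<in> ?X"
      proof (rule arc_graphsI)
        show "?s ` T \<subseteq> {(x, y). x < y \<and> y \<le> Suc L}" using TL by (auto simp: s_less s_L)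
        show "(0, Suc L) \<in> ?s ` T" using arc_graphsD(2)[OF T] s_mem[of 0 L T] s_L by simp
        fix x y assume "(x, y) \<in> ?s ` T"
        then obtain a b where ab: "(a, b) \<in> T" "x = s a" "y = s b" by auto
        from arc_graphsD(3)[OF T ab(1)]
        show "(x, y) = (0, Suc L) \<or> (\<exists>y'>y. (x, y') \<in> ?s ` T) \<or> (\<exists>x'<x. (x', y) \<in> ?s ` T)"
        proof (elim disjE exE conjE)
          assume "(a, b) = (0, L)"
          then show ?thesis using ab(2,3) s_L by simp
        next
          fix y' assume "b < y'" "(a, y') \<in> T"
          then have "s b < s y'" "(s a, s y') \<in> ?s ` T" using s_less s_mem by blast+
          then show ?thesis unfolding ab(2,3) by blast
        next
          fix x' assume "x' < a" "(x', b) \<in> T"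
          then have "s x' < s a" "(s x', s b) \<in> ?s ` T" using s_less s_mem by blast+
          then show ?thesis unfolding ab(2,3) by blast
        qed
      next
        fix h assume h: "0 < h" "h < Suc L"
        show "True \<and> h = 1 \<or> \<beta> \<and> Suc h = Suc L \<or> (\<exists>y. (h, y) \<in> ?s ` T) \<or> (\<exists>x. (x, h) \<in> ?s ` T)"
        proof (cases "h = 1")
          case False
          then obtain h' where h': "h = s h'" using s_ran by blast
          have "0 < h'" "h' < L" using h s_less[of 0 h'] s_less[of h' L] s_L unfolding h' by auto
          from arc_graphsD(4)[OF T this]
          show ?thesis unfolding h' using s_mem assms(2) s_Suc by blast
        qed simp
      next
        show "(0, 1) \<notin> ?s ` T" using s_not1 by blast
        fix h assume \<beta> "Suc h = Suc L"
        show "(h, Suc L) \<notin> ?s ` T"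
        proof
          assume "(h, Suc L) \<in> ?s ` T"
          then obtain a b where ab: "(a, b) \<in> T" "h = s a" "Suc L = s b" by auto
          have "b = L" using ab(3) s_L s_eq by metis
          moreover have "Suc a = L" using ab(2) \<open>Suc h = Suc L\<close> s_Suc assms(2)[OF \<open>\<beta>\<close>] by metis
          ultimately show False using arc_graphsD(6)[OF T \<open>\<beta>\<close>] ab(1) by blast
        qed
      qed
      then show "?s ` T \<in> ?Iso" using s_not1 by blast
    qed
    show "(\<lambda>T. {(x, y). (s x, s y) \<in> T}) ` ?Iso \<subseteq> arc_graphs L False \<beta>"
    proof (rule image_subsetI)
      fix T assume T0: "T \<in> ?Iso"
      then have T: "T \<in> ?X" by simp
      let ?U = "{(x, y). (s x, s y) \<in> T}"
      show "?U \<in> arc_graphs L False \<beta>"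
      proof (rule arc_graphsI)
        show "?U \<subseteq> {(x, y). x < y \<and> y \<le> L}" using arc_graphsD(1)[OF T] s_less s_L by blast
        show "(0, L) \<in> ?U" using arc_graphsD(2)[OF T] s_L by simp
        fix x y assume "(x, y) \<in> ?U"
        then have xy: "(s x, s y) \<in> T" by simp
        from arc_graphsD(3)[OF T xy]
        show "(x, y) = (0, L) \<or> (\<exists>y'>y. (x, y') \<in> ?U) \<or> (\<exists>x'<x. (x', y) \<in> ?U)"
        proof (elim disjE exE conjE)
          assume "(s x, s y) = (0, Suc L)"
          then show ?thesis using s_L s_eq by (metis prod.inject)
        next
          fix y' assume y': "s y < y'" "(s x, y') \<in> T"
          then obtain b where "y' = s b" using no1[OF T0] s_ran by blast
          then show ?thesis using y' s_less by blast
        next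
          fix x' assume x': "x' < s x" "(x', s y) \<in> T"
          then obtain a where "x' = s a" using no1[OF T0] s_ran by blast
          then show ?thesis using x' s_less by blast
        qed
      next
        fix h assume h: "0 < h" "h < L"
        have sh: "0 < s h" "s h < Suc L" "s h \<noteq> 1" using h s_less[of 0 h] s_less[of h L] s_L s_1 by auto
        from arc_graphsD(4)[OF T sh(1,2)] sh(3)
        show "False \<and> h = 1 \<or> \<beta> \<and> Suc h = L \<or> (\<exists>y. (h, y) \<in> ?U) \<or> (\<exists>x. (x, h) \<in> ?U)"
        proof (elim disjE exE conjE)
          fix y assume y: "(s h, y) \<in> T"
          then obtain b where "y = s b" using no1[OF T0] s_ran by blast
          then show ?thesis using y by blast
        next
          fix x assume x: "(x, s h) \<in> T"
          then obtain a where "x = s a" using no1[OF T0] s_ran by blast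
          then show ?thesis using x by blast
        next
          assume \<beta> "Suc (s h) = Suc L"
          then show ?thesis using s_Suc assms(2) by blast
        qed auto
      next
        fix h assume \<beta> "Suc h = L"
        then have "Suc (s h) = Suc L" using s_Suc assms(2) by blast
        then show "(h, L) \<notin> ?U" using arc_graphsD(6)[OF T \<open>\<beta>\<close>, of "s h"] s_L by simp
      qed simp
    qed
  qed
  then have c3: "card (arc_graphs L False \<beta>) = card ?Iso" by (rule bij_betw_same_card)
  have "card ?X = card ?Non + card ?Iso"
    by (subst card_Un_disjoint[symmetric]) (auto simp: finite_arc_graphs intro!: arg_cong[where f = card])
  then show ?thesis using c2 c3 by simp
qed

lemma qfact2_Suc: "qfact2 (Suc m) = (2 ^ Suc m - 1) * qfact2 m"
  unfolding qfact2_def by (simp add: prod.nat_ivl_Suc')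

text \<open>Half of \<open>qfact2 L + qfact2 (L - 1) = 2 ^ L * qfact2 (L - 1)\<close>.\<close>

lemma card_arc_graphs_TF:
  assumes "2 \<le> L"
  shows "card (arc_graphs L True False) = N1 L"
proof -
  obtain l where l: "L = Suc l" "1 \<le> l" using assms by (metis Suc_le_D Suc_le_mono numeral_2_eq_2 One_nat_def)
  have "2 * card (arc_graphs L True False) = qfact2 (Suc l) + qfact2 l"
    using card_arc_graphs_first[of l False] card_arc_graphs_FF[of l] card_arc_graphs_FF[of "Suc l"] l by simp
  also have "\<dots> = 2 ^ Suc l * qfact2 l"
    unfolding qfact2_Suc by (simp add: diff_mult_distrib)
  finally show ?thesis unfolding N1_def l by simp
qed

lemma card_arc_graphs_TT:
  assumes "2 \<le> L"
  shows "card (arc_graphs L True True) = N2 L"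
proof (cases "L = 2")
  case True
  \<comment> \<open>For \<open>L = 2\<close> the two ends are neighbours and the recursion does not
    apply. The flags exclude both simple modules, which leaves the whole path alone.\<close>
  have "arc_graphs 2 True True = {{(0, 2)}}"
  proof (rule equalityI; rule subsetI)
    fix T assume T: "T \<in> arc_graphs 2 True True"
    have "(x, y) = (0, 2)" if "(x, y) \<in> T" for x y
    proof -
      have "x < y" "y \<le> 2" using arc_graphsD(1)[OF T] that by auto
      then have "(x, y) \<in> {(0, 1), (1, 2), (0, 2)}" by auto
      moreover have "(0, 1) \<notin> T" "(1, 2) \<notin> T"
        using arc_graphsD(5)[OF T] arc_graphsD(6)[OF T, of 1] by auto
      ultimately show ?thesis using that by auto
    qed
    then have "T \<subseteq> {(0, 2)}" by (intro subrelI) blast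
    then show "T \<in> {{(0, 2)}}" using arc_graphsD(2)[OF T] by blast
  next
    fix T :: "(nat \<times> nat) set" assume "T \<in> {{(0, 2)}}"
    then have [simp]: "T = {(0, 2)}" by simp
    show "T \<in> arc_graphs 2 True True" by (intro arc_graphsI) auto
  qed
  then show ?thesis using True by (simp add: N2_def)
next
  case False
  then obtain l where l: "L = Suc (Suc l)" "1 \<le> l"
    using assms by (intro that[of "L - 2"]) auto
  have "card (arc_graphs (Suc l') False True) = N1 (Suc l')" if "1 \<le> l'" for l'
    using card_arc_graphs_reverse[of "Suc l'" False True] card_arc_graphs_TF[of "Suc l'"] that by simp
  then have "2 * card (arc_graphs L True True) = N1 (Suc (Suc l)) + N1 (Suc l)"
    using card_arc_graphs_first[of "Suc l" True] l by simp
  also have "\<dots> = 2 ^ Suc l * ((2 ^ Suc l - 1) * qfact2 l) + 2 ^ l * qfact2 l"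
    unfolding N1_def by (simp add: qfact2_Suc)
  \<comment> \<open>This is \<open>2 * (2 ^ Suc l - 1) + 1 = 2 ^ L - 1\<close> with
    \<open>L = l + 2\<close>.\<close>
  also have "\<dots> = 2 ^ l * ((2 ^ L - 1) * qfact2 l)"
    unfolding l by (simp add: algebra_simps diff_mult_distrib diff_mult_distrib2)
  finally have "2 * card (arc_graphs L True True) = 2 * (2 ^ (l - 1) * ((2 ^ L - 1) * qfact2 l))"
    using l by (cases l) auto
  then show ?thesis unfolding N2_def using l by simp
qed

lemma card_arc_graphs:
  assumes "2 \<le> L"
  shows "card (arc_graphs L \<alpha> \<beta>) = Nk (if \<alpha> \<and> \<beta> then 2 else if \<alpha> \<or> \<beta> then 1 else 0) L"
proof -
  have "card (arc_graphs L False True) = N1 L"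
    using card_arc_graphs_reverse[of L False True] card_arc_graphs_TF[OF assms] by simp
  moreover have "card (arc_graphs L False False) = N0 L"
    using card_arc_graphs_FF assms unfolding N0_def by simp
  ultimately show ?thesis
    using card_arc_graphs_TF[OF assms] card_arc_graphs_TT[OF assms] by (cases \<alpha>; cases \<beta>) (simp_all add: Nk_def)
qed

section \<open>Left modules\<close>

context left_module
begin

lemma smult_zero [simp]: "a \<in> carrier R \<Longrightarrow> a \<odot>\<^bsub>M\<^esub> \<zero>\<^bsub>M\<^esub> = \<zero>\<^bsub>M\<^esub>"
  using smult_r_distr[of a "\<zero>\<^bsub>M\<^esub>" "\<zero>\<^bsub>M\<^esub>"] smult_closed[of a "\<zero>\<^bsub>M\<^esub>"]
  by (simp add: M.add.r_cancel_one')

lemma zero_smult [simp]: "x \<in> carrier M \<Longrightarrow> \<zero> \<odot>\<^bsub>M\<^esub> x = \<zero>\<^bsub>M\<^esub>"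
  using smult_l_distr[of \<zero> \<zero> x] smult_closed[of \<zero> x]
  by (simp add: M.add.r_cancel_one')

text \<open>Makes negation a scalar multiplication, so that a set closed under the action has the
  inverses which \<open>submodule\<close> asks for.\<close>

lemma neg_one_smult:
  assumes "x \<in> carrier M"
  shows "(\<ominus> \<one>) \<odot>\<^bsub>M\<^esub> x = \<ominus>\<^bsub>M\<^esub> x"
proof -
  have "(\<ominus> \<one>) \<odot>\<^bsub>M\<^esub> x \<oplus>\<^bsub>M\<^esub> x = \<zero>\<^bsub>M\<^esub>"
    using assms smult_l_distr[of "\<ominus> \<one>" \<one> x] by (simp add: R.l_neg smult_one)
  then show ?thesis using assms by (simp add: M.minus_equality smult_closed)
qed

lemma left_submoduleI:
  assumes "H \<subseteq> carrier M" "\<zero>\<^bsub>M\<^esub> \<in> H"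
    and "\<And>x y. x \<in> H \<Longrightarrow> y \<in> H \<Longrightarrow> x \<oplus>\<^bsub>M\<^esub> y \<in> H"
    and "\<And>a x. a \<in> carrier R \<Longrightarrow> x \<in> H \<Longrightarrow> a \<odot>\<^bsub>M\<^esub> x \<in> H"
  shows "submodule H R M"
proof (intro submodule.intro subgroup.intro submodule_axioms.intro)
  show "inv\<^bsub>add_monoid M\<^esub> x \<in> H" if "x \<in> H" for x
    using assms(4)[of "\<ominus> \<one>" x] that assms(1) neg_one_smult[of x] by (auto simp: a_inv_def)
qed (use assms in auto)

lemma left_submoduleD:
  assumes "submodule H R M"
  shows "H \<subseteq> carrier M" "\<zero>\<^bsub>M\<^esub> \<in> H"
    and "\<And>x y. x \<in> H \<Longrightarrow> y \<in> H \<Longrightarrow> x \<oplus>\<^bsub>M\<^esub> y \<in> H"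
    and "\<And>a x. a \<in> carrier R \<Longrightarrow> x \<in> H \<Longrightarrow> a \<odot>\<^bsub>M\<^esub> x \<in> H"
    and "\<And>x. x \<in> H \<Longrightarrow> \<ominus>\<^bsub>M\<^esub> x \<in> H"
proof -
  note sg = submodule.axioms(1)[OF assms]
  show *: "H \<subseteq> carrier M" using subgroup.subset[OF sg] by simp
  show "\<zero>\<^bsub>M\<^esub> \<in> H" using subgroup.one_closed[OF sg] by simp
  show "x \<oplus>\<^bsub>M\<^esub> y \<in> H" if "x \<in> H" "y \<in> H" for x y
    using subgroup.m_closed[OF sg that] by simp
  show **: "a \<odot>\<^bsub>M\<^esub> x \<in> H" if "a \<in> carrier R" "x \<in> H" for a x
    by (rule submodule.smult_closed[OF assms that])
  show "\<ominus>\<^bsub>M\<^esub> x \<in> H" if "x \<in> H" for x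
    using **[of "\<ominus> \<one>" x] that neg_one_smult[of x] * by (simp add: subset_iff)
qed

lemma carrier_submodule: "submodule (carrier M) R M"
  by (rule left_submoduleI) (auto intro: smult_closed)

lemma zero_submodule: "submodule {\<zero>\<^bsub>M\<^esub>} R M"
  by (rule left_submoduleI) auto

lemma submodule_left_module:
  assumes "submodule H R M"
  shows "left_module R (M\<lparr>carrier := H\<rparr>)"
proof -
  note H = left_submoduleD[OF assms]
  have c: "\<And>x. x \<in> H \<Longrightarrow> x \<in> carrier M" using H(1) by blast
  have "abelian_group (M\<lparr>carrier := H\<rparr>)"
  proof (rule abelian_groupI)
    fix x assume "x \<in> carrier (M\<lparr>carrier := H\<rparr>)"
    then show "\<exists>y\<in>carrier (M\<lparr>carrier := H\<rparr>). y \<oplus>\<^bsub>M\<lparr>carrier := H\<rparr>\<^esub> x = \<zero>\<^bsub>M\<lparr>carrier := H\<rparr>\<^esub>"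
      using H(5)[of x] c M.l_neg by auto
  qed (use H c in \<open>auto simp: M.a_ac\<close>)
  then show ?thesis
    by (intro left_module.intro left_module_axioms.intro R.ring_axioms)
       (use H c in \<open>auto simp: smult_l_distr smult_r_distr smult_assoc1 smult_one\<close>)
qed

end

subsection \<open>Homomorphisms\<close>

lemma mod_homI:
  assumes "\<And>x. x \<in> carrier M \<Longrightarrow> f x \<in> carrier N"
    and "\<And>x. x \<notin> carrier M \<Longrightarrow> f x = undefined"
    and "\<And>x y. x \<in> carrier M \<Longrightarrow> y \<in> carrier M \<Longrightarrow> f (x \<oplus>\<^bsub>M\<^esub> y) = f x \<oplus>\<^bsub>N\<^esub> f y"
    and "\<And>a x. a \<in> carrier A \<Longrightarrow> x \<in> carrier M \<Longrightarrow> f (a \<odot>\<^bsub>M\<^esub> x) = a \<odot>\<^bsub>N\<^esub> f x"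
  shows "f \<in> mod_hom A M N"
  using assms unfolding mod_hom_def by (auto simp: PiE_def extensional_def)

lemma mod_hom_restrictI:
  assumes "left_module A M"
    and "\<And>x. x \<in> carrier M \<Longrightarrow> f x \<in> carrier N"
    and "\<And>x y. x \<in> carrier M \<Longrightarrow> y \<in> carrier M \<Longrightarrow> f (x \<oplus>\<^bsub>M\<^esub> y) = f x \<oplus>\<^bsub>N\<^esub> f y"
    and "\<And>a x. a \<in> carrier A \<Longrightarrow> x \<in> carrier M \<Longrightarrow> f (a \<odot>\<^bsub>M\<^esub> x) = a \<odot>\<^bsub>N\<^esub> f x"
  shows "restrict f (carrier M) \<in> mod_hom A M N"
proof -
  interpret left_module A M by fact
  show ?thesis using assms by (intro mod_homI) (auto simp: smult_closed)
qed

lemma mod_homD: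
  assumes "f \<in> mod_hom A M N"
  shows "\<And>x. x \<in> carrier M \<Longrightarrow> f x \<in> carrier N"
    and "\<And>x. x \<notin> carrier M \<Longrightarrow> f x = undefined"
    and "\<And>x y. x \<in> carrier M \<Longrightarrow> y \<in> carrier M \<Longrightarrow> f (x \<oplus>\<^bsub>M\<^esub> y) = f x \<oplus>\<^bsub>N\<^esub> f y"
    and "\<And>a x. a \<in> carrier A \<Longrightarrow> x \<in> carrier M \<Longrightarrow> f (a \<odot>\<^bsub>M\<^esub> x) = a \<odot>\<^bsub>N\<^esub> f x"
  using assms unfolding mod_hom_def by (auto simp: PiE_def extensional_def)

lemma mod_hom_zero:
  assumes "left_module A M" "left_module A N" "f \<in> mod_hom A M N"
  shows "f \<zero>\<^bsub>M\<^esub> = \<zero>\<^bsub>N\<^esub>"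
proof -
  interpret M: left_module A M by fact
  interpret N: left_module A N by fact
  have "f (\<zero>\<^bsub>A\<^esub> \<odot>\<^bsub>M\<^esub> \<zero>\<^bsub>M\<^esub>) = \<zero>\<^bsub>A\<^esub> \<odot>\<^bsub>N\<^esub> f \<zero>\<^bsub>M\<^esub>"
    by (rule mod_homD(4)[OF assms(3)]) auto
  then show ?thesis using mod_homD(1)[OF assms(3), of "\<zero>\<^bsub>M\<^esub>"] by simp
qed

lemma mod_hom_minus:
  assumes "left_module A M" "left_module A N" "f \<in> mod_hom A M N" "x \<in> carrier M" "y \<in> carrier M"
  shows "f (x \<ominus>\<^bsub>M\<^esub> y) = f x \<ominus>\<^bsub>N\<^esub> f y"
proof -
  interpret M: left_module A M by fact
  interpret N: left_module A N by fact
  have "f (\<ominus>\<^bsub>M\<^esub> y) = \<ominus>\<^bsub>N\<^esub> f y"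
    using mod_homD(4)[OF assms(3), of "\<ominus>\<^bsub>A\<^esub> \<one>\<^bsub>A\<^esub>" y] assms(5) mod_homD(1)[OF assms(3,5)]
    by (simp add: M.neg_one_smult N.neg_one_smult)
  then show ?thesis
    using mod_homD(3)[OF assms(3,4), of "\<ominus>\<^bsub>M\<^esub> y"] assms(5) by (simp add: a_minus_def)
qed

lemma mod_hom_inj_iff:
  assumes "left_module A M" "left_module A N" "f \<in> mod_hom A M N"
  shows "inj_on f (carrier M) \<longleftrightarrow> (\<forall>x\<in>carrier M. f x = \<zero>\<^bsub>N\<^esub> \<longrightarrow> x = \<zero>\<^bsub>M\<^esub>)"
proof
  interpret M: left_module A M by fact
  interpret N: left_module A N by fact
  show "inj_on f (carrier M) \<Longrightarrow> \<forall>x\<in>carrier M. f x = \<zero>\<^bsub>N\<^esub> \<longrightarrow> x = \<zero>\<^bsub>M\<^esub>"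
    using mod_hom_zero[OF assms] M.M.zero_closed by (metis inj_onD)
  assume *: "\<forall>x\<in>carrier M. f x = \<zero>\<^bsub>N\<^esub> \<longrightarrow> x = \<zero>\<^bsub>M\<^esub>"
  show "inj_on f (carrier M)"
  proof (rule inj_onI)
    fix x y assume xy: "x \<in> carrier M" "y \<in> carrier M" "f x = f y"
    have "f (x \<ominus>\<^bsub>M\<^esub> y) = \<zero>\<^bsub>N\<^esub>"
      using mod_hom_minus[OF assms xy(1,2)] mod_homD(1)[OF assms(3)] xy by (simp add: N.M.r_neg a_minus_def)
    then have "x \<ominus>\<^bsub>M\<^esub> y = \<zero>\<^bsub>M\<^esub>" using * xy by simp
    then show "x = y" using xy by (simp add: M.M.minus_eq) (metis M.M.minus_equality M.M.minus_minus M.M.a_inv_closed)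
  qed
qed

lemma mod_hom_compose:
  assumes "f \<in> mod_hom A L M" "g \<in> mod_hom A M N"
    and "\<And>x y. x \<in> carrier L \<Longrightarrow> y \<in> carrier L \<Longrightarrow> x \<oplus>\<^bsub>L\<^esub> y \<in> carrier L"
    and "\<And>a x. a \<in> carrier A \<Longrightarrow> x \<in> carrier L \<Longrightarrow> a \<odot>\<^bsub>L\<^esub> x \<in> carrier L"
  shows "compose (carrier L) g f \<in> mod_hom A L N"
  by (rule mod_homI) (use assms mod_homD[OF assms(1)] mod_homD[OF assms(2)] in \<open>auto simp: compose_def\<close>)

lemma mod_hom_compose':
  assumes "left_module A L" "f \<in> mod_hom A L M" "g \<in> mod_hom A M N"
  shows "compose (carrier L) g f \<in> mod_hom A L N"
proof -
  interpret left_module A L by fact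
  show ?thesis by (rule mod_hom_compose[OF assms(2,3)]) (auto intro: smult_closed)
qed

lemma mod_hom_inverse:
  assumes "left_module A M" "left_module A N" "f \<in> mod_hom A M N" "bij_betw f (carrier M) (carrier N)"
  shows "restrict (inv_into (carrier M) f) (carrier N) \<in> mod_hom A N M"
proof -
  interpret M: left_module A M by fact
  interpret N: left_module A N by fact
  let ?g = "inv_into (carrier M) f"
  have fg: "f (?g y) = y" "?g y \<in> carrier M" if "y \<in> carrier N" for y
    using assms(4) that by (auto simp: bij_betw_inv_into_right bij_betw_def inv_into_into)
  have gf: "?g (f x) = x" if "x \<in> carrier M" for x
    using assms(4) that by (simp add: bij_betw_inv_into_left)
  show ?thesis
  proof (rule mod_hom_restrictI[OF assms(2)])
    fix x y assume xy: "x \<in> carrier N" "y \<in> carrier N"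
    have "f (?g x \<oplus>\<^bsub>M\<^esub> ?g y) = x \<oplus>\<^bsub>N\<^esub> y"
      using mod_homD(3)[OF assms(3), of "?g x" "?g y"] fg xy by simp
    then show "?g (x \<oplus>\<^bsub>N\<^esub> y) = ?g x \<oplus>\<^bsub>M\<^esub> ?g y"
      using gf[of "?g x \<oplus>\<^bsub>M\<^esub> ?g y"] fg xy by simp
  next
    fix a y assume ay: "a \<in> carrier A" "y \<in> carrier N"
    have "f (a \<odot>\<^bsub>M\<^esub> ?g y) = a \<odot>\<^bsub>N\<^esub> y"
      using mod_homD(4)[OF assms(3), of a "?g y"] fg ay by simp
    then show "?g (a \<odot>\<^bsub>N\<^esub> y) = a \<odot>\<^bsub>M\<^esub> ?g y"
      using gf[of "a \<odot>\<^bsub>M\<^esub> ?g y"] fg ay M.smult_closed by simp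
  qed (use fg in auto)
qed

lemma mod_iso_refl:
  assumes "left_module A M"
  shows "mod_iso A M M"
  unfolding mod_iso_def
proof (intro bexI)
  show "restrict (\<lambda>x. x) (carrier M) \<in> mod_hom A M M"
    by (rule mod_hom_restrictI[OF assms]) auto
  show "bij_betw (restrict (\<lambda>x. x) (carrier M)) (carrier M) (carrier M)"
    by (auto simp: bij_betw_def inj_on_def)
qed

lemma mod_iso_sym:
  assumes "left_module A M" "left_module A N" "mod_iso A M N"
  shows "mod_iso A N M"
proof -
  obtain f where f: "f \<in> mod_hom A M N" "bij_betw f (carrier M) (carrier N)"
    using assms(3) unfolding mod_iso_def by blast
  have "bij_betw (restrict (inv_into (carrier M) f) (carrier N)) (carrier N) (carrier M)"
    using bij_betw_inv_into[OF f(2)] by (simp add: bij_betw_def inj_on_restrict_eq)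
  then show ?thesis using mod_hom_inverse[OF assms(1,2) f] unfolding mod_iso_def by blast
qed

lemma mod_iso_trans:
  assumes "left_module A L" "mod_iso A L M" "mod_iso A M N"
  shows "mod_iso A L N"
proof -
  obtain f g where f: "f \<in> mod_hom A L M" "bij_betw f (carrier L) (carrier M)"
    and g: "g \<in> mod_hom A M N" "bij_betw g (carrier M) (carrier N)"
    using assms(2,3) unfolding mod_iso_def by blast
  have "bij_betw (compose (carrier L) g f) (carrier L) (carrier N)"
    using bij_betw_trans[OF f(2) g(2)] by (rule bij_betw_cong[THEN iffD2, rotated]) (simp add: compose_def)
  then show ?thesis using mod_hom_compose'[OF assms(1) f(1) g(1)] unfolding mod_iso_def by blast
qed

text \<open>Reduces counting to a list of pairwise non-isomorphic representatives. They must belong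
  to \<open>C\<close> itself and hence have its carrier type; for this reason the interval modules
  below are realised on functions \<open>nat \<Rightarrow> 'k\<close>.\<close>

lemma card_iso_classes:
  assumes "\<And>M. M \<in> C \<Longrightarrow> left_module A M"
    and "\<And>i. i \<in> I \<Longrightarrow> rep i \<in> C"
    and "\<And>M. M \<in> C \<Longrightarrow> \<exists>i\<in>I. mod_iso A M (rep i)"
    and "\<And>i j. i \<in> I \<Longrightarrow> j \<in> I \<Longrightarrow> mod_iso A (rep i) (rep j) \<Longrightarrow> i = j"
  shows "card (iso_classes A C) = card I"
proof -
  let ?r = "{(M, N). M \<in> C \<and> N \<in> C \<and> mod_iso A M N}"
  have equiv: "equiv C ?r"
  proof (rule equivI)
    show "?r \<subseteq> C \<times> C" by auto
    show "refl_on C ?r" using mod_iso_refl assms(1) by (auto simp: refl_on_def)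
    show "sym ?r" using mod_iso_sym assms(1) by (auto simp: sym_def)
    show "trans ?r" using mod_iso_trans assms(1) by (auto simp: trans_def) blast
  qed
  have "bij_betw (\<lambda>i. ?r `` {rep i}) I (C // ?r)"
  proof (rule bij_betw_imageI)
    show "inj_on (\<lambda>i. ?r `` {rep i}) I"
    proof (rule inj_onI)
      fix i j assume ij: "i \<in> I" "j \<in> I" "?r `` {rep i} = ?r `` {rep j}"
      have "(rep i, rep j) \<in> ?r"
        using eq_equiv_class[OF ij(3) equiv] assms(2) ij by blast
      then show "i = j" using assms(4) ij by blast
    qed
    show "(\<lambda>i. ?r `` {rep i}) ` I = C // ?r"
    proof (rule equalityI; rule subsetI)
      fix X assume "X \<in> (\<lambda>i. ?r `` {rep i}) ` I"
      then obtain i where "i \<in> I" "X = ?r `` {rep i}" by blast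
      then show "X \<in> C // ?r" using quotientI[of "rep i" C ?r] assms(2) by simp
    next
      fix X assume "X \<in> C // ?r"
      then obtain M where M: "M \<in> C" "X = ?r `` {M}" by (auto elim: quotientE)
      obtain i where i: "i \<in> I" "mod_iso A M (rep i)" using assms(3)[OF M(1)] by blast
      have "X = ?r `` {rep i}"
        unfolding M(2) by (rule equiv_class_eq[OF equiv]) (use M(1) i(2) assms(2)[OF i(1)] in simp)
      then show "X \<in> (\<lambda>i. ?r `` {rep i}) ` I" using i(1) by blast
    qed
  qed
  then show ?thesis unfolding iso_classes_def by (rule bij_betw_same_card[symmetric])
qed

section \<open>Images, preimages and kernels of homomorphisms\<close>

lemma submodule_preimage:
  assumes "left_module A M" "left_module A N" "f \<in> mod_hom A M N" "submodule V A N"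
  shows "submodule {x \<in> carrier M. f x \<in> V} A M"
proof -
  interpret M: left_module A M by fact
  interpret N: left_module A N by fact
  show ?thesis
    by (rule M.left_submoduleI)
       (use mod_hom_zero[OF assms(1-3)] mod_homD[OF assms(3)] N.left_submoduleD[OF assms(4)] in
        \<open>auto simp: M.smult_closed\<close>)
qed

lemma submodule_image:
  assumes "left_module A M" "left_module A N" "f \<in> mod_hom A M N" "submodule U A M"
  shows "submodule (f ` U) A N"
proof -
  interpret M: left_module A M by fact
  interpret N: left_module A N by fact
  note U = M.left_submoduleD[OF assms(4)]
  note f = mod_homD[OF assms(3)]
  have c: "\<And>x. x \<in> U \<Longrightarrow> x \<in> carrier M" using U(1) by blast
  show ?thesis
  proof (rule N.left_submoduleI)
    show "f ` U \<subseteq> carrier N" using c f(1) by blast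
    show "\<zero>\<^bsub>N\<^esub> \<in> f ` U" using mod_hom_zero[OF assms(1-3)] U(2) by force
    fix y y' assume "y \<in> f ` U" "y' \<in> f ` U"
    then obtain x x' where "x \<in> U" "x' \<in> U" "y = f x" "y' = f x'" by blast
    then show "y \<oplus>\<^bsub>N\<^esub> y' \<in> f ` U" using f(3)[of x x'] U(3) c by (metis imageI)
  next
    fix a y assume a: "a \<in> carrier A" "y \<in> f ` U"
    then obtain x where "x \<in> U" "y = f x" by blast
    then show "a \<odot>\<^bsub>N\<^esub> y \<in> f ` U" using f(4)[of a x] U(4) c a by (metis imageI)
  qed
qed

lemma submodule_kernel:
  assumes "left_module A M" "left_module A N" "f \<in> mod_hom A M N"
  shows "submodule {x \<in> carrier M. f x = \<zero>\<^bsub>N\<^esub>} A M"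
proof -
  interpret N: left_module A N by fact
  show ?thesis using submodule_preimage[OF assms N.zero_submodule] by simp
qed

subsection \<open>Quotients\<close>

context left_module
begin

lemma submodule_abelian_subgroup:
  assumes "submodule U R M"
  shows "abelian_subgroup U M"
proof -
  interpret submodule U R M by fact
  show ?thesis
    by (rule abelian_subgroupI3) (auto simp: additive_subgroup_def subgroup_axioms M.abelian_group_axioms)
qed

lemma smult_coset:
  assumes "submodule U R M" "a \<in> carrier R" "x \<in> carrier M"
  shows "a \<odot>\<^bsub>quotient_module M U\<^esub> (U +>\<^bsub>M\<^esub> x) = U +>\<^bsub>M\<^esub> (a \<odot>\<^bsub>M\<^esub> x)"
proof -
  interpret U: abelian_subgroup U M by (rule submodule_abelian_subgroup[OF assms(1)])
  note U = left_submoduleD[OF assms(1)]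
  have ax: "a \<odot>\<^bsub>M\<^esub> x \<in> carrier M" using assms smult_closed by simp
  show ?thesis
  proof (rule equalityI; rule subsetI)
    fix y assume "y \<in> a \<odot>\<^bsub>quotient_module M U\<^esub> (U +>\<^bsub>M\<^esub> x)"
    then obtain u v where uv: "u \<in> U" "v \<in> U" "y = u \<oplus>\<^bsub>M\<^esub> a \<odot>\<^bsub>M\<^esub> (v \<oplus>\<^bsub>M\<^esub> x)"
      unfolding quotient_module_def set_add_def' a_r_coset_def' by auto
    then have "y = (u \<oplus>\<^bsub>M\<^esub> a \<odot>\<^bsub>M\<^esub> v) \<oplus>\<^bsub>M\<^esub> a \<odot>\<^bsub>M\<^esub> x"
      using assms U(1) ax smult_closed by (simp add: smult_r_distr M.a_assoc subset_iff)
    moreover have "u \<oplus>\<^bsub>M\<^esub> a \<odot>\<^bsub>M\<^esub> v \<in> U" using U(3)[OF uv(1) U(4)[OF assms(2) uv(2)]] .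
    ultimately show "y \<in> U +>\<^bsub>M\<^esub> (a \<odot>\<^bsub>M\<^esub> x)" unfolding a_r_coset_def' by blast
  next
    fix y assume "y \<in> U +>\<^bsub>M\<^esub> (a \<odot>\<^bsub>M\<^esub> x)"
    then obtain u where u: "u \<in> U" "y = u \<oplus>\<^bsub>M\<^esub> a \<odot>\<^bsub>M\<^esub> x" unfolding a_r_coset_def' by blast
    have "y = u \<oplus>\<^bsub>M\<^esub> a \<odot>\<^bsub>M\<^esub> (\<zero>\<^bsub>M\<^esub> \<oplus>\<^bsub>M\<^esub> x)" using u assms(3) by simp
    then have "\<exists>v\<in>U. \<exists>w\<in>U. y = v \<oplus>\<^bsub>M\<^esub> a \<odot>\<^bsub>M\<^esub> (w \<oplus>\<^bsub>M\<^esub> x)"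
      using u(1) U(2) by blast
    then show "y \<in> a \<odot>\<^bsub>quotient_module M U\<^esub> (U +>\<^bsub>M\<^esub> x)"
      unfolding quotient_module_def set_add_def' a_r_coset_def' by simp
  qed
qed

lemma carrier_quotient_module: "carrier (quotient_module M U) = (\<lambda>x. U +>\<^bsub>M\<^esub> x) ` carrier M"
  unfolding quotient_module_def A_RCOSETS_def' by auto

lemma left_module_quotient_module:
  assumes "submodule U R M"
  shows "left_module R (quotient_module M U)"
proof -
  interpret U: abelian_subgroup U M by (rule submodule_abelian_subgroup[OF assms])
  note sc = smult_coset[OF assms]
  have ac: "(U +>\<^bsub>M\<^esub> x) \<oplus>\<^bsub>quotient_module M U\<^esub> (U +>\<^bsub>M\<^esub> y) = U +>\<^bsub>M\<^esub> (x \<oplus>\<^bsub>M\<^esub> y)"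
    if "x \<in> carrier M" "y \<in> carrier M" for x y
    using U.a_rcos_sum[OF that] by (simp add: quotient_module_def)
  have 0: "\<zero>\<^bsub>quotient_module M U\<^esub> = U +>\<^bsub>M\<^esub> \<zero>\<^bsub>M\<^esub>"
    by (simp add: quotient_module_def U.a_rcos_const)
  have "abelian_group (quotient_module M U)"
  proof (rule abelian_groupI)
    fix X assume "X \<in> carrier (quotient_module M U)"
    then obtain x where x: "x \<in> carrier M" "X = U +>\<^bsub>M\<^esub> x" unfolding carrier_quotient_module by blast
    show "\<exists>Y\<in>carrier (quotient_module M U). Y \<oplus>\<^bsub>quotient_module M U\<^esub> X = \<zero>\<^bsub>quotient_module M U\<^esub>"
    proof (rule bexI)
      show "(U +>\<^bsub>M\<^esub> (\<ominus>\<^bsub>M\<^esub> x)) \<oplus>\<^bsub>quotient_module M U\<^esub> X = \<zero>\<^bsub>quotient_module M U\<^esub>"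
        using x by (simp add: ac 0 M.l_neg del: M.a_coset_add_zero)
      show "U +>\<^bsub>M\<^esub> (\<ominus>\<^bsub>M\<^esub> x) \<in> carrier (quotient_module M U)"
        using x unfolding carrier_quotient_module by simp
    qed
  qed (auto simp: carrier_quotient_module ac 0 M.a_ac simp del: M.a_coset_add_zero)
  then show ?thesis
    by (intro left_module.intro left_module_axioms.intro R.ring_axioms)
       (auto simp: carrier_quotient_module ac sc smult_closed smult_l_distr smult_r_distr smult_assoc1 smult_one)
qed

lemma coset_in_quotient: "x \<in> carrier M \<Longrightarrow> U +>\<^bsub>M\<^esub> x \<in> carrier (quotient_module M U)"
  unfolding carrier_quotient_module by simp

end

lemma first_isomorphism:
  assumes "left_module A M" "left_module A N" "f \<in> mod_hom A M N" "f ` carrier M = carrier N"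
    and "U = {x \<in> carrier M. f x = \<zero>\<^bsub>N\<^esub>}"
  shows "mod_iso A (quotient_module M U) N"
proof -
  interpret M: left_module A M by fact
  interpret N: left_module A N by fact
  have subU: "submodule U A M" unfolding assms(5) by (rule submodule_kernel[OF assms(1-3)])
  interpret U: abelian_subgroup U M by (rule M.submodule_abelian_subgroup[OF subU])
  note f = mod_homD[OF assms(3)]
  \<comment> \<open>\<open>f\<close> is constant on every coset of its kernel, so the image of a
    coset is a singleton.\<close>
  define g where "g X = the_elem (f ` X)" for X
  have g: "g (U +>\<^bsub>M\<^esub> x) = f x" if x: "x \<in> carrier M" for x
  proof -
    have "f ` (U +>\<^bsub>M\<^esub> x) = {f x}"
    proof (rule equalityI; rule subsetI)
      fix y assume "y \<in> f ` (U +>\<^bsub>M\<^esub> x)"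
      then obtain u where u: "u \<in> U" "y = f (u \<oplus>\<^bsub>M\<^esub> x)" unfolding a_r_coset_def' by blast
      then show "y \<in> {f x}" using f(1,3) x unfolding assms(5) by simp
    next
      fix y assume "y \<in> {f x}"
      then show "y \<in> f ` (U +>\<^bsub>M\<^esub> x)" using U.a_rcos_self[OF x] by blast
    qed
    then show ?thesis unfolding g_def by simp
  qed
  let ?Q = "quotient_module M U"
  note Q = M.left_module_quotient_module[OF subU]
  have hom: "restrict g (carrier ?Q) \<in> mod_hom A ?Q N"
  proof (rule mod_hom_restrictI[OF Q])
    fix X assume "X \<in> carrier ?Q"
    then show "g X \<in> carrier N" unfolding M.carrier_quotient_module using g f(1) by auto
  next
    fix X Y assume "X \<in> carrier ?Q" "Y \<in> carrier ?Q"
    then obtain x y where "x \<in> carrier M" "y \<in> carrier M" "X = U +>\<^bsub>M\<^esub> x" "Y = U +>\<^bsub>M\<^esub> y"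
      unfolding M.carrier_quotient_module by (elim imageE) (rule that)
    then show "g (X \<oplus>\<^bsub>?Q\<^esub> Y) = g X \<oplus>\<^bsub>N\<^esub> g Y"
      using g f(3) U.a_rcos_sum by (simp add: quotient_module_def)
  next
    fix a X assume "a \<in> carrier A" "X \<in> carrier ?Q"
    then show "g (a \<odot>\<^bsub>?Q\<^esub> X) = a \<odot>\<^bsub>N\<^esub> g X"
      unfolding M.carrier_quotient_module using g f(4) M.smult_coset[OF subU] M.smult_closed by auto
  qed
  have "inj_on (restrict g (carrier ?Q)) (carrier ?Q)"
    unfolding mod_hom_inj_iff[OF Q assms(2) hom]
  proof (intro ballI impI)
    fix X assume X: "X \<in> carrier ?Q" "restrict g (carrier ?Q) X = \<zero>\<^bsub>N\<^esub>"
    then obtain x where x: "x \<in> carrier M" "X = U +>\<^bsub>M\<^esub> x"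
      unfolding M.carrier_quotient_module by (elim imageE)
    then have "x \<in> U" using X g unfolding assms(5) by simp
    then show "X = \<zero>\<^bsub>?Q\<^esub>" unfolding x(2) using U.a_rcos_const by (simp add: quotient_module_def)
  qed
  moreover have "restrict g (carrier ?Q) ` carrier ?Q = carrier N"
    unfolding assms(4)[symmetric] M.carrier_quotient_module using g
    by (simp add: image_image cong: image_cong)
  ultimately show ?thesis using hom unfolding mod_iso_def bij_betw_def by blast
qed

subsection \<open>Invariance under isomorphism\<close>

text \<open>\<open>X\<close> enters through closure of its carrier, so for the dual module two
  closure lemmas are what has to be supplied.\<close>

lemma in_gen_iso:
  assumes "in_gen A X M" "mod_iso A M N"
    and "\<And>x y. x \<in> carrier X \<Longrightarrow> y \<in> carrier X \<Longrightarrow> x \<oplus>\<^bsub>X\<^esub> y \<in> carrier X"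
    and "\<And>a x. a \<in> carrier A \<Longrightarrow> x \<in> carrier X \<Longrightarrow> a \<odot>\<^bsub>X\<^esub> x \<in> carrier X"
  shows "in_gen A X N"
proof -
  obtain n f where f: "f \<in> mod_hom A (power_module n X) M" "f ` carrier (power_module n X) = carrier M"
    using assms(1) unfolding in_gen_def by blast
  obtain h where h: "h \<in> mod_hom A M N" "bij_betw h (carrier M) (carrier N)"
    using assms(2) unfolding mod_iso_def by blast
  let ?g = "compose (carrier (power_module n X)) h f"
  have "?g \<in> mod_hom A (power_module n X) N"
    by (rule mod_hom_compose[OF f(1) h(1)]) (use assms(3,4) in \<open>auto simp: power_module_def PiE_iff\<close>)
  moreover have "?g ` carrier (power_module n X) = carrier N"
  proof -
    have "?g ` carrier (power_module n X) = h ` f ` carrier (power_module n X)"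
      unfolding image_image by (rule image_cong) (simp_all add: compose_def)
    then show ?thesis using f(2) h(2) by (simp add: bij_betw_def)
  qed
  ultimately show ?thesis unfolding in_gen_def by blast
qed

lemma in_cogen_iso:
  assumes "left_module A N" "in_cogen A X M" "mod_iso A N M"
  shows "in_cogen A X N"
proof -
  obtain n f where f: "f \<in> mod_hom A M (power_module n X)" "inj_on f (carrier M)"
    using assms(2) unfolding in_cogen_def by blast
  obtain h where h: "h \<in> mod_hom A N M" "bij_betw h (carrier N) (carrier M)"
    using assms(3) unfolding mod_iso_def by blast
  have "inj_on (compose (carrier N) f h) (carrier N)"
  proof -
    have "inj_on (f \<circ> h) (carrier N)" using f(2) h(2) by (intro comp_inj_on) (auto simp: bij_betw_def)
    then show ?thesis by (simp add: compose_def inj_on_def)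
  qed
  then show ?thesis
    using mod_hom_compose'[OF assms(1) h(1) f(1)] unfolding in_cogen_def by blast
qed

lemma simple_module_iso:
  assumes "left_module A M" "left_module A N" "mod_iso A M N" "simple_module A M"
  shows "simple_module A N"
proof -
  interpret M: left_module A M by fact
  interpret N: left_module A N by fact
  obtain f where f: "f \<in> mod_hom A M N" "bij_betw f (carrier M) (carrier N)"
    using assms(3) unfolding mod_iso_def by blast
  have f0: "f \<zero>\<^bsub>M\<^esub> = \<zero>\<^bsub>N\<^esub>" by (rule mod_hom_zero[OF assms(1,2) f(1)])
  have im: "f ` carrier M = carrier N" and inj: "inj_on f (carrier M)" using f(2) unfolding bij_betw_def by auto
  show ?thesis unfolding simple_module_def
  proof (intro conjI allI impI)
    obtain x where "x \<in> carrier M" "x \<noteq> \<zero>\<^bsub>M\<^esub>"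
      using assms(4) M.M.zero_closed unfolding simple_module_def by blast
    then have "f x \<noteq> \<zero>\<^bsub>N\<^esub>" "f x \<in> carrier N" 
      using inj f0 im M.M.zero_closed by (metis inj_onD, metis imageI)
    then show "carrier N \<noteq> {\<zero>\<^bsub>N\<^esub>}" by (metis singletonD)
    fix V assume V: "submodule V A N"
    let ?U = "{x \<in> carrier M. f x \<in> V}"
    have fU: "f ` ?U = V"
    proof (rule equalityI; rule subsetI)
      fix y assume y: "y \<in> V"
      then have "y \<in> f ` carrier M" using N.left_submoduleD(1)[OF V] im by (simp add: subset_iff)
      then show "y \<in> f ` ?U" using y by (elim imageE) simp
    qed auto
    have "?U = {\<zero>\<^bsub>M\<^esub>} \<or> ?U = carrier M"
      by (rule assms(4)[unfolded simple_module_def, THEN conjunct2, rule_format,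
            OF submodule_preimage[OF assms(1,2) f(1) V]])
    then show "V = {\<zero>\<^bsub>N\<^esub>} \<or> V = carrier N" using fU f0 im by auto
  qed
qed

text \<open>The scalars of \<open>End_module M\<close> are the endomorphisms of \<open>M\<close>
  acting by evaluation; linearity over them therefore means commuting with them.\<close>

lemma biendomorphism_iff:
  "\<phi> \<in> carrier (End_ring (End_ring A M) (End_module M)) \<longleftrightarrow>
    \<phi> \<in> carrier M \<rightarrow>\<^sub>E carrier M \<and>
    (\<forall>x\<in>carrier M. \<forall>y\<in>carrier M. \<phi> (x \<oplus>\<^bsub>M\<^esub> y) = \<phi> x \<oplus>\<^bsub>M\<^esub> \<phi> y) \<and>
    (\<forall>e\<in>mod_hom A M M. \<forall>x\<in>carrier M. \<phi> (e x) = e (\<phi> x))"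
  by (auto simp: End_ring_def End_module_def mod_hom_def)

text \<open>Injectivity of the natural map is faithfulness, surjectivity is the double centraliser
  property. Both are put pointwise, which frees later arguments from the extensionality of
  homomorphisms.\<close>

lemma faithfully_balanced_iff:
  assumes "left_module A M"
  shows "faithfully_balanced A M \<longleftrightarrow>
    (\<forall>a\<in>carrier A. \<forall>b\<in>carrier A. (\<forall>x\<in>carrier M. a \<odot>\<^bsub>M\<^esub> x = b \<odot>\<^bsub>M\<^esub> x) \<longrightarrow> a = b) \<and>
    (\<forall>\<phi>\<in>carrier (End_ring (End_ring A M) (End_module M)). \<exists>a\<in>carrier A. \<forall>x\<in>carrier M. \<phi> x = a \<odot>\<^bsub>M\<^esub> x)"
proof -
  interpret left_module A M by fact
  let ?B = "carrier (End_ring (End_ring A M) (End_module M))"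
  let ?f = "\<lambda>a. \<lambda>x\<in>carrier M. a \<odot>\<^bsub>M\<^esub> x"
  have sub: "?f a \<in> ?B" if "a \<in> carrier A" for a
    unfolding biendomorphism_iff using that mod_homD by (fastforce simp: smult_closed smult_r_distr)
  have eq: "?f a = \<phi> \<longleftrightarrow> (\<forall>x\<in>carrier M. \<phi> x = a \<odot>\<^bsub>M\<^esub> x)" if "\<phi> \<in> extensional (carrier M)" for a \<phi>
  proof
    assume "\<forall>x\<in>carrier M. \<phi> x = a \<odot>\<^bsub>M\<^esub> x"
    then show "?f a = \<phi>" by (intro extensionalityI[OF restrict_extensional that]) simp
  qed auto
  have "inj_on ?f (carrier A) \<longleftrightarrow>
      (\<forall>a\<in>carrier A. \<forall>b\<in>carrier A. (\<forall>x\<in>carrier M. a \<odot>\<^bsub>M\<^esub> x = b \<odot>\<^bsub>M\<^esub> x) \<longrightarrow> a = b)"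
  proof -
    have "?f a = ?f b \<longleftrightarrow> (\<forall>x\<in>carrier M. a \<odot>\<^bsub>M\<^esub> x = b \<odot>\<^bsub>M\<^esub> x)" for a b
      using eq[OF restrict_extensional, of a "\<lambda>x. b \<odot>\<^bsub>M\<^esub> x"] by auto
    then show ?thesis unfolding inj_on_def by simp
  qed
  moreover have "?f ` carrier A = ?B \<longleftrightarrow> (\<forall>\<phi>\<in>?B. \<exists>a\<in>carrier A. ?f a = \<phi>)"
  proof
    assume R: "\<forall>\<phi>\<in>?B. \<exists>a\<in>carrier A. ?f a = \<phi>"
    show "?f ` carrier A = ?B"
    proof (rule equalityI[OF image_subsetI[OF sub] subsetI])
      fix \<phi> assume "\<phi> \<in> ?B"
      from bspec[OF R this] show "\<phi> \<in> ?f ` carrier A" by (elim bexE) (rule image_eqI[OF sym])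
    qed
  next
    assume *: "?f ` carrier A = ?B"
    show "\<forall>\<phi>\<in>?B. \<exists>a\<in>carrier A. ?f a = \<phi>"
      unfolding *[symmetric] by (intro ballI) (elim imageE, rule bexI, rule sym)
  qed
  moreover have "\<dots> \<longleftrightarrow> (\<forall>\<phi>\<in>?B. \<exists>a\<in>carrier A. \<forall>x\<in>carrier M. \<phi> x = a \<odot>\<^bsub>M\<^esub> x)"
    by (rule ball_cong[OF refl], rule bex_cong[OF refl], rule eq) (simp add: biendomorphism_iff PiE_iff)
  ultimately show ?thesis unfolding faithfully_balanced_def bij_betw_def by blast
qed

lemma faithfully_balanced_iso:
  assumes "left_module A M" "left_module A N" "mod_iso A M N" "faithfully_balanced A M"
  shows "faithfully_balanced A N"
proof -
  interpret M: left_module A M by fact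
  interpret N: left_module A N by fact
  obtain h where h: "h \<in> mod_hom A M N" "bij_betw h (carrier M) (carrier N)"
    using assms(3) unfolding mod_iso_def by blast
  note hD = mod_homD[OF h(1)]
  define k where "k = restrict (inv_into (carrier M) h) (carrier N)"
  have k: "k \<in> mod_hom A N M" unfolding k_def by (rule mod_hom_inverse[OF assms(1,2) h])
  note kD = mod_homD[OF k]
  have hk: "h (k y) = y" if "y \<in> carrier N" for y
    using h(2) that by (simp add: k_def bij_betw_inv_into_right)
  have kh: "k (h x) = x" if "x \<in> carrier M" for x
    using h(2) that hD(1) by (simp add: k_def bij_betw_inv_into_left)
  note fb = assms(4)[unfolded faithfully_balanced_iff[OF assms(1)]]
  show ?thesis unfolding faithfully_balanced_iff[OF assms(2)]
  proof (intro conjI ballI impI)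
    fix a b assume ab: "a \<in> carrier A" "b \<in> carrier A" "\<forall>y\<in>carrier N. a \<odot>\<^bsub>N\<^esub> y = b \<odot>\<^bsub>N\<^esub> y"
    have "a \<odot>\<^bsub>M\<^esub> x = b \<odot>\<^bsub>M\<^esub> x" if x: "x \<in> carrier M" for x
    proof -
      have "h (a \<odot>\<^bsub>M\<^esub> x) = h (b \<odot>\<^bsub>M\<^esub> x)" using hD x ab by simp
      then show ?thesis using kh x ab M.smult_closed by metis
    qed
    then show "a = b" using fb ab by blast
  next
    fix \<phi> assume "\<phi> \<in> carrier (End_ring (End_ring A N) (End_module N))"
    then have \<phi>: "\<And>x. x \<in> carrier N \<Longrightarrow> \<phi> x \<in> carrier N"
      "\<And>x y. x \<in> carrier N \<Longrightarrow> y \<in> carrier N \<Longrightarrow> \<phi> (x \<oplus>\<^bsub>N\<^esub> y) = \<phi> x \<oplus>\<^bsub>N\<^esub> \<phi> y"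
      "\<And>e x. e \<in> mod_hom A N N \<Longrightarrow> x \<in> carrier N \<Longrightarrow> \<phi> (e x) = e (\<phi> x)"
      unfolding biendomorphism_iff by (auto simp: PiE_iff)
    \<comment> \<open>The conjugate of \<open>\<phi>\<close> under the isomorphism. It commutes with
      an endomorphism \<open>e\<close> of \<open>M\<close> because \<open>\<phi>\<close> commutes
      with the conjugate \<open>e'\<close> on \<open>N\<close>.\<close>
    define \<psi> where "\<psi> = (\<lambda>x\<in>carrier M. k (\<phi> (h x)))"
    have "\<psi> \<in> carrier (End_ring (End_ring A M) (End_module M))"
      unfolding biendomorphism_iff
    proof (intro conjI ballI)
      show "\<psi> \<in> carrier M \<rightarrow>\<^sub>E carrier M" using hD(1) kD(1) \<phi>(1) by (auto simp: \<psi>_def)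
      fix x y assume "x \<in> carrier M" "y \<in> carrier M"
      then show "\<psi> (x \<oplus>\<^bsub>M\<^esub> y) = \<psi> x \<oplus>\<^bsub>M\<^esub> \<psi> y" using hD kD \<phi> by (simp add: \<psi>_def)
    next
      fix e x assume e: "e \<in> mod_hom A M M" and x: "x \<in> carrier M"
      define e' where "e' = compose (carrier N) (compose (carrier M) h e) k"
      have "e' \<in> mod_hom A N N"
        unfolding e'_def
        by (rule mod_hom_compose'[OF assms(2) k mod_hom_compose'[OF assms(1) e h(1)]])
      note \<phi>e = \<phi>(3)[OF this]
      have e'h: "e' y = h (e (k y))" if "y \<in> carrier N" for y
        using that kD(1) by (simp add: e'_def compose_def)
      have "\<phi> (h (e x)) = h (e (k (\<phi> (h x))))"
        using \<phi>e[of "h x"] e'h[of "h x"] e'h[of "\<phi> (h x)"] \<phi>(1) hD(1) kh x by simp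
      then show "\<psi> (e x) = e (\<psi> x)"
        using mod_homD(1)[OF e] x kh kD(1) \<phi>(1) hD(1) by (simp add: \<psi>_def)
    qed
    from bspec[OF conjunct2[OF fb] this] obtain a
      where a: "a \<in> carrier A" "\<forall>x\<in>carrier M. \<psi> x = a \<odot>\<^bsub>M\<^esub> x"
      by (elim bexE) (rule that)
    have "\<phi> y = a \<odot>\<^bsub>N\<^esub> y" if y: "y \<in> carrier N" for y
    proof -
      have "k (\<phi> y) = a \<odot>\<^bsub>M\<^esub> k y" using bspec[OF a(2), of "k y"] hk y kD(1) by (simp add: \<psi>_def)
      then have "h (k (\<phi> y)) = a \<odot>\<^bsub>N\<^esub> h (k y)" using hD(4) a(1) kD(1) y by simp
      then show ?thesis using hk \<phi>(1) y by simp
    qed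
    then show "\<exists>a\<in>carrier A. \<forall>x\<in>carrier N. \<phi> x = a \<odot>\<^bsub>N\<^esub> x" using a(1) by blast
  qed
qed

section \<open>Nonzero paths of a quadratic Nakayama algebra\<close>

definition vtx :: "(nat \<Rightarrow> nat) \<Rightarrow> nat \<Rightarrow> nat \<Rightarrow> nat" where
  "vtx s u i = (s ^^ i) u"

lemma vtx_0 [simp]: "vtx s u 0 = u"
  by (simp add: vtx_def)

lemma vtx_vtx [simp]: "vtx s (vtx s u i) j = vtx s u (i + j)"
  by (simp add: vtx_def funpow_add add.commute[of i j])

text \<open>
  The set \<open>W\<close> consists of the nonzero paths, \<open>(u, m)\<close> being the path of length \<open>m\<close> that starts at \<open>u\<close>;
  the arrow starting at \<open>u\<close> ends at \<open>s u\<close>. Assumption \<open>W_glue\<close>, on paths overlapping in an arrow, says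
  that the relations are quadratic.
\<close>

locale nakayama_quiver =
  fixes V :: "nat set" and s :: "nat \<Rightarrow> nat" and W :: "(nat \<times> nat) set"
  assumes finite_W: "finite W"
    and W_vertex: "(u, m) \<in> W \<Longrightarrow> u \<in> V"
    and W_trivial: "v \<in> V \<Longrightarrow> (v, 0) \<in> W"
    and W_sub: "(u, m) \<in> W \<Longrightarrow> i + j \<le> m \<Longrightarrow> (vtx s u i, j) \<in> W"
    and W_glue: "(u, Suc i) \<in> W \<Longrightarrow> (vtx s u i, Suc j) \<in> W \<Longrightarrow> (u, Suc (i + j)) \<in> W"
    and vtx_inj: "u \<in> V \<Longrightarrow> u' \<in> V \<Longrightarrow> vtx s u i = vtx s u' i \<Longrightarrow> u = u'"
    and arrow_at: "v \<in> V \<Longrightarrow> (v, 1) \<in> W \<or> (\<exists>u. (u, 1) \<in> W \<and> vtx s u 1 = v)"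
begin

section \<open>Maximal paths and how they meet\<close>

definition maximal :: "(nat \<times> nat) set" where
  "maximal = {(u, m) \<in> W. (u, Suc m) \<notin> W \<and> (\<forall>u'. vtx s u' 1 = u \<longrightarrow> (u', Suc m) \<notin> W)}"

text \<open>These turn out to be the vertices whose simple modules are both generated by the
  injective cogenerator and cogenerated by the algebra, see
  \<open>simple_in_gen_cogen\<close>.\<close>

definition shared :: "nat set" where
  "shared = {v. (\<exists>m. (v, m) \<in> maximal) \<and> (\<exists>u m. (u, m) \<in> maximal \<and> vtx s u m = v)}"

lemma maximal_W: "w \<in> maximal \<Longrightarrow> w \<in> W"
  by (auto simp: maximal_def)

lemma maximalD:
  assumes "(u, m) \<in> maximal"
  shows "(u, m) \<in> W" "(u, Suc m) \<notin> W" "vtx s u' 1 = u \<Longrightarrow> (u', Suc m) \<notin> W"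
  using assms by (auto simp: maximal_def)

lemma W_head: "(u, m) \<in> W \<Longrightarrow> j \<le> m \<Longrightarrow> (u, j) \<in> W"
  using W_sub[of u m 0 j] by simp

lemma W_tail: "(u, m) \<in> W \<Longrightarrow> i \<le> m \<Longrightarrow> vtx s u i \<in> V"
  using W_sub[of u m i 0] W_vertex by auto

lemma maximal_start_unique:
  assumes "(u, m) \<in> maximal" "(u, m') \<in> W"
  shows "m' \<le> m"
  using maximalD(2)[OF assms(1)] W_head[OF assms(2), of "Suc m"] by (meson not_less_eq_eq)

text \<open>Among the nonzero paths that run through the given one, a longest exists by finiteness
  of \<open>W\<close>, and it cannot be prolonged at either end.\<close>

lemma in_maximal:
  assumes "(u, k) \<in> W"
  obtains a m i where "(a, m) \<in> maximal" "vtx s a i = u" "i + k \<le> m"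
proof -
  let ?E = "{(a, m) \<in> W. \<exists>i. vtx s a i = u \<and> i + k \<le> m}"
  have fin: "finite (snd ` ?E)" by (rule finite_subset[of _ "snd ` W"]) (use finite_W in auto)
  have "(u, k) \<in> ?E" using assms by (auto intro!: exI[of _ 0])
  then have ne: "snd ` ?E \<noteq> {}" by blast
  obtain a m where am: "(a, m) \<in> ?E" "m = Max (snd ` ?E)" using Max_in[OF fin ne] by force
  then obtain i where i: "vtx s a i = u" "i + k \<le> m" by blast
  have le: "m' \<le> m" if "(a', m') \<in> ?E" for a' m'
    unfolding am(2) by (rule Max_ge[OF fin]) (use that in force)
  have "(a, m) \<in> maximal"
    unfolding maximal_def
  proof (clarify, intro conjI allI impI notI)
    show "(a, m) \<in> W" using am by blast
    show False if "(a, Suc m) \<in> W"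
      using le[of a "Suc m"] that i by (auto intro: le_SucI)
    show False if "vtx s u' 1 = a" "(u', Suc m) \<in> W" for u'
    proof -
      have "vtx s u' (Suc i) = u" using i(1) vtx_vtx[of s u' 1 i] unfolding that(1) by simp
      then have "(u', Suc m) \<in> ?E" using that(2) i(2) by (auto intro!: exI[of _ "Suc i"])
      then show False using le by fastforce
    qed
  qed
  then show thesis using that i by blast
qed

text \<open>Every vertex touches an arrow, so a trivial path can always be prolonged. This is the
  point at which the algebra \<open>K\<close> itself drops out.\<close>

lemma maximal_arrow:
  assumes "(u, m) \<in> maximal"
  shows "1 \<le> m"
proof (rule ccontr)
  assume "\<not> 1 \<le> m"
  then have m: "m = 0" by simp
  note M = maximalD[OF assms]
  have "u \<in> V" using M(1) W_vertex by blast
  then show False using arrow_at[of u] M(2,3) unfolding m by auto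
qed

text \<open>An arrow lies on one maximal path and at one place of it. If it occurred further along
  on the second path, the arrow in front of \<open>u1\<close> there could be glued to the first
  path, the overlap being the common arrow, and would prolong the first path beyond its
  start.\<close>

lemma location_unique_arrow:
  assumes "(u1, m1) \<in> maximal" "(u2, m2) \<in> maximal" "vtx s u1 i = vtx s u2 j" "i < m1" "j < m2"
  shows "(u1, m1) = (u2, m2) \<and> i = j"
proof -
  have le: "i = j" if "(u1, m1) \<in> maximal" "(u2, m2) \<in> maximal" "vtx s u1 i = vtx s u2 j" "i < m1" "j < m2" "i \<le> j"
    for u1 m1 u2 m2 i j
  proof (rule ccontr)
    assume "i \<noteq> j"
    then have "i < j" using that(6) by simp
    then obtain d where d: "j = i + Suc d" using less_imp_Suc_add by auto
    note M1 = maximalD[OF that(1)] and M2 = maximalD[OF that(2)]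
    have a: "(vtx s u2 (Suc d)) = u1"
    proof (rule vtx_inj)
      show "vtx s u2 (Suc d) \<in> V" using W_tail[OF M2(1)] that(5) d by simp
      show "u1 \<in> V" using M1(1) W_vertex by blast
      show "vtx s (vtx s u2 (Suc d)) i = vtx s u1 i" using that(3) d by (simp add: add.commute)
    qed
    have "(vtx s u2 d, Suc (Suc i)) \<in> W" using W_sub[OF M2(1), of d "Suc (Suc i)"] that(5) d by simp
    moreover have "(vtx s (vtx s u2 d) (Suc i), m1 - i) \<in> W"
    proof -
      have "vtx s (vtx s u2 d) (Suc i) = vtx s u1 i"
        using a vtx_vtx[of s u2 "Suc d" i] by simp
      then show ?thesis using W_sub[OF M1(1), of i "m1 - i"] that(4) by simp
    qed
    ultimately have "(vtx s u2 d, Suc (Suc i + (m1 - Suc i))) \<in> W"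
      using W_glue[of "vtx s u2 d" "Suc i" "m1 - Suc i"] that(4) by (simp add: Suc_diff_Suc)
    then have "(vtx s u2 d, Suc m1) \<in> W" using that(4) by simp
    moreover have "vtx s (vtx s u2 d) 1 = u1" using a by simp
    ultimately show False using M1(3) by blast
  qed
  have ij: "i = j"
    using le[OF assms] le[OF assms(2,1) assms(3)[symmetric] assms(5,4)] by linarith
  have "u1 = u2"
    using vtx_inj[of u1 u2 i] assms(3) W_vertex maximalD(1)[OF assms(1)] maximalD(1)[OF assms(2)]
    unfolding ij by blast
  then show ?thesis
    using ij maximal_start_unique[OF assms(1)] maximal_start_unique[OF assms(2)] maximalD(1)[OF assms(1)] maximalD(1)[OF assms(2)]
    by (metis le_antisym)
qed

text \<open>If the common vertex is followed by an arrow on both paths, or preceded by one on both,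
  there is a common arrow and the preceding lemma applies; a predecessor is unique by
  \<open>vtx_inj\<close>. Otherwise one path ends where the other starts. The two paths may
  coincide, as for a closed path.\<close>

lemma two_locations:
  assumes "(u1, m1) \<in> maximal" "(u2, m2) \<in> maximal" "vtx s u1 i = vtx s u2 j" "i \<le> m1" "j \<le> m2"
  shows "(u1, m1) = (u2, m2) \<and> i = j \<or> i = m1 \<and> j = 0 \<or> i = 0 \<and> j = m2"
proof (cases "i < m1 \<and> j < m2")
  case True
  then show ?thesis using location_unique_arrow[OF assms(1-3)] by blast
next
  case False
  show ?thesis
  proof (cases "0 < i \<and> 0 < j")
    case True
    then obtain i' j' where ij: "i = Suc i'" "j = Suc j'" by (metis Suc_pred)
    have "vtx s u1 i' = vtx s u2 j'"
    proof (rule vtx_inj[of _ _ 1])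
      show "vtx s u1 i' \<in> V" "vtx s u2 j' \<in> V"
        using W_tail[OF maximalD(1)[OF assms(1)], of i'] W_tail[OF maximalD(1)[OF assms(2)], of j'] assms(4,5) ij by auto
    qed (use assms(3) ij in simp)
    then show ?thesis using location_unique_arrow[OF assms(1,2), of i' j'] assms(4,5) ij by simp
  next
    case no: False
    then show ?thesis using False assms(4,5) maximal_arrow[OF assms(1)] maximal_arrow[OF assms(2)] by auto
  qed
qed

lemma shared_start: "(u, m) \<in> maximal \<Longrightarrow> u \<in> shared \<longleftrightarrow> (\<exists>a k. (a, k) \<in> maximal \<and> vtx s a k = u)"
  unfolding shared_def by blast

lemma shared_end: "(u, m) \<in> maximal \<Longrightarrow> vtx s u m \<in> shared \<longleftrightarrow> (\<exists>k. (vtx s u m, k) \<in> maximal)"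
  unfolding shared_def by blast

text \<open>
  If the last clause fails for an arrow from \<open>u\<close> to \<open>v\<close>, then the arrow acts as a bijection from the
  part of the module at \<open>u\<close> onto the part at \<open>v\<close>, and the inverse of this bijection is a biendomorphism
  which is not given by an element of the algebra.
\<close>

definition balanced :: "(nat \<times> nat) set \<Rightarrow> bool" where
  "balanced S \<longleftrightarrow> maximal \<subseteq> S \<and>
    (\<forall>u m. (u, m) \<in> S \<longrightarrow> (u, m) \<in> maximal \<or> (\<exists>m'>m. (u, m') \<in> S) \<or>
       (\<exists>u' d. 0 < d \<and> vtx s u' d = u \<and> (u', d + m) \<in> S)) \<and>
    (\<forall>u. (u, 1) \<in> W \<longrightarrow> (\<exists>m. (vtx s u 1, m) \<in> S) \<or> (\<exists>u' m. (u', m) \<in> S \<and> vtx s u' m = u))"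

section \<open>Path sets as families of interval sets\<close>

definition arc_edges :: "nat \<times> nat \<Rightarrow> (nat \<times> nat) set" where
  "arc_edges w = {(x, y). x < y \<and> y \<le> Suc (snd w) \<and> \<not> (fst w \<in> shared \<and> (x, y) = (0, 1)) \<and>
     \<not> (vtx s (fst w) (snd w) \<in> shared \<and> (x, y) = (snd w, Suc (snd w)))}"

text \<open>The interval from \<open>x\<close> to \<open>y\<close> consists of the
  \<open>y - x\<close> vertices \<open>x, \<dots>, y - 1\<close>, hence of \<open>y - x - 1\<close>
  arrows.\<close>

definition edge_path :: "nat \<times> nat \<Rightarrow> nat \<times> nat \<Rightarrow> nat \<times> nat" where
  "edge_path w d = (vtx s (fst w) (fst d), snd d - fst d - 1)"

definition arc_part :: "(nat \<times> nat) set \<Rightarrow> nat \<times> nat \<Rightarrow> (nat \<times> nat) set" where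
  "arc_part S w = {d \<in> arc_edges w. edge_path w d \<in> S}"

abbreviation arc_family :: "nat \<times> nat \<Rightarrow> (nat \<times> nat) set set" where
  "arc_family w \<equiv> arc_graphs (Suc (snd w)) (fst w \<in> shared) (vtx s (fst w) (snd w) \<in> shared)"

lemma arc_edges_long: "x < y \<Longrightarrow> y \<le> Suc m \<Longrightarrow> Suc x < y \<Longrightarrow> (x, y) \<in> arc_edges (u, m)"
  by (auto simp: arc_edges_def)

lemma edge_path_W:
  assumes "w \<in> maximal" "d \<in> arc_edges w"
  shows "edge_path w d \<in> W"
proof -
  obtain u m x y where w: "w = (u, m)" and d: "d = (x, y)" by (metis surj_pair)
  have "x < y" "y \<le> Suc m" using assms(2) unfolding w d arc_edges_def by auto
  then show ?thesis
    using W_sub[OF maximalD(1)[OF assms(1)[unfolded w]], of x "y - x - 1"] unfolding w d edge_path_def by simp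
qed

text \<open>By \<open>two_locations\<close> a shared vertex occurs on a maximal path at its ends
  only, and there \<open>arc_edges\<close> omits the trivial path.\<close>

lemma edge_path_not_shared:
  assumes "w \<in> maximal" "d \<in> arc_edges w" "v \<in> shared"
  shows "edge_path w d \<noteq> (v, 0)"
proof
  assume *: "edge_path w d = (v, 0)"
  obtain u m x y where w: "w = (u, m)" and d: "d = (x, y)" by (metis surj_pair)
  have xy: "y = Suc x" "x \<le> m" and v: "vtx s u x = v"
    and ex: "u \<in> shared \<Longrightarrow> x \<noteq> 0" "vtx s u m \<in> shared \<Longrightarrow> x \<noteq> m"
    using assms(2) * unfolding w d arc_edges_def edge_path_def by auto
  obtain m' where m': "(v, m') \<in> maximal" using assms(3) unfolding shared_def by blast
  from two_locations[OF assms(1)[unfolded w] m', of x 0] v xy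
  have "u = v \<and> x = 0 \<or> x = m \<or> 0 = m'" by auto
  then show False using ex v assms(3) maximal_arrow[OF m'] by auto
qed

text \<open>Two different occurrences of a path are, by \<open>two_locations\<close>, an end of one
  maximal path and the start of another. One of the two intervals then has a single vertex, which is
  shared, and such intervals are no edges.\<close>

lemma edge_path_inj:
  assumes "w \<in> maximal" "d \<in> arc_edges w" "w' \<in> maximal" "d' \<in> arc_edges w'" "edge_path w d = edge_path w' d'"
  shows "w = w' \<and> d = d'"
proof -
  obtain u m x y where w: "w = (u, m)" and d: "d = (x, y)" by (metis surj_pair)
  obtain u' m' x' y' where w': "w' = (u', m')" and d': "d' = (x', y')" by (metis surj_pair)
  have xy: "x < y" "y \<le> Suc m" and ex: "u \<in> shared \<Longrightarrow> (x, y) \<noteq> (0, 1)" "vtx s u m \<in> shared \<Longrightarrow> (x, y) \<noteq> (m, Suc m)"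
    using assms(2) unfolding w d arc_edges_def by auto
  have xy': "x' < y'" "y' \<le> Suc m'" and ex': "u' \<in> shared \<Longrightarrow> (x', y') \<noteq> (0, 1)"
      "vtx s u' m' \<in> shared \<Longrightarrow> (x', y') \<noteq> (m', Suc m')"
    using assms(4) unfolding w' d' arc_edges_def by auto
  have eq: "vtx s u x = vtx s u' x'" and len: "y - x - 1 = y' - x' - 1"
    using assms(5) unfolding w w' d d' edge_path_def by auto
  note M = assms(1)[unfolded w] and M' = assms(3)[unfolded w']
  from two_locations[OF M M' eq] xy xy'
  consider "(u, m) = (u', m')" "x = x'" | "x = m" "x' = 0" | "x = 0" "x' = m'" by fastforce
  then show ?thesis
  proof cases
    case 1
    then show ?thesis using len xy xy' unfolding w w' d d' by auto
  next
    case 2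
    then have "vtx s u m \<in> shared" using eq shared_end[OF M] M' by auto
    then have "(x, y) \<noteq> (m, Suc m)" by (rule ex(2))
    then show ?thesis using xy 2 by auto
  next
    case 3
    then have "vtx s u' m' \<in> shared" using eq[symmetric] shared_end[OF M'] M by auto
    then have "(x', y') \<noteq> (m', Suc m')" by (rule ex'(2))
    then show ?thesis using xy' 3 by auto
  qed
qed

text \<open>With \<open>edge_path_inj\<close> and \<open>edge_path_not_shared\<close> this
  decomposes \<open>W\<close> disjointly into the shared trivial paths and the edges of the single
  maximal paths.\<close>

lemma W_cases:
  assumes "p \<in> W"
  obtains (simple) v where "v \<in> shared" "p = (v, 0)"
  | (edge) w d where "w \<in> maximal" "d \<in> arc_edges w" "p = edge_path w d"
proof -
  obtain u k where p: "p = (u, k)" by (cases p)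
  obtain a m i where a: "(a, m) \<in> maximal" "vtx s a i = u" "i + k \<le> m"
    using in_maximal assms unfolding p by blast
  show thesis
  proof (cases "(i, Suc (i + k)) \<in> arc_edges (a, m)")
    case True
    have "p = edge_path (a, m) (i, Suc (i + k))" unfolding p edge_path_def using a by simp
    then show thesis using edge a(1) True by blast
  next
    case False
    then have "k = 0 \<and> u \<in> shared" using a unfolding arc_edges_def by auto
    then show thesis using simple p by blast
  qed
qed

text \<open>The witnesses which \<open>balanced\<close> provides may lie on a different maximal
  path. By \<open>two_locations\<close> they then meet \<open>w\<close> in an end only; that end is
  shared, and the case is either impossible for an edge or exempted by the flags.\<close>

lemma arc_part_graph:
  assumes S: "S \<subseteq> W" "balanced S" and w: "w \<in> maximal"
  shows "arc_part S w \<in> arc_family w"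
proof -
  obtain u m where um: "w = (u, m)" by (cases w)
  have M: "(u, m) \<in> maximal" using w um by simp
  have m1: "1 \<le> m" by (rule maximal_arrow[OF M])
  let ?T = "arc_part S w"
  have T: "(x, y) \<in> ?T \<longleftrightarrow> (x, y) \<in> arc_edges (u, m) \<and> (vtx s u x, y - x - 1) \<in> S" for x y
    unfolding arc_part_def edge_path_def um by simp
  have B1: "maximal \<subseteq> S"
    and B2: "\<And>u m. (u, m) \<in> S \<Longrightarrow> (u, m) \<in> maximal \<or> (\<exists>m'>m. (u, m') \<in> S) \<or>
       (\<exists>u' d. 0 < d \<and> vtx s u' d = u \<and> (u', d + m) \<in> S)"
    and B3: "\<And>u. (u, 1) \<in> W \<Longrightarrow> (\<exists>m. (vtx s u 1, m) \<in> S) \<or> (\<exists>u' m. (u', m) \<in> S \<and> vtx s u' m = u)"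
    using S(2) unfolding balanced_def by auto
  show ?thesis unfolding um fst_conv snd_conv
  proof (rule arc_graphsI)
    show "arc_part S (u, m) \<subseteq> {(x, y). x < y \<and> y \<le> Suc m}"
      unfolding arc_part_def arc_edges_def by auto
    show "(0, Suc m) \<in> arc_part S (u, m)"
      using T[of 0 "Suc m"] B1 M arc_edges_long[of 0 "Suc m" m u] m1 unfolding um by auto
  next
    fix x y assume "(x, y) \<in> arc_part S (u, m)"
    then have e: "(x, y) \<in> arc_edges (u, m)" and X: "(vtx s u x, y - x - 1) \<in> S" using T um by auto
    have l: "x < y" "y \<le> Suc m" and ex: "u \<in> shared \<Longrightarrow> (x, y) \<noteq> (0, 1)" "vtx s u m \<in> shared \<Longrightarrow> (x, y) \<noteq> (m, Suc m)"
      using e unfolding arc_edges_def by auto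
    define k where "k = y - x - 1"
    have y: "y = Suc (x + k)" using l k_def by simp
    from B2[OF X[folded k_def]]
    show "(x, y) = (0, Suc m) \<or> (\<exists>y'>y. (x, y') \<in> arc_part S (u, m)) \<or> (\<exists>x'<x. (x', y) \<in> arc_part S (u, m))"
    proof (elim disjE exE conjE)
      assume Xm: "(vtx s u x, k) \<in> maximal"
      from two_locations[OF M Xm, of x 0] l maximal_arrow[OF Xm] y
      have "(u, m) = (vtx s u x, k) \<and> x = 0" by auto
      then show ?thesis using y by auto
    next
      fix m' assume m': "k < m'" "(vtx s u x, m') \<in> S"
      obtain a n j where a: "(a, n) \<in> maximal" "vtx s a j = vtx s u x" "j + m' \<le> n"
        using in_maximal m'(2) S(1) by blast
      from two_locations[OF M a(1), of x j] a l
      have "(u, m) = (a, n) \<and> x = j \<or> x = m \<and> j = 0 \<or> x = 0 \<and> j = n" by auto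
      then show ?thesis
      proof (elim disjE conjE)
        assume "(u, m) = (a, n)" "x = j"
        then have "(x, Suc (x + m')) \<in> ?T" using T a m' arc_edges_long[of x "Suc (x + m')" m u] by auto
        then show ?thesis using m'(1) y um by auto
      next
        assume "x = m" "j = 0"
        then have "vtx s u m \<in> shared" using a shared_end[OF M] by auto
        then show ?thesis using ex(2) \<open>x = m\<close> l by auto
      next
        assume "x = 0" "j = n"
        then show ?thesis using a(3) m'(1) by simp
      qed
    next
      fix u' d assume d: "0 < d" "vtx s u' d = vtx s u x" "(u', d + k) \<in> S"
      obtain a n j where a: "(a, n) \<in> maximal" "vtx s a j = u'" "j + (d + k) \<le> n"
        using in_maximal d(3) S(1) by blast
      have "vtx s u x = vtx s a (j + d)" using a(2) d(2) by auto
      from two_locations[OF M a(1) this] a l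
      have "(u, m) = (a, n) \<and> x = j + d \<or> x = m \<and> j + d = 0 \<or> x = 0 \<and> j + d = n" by auto
      then show ?thesis
      proof (elim disjE conjE)
        assume "(u, m) = (a, n)" "x = j + d"
        then have "(j, y) \<in> ?T" using T[of j y] a d y arc_edges_long[of j y m u] by (auto simp: add_ac)
        then show ?thesis using d(1) \<open>x = j + d\<close> um by auto
      next
        assume "x = 0" "j + d = n"
        then have "vtx s a n = u" "k = 0" using a d by auto
        then have "u \<in> shared" "k = 0" using a(1) shared_start[OF M] by blast+
        then show ?thesis using ex(1) \<open>x = 0\<close> y by auto
      qed (use d in auto)
    qed
  next
    \<comment> \<open>The point \<open>h\<close> stands for the arrow from vertex
      \<open>h - 1\<close> to vertex \<open>h\<close>: an interval starting at \<open>h\<close> has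
      top \<open>h\<close>, an interval ending at \<open>h\<close> has socle
      \<open>h - 1\<close>.\<close>
    fix h assume h: "0 < h" "h < Suc m"
    then obtain h' where h': "h = Suc h'" by (cases h) auto
    have "(vtx s u h', 1) \<in> W" using W_sub[OF maximalD(1)[OF M], of h' 1] h h' by simp
    from B3[OF this]
    show "u \<in> shared \<and> h = 1 \<or> vtx s u m \<in> shared \<and> Suc h = Suc m \<or>
        (\<exists>y. (h, y) \<in> arc_part S (u, m)) \<or> (\<exists>x. (x, h) \<in> arc_part S (u, m))"
    proof (elim disjE exE conjE)
      fix k assume "(vtx s (vtx s u h') 1, k) \<in> S"
      then have X: "(vtx s u h, k) \<in> S" using h' by simp
      obtain a n j where a: "(a, n) \<in> maximal" "vtx s a j = vtx s u h" "j + k \<le> n"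
        using in_maximal X S(1) by blast
      from two_locations[OF M a(1), of h j] a h
      have "(u, m) = (a, n) \<and> h = j \<or> h = m \<and> j = 0" by auto
      then show ?thesis
      proof (elim disjE conjE)
        assume *: "(u, m) = (a, n)" "h = j"
        show ?thesis
        proof (cases "(h, Suc (h + k)) \<in> arc_edges (u, m)")
          case True
          then show ?thesis using T[of h "Suc (h + k)"] X um by auto
        next
          case False
          then show ?thesis using * a(3) h unfolding arc_edges_def by auto
        qed
      next
        assume "h = m" "j = 0"
        then show ?thesis using shared_end[OF M] a by auto
      qed
    next
      fix u' k assume X: "(u', k) \<in> S" "vtx s u' k = vtx s u h'"
      obtain a n j where a: "(a, n) \<in> maximal" "vtx s a j = u'" "j + k \<le> n"
        using in_maximal X S(1) by blast
      have "vtx s u h' = vtx s a (j + k)" using a X by auto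
      from two_locations[OF M a(1) this] a h h'
      have "(u, m) = (a, n) \<and> h' = j + k \<or> h' = 0 \<and> j + k = n" by auto
      then show ?thesis
      proof (elim disjE conjE)
        assume *: "(u, m) = (a, n)" "h' = j + k"
        show ?thesis
        proof (cases "(j, h) \<in> arc_edges (u, m)")
          case True
          then show ?thesis using T[of j h] X a * h' um by auto
        next
          case False
          then show ?thesis using * h h' unfolding arc_edges_def by auto
        qed
      next
        assume "h' = 0" "j + k = n"
        then have "vtx s a n = u" using a X by auto
        then have "u \<in> shared" using a(1) shared_start[OF M] by blast
        then show ?thesis using \<open>h' = 0\<close> h' by simp
      qed
    qed
  next
    show "(0, 1) \<notin> arc_part S (u, m)" if "u \<in> shared"
      using that unfolding arc_part_def arc_edges_def by auto
    show "(h, Suc m) \<notin> arc_part S (u, m)" if "vtx s u m \<in> shared" "Suc h = Suc m" for h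
      using that unfolding arc_part_def arc_edges_def by auto
  qed
qed

text \<open>What the flags exempt holds by itself: a trivial path at a shared vertex is hooked onto
  the maximal path starting there, and an arrow next to a shared end is served by the other maximal
  path at this end.\<close>

lemma balancedI_arc_part:
  assumes S: "S \<subseteq> W" and fam: "\<And>w. w \<in> maximal \<Longrightarrow> arc_part S w \<in> arc_family w"
  shows "balanced S"
proof -
  have T: "(x, y) \<in> arc_part S (u, m) \<longleftrightarrow> (x, y) \<in> arc_edges (u, m) \<and> (vtx s u x, y - x - 1) \<in> S" for x y u m
    unfolding arc_part_def edge_path_def by simp
  have l: "x < y \<and> y \<le> Suc m" if "(x, y) \<in> arc_part S (u, m)" for x y u m
    using that unfolding T arc_edges_def by auto
  have B1: "maximal \<subseteq> S"
  proof
    fix w assume w: "w \<in> maximal"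
    then show "w \<in> S" using arc_graphsD(2)[OF fam[OF w]] T[of 0 "Suc (snd w)" "fst w" "snd w"] by simp
  qed
  show ?thesis unfolding balanced_def
  proof (intro conjI allI impI)
    show "maximal \<subseteq> S" by (rule B1)
    fix u m assume um: "(u, m) \<in> S"
    then have "(u, m) \<in> W" using S by blast
    then show "(u, m) \<in> maximal \<or> (\<exists>m'>m. (u, m') \<in> S) \<or> (\<exists>u' d. 0 < d \<and> vtx s u' d = u \<and> (u', d + m) \<in> S)"
    proof (cases rule: W_cases)
      case (simple v)
      then obtain k where "(u, k) \<in> maximal" unfolding shared_def by blast
      then have "(u, k) \<in> S" "k > m" using B1 maximal_arrow simple by force+
      then show ?thesis by blast
    next
      case (edge w d)
      obtain a n x y where w: "w = (a, n)" and d: "d = (x, y)" by (metis surj_pair)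
      have xy: "(x, y) \<in> arc_part S (a, n)" using edge um w d unfolding arc_part_def by auto
      have u: "u = vtx s a x" and m: "m = y - x - 1" using edge w d unfolding edge_path_def by auto
      from arc_graphsD(3)[OF fam[OF edge(1)], unfolded w, OF xy] show ?thesis
      proof (elim disjE exE conjE)
        assume "(x, y) = (0, Suc (snd (a, n)))"
        then show ?thesis using edge(1) u m w by simp
      next
        fix y' assume y': "y < y'" "(x, y') \<in> arc_part S (a, n)"
        then show ?thesis using T[of x y' a n] l[OF xy] u m by (intro disjI2 disjI1 exI[of _ "y' - x - 1"]) auto
      next
        fix x' assume x': "x' < x" "(x', y) \<in> arc_part S (a, n)"
        then show ?thesis using T[of x' y a n] l[OF xy] u m
          by (intro disjI2 exI[of _ "vtx s a x'"] exI[of _ "x - x'"]) auto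
      qed
    qed
  next
    fix c assume "(c, 1) \<in> W"
    then obtain u m i where M: "(u, m) \<in> maximal" and i: "vtx s u i = c" "i + 1 \<le> m"
      using in_maximal by blast
    have "0 < Suc i" "Suc i < Suc (snd (u, m))" using i by auto
    from arc_graphsD(4)[OF fam[OF M] this]
    show "(\<exists>m. (vtx s c 1, m) \<in> S) \<or> (\<exists>u' m. (u', m) \<in> S \<and> vtx s u' m = c)"
    proof (elim disjE exE conjE)
      assume "fst (u, m) \<in> shared" "Suc i = 1"
      then obtain a k where "(a, k) \<in> maximal" "vtx s a k = c" using shared_start[OF M] i by auto
      then show ?thesis using B1 by blast
    next
      assume "vtx s (fst (u, m)) (snd (u, m)) \<in> shared" "Suc (Suc i) = Suc (snd (u, m))"
      then obtain k where "(vtx s c 1, k) \<in> maximal" using shared_end[OF M] i by auto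
      then show ?thesis using B1 by blast
    next
      fix y assume "(Suc i, y) \<in> arc_part S (u, m)"
      then have "(vtx s c 1, y - Suc i - 1) \<in> S" using T[of "Suc i" y u m] i by auto
      then show ?thesis by blast
    next
      fix x assume x: "(x, Suc i) \<in> arc_part S (u, m)"
      then have "(vtx s u x, i - x) \<in> S" "vtx s (vtx s u x) (i - x) = c"
        using T[of x "Suc i" u m] i l[OF x] by auto
      then show ?thesis by blast
    qed
  qed
qed

lemma finite_maximal: "finite maximal"
  by (rule finite_subset[OF _ finite_W]) (auto simp: maximal_def)

lemma finite_shared: "finite shared"
  by (rule finite_subset[of _ "fst ` maximal"]) (force simp: shared_def, simp add: finite_maximal)

theorem card_balanced:
  "card {S. S \<subseteq> W \<and> balanced S} = 2 ^ card shared * (\<Prod>w\<in>maximal.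
     Nk (if fst w \<in> shared \<and> vtx s (fst w) (snd w) \<in> shared then 2
         else if fst w \<in> shared \<or> vtx s (fst w) (snd w) \<in> shared then 1 else 0) (Suc (snd w)))"
proof -
  let ?X = "{S. S \<subseteq> W \<and> balanced S}" and ?Y = "Pow shared \<times> (\<Pi>\<^sub>E w\<in>maximal. arc_family w)"
  let ?f = "\<lambda>S. ({v \<in> shared. (v, 0) \<in> S}, \<lambda>w\<in>maximal. arc_part S w)"
  let ?g = "\<lambda>(B, F). (\<lambda>v. (v, 0)) ` B \<union> (\<Union>w\<in>maximal. edge_path w ` F w)"
  have sharedW: "(v, 0) \<in> W" if "v \<in> shared" for v
    using that W_trivial W_vertex maximal_W unfolding shared_def by blast
  have famD: "F w \<subseteq> arc_edges w" if "F \<in> (\<Pi>\<^sub>E w\<in>maximal. arc_family w)" "w \<in> maximal" for F w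
  proof -
    have F: "F w \<in> arc_family w" using that by (rule PiE_mem)
    show ?thesis
    proof (rule subrelI)
      fix x y assume xy: "(x, y) \<in> F w"
      then have "x < y \<and> y \<le> Suc (snd w)" using arc_graphsD(1)[OF F] by blast
      moreover have "(x, y) \<noteq> (0, 1)" if "fst w \<in> shared"
        using arc_graphsD(5)[OF F that] xy by blast
      moreover have "(x, y) \<noteq> (snd w, Suc (snd w))" if "vtx s (fst w) (snd w) \<in> shared"
        using arc_graphsD(6)[OF F that refl] xy by blast
      ultimately show "(x, y) \<in> arc_edges w" unfolding arc_edges_def by auto
    qed
  qed
  have fg: "?f (?g (B, F)) = (B, F)" if BF: "B \<subseteq> shared" "F \<in> (\<Pi>\<^sub>E w\<in>maximal. arc_family w)" for B F
  proof -
    have "(v, 0) \<in> ?g (B, F) \<longleftrightarrow> v \<in> B" if "v \<in> shared" for v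
      using edge_path_not_shared[OF _ _ that] famD[OF BF(2)] by fastforce
    then have 1: "{v \<in> shared. (v, 0) \<in> ?g (B, F)} = B" using BF(1) by blast
    have 2: "arc_part (?g (B, F)) w = F w" if w: "w \<in> maximal" for w
    proof (rule equalityI; rule subsetI)
      fix d assume d: "d \<in> F w"
      then show "d \<in> arc_part (?g (B, F)) w" using famD[OF BF(2) w] w unfolding arc_part_def by auto
    next
      fix d assume "d \<in> arc_part (?g (B, F)) w"
      then have d: "d \<in> arc_edges w" "edge_path w d \<in> ?g (B, F)" unfolding arc_part_def by auto
      have "edge_path w d \<notin> (\<lambda>v. (v, 0)) ` B" using edge_path_not_shared[OF w d(1)] BF(1) by blast
      then obtain w' d' where "w' \<in> maximal" "d' \<in> F w'" "edge_path w d = edge_path w' d'" using d(2) by auto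
      then show "d \<in> F w" using edge_path_inj[OF w d(1)] famD[OF BF(2)] by blast
    qed
    have "(\<lambda>w\<in>maximal. arc_part (?g (B, F)) w) = F"
      by (rule PiE_ext[of _ maximal "\<lambda>w. arc_family w"]) (use 2 BF(2) PiE_mem[OF BF(2)] in auto)
    then show ?thesis using 1 by simp
  qed
  have "bij_betw ?f ?X ?Y"
  proof (rule bij_betw_byWitness[where f' = ?g])
    show "\<forall>S\<in>?X. ?g (?f S) = S"
    proof
      fix S assume S: "S \<in> ?X"
      show "?g (?f S) = S"
      proof (rule equalityI; rule subsetI)
        fix p assume "p \<in> ?g (?f S)"
        then show "p \<in> S" by (auto simp: arc_part_def)
      next
        fix p assume p: "p \<in> S"
        then have "p \<in> W" using S by blast
        then show "p \<in> ?g (?f S)"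
        proof (cases rule: W_cases)
          case (simple v)
          then show ?thesis using p by auto
        next
          case (edge w d)
          then have "d \<in> arc_part S w" using p by (simp add: arc_part_def)
          then show ?thesis using edge by auto
        qed
      qed
    qed
    show "\<forall>z\<in>?Y. ?f (?g z) = z" using fg by auto
    show "?f ` ?X \<subseteq> ?Y"
    proof (rule image_subsetI)
      fix S assume "S \<in> ?X"
      then show "?f S \<in> ?Y" using arc_part_graph by auto
    qed
    show "?g ` ?Y \<subseteq> ?X"
    proof (rule image_subsetI)
      fix z assume "z \<in> ?Y"
      then obtain B F where z: "z = (B, F)" and BF: "B \<subseteq> shared" "F \<in> (\<Pi>\<^sub>E w\<in>maximal. arc_family w)" by auto
      have sub: "?g (B, F) \<subseteq> W"
      proof (rule subsetI)
        fix p assume "p \<in> ?g (B, F)"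
        then consider v where "v \<in> B" "p = (v, 0)" | w d where "w \<in> maximal" "d \<in> F w" "p = edge_path w d"
          by auto
        then show "p \<in> W"
        proof cases
          case 1
          then show ?thesis using BF(1) sharedW by blast
        next
          case 2
          then show ?thesis using edge_path_W famD[OF BF(2)] by blast
        qed
      qed
      have "arc_part (?g (B, F)) w \<in> arc_family w" if w: "w \<in> maximal" for w
      proof -
        have "snd (?f (?g (B, F))) w = F w" unfolding fg[OF BF] by simp
        then show ?thesis using w PiE_mem[OF BF(2) w] by simp
      qed
      then have "balanced (?g (B, F))" by (rule balancedI_arc_part[OF sub])
      then show "?g z \<in> ?X" using sub z by simp
    qed
  qed
  then have "card ?X = card ?Y" by (rule bij_betw_same_card)
  also have "\<dots> = 2 ^ card shared * (\<Prod>w\<in>maximal. card (arc_family w))"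
    by (simp add: card_cartesian_product card_Pow finite_shared card_PiE[OF finite_maximal])
  also have "(\<Prod>w\<in>maximal. card (arc_family w)) = (\<Prod>w\<in>maximal.
     Nk (if fst w \<in> shared \<and> vtx s (fst w) (snd w) \<in> shared then 2
         else if fst w \<in> shared \<or> vtx s (fst w) (snd w) \<in> shared then 1 else 0) (Suc (snd w)))"
  proof (rule prod.cong[OF refl])
    fix w assume "w \<in> maximal"
    then have "2 \<le> Suc (snd w)" using maximal_arrow[of "fst w" "snd w"] by simp
    then show "card (arc_family w) = Nk (if fst w \<in> shared \<and> vtx s (fst w) (snd w) \<in> shared then 2
         else if fst w \<in> shared \<or> vtx s (fst w) (snd w) \<in> shared then 1 else 0) (Suc (snd w))"
      by (rule card_arc_graphs)
  qed
  finally show ?thesis .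
qed

end

section \<open>Algebras with a basis of nonzero paths\<close>

text \<open>Both sides run over the pairs of cuts \<open>r \<le> q \<le> t\<close> of a path of
  length \<open>t\<close>. This is associativity, for the action on interval modules as well as in
  the path algebra.\<close>

lemma sum_triangle_shift:
  fixes f :: "nat \<Rightarrow> nat \<Rightarrow> 'c::comm_monoid_add"
  shows "(\<Sum>q\<le>t. \<Sum>r\<le>q. f q r) = (\<Sum>r\<le>t. \<Sum>i\<le>t - r. f (r + i) r)"
  unfolding sum.Sigma[OF finite_atMost ballI[OF finite_atMost]]
  by (rule sum.reindex_bij_witness[of _ "\<lambda>(r, i). (r + i, r)" "\<lambda>(q, r). (r, q - r)"]) auto

text \<open>The scalar \<open>co x (u, m)\<close> is the coefficient of the path \<open>(u, m)\<close> in \<open>x\<close>.\<close>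

locale nakayama_algebra = nakayama_quiver V s W + A?: ring A
  for V s W and A :: "('a, 'b) ring_scheme" (structure) +
  fixes co :: "'a \<Rightarrow> nat \<times> nat \<Rightarrow> 'k::field"
  assumes co_inj: "x \<in> carrier A \<Longrightarrow> y \<in> carrier A \<Longrightarrow> (\<And>p. p \<in> W \<Longrightarrow> co x p = co y p) \<Longrightarrow> x = y"
    and co_surj: "\<exists>x\<in>carrier A. \<forall>p\<in>W. co x p = c p"
    and co_add: "x \<in> carrier A \<Longrightarrow> y \<in> carrier A \<Longrightarrow> p \<in> W \<Longrightarrow> co (x \<oplus> y) p = co x p + co y p"
    and co_one: "(u, m) \<in> W \<Longrightarrow> co \<one> (u, m) = (if m = 0 then 1 else 0)"
    and co_mult: "x \<in> carrier A \<Longrightarrow> y \<in> carrier A \<Longrightarrow> (u, m) \<in> W \<Longrightarrow>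
      co (x \<otimes> y) (u, m) = (\<Sum>i\<le>m. co x (vtx s u i, m - i) * co y (u, i))"
begin

section \<open>Elements given by coefficients and their rules of calculation\<close>

definition el :: "(nat \<times> nat \<Rightarrow> 'k) \<Rightarrow> 'a" where
  "el c = (SOME x. x \<in> carrier A \<and> (\<forall>p\<in>W. co x p = c p))"

lemma el: "el c \<in> carrier A" "p \<in> W \<Longrightarrow> co (el c) p = c p"
  using someI_ex[of "\<lambda>x. x \<in> carrier A \<and> (\<forall>p\<in>W. co x p = c p)"] co_surj[of c] unfolding el_def by blast+

lemma co_zero: "p \<in> W \<Longrightarrow> co \<zero> p = 0"
  using co_add[of \<zero> \<zero> p] by (metis A.l_zero A.zero_closed add_cancel_left_right)

text \<open>
  These are the sum of all paths of length \<open>k\<close>, the trivial path at \<open>v\<close> and a scalar; together they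
  generate the algebra.
\<close>

definition aa :: "nat \<Rightarrow> 'a" where "aa k = el (\<lambda>(u, m). if m = k then 1 else 0)"
definition ee :: "nat \<Rightarrow> 'a" where "ee v = el (\<lambda>(u, m). if u = v \<and> m = 0 then 1 else 0)"
definition sc :: "'k \<Rightarrow> 'a" where "sc c = el (\<lambda>(u, m). if m = 0 then c else 0)"

lemma gens_closed [simp]: "aa k \<in> carrier A" "ee v \<in> carrier A" "sc c \<in> carrier A"
  by (simp_all add: aa_def ee_def sc_def el)

lemma co_gens:
  "(u, m) \<in> W \<Longrightarrow> co (aa k) (u, m) = (if m = k then 1 else 0)"
  "(u, m) \<in> W \<Longrightarrow> co (ee v) (u, m) = (if u = v \<and> m = 0 then 1 else 0)"
  "(u, m) \<in> W \<Longrightarrow> co (sc c) (u, m) = (if m = 0 then c else 0)"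
  by (simp_all add: aa_def ee_def sc_def el)

lemma W_suffix: "(u, m) \<in> W \<Longrightarrow> i \<le> m \<Longrightarrow> (vtx s u i, m - i) \<in> W"
  using W_sub[of u m i "m - i"] by simp

lemma W_shift: "(u, k + l) \<in> W \<Longrightarrow> (vtx s u l, k) \<in> W"
  using W_sub[of u "k + l" l k] by simp

lemma W_end: "(u, k) \<in> W \<Longrightarrow> (vtx s u k, 0) \<in> W"
  using W_sub[of u k k 0] by simp

lemma co_aa_mult:
  assumes "y \<in> carrier A" "(u, m) \<in> W"
  shows "co (aa k \<otimes> y) (u, m) = (if k \<le> m then co y (u, m - k) else 0)"
proof -
  have "co (aa k \<otimes> y) (u, m) = (\<Sum>i\<le>m. if i = m - k \<and> k \<le> m then co y (u, i) else 0)"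
    unfolding co_mult[OF gens_closed(1) assms]
    by (rule sum.cong[OF refl]) (use W_suffix[OF assms(2)] in \<open>auto simp: co_gens\<close>)
  also have "\<dots> = (if k \<le> m then co y (u, m - k) else 0)"
    by (cases "k \<le> m") (simp_all add: sum.delta)
  finally show ?thesis .
qed

lemma co_mult_aa:
  assumes "x \<in> carrier A" "(u, m) \<in> W"
  shows "co (x \<otimes> aa k) (u, m) = (if k \<le> m then co x (vtx s u k, m - k) else 0)"
proof -
  have "co (x \<otimes> aa k) (u, m) = (\<Sum>i\<le>m. if i = k then co x (vtx s u i, m - i) else 0)"
    unfolding co_mult[OF assms(1) gens_closed(1) assms(2)]
    by (rule sum.cong[OF refl]) (use W_head[OF assms(2)] in \<open>auto simp: co_gens\<close>)
  then show ?thesis by (simp add: sum.delta)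
qed

lemma co_ee_mult:
  assumes "y \<in> carrier A" "(u, m) \<in> W"
  shows "co (ee v \<otimes> y) (u, m) = (if vtx s u m = v then co y (u, m) else 0)"
proof -
  have "co (ee v \<otimes> y) (u, m) = (\<Sum>i\<le>m. if i = m then (if vtx s u m = v then co y (u, m) else 0) else 0)"
    unfolding co_mult[OF gens_closed(2) assms]
    by (rule sum.cong[OF refl]) (use W_suffix[OF assms(2)] in \<open>auto simp: co_gens\<close>)
  then show ?thesis by (simp add: sum.delta)
qed

lemma co_mult_ee:
  assumes "x \<in> carrier A" "(u, m) \<in> W"
  shows "co (x \<otimes> ee v) (u, m) = (if u = v then co x (u, m) else 0)"
proof -
  have "co (x \<otimes> ee v) (u, m) = (\<Sum>i\<le>m. if i = 0 then (if u = v then co x (u, m) else 0) else 0)"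
    unfolding co_mult[OF assms(1) gens_closed(2) assms(2)]
    by (rule sum.cong[OF refl]) (use W_head[OF assms(2)] in \<open>auto simp: co_gens\<close>)
  then show ?thesis by (simp add: sum.delta)
qed

lemma co_sc_mult:
  assumes "y \<in> carrier A" "(u, m) \<in> W"
  shows "co (sc c \<otimes> y) (u, m) = c * co y (u, m)"
proof -
  have "co (sc c \<otimes> y) (u, m) = (\<Sum>i\<le>m. if i = m then c * co y (u, m) else 0)"
    unfolding co_mult[OF gens_closed(3) assms]
    by (rule sum.cong[OF refl]) (use W_suffix[OF assms(2)] in \<open>auto simp: co_gens\<close>)
  then show ?thesis by (simp add: sum.delta)
qed

lemma co_mult_sc:
  assumes "x \<in> carrier A" "(u, m) \<in> W"
  shows "co (x \<otimes> sc c) (u, m) = c * co x (u, m)"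
proof -
  have "co (x \<otimes> sc c) (u, m) = (\<Sum>i\<le>m. if i = 0 then c * co x (u, m) else 0)"
    unfolding co_mult[OF assms(1) gens_closed(3) assms(2)]
    by (rule sum.cong[OF refl]) (use W_head[OF assms(2)] in \<open>auto simp: co_gens\<close>)
  then show ?thesis by (simp add: sum.delta)
qed

lemmas co_simps = co_aa_mult co_mult_aa co_ee_mult co_mult_ee co_sc_mult co_mult_sc co_gens co_zero co_one co_add

lemma aa_add: "aa k \<otimes> aa l = aa (k + l)"
  by (rule co_inj) (auto simp: co_simps W_suffix W_shift)

lemma aa_0: "aa 0 = \<one>"
  by (rule co_inj) (auto simp: co_simps)

lemma ee_idem: "ee v \<otimes> ee w = (if v = w then ee v else \<zero>)"
  by (rule co_inj) (auto simp: co_simps)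

text \<open>By \<open>vtx_inj\<close> the paths of length \<open>k\<close> ending in
  \<open>vtx s u k\<close> are the ones starting at \<open>u\<close>, so an idempotent can be moved
  past a path sum.\<close>

lemma ee_aa:
  assumes "u \<in> V"
  shows "ee (vtx s u k) \<otimes> aa k = aa k \<otimes> ee u"
proof (rule co_inj)
  fix p assume p: "p \<in> W"
  obtain a m where [simp]: "p = (a, m)" by (cases p)
  have "a \<in> V" using p W_vertex by simp
  then show "co (ee (vtx s u k) \<otimes> aa k) p = co (aa k \<otimes> ee u) p"
    using p vtx_inj[of a u k] assms by (auto simp: co_simps W_head W_suffix W_end)
qed auto

lemma sc_central: "x \<in> carrier A \<Longrightarrow> sc c \<otimes> x = x \<otimes> sc c"
  by (rule co_inj) (auto simp: co_simps)

lemma sc_1: "sc 1 = \<one>"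
  by (rule co_inj) (auto simp: co_simps)

lemma sc_0: "sc 0 = \<zero>"
  by (rule co_inj) (auto simp: co_simps)

lemma sc_add: "sc (c + d) = sc c \<oplus> sc d"
  by (rule co_inj) (auto simp: co_simps)

lemma sc_mult: "sc (c * d) = sc c \<otimes> sc d"
  by (rule co_inj) (auto simp: co_simps)

lemma aa_ee_nonpath:
  assumes "(u, k) \<notin> W"
  shows "aa k \<otimes> ee u = \<zero>"
  by (rule co_inj) (use assms in \<open>auto simp: co_simps W_head\<close>)

definition loewy :: nat where "loewy = Suc (Max (insert 0 (snd ` W)))"

lemma aa_nilpotent:
  assumes "loewy \<le> k"
  shows "aa k = \<zero>"
proof (rule co_inj)
  fix p assume p: "p \<in> W"
  obtain a m where [simp]: "p = (a, m)" by (cases p)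
  have "m \<le> Max (insert 0 (snd ` W))" using p finite_W by (intro Max_ge) force+
  then show "co (aa k) p = co \<zero> p" using p assms by (simp add: co_simps loewy_def)
qed auto

text \<open>Every element is a finite sum of scalar multiples of nonzero paths, and
  \<open>aa k \<otimes> ee u\<close> is the path \<open>(u, k)\<close>. Compatibility with the
  action thus needs checking on such products only.\<close>

lemma span_induct:
  assumes "x \<in> carrier A" "P \<zero>"
    and "\<And>c u k. (u, k) \<in> W \<Longrightarrow> P (sc c \<otimes> (aa k \<otimes> ee u))"
    and "\<And>x y. x \<in> carrier A \<Longrightarrow> y \<in> carrier A \<Longrightarrow> P x \<Longrightarrow> P y \<Longrightarrow> P (x \<oplus> y)"
  shows "P x"
proof -
  have fin: "P (el (\<lambda>p. if p \<in> F then co x p else 0))" if "finite F" "F \<subseteq> W" for F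
    using that
  proof (induction F)
    case empty
    have "el (\<lambda>p. if p \<in> {} then co x p else 0) = \<zero>" by (rule co_inj) (auto simp: el co_zero)
    then show ?case using assms(2) by simp
  next
    case (insert q F)
    obtain u k where q: "q = (u, k)" by (cases q)
    have qW: "(u, k) \<in> W" using insert q by simp
    have "el (\<lambda>p. if p \<in> insert q F then co x p else 0)
        = el (\<lambda>p. if p \<in> F then co x p else 0) \<oplus> sc (co x q) \<otimes> (aa k \<otimes> ee u)"
    proof (rule co_inj)
      fix p assume p: "p \<in> W"
      obtain a m where [simp]: "p = (a, m)" by (cases p)
      show "co (el (\<lambda>p. if p \<in> insert q F then co x p else 0)) p
        = co (el (\<lambda>p. if p \<in> F then co x p else 0) \<oplus> sc (co x q) \<otimes> (aa k \<otimes> ee u)) p"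
        using p insert.hyps(2) q by (auto simp: co_simps el W_head split: if_splits)
    qed (auto simp: el)
    then show ?case using insert assms(3)[OF qW] by (auto simp: el intro!: assms(4))
  qed
  have "el (\<lambda>p. if p \<in> W then co x p else 0) = x" by (rule co_inj) (auto simp: el assms(1))
  then show ?thesis using fin[OF finite_W subset_refl] by simp
qed

end

subsection \<open>Direct sums of interval modules\<close>

text \<open>The modules in the theorem have carrier type \<open>nat \<Rightarrow> 'k\<close>, so a
  coordinate, given by a path and a position on it, is coded as one number.\<close>

definition enc :: "nat \<times> nat \<Rightarrow> nat \<Rightarrow> nat" where
  "enc w t = prod_encode (prod_encode w, t)"

definition enc_fun :: "(nat \<times> nat \<Rightarrow> nat \<Rightarrow> 'k) \<Rightarrow> nat \<Rightarrow> 'k" where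
  "enc_fun F i = (case prod_decode i of (j, t) \<Rightarrow> F (prod_decode j) t)"

lemma enc_fun_enc [simp]: "enc_fun F (enc w t) = F w t"
  by (simp add: enc_fun_def enc_def)

lemma enc_ext:
  assumes "\<And>w t. x (enc w t) = y (enc w t)"
  shows "x = y"
proof
  fix i
  obtain j t where jt: "prod_decode i = (j, t)" by (metis surj_pair)
  have "i = enc (prod_decode j) t" unfolding enc_def prod_decode_inverse by (metis jt prod_decode_inverse)
  then show "x i = y i" using assms by metis
qed

context nakayama_algebra
begin

text \<open>
  The direct sum of the uniserial modules given by the paths in \<open>S\<close>. The number \<open>x (enc w t)\<close> is the
  coordinate of \<open>x\<close> at the \<open>t\<close>-th basis vector of the summand \<open>w\<close>.
\<close>

definition mdl :: "(nat \<times> nat) set \<Rightarrow> ('a, nat \<Rightarrow> 'k) module" where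
  "mdl S = \<lparr>carrier = {x. \<forall>w t. x (enc w t) \<noteq> 0 \<longrightarrow> w \<in> S \<and> t \<le> snd w},
     mult = undefined, one = undefined, zero = (\<lambda>i. 0), add = (\<lambda>x y i. x i + y i),
     smult = (\<lambda>a x. enc_fun (\<lambda>w t. if t \<le> snd w
        then \<Sum>r\<le>t. co a (vtx s (fst w) r, t - r) * x (enc w r) else 0))\<rparr>"

lemma mdl_carrier: "x \<in> carrier (mdl S) \<longleftrightarrow> (\<forall>w t. x (enc w t) \<noteq> 0 \<longrightarrow> w \<in> S \<and> t \<le> snd w)"
  by (simp add: mdl_def)

lemma mdl_zero [simp]: "\<zero>\<^bsub>mdl S\<^esub> = (\<lambda>i. 0)"
  by (simp add: mdl_def)

lemma mdl_add [simp]: "(x \<oplus>\<^bsub>mdl S\<^esub> y) i = x i + y i"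
  by (simp add: mdl_def)

lemma mdl_smult: "(a \<odot>\<^bsub>mdl S\<^esub> x) (enc w t) = (if t \<le> snd w
    then \<Sum>r\<le>t. co a (vtx s (fst w) r, t - r) * x (enc w r) else 0)"
  by (simp add: mdl_def)

lemma mdl_carrier_restrict: "mdl S\<lparr>carrier := carrier (mdl T)\<rparr> = mdl T"
  by (simp add: mdl_def)

lemma mdl_D: "x \<in> carrier (mdl S) \<Longrightarrow> w \<notin> S \<Longrightarrow> x (enc w t) = 0"
  "x \<in> carrier (mdl S) \<Longrightarrow> snd w < t \<Longrightarrow> x (enc w t) = 0"
  unfolding mdl_carrier using leD by blast+

text \<open>The axioms for \<open>co\<close> speak about nonzero paths only. Outside
  \<open>S\<close> the coordinates of \<open>x\<close> vanish, so coefficients may be rewritten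
  under the assumption that \<open>w\<close> is in \<open>W\<close>.\<close>

lemma mdl_smult_sub:
  assumes "S \<subseteq> W" "x \<in> carrier (mdl S)"
    and "\<And>u m r. (u, m) \<in> W \<Longrightarrow> r \<le> t \<Longrightarrow> t \<le> m \<Longrightarrow> w = (u, m) \<Longrightarrow> co a (vtx s u r, t - r) = f r"
  shows "(a \<odot>\<^bsub>mdl S\<^esub> x) (enc w t) = (if t \<le> snd w then \<Sum>r\<le>t. f r * x (enc w r) else 0)"
proof (cases "w \<in> S")
  case True
  then have "w \<in> W" using assms(1) by blast
  then show ?thesis unfolding mdl_smult using assms(3)[of "fst w" "snd w"] by (auto intro!: sum.cong)
next
  case False
  then show ?thesis unfolding mdl_smult using mdl_D(1)[OF assms(2) False] by simp
qed

lemma left_module_mdl: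
  assumes "S \<subseteq> W"
  shows "left_module A (mdl S)"
proof -
  have sub: "(vtx s (fst w) r, t - r) \<in> W" if "w \<in> S" "r \<le> t" "t \<le> snd w" for w r t
    using W_sub[of "fst w" "snd w" r "t - r"] that assms by auto
  have "abelian_group (mdl S)"
  proof (rule abelian_groupI)
    show "\<zero>\<^bsub>mdl S\<^esub> \<in> carrier (mdl S)" by (simp add: mdl_carrier)
    fix x y z assume xyz: "x \<in> carrier (mdl S)"
    show "\<exists>y\<in>carrier (mdl S). y \<oplus>\<^bsub>mdl S\<^esub> x = \<zero>\<^bsub>mdl S\<^esub>"
      by (rule bexI[of _ "\<lambda>i. - x i"]) (use xyz in \<open>auto simp: mdl_carrier intro!: ext\<close>)
  next
    fix x y assume "x \<in> carrier (mdl S)" "y \<in> carrier (mdl S)"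
    then show "x \<oplus>\<^bsub>mdl S\<^esub> y \<in> carrier (mdl S)"
      by (auto simp: mdl_carrier) (metis add.right_neutral add_0)+
  qed (auto intro!: ext)
  moreover have "left_module_axioms A (mdl S)"
  proof
    fix a x assume a: "a \<in> carrier A" and x: "x \<in> carrier (mdl S)"
    show "a \<odot>\<^bsub>mdl S\<^esub> x \<in> carrier (mdl S)"
      unfolding mdl_carrier
    proof (intro allI impI)
      fix w t assume nz: "(a \<odot>\<^bsub>mdl S\<^esub> x) (enc w t) \<noteq> 0"
      have "w \<in> S"
      proof (rule ccontr)
        assume "w \<notin> S"
        then have "(a \<odot>\<^bsub>mdl S\<^esub> x) (enc w t) = 0" unfolding mdl_smult by (simp add: mdl_D(1)[OF x])
        then show False using nz by simp
      qed
      moreover have "t \<le> snd w" using nz unfolding mdl_smult by presburger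
      ultimately show "w \<in> S \<and> t \<le> snd w" ..
    qed
    fix y assume y: "y \<in> carrier (mdl S)"
    show "a \<odot>\<^bsub>mdl S\<^esub> (x \<oplus>\<^bsub>mdl S\<^esub> y) = a \<odot>\<^bsub>mdl S\<^esub> x \<oplus>\<^bsub>mdl S\<^esub> a \<odot>\<^bsub>mdl S\<^esub> y"
      by (rule enc_ext) (simp add: mdl_smult distrib_left sum.distrib)
  next
    fix a b x assume ab: "a \<in> carrier A" "b \<in> carrier A" and x: "x \<in> carrier (mdl S)"
    show "(a \<oplus> b) \<odot>\<^bsub>mdl S\<^esub> x = a \<odot>\<^bsub>mdl S\<^esub> x \<oplus>\<^bsub>mdl S\<^esub> b \<odot>\<^bsub>mdl S\<^esub> x"
    proof (rule enc_ext)
      fix w t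
      show "((a \<oplus> b) \<odot>\<^bsub>mdl S\<^esub> x) (enc w t) = (a \<odot>\<^bsub>mdl S\<^esub> x \<oplus>\<^bsub>mdl S\<^esub> b \<odot>\<^bsub>mdl S\<^esub> x) (enc w t)"
      proof (cases "w \<in> S")
        case True
        then show ?thesis
          using sub[OF True] by (auto simp: mdl_smult co_add[OF ab] distrib_right sum.distrib intro!: sum.cong)
      next
        case False
        then show ?thesis using mdl_D(1)[OF x False] by (simp add: mdl_smult)
      qed
    qed
    show "(a \<otimes> b) \<odot>\<^bsub>mdl S\<^esub> x = a \<odot>\<^bsub>mdl S\<^esub> (b \<odot>\<^bsub>mdl S\<^esub> x)"
    proof (rule enc_ext)
      fix w :: "nat \<times> nat" and t
      obtain u m where w: "w = (u, m)" by (cases w)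
      show "((a \<otimes> b) \<odot>\<^bsub>mdl S\<^esub> x) (enc w t) = (a \<odot>\<^bsub>mdl S\<^esub> (b \<odot>\<^bsub>mdl S\<^esub> x)) (enc w t)"
      proof (cases "w \<in> S \<and> t \<le> m")
        case True
        have "((a \<otimes> b) \<odot>\<^bsub>mdl S\<^esub> x) (enc w t) = (\<Sum>r\<le>t. co (a \<otimes> b) (vtx s u r, t - r) * x (enc w r))"
          using True by (simp add: mdl_smult w)
        also have "\<dots> = (\<Sum>r\<le>t. \<Sum>i\<le>t - r. co a (vtx s u (r + i), t - (r + i)) * co b (vtx s u r, i) * x (enc w r))"
        proof (rule sum.cong[OF refl])
          fix r assume "r \<in> {..t}"
          then have "(vtx s u r, t - r) \<in> W" using sub[of w r t] True w by simp
          then show "co (a \<otimes> b) (vtx s u r, t - r) * x (enc w r)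
            = (\<Sum>i\<le>t - r. co a (vtx s u (r + i), t - (r + i)) * co b (vtx s u r, i) * x (enc w r))"
            by (simp add: co_mult[OF ab] sum_distrib_right)
        qed
        also have "\<dots> = (\<Sum>q\<le>t. \<Sum>r\<le>q. co a (vtx s u q, t - q) * co b (vtx s u r, q - r) * x (enc w r))"
          unfolding sum_triangle_shift by simp
        also have "\<dots> = (a \<odot>\<^bsub>mdl S\<^esub> (b \<odot>\<^bsub>mdl S\<^esub> x)) (enc w t)"
          using True by (simp add: mdl_smult w sum_distrib_left mult.assoc)
        finally show ?thesis .
      next
        case False
        then show ?thesis using mdl_D(1)[OF x, of w] by (auto simp: mdl_smult w)
      qed
    qed
  next
    fix x assume x: "x \<in> carrier (mdl S)"
    show "\<one> \<odot>\<^bsub>mdl S\<^esub> x = x"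
    proof (rule enc_ext)
      fix w t
      have "(\<one> \<odot>\<^bsub>mdl S\<^esub> x) (enc w t) = (if t \<le> snd w then \<Sum>r\<le>t. (if r = t then 1 else 0) * x (enc w r) else 0)"
        by (rule mdl_smult_sub[OF assms x]) (auto simp: co_one W_sub)
      also have "\<dots> = x (enc w t)"
        using mdl_D(2)[OF x] by (auto simp: if_distrib[of "\<lambda>c. c * _"] sum.delta cong: if_cong)
      finally show "(\<one> \<odot>\<^bsub>mdl S\<^esub> x) (enc w t) = x (enc w t)" .
    qed
  qed
  ultimately show ?thesis by (intro left_module.intro A.ring_axioms)
qed

lemma mdl_aa:
  assumes "S \<subseteq> W" "x \<in> carrier (mdl S)"
  shows "(aa k \<odot>\<^bsub>mdl S\<^esub> x) (enc w t) = (if t \<le> snd w \<and> k \<le> t then x (enc w (t - k)) else 0)"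
proof -
  have "(aa k \<odot>\<^bsub>mdl S\<^esub> x) (enc w t)
      = (if t \<le> snd w then \<Sum>r\<le>t. (if r = t - k \<and> k \<le> t then 1 else 0) * x (enc w r) else 0)"
    by (rule mdl_smult_sub[OF assms]) (auto simp: co_gens W_sub)
  also have "\<dots> = (if t \<le> snd w \<and> k \<le> t then x (enc w (t - k)) else 0)"
    by (cases "k \<le> t") (auto simp: if_distrib[of "\<lambda>c. c * _"] sum.delta cong: if_cong)
  finally show ?thesis .
qed

lemma mdl_ee:
  assumes "S \<subseteq> W" "x \<in> carrier (mdl S)"
  shows "(ee v \<odot>\<^bsub>mdl S\<^esub> x) (enc w t) = (if vtx s (fst w) t = v then x (enc w t) else 0)"
proof -
  have "(ee v \<odot>\<^bsub>mdl S\<^esub> x) (enc w t)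
      = (if t \<le> snd w then \<Sum>r\<le>t. (if r = t \<and> vtx s (fst w) t = v then 1 else 0) * x (enc w r) else 0)"
    by (rule mdl_smult_sub[OF assms]) (auto simp: co_gens W_sub)
  also have "\<dots> = (if vtx s (fst w) t = v then x (enc w t) else 0)"
    using mdl_D(2)[OF assms(2)]
    by (cases "vtx s (fst w) t = v") (auto simp: if_distrib[of "\<lambda>c. c * _"] sum.delta cong: if_cong)
  finally show ?thesis .
qed

lemma mdl_sc:
  assumes "S \<subseteq> W" "x \<in> carrier (mdl S)"
  shows "(sc c \<odot>\<^bsub>mdl S\<^esub> x) (enc w t) = c * x (enc w t)"
proof -
  have "(sc c \<odot>\<^bsub>mdl S\<^esub> x) (enc w t)
      = (if t \<le> snd w then \<Sum>r\<le>t. (if r = t then c else 0) * x (enc w r) else 0)"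
    by (rule mdl_smult_sub[OF assms]) (auto simp: co_gens W_sub)
  also have "\<dots> = c * x (enc w t)"
    using mdl_D(2)[OF assms(2)] by (auto simp: if_distrib[of "\<lambda>c. c * _"] sum.delta cong: if_cong)
  finally show ?thesis .
qed

section \<open>Basis vectors of the direct sums\<close>

definition bas :: "nat \<times> nat \<Rightarrow> nat \<Rightarrow> 'k \<Rightarrow> nat \<Rightarrow> 'k" where
  "bas w t c = enc_fun (\<lambda>w' t'. if w' = w \<and> t' = t then c else 0)"

lemma bas_enc [simp]: "bas w t c (enc w' t') = (if w' = w \<and> t' = t then c else 0)"
  by (simp add: bas_def)

lemma bas_carrier: "w \<in> S \<Longrightarrow> t \<le> snd w \<Longrightarrow> bas w t c \<in> carrier (mdl S)"
  by (auto simp: mdl_carrier)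

lemma sc_bas: "S \<subseteq> W \<Longrightarrow> w \<in> S \<Longrightarrow> t \<le> snd w \<Longrightarrow> sc c \<odot>\<^bsub>mdl S\<^esub> bas w t d = bas w t (c * d)"
  by (rule enc_ext) (simp add: mdl_sc bas_carrier)

lemma aa_bas:
  assumes "S \<subseteq> W" "w \<in> S" "t + k \<le> snd w"
  shows "aa k \<odot>\<^bsub>mdl S\<^esub> bas w t d = bas w (t + k) d"
  by (rule enc_ext) (use assms in \<open>auto simp: mdl_aa bas_carrier\<close>)

lemma mdl_induct:
  assumes "S \<subseteq> W" "x \<in> carrier (mdl S)" "P (\<lambda>i. 0)"
    and "\<And>w t c. w \<in> S \<Longrightarrow> t \<le> snd w \<Longrightarrow> P (bas w t c)"
    and "\<And>x y. x \<in> carrier (mdl S) \<Longrightarrow> y \<in> carrier (mdl S) \<Longrightarrow> P x \<Longrightarrow> P y \<Longrightarrow> P (x \<oplus>\<^bsub>mdl S\<^esub> y)"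
  shows "P x"
proof -
  let ?B = "SIGMA w:S. {..snd w}"
  have finB: "finite ?B" using finite_subset[OF assms(1) finite_W] by auto
  define r where "r F = enc_fun (\<lambda>w t. if (w, t) \<in> F then x (enc w t) else 0)" for F
  have rc: "r F \<in> carrier (mdl S)" if "F \<subseteq> ?B" for F
    using that by (auto simp: mdl_carrier r_def split: if_splits)
  have fin: "P (r F)" if "finite F" "F \<subseteq> ?B" for F
    using that
  proof (induction F)
    case empty
    have "r {} = (\<lambda>i. 0)" by (rule enc_ext) (simp add: r_def)
    then show ?case using assms(3) by simp
  next
    case (insert q F)
    obtain w t where q: "q = (w, t)" by (cases q)
    have wt: "w \<in> S" "t \<le> snd w" using insert q by auto
    have "r (insert q F) = r F \<oplus>\<^bsub>mdl S\<^esub> bas w t (x (enc w t))"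
      by (rule enc_ext) (use insert.hyps(2) q in \<open>auto simp: r_def\<close>)
    moreover have "P (r F \<oplus>\<^bsub>mdl S\<^esub> bas w t (x (enc w t)))"
      by (rule assms(5)) (use insert rc[of F] bas_carrier[OF wt] assms(4)[OF wt] in auto)
    ultimately show ?case by (simp only:)
  qed
  have "r ?B = x"
    by (rule enc_ext) (use mdl_D[OF assms(2)] in \<open>auto simp: r_def not_le\<close>)
  then show ?thesis using fin[OF finB subset_refl] by simp
qed

lemma fg_module_mdl:
  assumes "S \<subseteq> W"
  shows "fg_module A (mdl S)"
  unfolding fg_module_def
proof (intro conjI exI allI impI)
  interpret M: left_module A "mdl S" by (rule left_module_mdl[OF assms])
  let ?X = "(\<lambda>(w, t). bas w t 1) ` (SIGMA w:S. {..snd w})"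
  show "left_module A (mdl S)" by (rule left_module_mdl[OF assms])
  show "finite ?X" using finite_subset[OF assms finite_W] by auto
  show "?X \<subseteq> carrier (mdl S)" using bas_carrier by auto
  fix U assume U: "submodule U A (mdl S) \<and> ?X \<subseteq> U"
  then have sub: "submodule U A (mdl S)" and X: "\<And>w t. w \<in> S \<Longrightarrow> t \<le> snd w \<Longrightarrow> bas w t 1 \<in> U" by auto
  note U = M.left_submoduleD[OF sub]
  have "x \<in> U" if x: "x \<in> carrier (mdl S)" for x
    using assms x
  proof (rule mdl_induct)
    show "(\<lambda>i. 0) \<in> U" using U(2) by simp
    show "bas w t c \<in> U" if "w \<in> S" "t \<le> snd w" for w t c
      using U(4)[OF gens_closed(3) X[OF that], of c] sc_bas[OF assms that, of c 1] by simp
  qed (rule U(3); assumption)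
  then show "U = carrier (mdl S)" by (rule equalityI[OF U(1) subsetI])
qed

text \<open>
  An element \<open>y\<close> as below exists iff \<open>M\<close> has a direct summand isomorphic to the interval module
  of the path of length \<open>m\<close> starting at \<open>u\<close>.
\<close>

definition has_summand :: "('a, 'm) module \<Rightarrow> nat \<times> nat \<Rightarrow> bool" where
  "has_summand M p \<longleftrightarrow> (case p of (u, m) \<Rightarrow> \<exists>y\<in>carrier M.
     aa (Suc m) \<odot>\<^bsub>M\<^esub> (ee u \<odot>\<^bsub>M\<^esub> y) = \<zero>\<^bsub>M\<^esub> \<and>
     (\<forall>z\<in>carrier M. aa m \<odot>\<^bsub>M\<^esub> (ee u \<odot>\<^bsub>M\<^esub> y) \<noteq> aa (Suc m) \<odot>\<^bsub>M\<^esub> z))"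

text \<open>For \<open>p\<close> in \<open>S\<close> the generator of that summand is a witness. For
  \<open>p\<close> outside \<open>S\<close>, a nonzero coordinate of \<open>aa m\<close> applied to
  \<open>ee u\<close> times \<open>y\<close> sits at the last position of a summand and stems from a
  position after its start: all others are excluded by \<open>aa (Suc m)\<close> or would belong to
  \<open>p\<close>. Moving these coordinates one place back yields the forbidden
  \<open>z\<close>.\<close>

lemma has_summand_mdl:
  assumes "S \<subseteq> W" "p \<in> W"
  shows "has_summand (mdl S) p \<longleftrightarrow> p \<in> S"
proof -
  interpret M: left_module A "mdl S" by (rule left_module_mdl[OF assms(1)])
  obtain u m where p: "p = (u, m)" by (cases p)
  have p': "fst p = u" "snd p = m" by (simp_all add: p)
  note ma = mdl_aa[OF assms(1)] and me = mdl_ee[OF assms(1)]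
  show ?thesis
  proof
    assume pS: "p \<in> S"
    let ?y = "bas p 0 1"
    have y: "?y \<in> carrier (mdl S)" using pS by (simp add: bas_carrier)
    have ey: "ee u \<odot>\<^bsub>mdl S\<^esub> ?y = ?y"
      by (rule enc_ext) (simp add: me[OF y] p')
    have "aa (Suc m) \<odot>\<^bsub>mdl S\<^esub> ?y = \<zero>\<^bsub>mdl S\<^esub>"
      by (rule enc_ext) (auto simp: ma[OF y] p')
    moreover have "aa m \<odot>\<^bsub>mdl S\<^esub> ?y \<noteq> aa (Suc m) \<odot>\<^bsub>mdl S\<^esub> z" if z: "z \<in> carrier (mdl S)" for z
    proof
      assume "aa m \<odot>\<^bsub>mdl S\<^esub> ?y = aa (Suc m) \<odot>\<^bsub>mdl S\<^esub> z"
      then have "(aa m \<odot>\<^bsub>mdl S\<^esub> ?y) (enc p m) = (aa (Suc m) \<odot>\<^bsub>mdl S\<^esub> z) (enc p m)" by simp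
      then show False by (simp add: ma[OF y] ma[OF z] p')
    qed
    ultimately show "has_summand (mdl S) p" unfolding has_summand_def p prod.case using y ey unfolding p by (intro bexI[of _ "bas (u, m) 0 1"] conjI ballI) simp_all
  next
    assume "has_summand (mdl S) p"
    then obtain y where y: "y \<in> carrier (mdl S)"
      and y0: "aa (Suc m) \<odot>\<^bsub>mdl S\<^esub> (ee u \<odot>\<^bsub>mdl S\<^esub> y) = (\<lambda>i. 0)"
      and yz: "\<And>z. z \<in> carrier (mdl S) \<Longrightarrow> aa m \<odot>\<^bsub>mdl S\<^esub> (ee u \<odot>\<^bsub>mdl S\<^esub> y) \<noteq> aa (Suc m) \<odot>\<^bsub>mdl S\<^esub> z"
      unfolding has_summand_def p by auto
    have ey: "ee u \<odot>\<^bsub>mdl S\<^esub> y \<in> carrier (mdl S)" using y by (simp add: M.smult_closed)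
    show "p \<in> S"
    proof (rule ccontr)
      assume pS: "p \<notin> S"
      have nz: "y (enc w t) = 0" if w: "w \<in> S" "t + m \<le> snd w" "vtx s (fst w) t = u" "t = 0 \<or> t + m < snd w" for w t
      proof (cases "t + m < snd w")
        case True
        have "(aa (Suc m) \<odot>\<^bsub>mdl S\<^esub> (ee u \<odot>\<^bsub>mdl S\<^esub> y)) (enc w (t + Suc m)) = 0" using y0 by simp
        then show ?thesis using True that by (simp add: ma[OF ey] me[OF y])
      next
        case False
        then have "w = p" using that p by (cases w) auto
        then show ?thesis using pS w by simp
      qed
      define z where "z = enc_fun (\<lambda>w t. if Suc t + m = snd w \<and> vtx s (fst w) (Suc t) = u then y (enc w (Suc t)) else 0)"
      have z: "z (enc w t) = (if Suc t + m = snd w \<and> vtx s (fst w) (Suc t) = u then y (enc w (Suc t)) else 0)" for w t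
        by (simp add: z_def)
      have zc: "z \<in> carrier (mdl S)"
        unfolding mdl_carrier z using mdl_D(1)[OF y] by auto
      have "aa m \<odot>\<^bsub>mdl S\<^esub> (ee u \<odot>\<^bsub>mdl S\<^esub> y) = aa (Suc m) \<odot>\<^bsub>mdl S\<^esub> z"
      proof (rule enc_ext)
        fix w t
        show "(aa m \<odot>\<^bsub>mdl S\<^esub> (ee u \<odot>\<^bsub>mdl S\<^esub> y)) (enc w t) = (aa (Suc m) \<odot>\<^bsub>mdl S\<^esub> z) (enc w t)"
        proof (cases "w \<in> S \<and> t \<le> snd w \<and> m \<le> t")
          case True
          then have l: "(aa m \<odot>\<^bsub>mdl S\<^esub> (ee u \<odot>\<^bsub>mdl S\<^esub> y)) (enc w t) = (if vtx s (fst w) (t - m) = u then y (enc w (t - m)) else 0)"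
            by (simp add: ma[OF ey] me[OF y])
          show ?thesis
          proof (cases "t = m \<or> t < snd w")
            case True
            then have 1: "(aa m \<odot>\<^bsub>mdl S\<^esub> (ee u \<odot>\<^bsub>mdl S\<^esub> y)) (enc w t) = 0"
              unfolding l using nz[of w "t - m"] \<open>w \<in> S \<and> t \<le> snd w \<and> m \<le> t\<close> by auto
            have "(aa (Suc m) \<odot>\<^bsub>mdl S\<^esub> z) (enc w t) = 0"
              using True by (auto simp: ma[OF zc] z)
            then show ?thesis using 1 by simp
          next
            case False
            then have t: "t = snd w" "Suc m \<le> t" using True by auto
            then have "Suc (t - Suc m) = t - m" by simp
            then show ?thesis unfolding l using t by (simp add: ma[OF zc] z)
          qed
        next
          case False
          then show ?thesis using mdl_D(1)[OF ey, of w] mdl_D(1)[OF zc, of w] by (auto simp: ma[OF ey] ma[OF zc])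
        qed
      qed
      then show False using yz[OF zc] by simp
    qed
  qed
qed

lemma has_summand_iso:
  assumes "left_module A M" "left_module A N" "mod_iso A M N" "has_summand M p"
  shows "has_summand N p"
proof -
  interpret M: left_module A M by fact
  interpret N: left_module A N by fact
  obtain u m where p: "p = (u, m)" by (cases p)
  obtain f where f: "f \<in> mod_hom A M N" "bij_betw f (carrier M) (carrier N)"
    using assms(3) unfolding mod_iso_def by blast
  note fD = mod_homD[OF f(1)]
  obtain y where y: "y \<in> carrier M" "aa (Suc m) \<odot>\<^bsub>M\<^esub> (ee u \<odot>\<^bsub>M\<^esub> y) = \<zero>\<^bsub>M\<^esub>"
    "\<And>z. z \<in> carrier M \<Longrightarrow> aa m \<odot>\<^bsub>M\<^esub> (ee u \<odot>\<^bsub>M\<^esub> y) \<noteq> aa (Suc m) \<odot>\<^bsub>M\<^esub> z"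
    using assms(4) unfolding has_summand_def p by auto
  have fk: "f (aa k \<odot>\<^bsub>M\<^esub> (ee u \<odot>\<^bsub>M\<^esub> y)) = aa k \<odot>\<^bsub>N\<^esub> (ee u \<odot>\<^bsub>N\<^esub> f y)" for k
    using fD(4) y(1) M.smult_closed by simp
  have "aa (Suc m) \<odot>\<^bsub>N\<^esub> (ee u \<odot>\<^bsub>N\<^esub> f y) = \<zero>\<^bsub>N\<^esub>"
    using fk[of "Suc m"] y(2) mod_hom_zero[OF assms(1,2) f(1)] by simp
  moreover have "aa m \<odot>\<^bsub>N\<^esub> (ee u \<odot>\<^bsub>N\<^esub> f y) \<noteq> aa (Suc m) \<odot>\<^bsub>N\<^esub> z" if "z \<in> carrier N" for z
  proof
    assume eq: "aa m \<odot>\<^bsub>N\<^esub> (ee u \<odot>\<^bsub>N\<^esub> f y) = aa (Suc m) \<odot>\<^bsub>N\<^esub> z"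
    have "z \<in> f ` carrier M" using f(2) that by (simp add: bij_betw_def)
    then obtain x where x: "x \<in> carrier M" "z = f x" by (elim imageE)
    have "f (aa m \<odot>\<^bsub>M\<^esub> (ee u \<odot>\<^bsub>M\<^esub> y)) = f (aa (Suc m) \<odot>\<^bsub>M\<^esub> x)"
      using eq fk fD(4)[OF gens_closed(1) x(1)] x(2) by simp
    then have "aa m \<odot>\<^bsub>M\<^esub> (ee u \<odot>\<^bsub>M\<^esub> y) = aa (Suc m) \<odot>\<^bsub>M\<^esub> x"
      using f(2) y(1) x(1) M.smult_closed unfolding bij_betw_def by (auto dest: inj_onD)
    then show False using y(3)[OF x(1)] by simp
  qed
  ultimately show ?thesis unfolding has_summand_def p using fD(1)[OF y(1)] by auto
qed

text \<open>The Krull-Schmidt uniqueness required here: \<open>has_summand\<close> is an isomorphism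
  invariant from which \<open>S\<close> can be recovered.\<close>

lemma mdl_iso_unique:
  assumes "S \<subseteq> W" "T \<subseteq> W" "mod_iso A (mdl S) (mdl T)"
  shows "S = T"
proof -
  note lm = left_module_mdl[OF assms(1)] left_module_mdl[OF assms(2)]
  have "p \<in> S \<longleftrightarrow> p \<in> T" if p: "p \<in> W" for p
    using has_summand_iso[OF lm assms(3), of p] has_summand_iso[OF lm(2,1) mod_iso_sym[OF lm assms(3)], of p]
      has_summand_mdl[OF assms(1) p] has_summand_mdl[OF assms(2) p] by blast
  then show ?thesis using assms(1,2) by blast
qed

end

context nakayama_algebra
begin

subsection \<open>Linear functionals\<close>

definition subspace_of :: "('a, 'm) module \<Rightarrow> 'm set \<Rightarrow> bool" where
  "subspace_of N H \<longleftrightarrow> H \<subseteq> carrier N \<and> \<zero>\<^bsub>N\<^esub> \<in> H \<and> (\<forall>x\<in>H. \<forall>y\<in>H. x \<oplus>\<^bsub>N\<^esub> y \<in> H) \<and>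
     (\<forall>c. \<forall>x\<in>H. sc c \<odot>\<^bsub>N\<^esub> x \<in> H)"

definition functional :: "('a, 'm) module \<Rightarrow> ('m \<Rightarrow> 'k) \<Rightarrow> bool" where
  "functional N f \<longleftrightarrow> (\<forall>x\<in>carrier N. \<forall>y\<in>carrier N. f (x \<oplus>\<^bsub>N\<^esub> y) = f x + f y) \<and>
     (\<forall>c. \<forall>x\<in>carrier N. f (sc c \<odot>\<^bsub>N\<^esub> x) = c * f x)"

lemma functional_zero:
  assumes "left_module A N" "functional N f"
  shows "f \<zero>\<^bsub>N\<^esub> = 0"
proof -
  interpret N: left_module A N by fact
  have "f (sc 0 \<odot>\<^bsub>N\<^esub> \<zero>\<^bsub>N\<^esub>) = 0 * f \<zero>\<^bsub>N\<^esub>" using assms(2) N.M.zero_closed unfolding functional_def by blast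
  then show ?thesis by (simp add: sc_0)
qed

text \<open>\<open>N\<close> may be infinite-dimensional, so Zorn's lemma supplies a subspace
  \<open>H\<close> that is maximal among those containing \<open>H0\<close> and avoiding
  \<open>x0\<close>. It is a complement of the line through \<open>x0\<close>, and \<open>f\<close>
  reads off the coefficient of \<open>x0\<close>.\<close>

lemma functional_exists:
  assumes N: "left_module A N" and H0: "subspace_of N H0" and x0: "x0 \<in> carrier N" "x0 \<notin> H0"
  shows "\<exists>f. functional N f \<and> (\<forall>x\<in>H0. f x = 0) \<and> f x0 = 1"
proof -
  interpret N: left_module A N by fact
  have scadd: "sc c \<odot>\<^bsub>N\<^esub> (x \<oplus>\<^bsub>N\<^esub> y) = sc c \<odot>\<^bsub>N\<^esub> x \<oplus>\<^bsub>N\<^esub> sc c \<odot>\<^bsub>N\<^esub> y"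
    "sc (c + d) \<odot>\<^bsub>N\<^esub> x = sc c \<odot>\<^bsub>N\<^esub> x \<oplus>\<^bsub>N\<^esub> sc d \<odot>\<^bsub>N\<^esub> x"
    "sc c \<odot>\<^bsub>N\<^esub> (sc d \<odot>\<^bsub>N\<^esub> x) = sc (c * d) \<odot>\<^bsub>N\<^esub> x" "sc c \<odot>\<^bsub>N\<^esub> x \<in> carrier N"
    "sc 1 \<odot>\<^bsub>N\<^esub> x = x" "sc 0 \<odot>\<^bsub>N\<^esub> x = \<zero>\<^bsub>N\<^esub>"
    if "x \<in> carrier N" "y \<in> carrier N" for c d x y
    using that by (simp_all add: N.smult_r_distr sc_add N.smult_l_distr sc_mult N.smult_assoc1 N.smult_closed sc_1 sc_0 N.smult_one)
  let ?F = "{H. subspace_of N H \<and> H0 \<subseteq> H \<and> x0 \<notin> H}"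
  have "\<exists>H\<in>?F. \<forall>X\<in>?F. H \<subseteq> X \<longrightarrow> X = H"
  proof (rule subset_Zorn_nonempty)
    show "?F \<noteq> {}" using H0 x0 by blast
    fix \<C> assume C: "\<C> \<noteq> {}" "subset.chain ?F \<C>"
    have CF: "\<And>X. X \<in> \<C> \<Longrightarrow> X \<in> ?F" and lin: "\<And>X Y. X \<in> \<C> \<Longrightarrow> Y \<in> \<C> \<Longrightarrow> X \<subseteq> Y \<or> Y \<subseteq> X"
      using C(2) unfolding subset_chain_def by auto
    obtain X\<^sub>0 where X0: "X\<^sub>0 \<in> \<C>" using C(1) by blast
    have "subspace_of N (\<Union>\<C>)" unfolding subspace_of_def
    proof (intro conjI ballI allI)
      show "\<Union>\<C> \<subseteq> carrier N" using CF unfolding subspace_of_def by blast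
      show "\<zero>\<^bsub>N\<^esub> \<in> \<Union>\<C>" using CF[OF X0] X0 unfolding subspace_of_def by blast
      show "sc c \<odot>\<^bsub>N\<^esub> x \<in> \<Union>\<C>" if "x \<in> \<Union>\<C>" for c x
        using that CF unfolding subspace_of_def by blast
      fix x y assume "x \<in> \<Union>\<C>" "y \<in> \<Union>\<C>"
      then obtain X Y where "X \<in> \<C>" "Y \<in> \<C>" "x \<in> X" "y \<in> Y" by blast
      then obtain Z where "Z \<in> \<C>" "x \<in> Z" "y \<in> Z" using lin by blast
      then show "x \<oplus>\<^bsub>N\<^esub> y \<in> \<Union>\<C>" using CF[of Z] unfolding subspace_of_def by blast
    qed
    moreover have "H0 \<subseteq> \<Union>\<C>" using CF[OF X0] X0 by blast
    moreover have "x0 \<notin> \<Union>\<C>" using CF by blast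
    ultimately show "\<Union>\<C> \<in> ?F" by blast
  qed
  then obtain H where HF: "H \<in> ?F" and maxF: "\<forall>X\<in>?F. H \<subseteq> X \<longrightarrow> X = H" by (elim bexE) (rule that)
  have H: "subspace_of N H" "H0 \<subseteq> H" "x0 \<notin> H" using HF by auto
  have max: "X = H" if "subspace_of N X" "H0 \<subseteq> X" "x0 \<notin> X" "H \<subseteq> X" for X
    using bspec[OF maxF, of X] that by simp
  have HN: "\<And>x. x \<in> H \<Longrightarrow> x \<in> carrier N" and Hz: "\<zero>\<^bsub>N\<^esub> \<in> H" and Ha: "\<And>x y. x \<in> H \<Longrightarrow> y \<in> H \<Longrightarrow> x \<oplus>\<^bsub>N\<^esub> y \<in> H"
    and Hs: "\<And>c x. x \<in> H \<Longrightarrow> sc c \<odot>\<^bsub>N\<^esub> x \<in> H"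
    using H(1) unfolding subspace_of_def by auto
  have ex: "\<exists>c h. h \<in> H \<and> x = h \<oplus>\<^bsub>N\<^esub> sc c \<odot>\<^bsub>N\<^esub> x0" if x: "x \<in> carrier N" for x
  proof (cases "x \<in> H")
    case True
    then show ?thesis using scadd(6)[OF x0(1) x0(1)] HN by (intro exI[of _ 0] exI[of _ x]) auto
  next
    case False
    \<comment> \<open>By maximality \<open>H\<close> together with \<open>x\<close> spans
      \<open>x0\<close>. The coefficient of \<open>x\<close> there is nonzero because
      \<open>x0\<close> is not in \<open>H\<close>, so the relation can be solved for
      \<open>x\<close>.\<close>
    let ?X = "{h \<oplus>\<^bsub>N\<^esub> sc c \<odot>\<^bsub>N\<^esub> x |h c. h \<in> H}"
    have "subspace_of N ?X" unfolding subspace_of_def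
    proof (intro conjI ballI allI)
      show "?X \<subseteq> carrier N" using HN scadd(4)[OF x x] by auto
      show "\<zero>\<^bsub>N\<^esub> \<in> ?X" using Hz scadd(6)[OF x x] by (intro CollectI exI[of _ "\<zero>\<^bsub>N\<^esub>"] exI[of _ 0]) simp
    next
      fix y z assume "y \<in> ?X" "z \<in> ?X"
      then obtain h c h' c' where e: "h \<in> H" "h' \<in> H" "y = h \<oplus>\<^bsub>N\<^esub> sc c \<odot>\<^bsub>N\<^esub> x" "z = h' \<oplus>\<^bsub>N\<^esub> sc c' \<odot>\<^bsub>N\<^esub> x" by blast
      have "y \<oplus>\<^bsub>N\<^esub> z = (h \<oplus>\<^bsub>N\<^esub> h') \<oplus>\<^bsub>N\<^esub> sc (c + c') \<odot>\<^bsub>N\<^esub> x"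
        unfolding e scadd(2)[OF x x] using HN[OF e(1)] HN[OF e(2)] scadd(4)[OF x x] by (simp add: N.M.a_ac)
      then show "y \<oplus>\<^bsub>N\<^esub> z \<in> ?X" using Ha[OF e(1,2)] by blast
    next
      fix d y assume "y \<in> ?X"
      then obtain h c where e: "h \<in> H" "y = h \<oplus>\<^bsub>N\<^esub> sc c \<odot>\<^bsub>N\<^esub> x" by blast
      have "sc d \<odot>\<^bsub>N\<^esub> y = sc d \<odot>\<^bsub>N\<^esub> h \<oplus>\<^bsub>N\<^esub> sc (d * c) \<odot>\<^bsub>N\<^esub> x"
        unfolding e using HN[OF e(1)] x scadd(4)[OF x x] by (simp add: scadd)
      then show "sc d \<odot>\<^bsub>N\<^esub> y \<in> ?X" using Hs[OF e(1)] by blast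
    qed
    moreover have "H \<subseteq> ?X"
    proof
      fix h assume "h \<in> H"
      then show "h \<in> ?X" using HN scadd(6)[OF x x] by (intro CollectI exI[of _ h] exI[of _ 0]) simp
    qed
    moreover have "x \<in> ?X" using Hz scadd(5)[OF x x] x by (intro CollectI exI[of _ "\<zero>\<^bsub>N\<^esub>"] exI[of _ 1]) simp
    ultimately have "x0 \<in> ?X" using max[of ?X] H(2) False by blast
    then obtain h d where e: "h \<in> H" "x0 = h \<oplus>\<^bsub>N\<^esub> sc d \<odot>\<^bsub>N\<^esub> x" by blast
    have d: "d \<noteq> 0" using H(3) e HN[OF e(1)] scadd(6)[OF x x] by auto
    have "sc (inverse d) \<odot>\<^bsub>N\<^esub> x0 = sc (inverse d) \<odot>\<^bsub>N\<^esub> h \<oplus>\<^bsub>N\<^esub> x"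
      unfolding e using HN[OF e(1)] x d scadd(4)[OF x x] by (simp add: scadd)
    moreover have "sc (- inverse d) \<odot>\<^bsub>N\<^esub> h \<oplus>\<^bsub>N\<^esub> sc (inverse d) \<odot>\<^bsub>N\<^esub> h = \<zero>\<^bsub>N\<^esub>"
      using scadd(2)[OF HN[OF e(1)] x, of "- inverse d" "inverse d"] scadd(6)[OF HN[OF e(1)] x] by simp
    ultimately have "x = sc (- inverse d) \<odot>\<^bsub>N\<^esub> h \<oplus>\<^bsub>N\<^esub> sc (inverse d) \<odot>\<^bsub>N\<^esub> x0"
      using HN[OF e(1)] x scadd(4) by (simp flip: N.M.a_assoc)
    then show ?thesis using Hs[OF e(1)] by blast
  qed
  have uniq: "c = d" if e: "h \<in> H" "h' \<in> H" "h \<oplus>\<^bsub>N\<^esub> sc c \<odot>\<^bsub>N\<^esub> x0 = h' \<oplus>\<^bsub>N\<^esub> sc d \<odot>\<^bsub>N\<^esub> x0" for c d h h'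
  proof (rule ccontr)
    assume cd: "c \<noteq> d"
    have c0: "sc c \<odot>\<^bsub>N\<^esub> x0 = sc (c - d) \<odot>\<^bsub>N\<^esub> x0 \<oplus>\<^bsub>N\<^esub> sc d \<odot>\<^bsub>N\<^esub> x0"
      using scadd(2)[OF x0(1) x0(1), of "c - d" d] by simp
    have "h \<oplus>\<^bsub>N\<^esub> sc (c - d) \<odot>\<^bsub>N\<^esub> x0 = h'"
      using e(3) HN[OF e(1)] HN[OF e(2)] scadd(4)[OF x0(1) x0(1)] unfolding c0
      by (simp flip: N.M.a_assoc)
    then have "sc (- 1) \<odot>\<^bsub>N\<^esub> h \<oplus>\<^bsub>N\<^esub> (h \<oplus>\<^bsub>N\<^esub> sc (c - d) \<odot>\<^bsub>N\<^esub> x0) \<in> H"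
      using Ha Hs e(1,2) by simp
    moreover have "sc (- 1) \<odot>\<^bsub>N\<^esub> h \<oplus>\<^bsub>N\<^esub> h = \<zero>\<^bsub>N\<^esub>"
      using scadd(2)[OF HN[OF e(1)] x0(1), of "- 1" 1] scadd(5,6)[OF HN[OF e(1)] x0(1)] by simp
    ultimately have "sc (c - d) \<odot>\<^bsub>N\<^esub> x0 \<in> H"
      using HN[OF e(1)] scadd(4)[OF HN[OF e(1)] x0(1)] scadd(4)[OF x0(1) x0(1)] by (simp flip: N.M.a_assoc)
    then have "sc (inverse (c - d)) \<odot>\<^bsub>N\<^esub> (sc (c - d) \<odot>\<^bsub>N\<^esub> x0) \<in> H" by (rule Hs)
    then show False using H(3) cd x0(1) scadd by simp
  qed
  define f where "f x = (SOME c. \<exists>h. h \<in> H \<and> x = h \<oplus>\<^bsub>N\<^esub> sc c \<odot>\<^bsub>N\<^esub> x0)" for x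
  have f: "f x = c" if "x = h \<oplus>\<^bsub>N\<^esub> sc c \<odot>\<^bsub>N\<^esub> x0" "h \<in> H" for x c h
    unfolding f_def by (rule some_equality) (use that uniq in blast)+
  show ?thesis
  proof (intro exI[of _ f] conjI)
    show "functional N f" unfolding functional_def
    proof (intro conjI ballI allI)
      fix x y assume xy: "x \<in> carrier N" "y \<in> carrier N"
      obtain c h d k where e: "h \<in> H" "x = h \<oplus>\<^bsub>N\<^esub> sc c \<odot>\<^bsub>N\<^esub> x0" "k \<in> H" "y = k \<oplus>\<^bsub>N\<^esub> sc d \<odot>\<^bsub>N\<^esub> x0"
        using ex[OF xy(1)] ex[OF xy(2)] by blast
      have "x \<oplus>\<^bsub>N\<^esub> y = (h \<oplus>\<^bsub>N\<^esub> k) \<oplus>\<^bsub>N\<^esub> sc (c + d) \<odot>\<^bsub>N\<^esub> x0"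
        unfolding e(2,4) scadd(2)[OF x0(1) x0(1)]
        using HN[OF e(1)] HN[OF e(3)] scadd(4)[OF x0(1) x0(1)] by (simp add: N.M.a_ac)
      then show "f (x \<oplus>\<^bsub>N\<^esub> y) = f x + f y"
        using f[OF _ Ha[OF e(1,3)]] f[OF e(2,1)] f[OF e(4,3)] by simp
    next
      fix d x assume x: "x \<in> carrier N"
      obtain c h where e: "h \<in> H" "x = h \<oplus>\<^bsub>N\<^esub> sc c \<odot>\<^bsub>N\<^esub> x0" using ex[OF x] by blast
      have "sc d \<odot>\<^bsub>N\<^esub> x = sc d \<odot>\<^bsub>N\<^esub> h \<oplus>\<^bsub>N\<^esub> sc (d * c) \<odot>\<^bsub>N\<^esub> x0"
        unfolding e using HN[OF e(1)] x0(1) scadd(4)[OF x0(1) x0(1)] by (simp add: scadd)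
      then show "f (sc d \<odot>\<^bsub>N\<^esub> x) = d * f x"
        using f[OF _ Hs[OF e(1)]] f[OF e(2,1)] by simp
    qed
    show "\<forall>x\<in>H0. f x = 0"
    proof
      fix x assume "x \<in> H0"
      then have "x \<in> H" using H(2) by blast
      then show "f x = 0" using f[of x x 0] HN scadd(6)[OF x0(1) x0(1)] by simp
    qed
    show "f x0 = 1" using f[of x0 "\<zero>\<^bsub>N\<^esub>" 1] Hz x0 scadd(5)[OF x0(1) x0(1)] by simp
  qed
qed

subsection \<open>Homomorphisms to and from interval modules\<close>

text \<open>The coordinate at position \<open>t\<close> is found by pushing it
  \<open>snd p - t\<close> places on to the last position and reading it there; \<open>f\<close>
  plays the part of the last coordinate.\<close>

definition to_interval :: "('a, 'm) module \<Rightarrow> nat \<times> nat \<Rightarrow> ('m \<Rightarrow> 'k) \<Rightarrow> 'm \<Rightarrow> nat \<Rightarrow> 'k" where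
  "to_interval N p f x = enc_fun (\<lambda>w t. if w = p \<and> t \<le> snd p
     then f (ee (vtx s (fst p) (snd p)) \<odot>\<^bsub>N\<^esub> (aa (snd p - t) \<odot>\<^bsub>N\<^esub> x)) else 0)"

lemma to_interval_enc: "to_interval N p f x (enc w t) = (if w = p \<and> t \<le> snd p
     then f (ee (vtx s (fst p) (snd p)) \<odot>\<^bsub>N\<^esub> (aa (snd p - t) \<odot>\<^bsub>N\<^esub> x)) else 0)"
  by (simp add: to_interval_def)

text \<open>Homomorphisms into an interval module come from functionals on the part of
  \<open>N\<close> at the end vertex of the path, the condition being that they vanish on the images
  of the path sums longer than \<open>m\<close>.\<close>

lemma to_interval_hom:
  assumes N: "left_module A N" and p: "(u, m) \<in> W" and f: "functional N f"
    and vanish: "\<And>j x. m < j \<Longrightarrow> x \<in> carrier N \<Longrightarrow> f (ee (vtx s u m) \<odot>\<^bsub>N\<^esub> (aa j \<odot>\<^bsub>N\<^esub> x)) = 0"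
  shows "restrict (to_interval N (u, m) f) (carrier N) \<in> mod_hom A N (mdl {(u, m)})"
proof -
  interpret N: left_module A N by fact
  let ?p = "(u, m)" let ?g = "to_interval N (u, m) f"
  have pW: "{?p} \<subseteq> W" using p by simp
  interpret I: left_module A "mdl {(u, m)}" by (rule left_module_mdl[OF pW])
  have fa: "f (x \<oplus>\<^bsub>N\<^esub> y) = f x + f y" if "x \<in> carrier N" "y \<in> carrier N" for x y
    using f that unfolding functional_def by blast
  have fs: "f (sc c \<odot>\<^bsub>N\<^esub> x) = c * f x" if "x \<in> carrier N" for x c
    using f that unfolding functional_def by blast
  have gc: "?g x \<in> carrier (mdl {?p})" for x
    unfolding mdl_carrier to_interval_enc by (auto split: if_splits)
  have ga: "?g (x \<oplus>\<^bsub>N\<^esub> y) = ?g x \<oplus>\<^bsub>mdl {?p}\<^esub> ?g y" if "x \<in> carrier N" "y \<in> carrier N" for x y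
    by (rule enc_ext) (use that in \<open>simp add: to_interval_enc N.smult_r_distr N.smult_closed fa\<close>)
  have gs: "\<forall>x\<in>carrier N. ?g (a \<odot>\<^bsub>N\<^esub> x) = a \<odot>\<^bsub>mdl {?p}\<^esub> ?g x" if a: "a \<in> carrier A" for a
    using a
  proof (rule span_induct)
    have f0: "f \<zero>\<^bsub>N\<^esub> = 0" by (rule functional_zero[OF N f])
    show "\<forall>x\<in>carrier N. ?g (\<zero> \<odot>\<^bsub>N\<^esub> x) = \<zero> \<odot>\<^bsub>mdl {?p}\<^esub> ?g x"
    proof
      fix x assume x: "x \<in> carrier N"
      show "?g (\<zero> \<odot>\<^bsub>N\<^esub> x) = \<zero> \<odot>\<^bsub>mdl {?p}\<^esub> ?g x"
        by (rule enc_ext) (simp add: x gc to_interval_enc f0)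
    qed
    fix c v k assume "(v, k) \<in> W"
    show "\<forall>x\<in>carrier N. ?g (sc c \<otimes> (aa k \<otimes> ee v) \<odot>\<^bsub>N\<^esub> x) = sc c \<otimes> (aa k \<otimes> ee v) \<odot>\<^bsub>mdl {?p}\<^esub> ?g x"
    proof
      fix x assume x: "x \<in> carrier N"
      have r: "sc c \<otimes> (aa k \<otimes> ee v) \<odot>\<^bsub>mdl {?p}\<^esub> ?g x = sc c \<odot>\<^bsub>mdl {?p}\<^esub> (aa k \<odot>\<^bsub>mdl {?p}\<^esub> (ee v \<odot>\<^bsub>mdl {?p}\<^esub> ?g x))"
        using gc by (simp add: I.smult_assoc1 I.smult_closed)
      have l: "f (ee (vtx s u m) \<odot>\<^bsub>N\<^esub> (aa (m - t) \<odot>\<^bsub>N\<^esub> (sc c \<otimes> (aa k \<otimes> ee v) \<odot>\<^bsub>N\<^esub> x)))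
          = c * f (ee (vtx s u m) \<odot>\<^bsub>N\<^esub> (aa (m - t + k) \<odot>\<^bsub>N\<^esub> (ee v \<odot>\<^bsub>N\<^esub> x)))" for t
      proof -
        define X where "X = ee (vtx s u m) \<otimes> aa (m - t)"
        have X: "X \<in> carrier A" by (simp add: X_def)
        have "X \<otimes> (sc c \<otimes> (aa k \<otimes> ee v)) = sc c \<otimes> X \<otimes> (aa k \<otimes> ee v)"
          unfolding sc_central[OF X] using X by (simp add: A.m_assoc)
        then have "ee (vtx s u m) \<otimes> aa (m - t) \<otimes> (sc c \<otimes> (aa k \<otimes> ee v)) = sc c \<otimes> (ee (vtx s u m) \<otimes> aa (m - t)) \<otimes> (aa k \<otimes> ee v)"
          unfolding X_def .
        also have "\<dots> = sc c \<otimes> (ee (vtx s u m) \<otimes> (aa (m - t + k) \<otimes> ee v))"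
          by (simp add: A.m_assoc flip: aa_add)
        finally have "ee (vtx s u m) \<odot>\<^bsub>N\<^esub> (aa (m - t) \<odot>\<^bsub>N\<^esub> (sc c \<otimes> (aa k \<otimes> ee v) \<odot>\<^bsub>N\<^esub> x))
          = sc c \<odot>\<^bsub>N\<^esub> (ee (vtx s u m) \<odot>\<^bsub>N\<^esub> (aa (m - t + k) \<odot>\<^bsub>N\<^esub> (ee v \<odot>\<^bsub>N\<^esub> x)))"
          using x by (simp add: N.smult_closed A.m_assoc flip: N.smult_assoc1)
        then show ?thesis using x by (simp add: fs N.smult_closed)
      qed
      show "?g (sc c \<otimes> (aa k \<otimes> ee v) \<odot>\<^bsub>N\<^esub> x) = sc c \<otimes> (aa k \<otimes> ee v) \<odot>\<^bsub>mdl {?p}\<^esub> ?g x"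
      proof (rule enc_ext)
        fix w t
        have g1: "ee v \<odot>\<^bsub>mdl {?p}\<^esub> ?g x \<in> carrier (mdl {?p})" "aa k \<odot>\<^bsub>mdl {?p}\<^esub> (ee v \<odot>\<^bsub>mdl {?p}\<^esub> ?g x) \<in> carrier (mdl {?p})"
          using gc by (simp_all add: I.smult_closed)
        have R: "(sc c \<otimes> (aa k \<otimes> ee v) \<odot>\<^bsub>mdl {?p}\<^esub> ?g x) (enc w t)
           = c * (if t \<le> snd w \<and> k \<le> t then if vtx s (fst w) (t - k) = v then ?g x (enc w (t - k)) else 0 else 0)"
          unfolding r by (simp add: mdl_sc[OF pW g1(2)] mdl_aa[OF pW g1(1)] mdl_ee[OF pW gc])
        have L: "?g (sc c \<otimes> (aa k \<otimes> ee v) \<odot>\<^bsub>N\<^esub> x) (enc w t)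
           = (if w = ?p \<and> t \<le> m then c * f (ee (vtx s u m) \<odot>\<^bsub>N\<^esub> (aa (m - t + k) \<odot>\<^bsub>N\<^esub> (ee v \<odot>\<^bsub>N\<^esub> x))) else 0)"
          unfolding to_interval_enc fst_conv snd_conv l ..
        show "?g (sc c \<otimes> (aa k \<otimes> ee v) \<odot>\<^bsub>N\<^esub> x) (enc w t) = (sc c \<otimes> (aa k \<otimes> ee v) \<odot>\<^bsub>mdl {?p}\<^esub> ?g x) (enc w t)"
        proof (cases "w = ?p \<and> t \<le> m")
          case False
          then show ?thesis unfolding L R by (auto simp: to_interval_enc)
        next
          case True
          then have wp: "w = ?p" and tm: "t \<le> m" by auto
          define j where "j = m - t + k"
          show ?thesis
          proof (cases "k \<le> t")
            \<comment> \<open>On the interval side the coordinate would come from a position before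
              the start and is zero; on the side of \<open>N\<close> the path sum is longer than
              \<open>m\<close>, where the functional vanishes.\<close>
            case False
            then have "m < j" using tm by (simp add: j_def)
            from vanish[OF this N.smult_closed[OF gens_closed(2) x, of v]]
            show ?thesis unfolding L R j_def[symmetric] using False wp tm by simp
          next
            case k: True
            have uV: "vtx s u (t - k) \<in> V" using W_tail[OF p, of "t - k"] tm by simp
            have "ee (vtx s u m) \<otimes> aa (m - t + k) = aa (m - t + k) \<otimes> ee (vtx s u (t - k))"
              using ee_aa[OF uV, of "m - t + k"] tm k by simp
            then have e: "ee (vtx s u m) \<odot>\<^bsub>N\<^esub> (aa (m - t + k) \<odot>\<^bsub>N\<^esub> y) = aa (m - t + k) \<odot>\<^bsub>N\<^esub> (ee (vtx s u (t - k)) \<odot>\<^bsub>N\<^esub> y)"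
              if "y \<in> carrier N" for y
              using that by (simp flip: N.smult_assoc1)
            have "ee (vtx s u (t - k)) \<odot>\<^bsub>N\<^esub> (ee v \<odot>\<^bsub>N\<^esub> x) = (if vtx s u (t - k) = v then ee v \<odot>\<^bsub>N\<^esub> x else \<zero>\<^bsub>N\<^esub>)"
              using x by (simp add: ee_idem flip: N.smult_assoc1)
            then have "ee (vtx s u m) \<odot>\<^bsub>N\<^esub> (aa (m - t + k) \<odot>\<^bsub>N\<^esub> (ee v \<odot>\<^bsub>N\<^esub> x))
               = (if vtx s u (t - k) = v then ee (vtx s u m) \<odot>\<^bsub>N\<^esub> (aa (m - t + k) \<odot>\<^bsub>N\<^esub> x) else \<zero>\<^bsub>N\<^esub>)"
              using x by (simp add: e N.smult_closed)
            then have "ee (vtx s u m) \<odot>\<^bsub>N\<^esub> (aa j \<odot>\<^bsub>N\<^esub> (ee v \<odot>\<^bsub>N\<^esub> x))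
               = (if vtx s u (t - k) = v then ee (vtx s u m) \<odot>\<^bsub>N\<^esub> (aa j \<odot>\<^bsub>N\<^esub> x) else \<zero>\<^bsub>N\<^esub>)"
              unfolding j_def .
            moreover have "m - (t - k) = j" "t - k \<le> m" using tm k by (simp_all add: j_def)
            ultimately show ?thesis unfolding L R j_def[symmetric] using wp tm k by (simp add: to_interval_enc f0)
          qed
        qed
      qed
    qed
  next
    fix a b assume ab: "a \<in> carrier A" "b \<in> carrier A" "\<forall>x\<in>carrier N. ?g (a \<odot>\<^bsub>N\<^esub> x) = a \<odot>\<^bsub>mdl {?p}\<^esub> ?g x"
      "\<forall>x\<in>carrier N. ?g (b \<odot>\<^bsub>N\<^esub> x) = b \<odot>\<^bsub>mdl {?p}\<^esub> ?g x"
    show "\<forall>x\<in>carrier N. ?g ((a \<oplus> b) \<odot>\<^bsub>N\<^esub> x) = (a \<oplus> b) \<odot>\<^bsub>mdl {?p}\<^esub> ?g x"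
    proof
      fix x assume "x \<in> carrier N"
      then show "?g ((a \<oplus> b) \<odot>\<^bsub>N\<^esub> x) = (a \<oplus> b) \<odot>\<^bsub>mdl {?p}\<^esub> ?g x"
        unfolding I.smult_l_distr[OF ab(1,2) gc] N.smult_l_distr[OF ab(1,2) \<open>x \<in> carrier N\<close>]
        using bspec[OF ab(3)] bspec[OF ab(4)]
          ga[OF N.smult_closed[OF ab(1)] N.smult_closed[OF ab(2)], of x x] by (simp only:)
    qed
  qed
  show ?thesis by (rule mod_hom_restrictI[OF N gc ga]) (use gs in blast)+
qed

text \<open>Paths from \<open>u\<close> that are longer than \<open>m\<close> factor through
  \<open>aa (Suc m) \<otimes> ee u\<close>, which annihilates \<open>y\<close>. The element
  \<open>r\<close> collects the remaining factors of the paths on which \<open>a\<close> and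
  \<open>b\<close> differ.\<close>

lemma action_eqI:
  assumes "left_module A N" "y \<in> carrier N" "aa (Suc m) \<odot>\<^bsub>N\<^esub> (ee u \<odot>\<^bsub>N\<^esub> y) = \<zero>\<^bsub>N\<^esub>"
    and "a \<in> carrier A" "b \<in> carrier A" "\<And>t. t \<le> m \<Longrightarrow> (u, t) \<in> W \<Longrightarrow> co a (u, t) = co b (u, t)"
  shows "a \<odot>\<^bsub>N\<^esub> (ee u \<odot>\<^bsub>N\<^esub> y) = b \<odot>\<^bsub>N\<^esub> (ee u \<odot>\<^bsub>N\<^esub> y)"
proof -
  interpret N: left_module A N by fact
  define r where "r = el (\<lambda>(v, t). if v = vtx s u (Suc m) then co a (u, Suc m + t) - co b (u, Suc m + t) else 0)"
  have r: "r \<in> carrier A" unfolding r_def by (rule el)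
  have "a \<otimes> ee u = b \<otimes> ee u \<oplus> r \<otimes> (aa (Suc m) \<otimes> ee u)"
  proof (rule co_inj)
    fix p assume p: "p \<in> W"
    obtain v t where [simp]: "p = (v, t)" by (cases p)
    have R: "co (r \<otimes> (aa (Suc m) \<otimes> ee u)) (v, t)
      = (if v = u then if Suc m \<le> t then co a (u, t) - co b (u, t) else 0 else 0)"
    proof -
      have "co (r \<otimes> (aa (Suc m) \<otimes> ee u)) (v, t) = (if v = u then co (r \<otimes> aa (Suc m)) (v, t) else 0)"
        using p r by (simp add: co_mult_ee flip: A.m_assoc)
      also have "\<dots> = (if v = u then if Suc m \<le> t then co r (vtx s v (Suc m), t - Suc m) else 0 else 0)"
        using p r by (cases "v = u") (simp_all add: co_mult_aa)
      finally show ?thesis using p W_suffix[of v t "Suc m"] by (auto simp: r_def el)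
    qed
    show "co (a \<otimes> ee u) p = co (b \<otimes> ee u \<oplus> r \<otimes> (aa (Suc m) \<otimes> ee u)) p"
      using p assms(4-6) r by (auto simp: co_add R co_mult_ee)
  qed (use assms r in auto)
  then have "(a \<otimes> ee u) \<odot>\<^bsub>N\<^esub> y = (b \<otimes> ee u \<oplus> r \<otimes> (aa (Suc m) \<otimes> ee u)) \<odot>\<^bsub>N\<^esub> y" by simp
  then show ?thesis
    using assms(2-5) r by (simp add: N.smult_l_distr N.smult_assoc1 N.smult_closed)
qed

text \<open>The generator is to go to \<open>y\<close> cut down to the starting vertex. A vector
  acts on it as the algebra element having the \<open>t\<close>-th coordinate as coefficient of
  paths of length \<open>t\<close>; the starting vertex \<open>v\<close> may be disregarded because
  the idempotent selects it.\<close>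

definition from_interval :: "('a, 'm) module \<Rightarrow> nat \<times> nat \<Rightarrow> 'm \<Rightarrow> (nat \<Rightarrow> 'k) \<Rightarrow> 'm" where
  "from_interval N p y x = el (\<lambda>(v, t). x (enc p t)) \<odot>\<^bsub>N\<^esub> (ee (fst p) \<odot>\<^bsub>N\<^esub> y)"

lemma from_interval_hom:
  assumes N: "left_module A N" and p: "(u, m) \<in> W"
    and y: "y \<in> carrier N" "aa (Suc m) \<odot>\<^bsub>N\<^esub> (ee u \<odot>\<^bsub>N\<^esub> y) = \<zero>\<^bsub>N\<^esub>"
  shows "restrict (from_interval N (u, m) y) (carrier (mdl {(u, m)})) \<in> mod_hom A (mdl {(u, m)}) N"
proof -
  interpret N: left_module A N by fact
  let ?p = "(u, m)"
  have pW: "{?p} \<subseteq> W" using p by simp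
  interpret I: left_module A "mdl {(u, m)}" by (rule left_module_mdl[OF pW])
  define l where "l x = el (\<lambda>(v, t). x (enc ?p t))" for x :: "nat \<Rightarrow> 'k"
  have l: "l x \<in> carrier A" "(v, t) \<in> W \<Longrightarrow> co (l x) (v, t) = x (enc ?p t)" for x v t
    unfolding l_def by (simp_all add: el)
  have g: "from_interval N ?p y x = l x \<odot>\<^bsub>N\<^esub> (ee u \<odot>\<^bsub>N\<^esub> y)" for x
    unfolding from_interval_def l_def by simp
  have ey: "ee u \<odot>\<^bsub>N\<^esub> y \<in> carrier N" using y(1) by (simp add: N.smult_closed)
  note eq = action_eqI[OF N y]
  show ?thesis
  proof (rule mod_hom_restrictI[OF left_module_mdl[OF pW]])
    fix x show "from_interval N ?p y x \<in> carrier N" unfolding g using l(1) ey by (simp add: N.smult_closed)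
  next
    fix x x' assume x: "x \<in> carrier (mdl {?p})" "x' \<in> carrier (mdl {?p})"
    have "l (x \<oplus>\<^bsub>mdl {?p}\<^esub> x') \<odot>\<^bsub>N\<^esub> (ee u \<odot>\<^bsub>N\<^esub> y) = (l x \<oplus> l x') \<odot>\<^bsub>N\<^esub> (ee u \<odot>\<^bsub>N\<^esub> y)"
      by (rule eq) (auto simp: l co_add)
    then show "from_interval N ?p y (x \<oplus>\<^bsub>mdl {?p}\<^esub> x') = from_interval N ?p y x \<oplus>\<^bsub>N\<^esub> from_interval N ?p y x'"
      unfolding g N.smult_l_distr[OF l(1) l(1) ey] .
  next
    fix a x assume a: "a \<in> carrier A" and x: "x \<in> carrier (mdl {?p})"
    have "l (a \<odot>\<^bsub>mdl {?p}\<^esub> x) \<odot>\<^bsub>N\<^esub> (ee u \<odot>\<^bsub>N\<^esub> y) = (a \<otimes> l x) \<odot>\<^bsub>N\<^esub> (ee u \<odot>\<^bsub>N\<^esub> y)"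
    proof (rule eq)
      fix t assume t: "t \<le> m" "(u, t) \<in> W"
      show "co (l (a \<odot>\<^bsub>mdl {?p}\<^esub> x)) (u, t) = co (a \<otimes> l x) (u, t)"
        unfolding l(2)[OF t(2)] mdl_smult co_mult[OF a l(1) t(2)] using t
        by (auto simp: l(2) W_head intro!: sum.cong)
    qed (use a l in auto)
    then show "from_interval N ?p y (a \<odot>\<^bsub>mdl {?p}\<^esub> x) = a \<odot>\<^bsub>N\<^esub> from_interval N ?p y x"
      unfolding g N.smult_assoc1[OF a l(1) ey] .
  qed
qed

lemma from_interval_bas:
  assumes "left_module A N" "(u, m) \<in> W" "y \<in> carrier N" "t \<le> m"
    "aa (Suc m) \<odot>\<^bsub>N\<^esub> (ee u \<odot>\<^bsub>N\<^esub> y) = \<zero>\<^bsub>N\<^esub>"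
  shows "from_interval N (u, m) y (bas (u, m) t 1) = aa t \<odot>\<^bsub>N\<^esub> (ee u \<odot>\<^bsub>N\<^esub> y)"
  unfolding from_interval_def fst_conv
  by (rule action_eqI[OF assms(1,3,5)]) (auto simp: el co_gens)

end

context nakayama_algebra
begin

subsection \<open>Interval modules are uniserial\<close>

text \<open>The radical filtration of an interval module, from everything at \<open>k = 0\<close>
  down to zero at \<open>k = Suc (snd p)\<close>.\<close>

definition flt :: "nat \<times> nat \<Rightarrow> nat \<Rightarrow> (nat \<Rightarrow> 'k) set" where
  "flt p k = {x \<in> carrier (mdl {p}). \<forall>r<k. x (enc p r) = 0}"

lemma flt_0: "flt p 0 = carrier (mdl {p})"
  by (simp add: flt_def)

lemma interval_eqI:
  assumes "x \<in> carrier (mdl {p})" "y \<in> carrier (mdl {p})" "\<And>t. t \<le> snd p \<Longrightarrow> x (enc p t) = y (enc p t)"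
  shows "x = y"
proof (rule enc_ext)
  fix w t
  show "x (enc w t) = y (enc w t)"
    using assms(3)[of t] mdl_D[OF assms(1), of w t] mdl_D[OF assms(2), of w t]
    by (cases "w = p"; cases "t \<le> snd p") (simp_all add: not_le)
qed

lemma flt_Suc: "flt p (Suc (snd p)) = {\<lambda>i. 0}"
proof (rule equalityI; rule subsetI)
  fix x assume x: "x \<in> flt p (Suc (snd p))"
  have "x = (\<lambda>i. 0)"
    by (rule interval_eqI[of _ p]) (use x in \<open>auto simp: flt_def mdl_carrier less_Suc_eq_le\<close>)
  then show "x \<in> {\<lambda>i. 0}" by simp
qed (auto simp: flt_def mdl_carrier)

lemma flt_submodule:
  assumes "p \<in> W"
  shows "submodule (flt p k) A (mdl {p})"
proof -
  have pW: "{p} \<subseteq> W" using assms by simp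
  interpret I: left_module A "mdl {p}" by (rule left_module_mdl[OF pW])
  show ?thesis
  proof (rule I.left_submoduleI)
    show "flt p k \<subseteq> carrier (mdl {p})" by (auto simp: flt_def)
    show "\<zero>\<^bsub>mdl {p}\<^esub> \<in> flt p k" by (auto simp: flt_def mdl_carrier)
    show "x \<oplus>\<^bsub>mdl {p}\<^esub> y \<in> flt p k" if "x \<in> flt p k" "y \<in> flt p k" for x y
      using that I.M.a_closed[of x y] by (simp add: flt_def del: mdl_add) (simp add: mdl_add)
    show "a \<odot>\<^bsub>mdl {p}\<^esub> x \<in> flt p k" if "a \<in> carrier A" "x \<in> flt p k" for a x
      using that I.smult_closed[of a x] by (auto simp: flt_def mdl_smult intro!: sum.neutral)
  qed
qed

text \<open>Uniseriality. If \<open>r\<close> is the first position at which some element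
  \<open>x\<close> of \<open>U\<close> is nonzero, the shifts of \<open>x\<close> have leading
  positions from \<open>r\<close> on, and elimination from the bottom of the filtration upwards
  shows that they generate all of \<open>flt p r\<close>.\<close>

lemma submodule_interval:
  assumes "p \<in> W" "submodule U A (mdl {p})"
  shows "\<exists>k\<le>Suc (snd p). U = flt p k"
proof (cases "U = {\<lambda>i. 0}")
  case True
  then show ?thesis using flt_Suc by blast
next
  case False
  have pW: "{p} \<subseteq> W" using assms by simp
  interpret I: left_module A "mdl {p}" by (rule left_module_mdl[OF pW])
  note U = I.left_submoduleD[OF assms(2)]
  have Uc: "x \<in> carrier (mdl {p})" if "x \<in> U" for x using U(1) that by (rule subsetD)
  obtain x0 where x0: "x0 \<in> U" "x0 \<noteq> (\<lambda>i. 0)" using False U(2) by auto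
  have "\<exists>r. \<exists>x\<in>U. x (enc p r) \<noteq> 0"
  proof (rule ccontr)
    assume no: "\<not> ?thesis"
    have "x0 = (\<lambda>i. 0)"
      by (rule interval_eqI[of _ p]) (use Uc[OF x0(1)] no x0(1) in \<open>auto simp: mdl_carrier\<close>)
    then show False using x0(2) by simp
  qed
  then obtain r where r: "\<exists>x\<in>U. x (enc p r) \<noteq> 0" and min: "\<And>i. i < r \<Longrightarrow> \<not> (\<exists>x\<in>U. x (enc p i) \<noteq> 0)"
    using exists_least_iff[of "\<lambda>r. \<exists>x\<in>U. x (enc p r) \<noteq> 0"] by auto
  obtain x where x: "x \<in> U" "x (enc p r) \<noteq> 0" using r by (elim bexE)
  have rm: "r \<le> snd p" using mdl_D(2)[OF Uc[OF x(1)], of p r] x(2) by (meson not_le)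
  have sub: "U \<subseteq> flt p r"
  proof
    fix y assume "y \<in> U"
    then show "y \<in> flt p r" using Uc min unfolding flt_def by auto
  qed
  have key: "flt p k \<subseteq> U" if "r \<le> k" "k \<le> Suc (snd p)" for k
    using that(2,1)
  proof (induction k rule: inc_induct)
    case base
    then show ?case using flt_Suc U(2) by simp
  next
    case (step k)
    show ?case
    proof
      fix z assume z: "z \<in> flt p k"
      then have zc: "z \<in> carrier (mdl {p})" by (simp add: flt_def)
      \<comment> \<open>The shift of \<open>x\<close> with leading position \<open>k\<close>;
        subtracting a multiple of it moves \<open>z\<close> into the next filtration step, which
        lies in \<open>U\<close> by induction.\<close>
      define w where "w = aa (k - r) \<odot>\<^bsub>mdl {p}\<^esub> x"
      have wU: "w \<in> U" unfolding w_def by (rule U(4)[OF gens_closed(1) x(1)])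
      have wt: "w (enc p t) = (if t \<le> snd p \<and> k - r \<le> t then x (enc p (t - (k - r))) else 0)" for t
        unfolding w_def by (rule mdl_aa[OF pW Uc[OF x(1)]])
      have w0: "w (enc p t) = 0" if "t < k" for t
        using that step.prems min x(1) unfolding wt by auto
      have wk: "w (enc p k) = x (enc p r)"
        using step unfolding wt by auto
      define c where "c = z (enc p k) / x (enc p r)"
      have scw: "(sc d \<odot>\<^bsub>mdl {p}\<^esub> w) (enc q t) = d * w (enc q t)" for d q t
        by (rule mdl_sc[OF pW Uc[OF wU]])
      have scU: "sc d \<odot>\<^bsub>mdl {p}\<^esub> w \<in> U" for d by (rule U(4)[OF gens_closed(3) wU])
      have "z \<oplus>\<^bsub>mdl {p}\<^esub> sc (- c) \<odot>\<^bsub>mdl {p}\<^esub> w \<in> flt p (Suc k)"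
      proof -
        have "(z \<oplus>\<^bsub>mdl {p}\<^esub> sc (- c) \<odot>\<^bsub>mdl {p}\<^esub> w) (enc p t) = 0" if "t < Suc k" for t
        proof (cases "t = k")
          case True
          then show ?thesis using x(2) by (simp add: mdl_add scw wk c_def)
        next
          case False
          then have "t < k" using that by simp
          then show ?thesis using z by (simp add: mdl_add scw w0 flt_def)
        qed
        then show ?thesis unfolding flt_def using I.M.a_closed[OF zc Uc[OF scU]] by blast
      qed
      then have "z \<oplus>\<^bsub>mdl {p}\<^esub> sc (- c) \<odot>\<^bsub>mdl {p}\<^esub> w \<in> U" using step by auto
      from U(3)[OF this scU[of c]]
      have "z \<oplus>\<^bsub>mdl {p}\<^esub> sc (- c) \<odot>\<^bsub>mdl {p}\<^esub> w \<oplus>\<^bsub>mdl {p}\<^esub> sc c \<odot>\<^bsub>mdl {p}\<^esub> w \<in> U" .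
      moreover have "z \<oplus>\<^bsub>mdl {p}\<^esub> sc (- c) \<odot>\<^bsub>mdl {p}\<^esub> w \<oplus>\<^bsub>mdl {p}\<^esub> sc c \<odot>\<^bsub>mdl {p}\<^esub> w = z"
        by (rule enc_ext) (simp add: mdl_add scw)
      ultimately show "z \<in> U" by simp
    qed
  qed
  have "U = flt p r" using sub by (rule equalityI) (rule key, use rm in simp_all)
  then show ?thesis using rm by (intro exI[of _ r]) simp
qed

lemma bas_flt_iff: "t \<le> snd p \<Longrightarrow> bas p t 1 \<in> flt p k \<longleftrightarrow> k \<le> t"
  using bas_carrier[of p "{p}" t 1] by (auto simp: flt_def not_less[symmetric])

text \<open>The last basis vector spans the socle. Two nonzero submodules thus never form a direct
  sum, and a homomorphism is injective as soon as it does not kill this vector.\<close>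

lemma submodule_interval_nonzero:
  assumes "p \<in> W" "submodule U A (mdl {p})" "U \<noteq> {\<lambda>i. 0}"
  shows "bas p (snd p) 1 \<in> U"
proof -
  obtain k where k: "k \<le> Suc (snd p)" "U = flt p k" using submodule_interval[OF assms(1,2)] by blast
  then have "k \<noteq> Suc (snd p)" using assms(3) flt_Suc[of p] by auto
  then show ?thesis using k bas_flt_iff[of "snd p" p k] by simp
qed

text \<open>Reduces surjectivity onto an interval module to a nonzero first coordinate.\<close>

lemma submodule_interval_top:
  assumes "p \<in> W" "submodule U A (mdl {p})" "x \<in> U" "x (enc p 0) \<noteq> 0"
  shows "U = carrier (mdl {p})"
proof -
  obtain k where k: "k \<le> Suc (snd p)" "U = flt p k" using submodule_interval[OF assms(1,2)] by blast
  then have "k = 0" using assms(3,4) by (cases k) (auto simp: flt_def)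
  then show ?thesis using k flt_0 by simp
qed

lemma bas_nonzero: "c \<noteq> 0 \<Longrightarrow> bas w t c \<noteq> (\<lambda>i. 0)"
proof
  assume "c \<noteq> 0" "bas w t c = (\<lambda>i. 0)"
  then show False using bas_enc[of w t c w t] by simp
qed

lemma indecomposable_interval:
  assumes "p \<in> W"
  shows "indecomposable A (mdl {p})"
  unfolding indecomposable_def
proof (intro conjI allI impI)
  show "carrier (mdl {p}) \<noteq> {\<zero>\<^bsub>mdl {p}\<^esub>}"
    using bas_carrier[of p "{p}" 0 1] bas_nonzero[of 1 p 0] by auto
  fix U V assume UV: "submodule U A (mdl {p}) \<and> submodule V A (mdl {p}) \<and> U \<inter> V = {\<zero>\<^bsub>mdl {p}\<^esub>} \<and>
    U <+>\<^bsub>mdl {p}\<^esub> V = carrier (mdl {p})"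
  show "U = {\<zero>\<^bsub>mdl {p}\<^esub>} \<or> V = {\<zero>\<^bsub>mdl {p}\<^esub>}"
  proof (rule ccontr)
    assume "\<not> ?thesis"
    then have "bas p (snd p) 1 \<in> U" "bas p (snd p) 1 \<in> V"
      using UV submodule_interval_nonzero[OF assms, of U] submodule_interval_nonzero[OF assms, of V] by simp_all
    then have "bas p (snd p) 1 \<in> U \<inter> V" by (rule IntI)
    then show False using UV bas_nonzero[of 1 p "snd p"] by simp
  qed
qed

lemma simple_interval_iff:
  assumes "p \<in> W"
  shows "simple_module A (mdl {p}) \<longleftrightarrow> snd p = 0"
proof
  assume s: "simple_module A (mdl {p})"
  have "flt p 1 = {\<lambda>i. 0} \<or> flt p 1 = carrier (mdl {p})"
    using s flt_submodule[OF assms, of 1] unfolding simple_module_def by simp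
  moreover have "flt p 1 \<noteq> carrier (mdl {p})"
    using bas_flt_iff[of 0 p 1] bas_carrier[of p "{p}" 0 1] by auto
  ultimately have "flt p 1 = {\<lambda>i. 0}" by simp
  then show "snd p = 0" using bas_flt_iff[of "snd p" p 1] bas_nonzero[of 1 p "snd p"] by auto
next
  assume p0: "snd p = 0"
  show "simple_module A (mdl {p})" unfolding simple_module_def
  proof (intro conjI allI impI)
    show "carrier (mdl {p}) \<noteq> {\<zero>\<^bsub>mdl {p}\<^esub>}"
      using bas_carrier[of p "{p}" 0 1] bas_nonzero[of 1 p 0] by auto
    fix U assume "submodule U A (mdl {p})"
    from submodule_interval[OF assms this] obtain k where k: "k \<le> 1" "U = flt p k" using p0 by auto
    then have "k = 0 \<or> k = Suc (snd p)" using p0 by auto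
    then show "U = {\<zero>\<^bsub>mdl {p}\<^esub>} \<or> U = carrier (mdl {p})" using k flt_0[of p] flt_Suc[of p] by auto
  qed
qed

subsection \<open>Classification of the indecomposable modules\<close>

text \<open>With \<open>m\<close> the largest index for which \<open>aa m\<close> acts nontrivially
  on \<open>N\<close>, both the vanishing condition for functionals and the annihilation condition
  for generators hold automatically. This gives homomorphisms \<open>l\<close> from and
  \<open>\<pi>\<close> to the interval module of length \<open>m\<close> whose composite is
  bijective, so \<open>N\<close> is the direct sum of the image of \<open>l\<close> and the kernel
  of \<open>\<pi>\<close>.\<close>

theorem indecomposable_classification:
  assumes N: "left_module A N" and ind: "indecomposable A N"
  shows "\<exists>p\<in>W. mod_iso A N (mdl {p})"
proof -
  interpret N: left_module A N by fact
  obtain z where z: "z \<in> carrier N" "z \<noteq> \<zero>\<^bsub>N\<^esub>"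
    using ind N.M.zero_closed unfolding indecomposable_def by auto
  have ex: "\<exists>k. \<forall>x\<in>carrier N. aa k \<odot>\<^bsub>N\<^esub> x = \<zero>\<^bsub>N\<^esub>"
    by (rule exI[of _ loewy]) (simp add: aa_nilpotent)
  define k0 where "k0 = (LEAST k. \<forall>x\<in>carrier N. aa k \<odot>\<^bsub>N\<^esub> x = \<zero>\<^bsub>N\<^esub>)"
  have k0: "\<forall>x\<in>carrier N. aa k0 \<odot>\<^bsub>N\<^esub> x = \<zero>\<^bsub>N\<^esub>" unfolding k0_def by (rule LeastI_ex[OF ex])
  have "k0 \<noteq> 0"
  proof
    assume "k0 = 0"
    then have "aa 0 \<odot>\<^bsub>N\<^esub> z = \<zero>\<^bsub>N\<^esub>" using k0 z by auto
    then show False using z by (simp add: aa_0 N.smult_one)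
  qed
  then obtain m where m: "k0 = Suc m" by (cases k0) auto
  have "\<not> (\<forall>x\<in>carrier N. aa m \<odot>\<^bsub>N\<^esub> x = \<zero>\<^bsub>N\<^esub>)"
    using not_less_Least[of m "\<lambda>k. \<forall>x\<in>carrier N. aa k \<odot>\<^bsub>N\<^esub> x = \<zero>\<^bsub>N\<^esub>"] m unfolding k0_def by simp
  then obtain x where x: "x \<in> carrier N" "aa m \<odot>\<^bsub>N\<^esub> x \<noteq> \<zero>\<^bsub>N\<^esub>" by auto
  have aj: "aa j \<odot>\<^bsub>N\<^esub> y = \<zero>\<^bsub>N\<^esub>" if "m < j" "y \<in> carrier N" for j y
  proof -
    have "aa j = aa (j - Suc m) \<otimes> aa (Suc m)" using that(1) by (simp add: aa_add)
    then show ?thesis using k0 that(2) unfolding m by (simp add: N.smult_assoc1)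
  qed
  \<comment> \<open>Otherwise \<open>aa m\<close> would kill \<open>a\<close> times \<open>x\<close>
    for every \<open>a\<close>, as \<open>aa m\<close> commutes with path sums and scalars;
    \<open>a = \<one>\<close> contradicts the choice of \<open>x\<close>.\<close>
  have "\<exists>u. aa m \<odot>\<^bsub>N\<^esub> (ee u \<odot>\<^bsub>N\<^esub> x) \<noteq> \<zero>\<^bsub>N\<^esub>"
  proof (rule ccontr)
    assume no: "\<nexists>u. aa m \<odot>\<^bsub>N\<^esub> (ee u \<odot>\<^bsub>N\<^esub> x) \<noteq> \<zero>\<^bsub>N\<^esub>"
    have "aa m \<odot>\<^bsub>N\<^esub> (a \<odot>\<^bsub>N\<^esub> x) = \<zero>\<^bsub>N\<^esub>" if "a \<in> carrier A" for a
      using that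
    proof (rule span_induct)
      fix c u k
      have "aa m \<otimes> (sc c \<otimes> (aa k \<otimes> ee u)) = (aa m \<otimes> sc c) \<otimes> (aa k \<otimes> ee u)" by (simp add: A.m_assoc)
      also have "\<dots> = sc c \<otimes> aa m \<otimes> (aa k \<otimes> ee u)" by (simp add: sc_central)
      also have "\<dots> = sc c \<otimes> (aa (m + k) \<otimes> ee u)" by (simp add: A.m_assoc flip: aa_add)
      also have "aa (m + k) = aa k \<otimes> aa m" by (simp add: aa_add add.commute)
      finally have "aa m \<odot>\<^bsub>N\<^esub> (sc c \<otimes> (aa k \<otimes> ee u) \<odot>\<^bsub>N\<^esub> x) = sc c \<otimes> aa k \<odot>\<^bsub>N\<^esub> (aa m \<odot>\<^bsub>N\<^esub> (ee u \<odot>\<^bsub>N\<^esub> x))"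
        using x(1) by (simp add: A.m_assoc N.smult_closed flip: N.smult_assoc1)
      then show "aa m \<odot>\<^bsub>N\<^esub> (sc c \<otimes> (aa k \<otimes> ee u) \<odot>\<^bsub>N\<^esub> x) = \<zero>\<^bsub>N\<^esub>" using no by simp
    qed (use x(1) in \<open>simp_all add: N.smult_l_distr N.smult_r_distr N.smult_closed\<close>)
    from this[of \<one>] show False using x by (simp add: N.smult_one)
  qed
  then obtain u where u: "aa m \<odot>\<^bsub>N\<^esub> (ee u \<odot>\<^bsub>N\<^esub> x) \<noteq> \<zero>\<^bsub>N\<^esub>" by auto
  have p: "(u, m) \<in> W"
  proof (rule ccontr)
    assume "(u, m) \<notin> W"
    then have "aa m \<otimes> ee u = \<zero>" by (rule aa_ee_nonpath)
    then have "(aa m \<otimes> ee u) \<odot>\<^bsub>N\<^esub> x = \<zero>\<^bsub>N\<^esub>" using x(1) by simp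
    then show False using u x(1) by (simp add: N.smult_assoc1)
  qed
  let ?p = "(u, m)" let ?I = "mdl {(u, m)}"
  have pW: "{?p} \<subseteq> W" using p by simp
  interpret I: left_module A ?I by (rule left_module_mdl[OF pW])
  define b where "b = aa m \<odot>\<^bsub>N\<^esub> (ee u \<odot>\<^bsub>N\<^esub> x)"
  have b: "b \<in> carrier N" "b \<noteq> \<zero>\<^bsub>N\<^esub>" using u x(1) by (simp_all add: b_def N.smult_closed)
  have eb: "ee (vtx s u m) \<odot>\<^bsub>N\<^esub> b = b"
  proof -
    have "ee (vtx s u m) \<otimes> (aa m \<otimes> ee u) = aa m \<otimes> ee u"
      using ee_aa[OF W_vertex[OF p], of m] by (simp add: A.m_assoc[symmetric]) (simp add: A.m_assoc ee_idem)
    then show ?thesis unfolding b_def using x(1) by (simp add: N.smult_closed flip: N.smult_assoc1)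
  qed
  \<comment> \<open>\<open>b\<close> is the image under \<open>l\<close> of the last basis vector.
    Normalising \<open>f\<close> at \<open>b\<close> gives the composite of \<open>l\<close> and
    \<open>\<pi>\<close> first coordinate \<open>1\<close> on the generator.\<close>
  have "subspace_of N {\<zero>\<^bsub>N\<^esub>}" unfolding subspace_of_def by simp
  then obtain f where f: "functional N f" "f b = 1" using functional_exists[OF N _ b(1)] b(2) by auto
  define \<pi> where "\<pi> = restrict (to_interval N ?p f) (carrier N)"
  have \<pi>: "\<pi> \<in> mod_hom A N ?I" unfolding \<pi>_def
    by (rule to_interval_hom[OF N p f(1)]) (simp add: aj functional_zero[OF N f(1)])
  have top0: "aa (Suc m) \<odot>\<^bsub>N\<^esub> (ee u \<odot>\<^bsub>N\<^esub> x) = \<zero>\<^bsub>N\<^esub>" using aj[of "Suc m"] x(1) by (simp add: N.smult_closed)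
  define l where "l = restrict (from_interval N ?p x) (carrier ?I)"
  have l: "l \<in> mod_hom A ?I N" unfolding l_def by (rule from_interval_hom[OF N p x(1) top0])
  note piD = mod_homD[OF \<pi>] and lD = mod_homD[OF l]
  have b0: "bas ?p 0 1 \<in> carrier ?I" by (simp add: bas_carrier)
  have lb: "l (bas ?p 0 1) = ee u \<odot>\<^bsub>N\<^esub> x"
    using from_interval_bas[OF N p x(1) _ top0, of 0] x(1) b0 unfolding l_def
    by (simp add: aa_0 N.smult_one N.smult_closed)
  have plb: "\<pi> (l (bas ?p 0 1)) (enc ?p 0) = 1"
    unfolding lb using x(1) eb f(2) by (simp add: \<pi>_def to_interval_enc N.smult_closed flip: b_def)
  define \<theta> where "\<theta> = compose (carrier ?I) \<pi> l"
  have \<theta>: "\<theta> \<in> mod_hom A ?I ?I" unfolding \<theta>_def by (rule mod_hom_compose'[OF left_module_mdl[OF pW] l \<pi>])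
  have \<theta>x: "\<theta> y = \<pi> (l y)" if "y \<in> carrier ?I" for y using that by (simp add: \<theta>_def compose_def)
  have sI: "submodule (carrier ?I) A ?I" by (rule I.carrier_submodule)
  have \<theta>surj: "\<theta> ` carrier ?I = carrier ?I"
  proof (rule submodule_interval_top[OF p])
    show "submodule (\<theta> ` carrier ?I) A ?I"
      by (rule submodule_image[OF left_module_mdl[OF pW] left_module_mdl[OF pW] \<theta> sI])
    show "\<theta> (bas ?p 0 1) \<in> \<theta> ` carrier ?I" using b0 by (rule imageI)
    show "\<theta> (bas ?p 0 1) (enc ?p 0) \<noteq> 0" using plb \<theta>x[OF b0] by simp
  qed
  \<comment> \<open>A nonzero kernel would contain the last basis vector. But this is
    \<open>aa m\<close> times the generator, so the last coordinate of its image is the first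
    coordinate of the image of the generator, that is \<open>1\<close>.\<close>
  have \<theta>inj: "y = (\<lambda>i. 0)" if y: "y \<in> carrier ?I" "\<theta> y = (\<lambda>i. 0)" for y
  proof (rule ccontr)
    assume y0: "y \<noteq> (\<lambda>i. 0)"
    let ?K = "{y \<in> carrier ?I. \<theta> y = \<zero>\<^bsub>?I\<^esub>}"
    have "bas ?p (snd ?p) 1 \<in> ?K"
    proof (rule submodule_interval_nonzero[OF p])
      show "submodule ?K A ?I" by (rule submodule_kernel[OF left_module_mdl[OF pW] left_module_mdl[OF pW] \<theta>])
      show "?K \<noteq> {\<lambda>i. 0}" using y y0 by auto
    qed
    then have 0: "\<theta> (bas ?p m 1) = (\<lambda>i. 0)" by simp
    have "bas ?p m 1 = aa m \<odot>\<^bsub>?I\<^esub> bas ?p 0 1" using aa_bas[OF pW, of ?p 0 m 1] by simp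
    then have "\<theta> (bas ?p m 1) = aa m \<odot>\<^bsub>?I\<^esub> \<theta> (bas ?p 0 1)" using mod_homD(4)[OF \<theta> gens_closed(1) b0] by simp
    then have "\<theta> (bas ?p m 1) (enc ?p m) = \<theta> (bas ?p 0 1) (enc ?p 0)"
      using mdl_aa[OF pW mod_homD(1)[OF \<theta> b0], of m ?p m] by simp
    then show False using 0 plb \<theta>x[OF b0] by simp
  qed
  let ?U = "l ` carrier ?I" and ?V = "{y \<in> carrier N. \<pi> y = \<zero>\<^bsub>?I\<^esub>}"
  have sU: "submodule ?U A N" by (rule submodule_image[OF left_module_mdl[OF pW] N l sI])
  have sV: "submodule ?V A N" by (rule submodule_kernel[OF N left_module_mdl[OF pW] \<pi>])
  have int: "?U \<inter> ?V = {\<zero>\<^bsub>N\<^esub>}"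
  proof (rule equalityI; rule subsetI)
    fix v assume v: "v \<in> ?U \<inter> ?V"
    then obtain y where y: "y \<in> carrier ?I" "v = l y" by auto
    then have "\<theta> y = (\<lambda>i. 0)" using v \<theta>x by simp
    then have "y = \<zero>\<^bsub>?I\<^esub>" using \<theta>inj y by simp
    then show "v \<in> {\<zero>\<^bsub>N\<^esub>}" using y mod_hom_zero[OF left_module_mdl[OF pW] N l] by simp
  qed (use N.left_submoduleD(2)[OF sU] N.left_submoduleD(2)[OF sV] in simp)
  have sum: "?U <+>\<^bsub>N\<^esub> ?V = carrier N"
  proof (rule equalityI; rule subsetI)
    fix v assume "v \<in> ?U <+>\<^bsub>N\<^esub> ?V"
    then show "v \<in> carrier N" using lD(1) unfolding set_add_def' by auto
  next
    fix v assume v: "v \<in> carrier N"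
    have "\<pi> v \<in> \<theta> ` carrier ?I" unfolding \<theta>surj by (rule piD(1)[OF v])
    then obtain y where y: "y \<in> carrier ?I" "\<pi> v = \<pi> (l y)" using \<theta>x by auto
    have ly: "l y \<in> carrier N" by (rule lD(1)[OF y(1)])
    have "\<pi> (v \<ominus>\<^bsub>N\<^esub> l y) = \<zero>\<^bsub>?I\<^esub>"
    proof -
      have "\<pi> (v \<ominus>\<^bsub>N\<^esub> l y) = \<pi> v \<ominus>\<^bsub>?I\<^esub> \<pi> (l y)" by (rule mod_hom_minus[OF N left_module_mdl[OF pW] \<pi> v ly])
      also have "\<dots> = \<zero>\<^bsub>?I\<^esub>" unfolding y(2) a_minus_def by (rule I.M.r_neg[OF piD(1)[OF ly]])
      finally show ?thesis .
    qed
    then have "v \<ominus>\<^bsub>N\<^esub> l y \<in> ?V" using v ly by simp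
    moreover have "v = l y \<oplus>\<^bsub>N\<^esub> (v \<ominus>\<^bsub>N\<^esub> l y)"
      using v ly by (simp add: a_minus_def N.M.a_lcomm[of "l y" v] N.M.r_neg)
    ultimately show "v \<in> ?U <+>\<^bsub>N\<^esub> ?V" using y(1) unfolding set_add_def' by blast
  qed
  have "?U = {\<zero>\<^bsub>N\<^esub>} \<or> ?V = {\<zero>\<^bsub>N\<^esub>}"
    using ind sU sV int sum unfolding indecomposable_def by simp
  moreover have "?U \<noteq> {\<zero>\<^bsub>N\<^esub>}"
  proof
    assume "?U = {\<zero>\<^bsub>N\<^esub>}"
    then have "l (bas ?p 0 1) = \<zero>\<^bsub>N\<^esub>" using b0 by auto
    then have "\<pi> (l (bas ?p 0 1)) = (\<lambda>i. 0)" using mod_hom_zero[OF N left_module_mdl[OF pW] \<pi>] by simp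
    then show False using plb by simp
  qed
  ultimately have V: "?V = {\<zero>\<^bsub>N\<^esub>}" by simp
  have "inj_on \<pi> (carrier N)"
    unfolding mod_hom_inj_iff[OF N left_module_mdl[OF pW] \<pi>] using V by auto
  moreover have "\<pi> ` carrier N = carrier ?I"
  proof (rule submodule_interval_top[OF p])
    show "submodule (\<pi> ` carrier N) A ?I"
      by (rule submodule_image[OF N left_module_mdl[OF pW] \<pi> N.carrier_submodule])
    show "\<pi> (l (bas ?p 0 1)) \<in> \<pi> ` carrier N" using lD(1)[OF b0] by (rule imageI)
    show "\<pi> (l (bas ?p 0 1)) (enc ?p 0) \<noteq> 0" using plb by simp
  qed
  ultimately show ?thesis using \<pi> p unfolding mod_iso_def bij_betw_def by auto
qed

subsection \<open>Basic modules\<close>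

definition summand :: "nat \<times> nat \<Rightarrow> (nat \<Rightarrow> 'k) \<Rightarrow> nat \<Rightarrow> 'k" where
  "summand p x = enc_fun (\<lambda>w t. if w = p then x (enc w t) else 0)"

lemma summand_enc [simp]: "summand p x (enc w t) = (if w = p then x (enc w t) else 0)"
  by (simp add: summand_def)

lemma summand_carrier: "x \<in> carrier (mdl S) \<Longrightarrow> summand p x \<in> carrier (mdl {p})"
  unfolding mdl_carrier summand_enc by auto

lemma interval_carrier_sub: "p \<in> S \<Longrightarrow> x \<in> carrier (mdl {p}) \<Longrightarrow> x \<in> carrier (mdl S)"
  unfolding mdl_carrier by auto

lemma finsum_mdl:
  assumes "S \<subseteq> W" "finite J" "\<And>j. j \<in> J \<Longrightarrow> f j \<in> carrier (mdl S)"
  shows "(\<Oplus>\<^bsub>mdl S\<^esub>j\<in>J. f j) i = (\<Sum>j\<in>J. f j i)"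
proof -
  interpret M: left_module A "mdl S" by (rule left_module_mdl[OF assms(1)])
  show ?thesis using assms(2,3)
  proof (induction J)
    case (insert j J)
    then have "(\<Oplus>\<^bsub>mdl S\<^esub>j\<in>insert j J. f j) = f j \<oplus>\<^bsub>mdl S\<^esub> (\<Oplus>\<^bsub>mdl S\<^esub>j\<in>J. f j)"
      by (intro M.M.finsum_insert) auto
    then show ?case using insert by (simp add: mdl_add)
  qed simp
qed

lemma basic_mdl:
  assumes "S \<subseteq> W"
  shows "basic_module A (mdl S)"
proof -
  interpret M: left_module A "mdl S" by (rule left_module_mdl[OF assms])
  have finS: "finite S" using finite_subset[OF assms finite_W] .
  obtain p where p: "bij_betw p {0..<card S} S" using ex_bij_betw_nat_finite[OF finS] by blast
  define n where "n = card S"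
  have pS: "p i \<in> S" if "i < n" for i using p that unfolding n_def bij_betw_def by auto
  have pinj: "p i = p j \<longleftrightarrow> i = j" if "i < n" "j < n" for i j
    using p that unfolding n_def bij_betw_def inj_on_def by auto
  have psurj: "\<exists>i<n. p i = w" if "w \<in> S" for w using p that unfolding n_def bij_betw_def by force
  have sm: "mdl S\<lparr>carrier := carrier (mdl T)\<rparr> = mdl T" for T by (rule mdl_carrier_restrict)
  show ?thesis unfolding basic_module_def
  proof (intro exI[of _ n] exI[of _ "\<lambda>i. carrier (mdl {p i})"] conjI allI impI ballI)
    fix i assume i: "i < n"
    have pW: "{p i} \<subseteq> W" using pS[OF i] assms by auto
    interpret I: left_module A "mdl {p i}" by (rule left_module_mdl[OF pW])
    show "submodule (carrier (mdl {p i})) A (mdl S)"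
    proof (rule M.left_submoduleI)
      show "carrier (mdl {p i}) \<subseteq> carrier (mdl S)" using interval_carrier_sub[OF pS[OF i]] by blast
      show "\<zero>\<^bsub>mdl S\<^esub> \<in> carrier (mdl {p i})" using I.M.zero_closed by simp
      show "x \<oplus>\<^bsub>mdl S\<^esub> y \<in> carrier (mdl {p i})" if "x \<in> carrier (mdl {p i})" "y \<in> carrier (mdl {p i})" for x y
        using I.M.a_closed[OF that] by (simp add: mdl_def)
      show "a \<odot>\<^bsub>mdl S\<^esub> x \<in> carrier (mdl {p i})" if "a \<in> carrier A" "x \<in> carrier (mdl {p i})" for a x
        using I.smult_closed[OF that] by (simp add: mdl_def)
    qed
    show "indecomposable A (mdl S\<lparr>carrier := carrier (mdl {p i})\<rparr>)"
      unfolding sm by (rule indecomposable_interval) (use pW in simp)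
    fix j assume j: "j < n" and ij: "i \<noteq> j"
    have "{p j} \<subseteq> W" using pS[OF j] assms by auto
    then show "\<not> mod_iso A (mdl S\<lparr>carrier := carrier (mdl {p i})\<rparr>) (mdl S\<lparr>carrier := carrier (mdl {p j})\<rparr>)"
      unfolding sm using mdl_iso_unique[OF pW] pinj[OF i j] ij by blast
  next
    fix x assume x: "x \<in> carrier (mdl S)"
    have fs: "(\<Oplus>\<^bsub>mdl S\<^esub>i\<in>{..<n}. y i) (enc (p j) t) = y j (enc (p j) t)"
      if y: "y \<in> (\<Pi>\<^sub>E i\<in>{..<n}. carrier (mdl {p i}))" and j: "j < n" for y j t
    proof -
      have yc: "y i \<in> carrier (mdl {p i})" if "i < n" for i using y that by auto
      have "(\<Oplus>\<^bsub>mdl S\<^esub>i\<in>{..<n}. y i) (enc (p j) t) = (\<Sum>i\<in>{..<n}. y i (enc (p j) t))"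
      proof (rule finsum_mdl[OF assms])
        fix i assume "i \<in> {..<n}"
        then show "y i \<in> carrier (mdl S)" by (intro interval_carrier_sub[OF pS yc]) simp_all
      qed simp
      also have "\<dots> = (\<Sum>i\<in>{..<n}. if i = j then y j (enc (p j) t) else 0)"
      proof (rule sum.cong[OF refl])
        fix i assume "i \<in> {..<n}"
        then show "y i (enc (p j) t) = (if i = j then y j (enc (p j) t) else 0)"
          using mdl_D(1)[OF yc[of i], of "p j" t] pinj[of i j] j by auto
      qed
      also have "\<dots> = y j (enc (p j) t)" using j by (simp add: sum.delta)
      finally show ?thesis .
    qed
    show "\<exists>!y. y \<in> (\<Pi>\<^sub>E i\<in>{..<n}. carrier (mdl {p i})) \<and> x = (\<Oplus>\<^bsub>mdl S\<^esub>i\<in>{..<n}. y i)"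
    proof (rule ex1I[of _ "\<lambda>i\<in>{..<n}. summand (p i) x"], rule conjI)
      let ?y = "\<lambda>i\<in>{..<n}. summand (p i) x"
      show y: "?y \<in> (\<Pi>\<^sub>E i\<in>{..<n}. carrier (mdl {p i}))" using summand_carrier[OF x] by auto
      have yM: "?y i \<in> carrier (mdl S)" if "i < n" for i
        using summand_carrier[OF x] interval_carrier_sub[OF pS[OF that]] that by simp
      have sc: "(\<Oplus>\<^bsub>mdl S\<^esub>i\<in>{..<n}. ?y i) \<in> carrier (mdl S)"
        by (rule M.M.finsum_closed) (use yM in auto)
      show "x = (\<Oplus>\<^bsub>mdl S\<^esub>i\<in>{..<n}. ?y i)"
      proof (rule enc_ext)
        fix w t
        show "x (enc w t) = (\<Oplus>\<^bsub>mdl S\<^esub>i\<in>{..<n}. ?y i) (enc w t)"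
        proof (cases "w \<in> S")
          case True
          then obtain j where "j < n" "w = p j" using psurj by blast
          then show ?thesis using fs[OF y, of j t] by simp
        next
          case False
          then show ?thesis using mdl_D(1)[OF x] mdl_D(1)[OF sc] by simp
        qed
      qed
      fix y assume y: "y \<in> (\<Pi>\<^sub>E i\<in>{..<n}. carrier (mdl {p i})) \<and> x = (\<Oplus>\<^bsub>mdl S\<^esub>i\<in>{..<n}. y i)"
      show "y = ?y"
      proof (rule PiE_ext[of _ "{..<n}" "\<lambda>i. carrier (mdl {p i})"])
        fix i assume i: "i \<in> {..<n}"
        have yi: "y i \<in> carrier (mdl {p i})" using y i by auto
        show "y i = ?y i"
        proof (rule interval_eqI[OF yi])
          show "?y i \<in> carrier (mdl {p i})" using i summand_carrier[OF x] by simp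
          show "y i (enc (p i) t) = ?y i (enc (p i) t)" for t
            using fs[OF conjunct1[OF y], of i t] conjunct2[OF y] i by simp
        qed
      qed (use y \<open>?y \<in> _\<close> in auto)
    qed
  qed
qed

lemma finsum_smult:
  assumes "left_module A N" "finite J" "a \<in> carrier A" "\<And>j. j \<in> J \<Longrightarrow> f j \<in> carrier N"
  shows "a \<odot>\<^bsub>N\<^esub> (\<Oplus>\<^bsub>N\<^esub>j\<in>J. f j) = (\<Oplus>\<^bsub>N\<^esub>j\<in>J. a \<odot>\<^bsub>N\<^esub> f j)"
proof -
  interpret N: left_module A N by fact
  show ?thesis using assms(2,4)
  proof (induction J)
    case empty
    then show ?case using assms(3) by simp
  next
    case (insert j J)
    have "(\<Oplus>\<^bsub>N\<^esub>j\<in>insert j J. f j) = f j \<oplus>\<^bsub>N\<^esub> (\<Oplus>\<^bsub>N\<^esub>j\<in>J. f j)"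
      using insert by (intro N.M.finsum_insert) auto
    moreover have "(\<Oplus>\<^bsub>N\<^esub>j\<in>insert j J. a \<odot>\<^bsub>N\<^esub> f j) = a \<odot>\<^bsub>N\<^esub> f j \<oplus>\<^bsub>N\<^esub> (\<Oplus>\<^bsub>N\<^esub>j\<in>J. a \<odot>\<^bsub>N\<^esub> f j)"
      using insert assms(3) by (intro N.M.finsum_insert) (auto simp: N.smult_closed)
    moreover have "(\<Oplus>\<^bsub>N\<^esub>j\<in>J. f j) \<in> carrier N" using insert by (intro N.M.finsum_closed) auto
    ultimately show ?case using insert assms(3) by (simp add: N.smult_r_distr)
  qed
qed

text \<open>The isomorphisms of the single summands are glued. Since the summands are pairwise
  non-isomorphic, the paths \<open>p i\<close> are distinct, and a set \<open>S\<close> instead of a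
  multiset describes the module.\<close>

theorem basic_classification:
  assumes N: "left_module A N" and basic: "basic_module A N"
  shows "\<exists>S\<subseteq>W. mod_iso A (mdl S) N"
proof -
  interpret N: left_module A N by fact
  obtain n :: nat and U where
    B: "(\<forall>i<n. submodule (U i) A N \<and> indecomposable A (N\<lparr>carrier := U i\<rparr>)) \<and>
      (\<forall>i<n. \<forall>j<n. i \<noteq> j \<longrightarrow> \<not> mod_iso A (N\<lparr>carrier := U i\<rparr>) (N\<lparr>carrier := U j\<rparr>)) \<and>
      (\<forall>x\<in>carrier N. \<exists>!y. y \<in> (\<Pi>\<^sub>E i\<in>{..<n}. U i) \<and> x = (\<Oplus>\<^bsub>N\<^esub>i\<in>{..<n}. y i))"
    using basic unfolding basic_module_def by (elim exE) (rule that)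
  then have
    U: "\<And>i. i < n \<Longrightarrow> submodule (U i) A N" "\<And>i. i < n \<Longrightarrow> indecomposable A (N\<lparr>carrier := U i\<rparr>)"
    and Uni: "\<And>i j. i < n \<Longrightarrow> j < n \<Longrightarrow> i \<noteq> j \<Longrightarrow> \<not> mod_iso A (N\<lparr>carrier := U i\<rparr>) (N\<lparr>carrier := U j\<rparr>)"
    and dec: "\<And>x. x \<in> carrier N \<Longrightarrow> \<exists>!y. y \<in> (\<Pi>\<^sub>E i\<in>{..<n}. U i) \<and> x = (\<Oplus>\<^bsub>N\<^esub>i\<in>{..<n}. y i)"
    by simp_all
  have UN: "x \<in> carrier N" if "i < n" "x \<in> U i" for i x
    using N.left_submoduleD(1)[OF U(1)[OF that(1)]] that(2) by (rule subsetD)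
  have lmU: "left_module A (N\<lparr>carrier := U i\<rparr>)" if "i < n" for i
    by (rule N.submodule_left_module[OF U(1)[OF that]])
  have "\<forall>i. \<exists>p. i < n \<longrightarrow> p \<in> W \<and> mod_iso A (N\<lparr>carrier := U i\<rparr>) (mdl {p})"
  proof
    fix i
    show "\<exists>p. i < n \<longrightarrow> p \<in> W \<and> mod_iso A (N\<lparr>carrier := U i\<rparr>) (mdl {p})"
    proof (cases "i < n")
      case True
      from indecomposable_classification[OF lmU[OF True] U(2)[OF True]] show ?thesis
        by (elim bexE) (intro exI impI conjI)
    qed simp
  qed
  then obtain p where p: "\<And>i. i < n \<Longrightarrow> p i \<in> W" "\<And>i. i < n \<Longrightarrow> mod_iso A (N\<lparr>carrier := U i\<rparr>) (mdl {p i})"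
    by metis
  have lmI: "left_module A (mdl {p i})" if "i < n" for i using left_module_mdl[of "{p i}"] p(1)[OF that] by simp
  have pinj: "i = j" if "i < n" "j < n" "p i = p j" for i j
  proof (rule ccontr)
    assume "i \<noteq> j"
    moreover have "mod_iso A (N\<lparr>carrier := U i\<rparr>) (N\<lparr>carrier := U j\<rparr>)"
      using mod_iso_trans[OF lmU[OF that(1)] p(2)[OF that(1)]] mod_iso_sym[OF lmU[OF that(2)] lmI[OF that(2)] p(2)[OF that(2)]]
      unfolding that(3) by blast
    ultimately show False using Uni that by blast
  qed
  have "\<forall>i. \<exists>g. i < n \<longrightarrow> g \<in> mod_hom A (mdl {p i}) (N\<lparr>carrier := U i\<rparr>) \<and> bij_betw g (carrier (mdl {p i})) (U i)"
  proof
    fix i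
    show "\<exists>g. i < n \<longrightarrow> g \<in> mod_hom A (mdl {p i}) (N\<lparr>carrier := U i\<rparr>) \<and> bij_betw g (carrier (mdl {p i})) (U i)"
      using mod_iso_sym[OF lmU lmI p(2), of i] unfolding mod_iso_def by auto
  qed
  then obtain g where g: "\<And>i. i < n \<Longrightarrow> g i \<in> mod_hom A (mdl {p i}) (N\<lparr>carrier := U i\<rparr>)"
    "\<And>i. i < n \<Longrightarrow> bij_betw (g i) (carrier (mdl {p i})) (U i)" by metis
  define S where "S = p ` {..<n}"
  have SW: "S \<subseteq> W" using p(1) by (auto simp: S_def)
  interpret M: left_module A "mdl S" by (rule left_module_mdl[OF SW])
  define h where "h x = (\<Oplus>\<^bsub>N\<^esub>i\<in>{..<n}. g i (summand (p i) x))" for x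
  have gc: "g i (summand (p i) x) \<in> U i" if "x \<in> carrier (mdl S)" "i < n" for i x
    using mod_homD(1)[OF g(1)[OF that(2)] summand_carrier[OF that(1)]] by simp
  have gN: "g i (summand (p i) x) \<in> carrier N" if "x \<in> carrier (mdl S)" "i < n" for i x
    using UN[OF that(2) gc[OF that]] .
  have hom: "restrict h (carrier (mdl S)) \<in> mod_hom A (mdl S) N"
  proof (rule mod_hom_restrictI[OF left_module_mdl[OF SW]])
    fix x assume x: "x \<in> carrier (mdl S)"
    show "h x \<in> carrier N" unfolding h_def by (rule N.M.finsum_closed) (use gN[OF x] in auto)
    fix y assume y: "y \<in> carrier (mdl S)"
    have "g i (summand (p i) (x \<oplus>\<^bsub>mdl S\<^esub> y)) = g i (summand (p i) x) \<oplus>\<^bsub>N\<^esub> g i (summand (p i) y)" if i: "i < n" for i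
    proof -
      have "summand (p i) (x \<oplus>\<^bsub>mdl S\<^esub> y) = summand (p i) x \<oplus>\<^bsub>mdl {p i}\<^esub> summand (p i) y"
        by (rule enc_ext) (simp add: mdl_add)
      then show ?thesis using mod_homD(3)[OF g(1)[OF i] summand_carrier[OF x] summand_carrier[OF y]] by simp
    qed
    then have "h (x \<oplus>\<^bsub>mdl S\<^esub> y) = (\<Oplus>\<^bsub>N\<^esub>i\<in>{..<n}. g i (summand (p i) x) \<oplus>\<^bsub>N\<^esub> g i (summand (p i) y))"
      unfolding h_def using gN[OF x] gN[OF y] by (intro N.M.finsum_cong') auto
    then show "h (x \<oplus>\<^bsub>mdl S\<^esub> y) = h x \<oplus>\<^bsub>N\<^esub> h y"
      unfolding h_def using gN[OF x] gN[OF y] by (simp add: N.M.finsum_addf Pi_def)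
  next
    fix a x assume a: "a \<in> carrier A" and x: "x \<in> carrier (mdl S)"
    have "g i (summand (p i) (a \<odot>\<^bsub>mdl S\<^esub> x)) = a \<odot>\<^bsub>N\<^esub> g i (summand (p i) x)" if i: "i < n" for i
    proof -
      have "summand (p i) (a \<odot>\<^bsub>mdl S\<^esub> x) = a \<odot>\<^bsub>mdl {p i}\<^esub> summand (p i) x"
        by (rule enc_ext) (simp add: mdl_smult)
      then show ?thesis using mod_homD(4)[OF g(1)[OF i] a summand_carrier[OF x]] by simp
    qed
    then have "h (a \<odot>\<^bsub>mdl S\<^esub> x) = (\<Oplus>\<^bsub>N\<^esub>i\<in>{..<n}. a \<odot>\<^bsub>N\<^esub> g i (summand (p i) x))"
      unfolding h_def using gN[OF x] a by (intro N.M.finsum_cong') (auto simp: N.smult_closed)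
    then show "h (a \<odot>\<^bsub>mdl S\<^esub> x) = a \<odot>\<^bsub>N\<^esub> h x"
      unfolding h_def using finsum_smult[OF N, of "{..<n}" a] gN[OF x] a by simp
  qed
  have "inj_on h (carrier (mdl S))"
  proof (rule inj_onI)
    fix x y assume x: "x \<in> carrier (mdl S)" and y: "y \<in> carrier (mdl S)" and eq: "h x = h y"
    let ?r = "\<lambda>z. \<lambda>i\<in>{..<n}. g i (summand (p i) z)"
    have hr: "h z = (\<Oplus>\<^bsub>N\<^esub>i\<in>{..<n}. ?r z i)" if "z \<in> carrier (mdl S)" for z
      unfolding h_def using gN[OF that] by (intro N.M.finsum_cong') auto
    have r: "?r z \<in> (\<Pi>\<^sub>E i\<in>{..<n}. U i)" if "z \<in> carrier (mdl S)" for z using gc[OF that] by auto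
    have hx: "h x \<in> carrier N" using mod_homD(1)[OF hom x] x by simp
    have "?r x = ?r y"
      by (rule trans[OF sym[OF the1_equality[OF dec[OF hx]]] the1_equality[OF dec[OF hx]]])
         (use r[OF x] r[OF y] hr[OF x] hr[OF y] eq in simp_all)
    then have r': "g i (summand (p i) x) = g i (summand (p i) y)" if "i < n" for i
    proof -
      have "?r x i = ?r y i" using \<open>?r x = ?r y\<close> by (rule fun_cong)
      then show ?thesis using that by simp
    qed
    show "x = y"
    proof (rule enc_ext)
      fix w t
      show "x (enc w t) = y (enc w t)"
      proof (cases "w \<in> S")
        case True
        then obtain i where i: "i < n" "w = p i" unfolding S_def by auto
        have "summand (p i) x = summand (p i) y"
          using r'[OF i(1)] g(2)[OF i(1)] summand_carrier[OF x] summand_carrier[OF y]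
          unfolding bij_betw_def inj_on_def by blast
        then have "summand (p i) x (enc w t) = summand (p i) y (enc w t)" by simp
        then show ?thesis using i by simp
      next
        case False
        then show ?thesis using mdl_D(1)[OF x] mdl_D(1)[OF y] by simp
      qed
    qed
  qed
  moreover have "h ` carrier (mdl S) = carrier N"
  proof (rule equalityI; rule subsetI)
    fix v assume "v \<in> h ` carrier (mdl S)"
    then obtain x where "x \<in> carrier (mdl S)" "v = h x" by (elim imageE)
    then show "v \<in> carrier N" using mod_homD(1)[OF hom, of x] by simp
  next
    fix v assume "v \<in> carrier N"
    then obtain y where y: "y \<in> (\<Pi>\<^sub>E i\<in>{..<n}. U i)" "v = (\<Oplus>\<^bsub>N\<^esub>i\<in>{..<n}. y i)" using dec by blast
    have "\<forall>i. \<exists>z. i < n \<longrightarrow> z \<in> carrier (mdl {p i}) \<and> g i z = y i"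
    proof
      fix i
      have "y i \<in> g i ` carrier (mdl {p i})" if "i < n" using g(2)[OF that] y(1) that unfolding bij_betw_def by auto
      then show "\<exists>z. i < n \<longrightarrow> z \<in> carrier (mdl {p i}) \<and> g i z = y i" by (metis imageE)
    qed
    then obtain z where z: "\<And>i. i < n \<Longrightarrow> z i \<in> carrier (mdl {p i})" "\<And>i. i < n \<Longrightarrow> g i (z i) = y i" by metis
    define ix where "ix w = (SOME i. i < n \<and> p i = w)" for w
    have ix: "ix (p i) = i" if "i < n" for i
      unfolding ix_def by (rule some_equality) (use that pinj in auto)
    define x where "x = enc_fun (\<lambda>w t. if w \<in> S then z (ix w) (enc w t) else 0)"
    have xe: "x (enc w t) = (if w \<in> S then z (ix w) (enc w t) else 0)" for w t by (simp add: x_def)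
    have x: "x \<in> carrier (mdl S)" unfolding mdl_carrier
    proof (intro allI impI)
      fix w t assume nz: "x (enc w t) \<noteq> 0"
      then have "w \<in> S" unfolding xe by presburger
      then obtain i where i: "i < n" "w = p i" unfolding S_def by auto
      then have "z i (enc w t) \<noteq> 0" using nz \<open>w \<in> S\<close> ix unfolding xe by simp
      then show "w \<in> S \<and> t \<le> snd w" using mdl_D(2)[OF z(1)[OF i(1)], of w t] \<open>w \<in> S\<close> by (meson not_le)
    qed
    have sx: "summand (p i) x = z i" if i: "i < n" for i
    proof (rule enc_ext)
      fix w t
      show "summand (p i) x (enc w t) = z i (enc w t)"
        using i ix[OF i] mdl_D(1)[OF z(1)[OF i], of w t] by (auto simp: xe S_def)
    qed
    have yN: "y i \<in> carrier N" if "i < n" for i using UN[OF that PiE_mem[OF y(1)]] that by simp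
    have "h x = v"
      unfolding h_def y(2) using sx z(2) yN by (intro N.M.finsum_cong') auto
    then show "v \<in> h ` carrier (mdl S)" using imageI[OF x, of h] by simp
  qed
  ultimately have "bij_betw (restrict h (carrier (mdl S))) (carrier (mdl S)) (carrier N)"
    unfolding bij_betw_def by (simp add: inj_on_def)
  then show ?thesis using hom SW unfolding mod_iso_def by blast
qed

end

section \<open>Faithfully balanced modules\<close>

context nakayama_quiver
begin

text \<open>Confines hooks to the given maximal path, so that an induction can stay on it. If the
  hook found lies on another maximal path, then \<open>k = 0\<close> and the vertex is an end of
  \<open>(u, m)\<close>; the whole path \<open>(u, m)\<close>, a member of \<open>S\<close>, then
  serves as a hook.\<close>

lemma balanced_extension:
  assumes S: "S \<subseteq> W" "balanced S" and w: "(u, m) \<in> maximal"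
    and X: "(vtx s u i, k) \<in> S" "i + k \<le> m"
  shows "i = 0 \<and> k = m \<or> (\<exists>k'>k. i + k' \<le> m \<and> (vtx s u i, k') \<in> S) \<or>
    (\<exists>j d. 0 < d \<and> i = j + d \<and> (vtx s u j, d + k) \<in> S)"
proof -
  have B1: "maximal \<subseteq> S"
    and B2: "\<And>u m. (u, m) \<in> S \<Longrightarrow> (u, m) \<in> maximal \<or> (\<exists>m'>m. (u, m') \<in> S) \<or>
       (\<exists>u' d. 0 < d \<and> vtx s u' d = u \<and> (u', d + m) \<in> S)"
    using S(2) unfolding balanced_def by auto
  have wS: "(u, m) \<in> S" using B1 w by blast
  have m1: "1 \<le> m" by (rule maximal_arrow[OF w])
  have im: "i \<le> m" using X(2) by simp
  from B2[OF X(1)] show ?thesis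
  proof (elim disjE exE conjE)
    assume Xm: "(vtx s u i, k) \<in> maximal"
    from two_locations[OF w Xm, of i 0] im maximal_arrow[OF Xm] X(2)
    show ?thesis by auto
  next
    fix k' assume k': "k < k'" "(vtx s u i, k') \<in> S"
    obtain a n j where a: "(a, n) \<in> maximal" "vtx s a j = vtx s u i" "j + k' \<le> n"
      using in_maximal k'(2) S(1) by blast
    from two_locations[OF w a(1), of i j] a im
    have "(u, m) = (a, n) \<and> i = j \<or> i = m \<and> j = 0 \<or> i = 0 \<and> j = n" by auto
    then show ?thesis
    proof (elim disjE conjE)
      assume "(u, m) = (a, n)" "i = j"
      then show ?thesis using k' a(3) by auto
    next
      assume "i = m" "j = 0"
      then have "k = 0" using X(2) by simp
      then show ?thesis using wS m1 \<open>i = m\<close> by (intro disjI2 exI[of _ 0] exI[of _ m]) auto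
    next
      assume "i = 0" "j = n"
      then show ?thesis using a(3) k'(1) by simp
    qed
  next
    fix u' d assume d: "0 < d" "vtx s u' d = vtx s u i" "(u', d + k) \<in> S"
    obtain a n j where a: "(a, n) \<in> maximal" "vtx s a j = u'" "j + (d + k) \<le> n"
      using in_maximal d(3) S(1) by blast
    have "vtx s u i = vtx s a (j + d)" using a(2) d(2) by auto
    from two_locations[OF w a(1) this] a im
    have "(u, m) = (a, n) \<and> i = j + d \<or> i = m \<and> j + d = 0 \<or> i = 0 \<and> j + d = n" by auto
    then show ?thesis
    proof (elim disjE conjE)
      assume "(u, m) = (a, n)" "i = j + d"
      then show ?thesis using d a by auto
    next
      assume "i = 0" "j + d = n"
      then have "k = 0" using a(3) by simp
      then show ?thesis using wS m1 \<open>i = 0\<close> by (intro disjI2 disjI1 exI[of _ m]) auto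
    qed (use d in auto)
  qed
qed

end

lemma sum_shift_zero:
  fixes F :: "nat \<Rightarrow> 'c::comm_monoid_add"
  assumes "d \<le> t" "\<And>r. r < d \<Longrightarrow> F r = 0"
  shows "(\<Sum>r\<le>t. F r) = (\<Sum>i\<le>t - d. F (i + d))"
proof -
  have "(\<Sum>r\<le>t. F r) = (\<Sum>r\<in>{d..t}. F r)"
    by (rule sum.mono_neutral_right) (use assms in auto)
  also have "\<dots> = (\<Sum>i\<le>t - d. F (i + d))"
    by (rule sum.reindex_bij_witness[of _ "\<lambda>i. i + d" "\<lambda>r. r - d"]) (use assms(1) in auto)
  finally show ?thesis .
qed

context nakayama_algebra
begin

text \<open>Takes the generator of the summand \<open>X\<close> to position \<open>d\<close> of the
  summand \<open>Y\<close> and kills the other summands. It is linear over the algebra if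
  \<open>X\<close> starts at the vertex of this position and reaches at least as far as
  \<open>Y\<close>.\<close>

definition shift_map :: "nat \<times> nat \<Rightarrow> nat \<times> nat \<Rightarrow> nat \<Rightarrow> (nat \<Rightarrow> 'k) \<Rightarrow> nat \<Rightarrow> 'k" where
  "shift_map X Y d x = enc_fun (\<lambda>w t. if w = Y \<and> d \<le> t \<and> t \<le> snd Y then x (enc X (t - d)) else 0)"

lemma shift_map_enc: "shift_map X Y d x (enc w t) =
    (if w = Y \<and> d \<le> t \<and> t \<le> snd Y then x (enc X (t - d)) else 0)"
  by (simp add: shift_map_def)

lemma shift_map_hom:
  assumes S: "S \<subseteq> W" and XY: "(u, m) \<in> S" "(a, n) \<in> S" and d: "vtx s a d = u" "d \<le> n" "n \<le> m + d"
  shows "restrict (shift_map (u, m) (a, n) d) (carrier (mdl S)) \<in> mod_hom A (mdl S) (mdl S)"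
proof (rule mod_hom_restrictI[OF left_module_mdl[OF S]])
  let ?g = "shift_map (u, m) (a, n) d"
  fix x assume x: "x \<in> carrier (mdl S)"
  show "?g x \<in> carrier (mdl S)" unfolding mdl_carrier shift_map_enc using XY(2) by auto
  fix y assume "y \<in> carrier (mdl S)"
  show "?g (x \<oplus>\<^bsub>mdl S\<^esub> y) = ?g x \<oplus>\<^bsub>mdl S\<^esub> ?g y"
    by (rule enc_ext) (simp add: mdl_add shift_map_enc)
next
  let ?g = "shift_map (u, m) (a, n) d"
  fix c x assume c: "c \<in> carrier A" and x: "x \<in> carrier (mdl S)"
  show "?g (c \<odot>\<^bsub>mdl S\<^esub> x) = c \<odot>\<^bsub>mdl S\<^esub> ?g x"
  proof (rule enc_ext)
    fix w t
    show "?g (c \<odot>\<^bsub>mdl S\<^esub> x) (enc w t) = (c \<odot>\<^bsub>mdl S\<^esub> ?g x) (enc w t)"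
    proof (cases "w = (a, n) \<and> t \<le> n")
      case False
      then show ?thesis by (cases "w = (a, n)") (simp_all add: shift_map_enc mdl_smult)
    next
      case True
      then have w: "w = (a, n)" and t: "t \<le> n" by auto
      have R: "(c \<odot>\<^bsub>mdl S\<^esub> ?g x) (enc w t) = (\<Sum>r\<le>t. co c (vtx s a r, t - r) * ?g x (enc w r))"
        using t by (simp add: mdl_smult w)
      show ?thesis
      proof (cases "d \<le> t")
        case True
        have "(\<Sum>r\<le>t. co c (vtx s a r, t - r) * ?g x (enc w r))
          = (\<Sum>i\<le>t - d. co c (vtx s a (i + d), t - (i + d)) * ?g x (enc w (i + d)))"
          by (rule sum_shift_zero[OF True]) (simp add: shift_map_enc)
        also have "\<dots> = (\<Sum>i\<le>t - d. co c (vtx s u i, t - d - i) * x (enc (u, m) i))"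
        proof (rule sum.cong[OF refl])
          fix i assume "i \<in> {..t - d}"
          then have "i + d \<le> t" using True by auto
          moreover have "vtx s a (i + d) = vtx s u i" using d(1) vtx_vtx[of s a d i] by (simp add: add.commute)
          ultimately show "co c (vtx s a (i + d), t - (i + d)) * ?g x (enc w (i + d))
            = co c (vtx s u i, t - d - i) * x (enc (u, m) i)"
            using t w by (simp add: shift_map_enc add.commute)
        qed
        also have "\<dots> = (c \<odot>\<^bsub>mdl S\<^esub> x) (enc (u, m) (t - d))"
          using d t by (simp add: mdl_smult)
        finally show ?thesis unfolding R using w t True by (simp add: shift_map_enc)
      next
        case False
        then show ?thesis unfolding R by (simp add: shift_map_enc)
      qed
    qed
  qed
qed

lemma shift_map_bas:
  assumes "p \<le> m"
  shows "shift_map (u, m) (a, n) d (bas (u, m) p c) = (if p + d \<le> n then bas (a, n) (p + d) c else (\<lambda>i. 0))"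
  by (rule enc_ext) (auto simp: shift_map_enc)

subsection \<open>Balanced sets give faithfully balanced modules\<close>

definition biend :: "(nat \<times> nat) set \<Rightarrow> ((nat \<Rightarrow> 'k) \<Rightarrow> nat \<Rightarrow> 'k) \<Rightarrow> bool" where
  "biend S \<phi> \<longleftrightarrow> \<phi> \<in> carrier (End_ring (End_ring A (mdl S)) (End_module (mdl S)))"

lemma biendD:
  assumes "biend S \<phi>"
  shows "x \<in> carrier (mdl S) \<Longrightarrow> \<phi> x \<in> carrier (mdl S)"
    and "x \<in> carrier (mdl S) \<Longrightarrow> y \<in> carrier (mdl S) \<Longrightarrow> \<phi> (x \<oplus>\<^bsub>mdl S\<^esub> y) = \<phi> x \<oplus>\<^bsub>mdl S\<^esub> \<phi> y"
    and "e \<in> mod_hom A (mdl S) (mdl S) \<Longrightarrow> x \<in> carrier (mdl S) \<Longrightarrow> \<phi> (e x) = e (\<phi> x)"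
  using assms unfolding biend_def biendomorphism_iff by (auto simp: PiE_iff)

lemma biend_zero:
  assumes "S \<subseteq> W" "biend S \<phi>"
  shows "\<phi> (\<lambda>i. 0) = (\<lambda>i. 0)"
proof -
  interpret M: left_module A "mdl S" by (rule left_module_mdl[OF assms(1)])
  have 0: "(\<lambda>i. 0) \<in> carrier (mdl S)" using M.M.zero_closed by simp
  have "(\<lambda>i. 0) \<oplus>\<^bsub>mdl S\<^esub> (\<lambda>i. 0) = (\<lambda>i. 0)" by (rule ext) (simp add: mdl_add)
  then have "\<phi> (\<lambda>i. 0) i + \<phi> (\<lambda>i. 0) i = \<phi> (\<lambda>i. 0) i" for i
    using biendD(2)[OF assms(2) 0 0] mdl_add[of S "\<phi> (\<lambda>i. 0)" "\<phi> (\<lambda>i. 0)" i] by simp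
  then show ?thesis by (intro ext) (metis add_cancel_left_left)
qed

text \<open>Commuting with \<open>shift_map\<close> compares the matrices of \<open>\<phi>\<close>
  on two summands. If exactly one of the two conditions holds, an entry is forced to be
  zero.\<close>

lemma biend_shift:
  assumes S: "S \<subseteq> W" and \<phi>: "biend S \<phi>" and XY: "(u, m) \<in> S" "(a, n) \<in> S"
    and d: "vtx s a d = u" "d \<le> n" "n \<le> m + d" and pq: "p \<le> m" "q \<le> n"
  shows "(if p + d \<le> n then \<phi> (bas (a, n) (p + d) 1) (enc (a, n) q) else 0) =
    (if d \<le> q then \<phi> (bas (u, m) p 1) (enc (u, m) (q - d)) else 0)"
proof -
  have b: "bas (u, m) p 1 \<in> carrier (mdl S)" using XY(1) pq(1) by (simp add: bas_carrier)
  have "\<phi> (shift_map (u, m) (a, n) d (bas (u, m) p 1)) = shift_map (u, m) (a, n) d (\<phi> (bas (u, m) p 1))"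
    using biendD(3)[OF \<phi> shift_map_hom[OF S XY d] b] b biendD(1)[OF \<phi> b] by simp
  then have "\<phi> (if p + d \<le> n then bas (a, n) (p + d) 1 else (\<lambda>i. 0)) (enc (a, n) q)
      = shift_map (u, m) (a, n) d (\<phi> (bas (u, m) p 1)) (enc (a, n) q)"
    unfolding shift_map_bas[OF pq(1)] by simp
  then show ?thesis using pq(2) biend_zero[OF S \<phi>] by (simp add: shift_map_enc split: if_splits)
qed

text \<open>\<open>shift_map X X 0\<close> is the projection onto the summand \<open>X\<close>, and
  \<open>\<phi>\<close> commutes with it.\<close>

lemma biend_diagonal:
  assumes S: "S \<subseteq> W" and \<phi>: "biend S \<phi>" and X: "X \<in> S" and p: "p \<le> snd X" and Y: "Y \<noteq> X"
  shows "\<phi> (bas X p 1) (enc Y q) = 0"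
proof -
  obtain u m where um: "X = (u, m)" by (cases X)
  have b: "bas X p 1 \<in> carrier (mdl S)" using X p by (simp add: bas_carrier)
  have h: "restrict (shift_map X X 0) (carrier (mdl S)) \<in> mod_hom A (mdl S) (mdl S)"
    unfolding um by (rule shift_map_hom[OF S]) (use X um in auto)
  have "shift_map X X 0 (bas X p 1) = bas X p 1" using shift_map_bas[of p m u u m 0] p um by simp
  then have "\<phi> (bas X p 1) = shift_map X X 0 (\<phi> (bas X p 1))"
    using biendD(3)[OF \<phi> h b] b biendD(1)[OF \<phi> b] by simp
  then have "\<phi> (bas X p 1) (enc Y q) = shift_map X X 0 (\<phi> (bas X p 1)) (enc Y q)" by (rule fun_cong)
  then show ?thesis using Y by (simp add: shift_map_enc)
qed

lemma sc_hom:
  assumes S: "S \<subseteq> W"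
  shows "restrict (\<lambda>x. sc c \<odot>\<^bsub>mdl S\<^esub> x) (carrier (mdl S)) \<in> mod_hom A (mdl S) (mdl S)"
proof -
  interpret M: left_module A "mdl S" by (rule left_module_mdl[OF S])
  show ?thesis
  proof (rule mod_hom_restrictI[OF left_module_mdl[OF S]])
    fix a x assume ax: "a \<in> carrier A" "x \<in> carrier (mdl S)"
    have "sc c \<odot>\<^bsub>mdl S\<^esub> (a \<odot>\<^bsub>mdl S\<^esub> x) = (sc c \<otimes> a) \<odot>\<^bsub>mdl S\<^esub> x" using ax by (simp only: M.smult_assoc1 gens_closed)
    also have "\<dots> = a \<odot>\<^bsub>mdl S\<^esub> (sc c \<odot>\<^bsub>mdl S\<^esub> x)" using ax by (simp only: sc_central M.smult_assoc1 gens_closed)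
    finally show "sc c \<odot>\<^bsub>mdl S\<^esub> (a \<odot>\<^bsub>mdl S\<^esub> x) = a \<odot>\<^bsub>mdl S\<^esub> (sc c \<odot>\<^bsub>mdl S\<^esub> x)" .
  qed (use M.smult_closed M.smult_r_distr in auto)
qed

text \<open>The summand is the subquotient of the maximal path module at the positions
  \<open>i, \<dots>, i + k\<close>, and \<open>\<phi>\<close> acts on it by the corresponding block.
  The second part says that \<open>\<phi>\<close> never leads back across either border of this
  block. The induction follows the hooks: the summand is a quotient or a submodule of a longer
  member of \<open>S\<close>, and the projection or inclusion is an endomorphism with which
  \<open>\<phi>\<close> commutes.\<close>

lemma biend_link:
  assumes S: "S \<subseteq> W" "balanced S" and \<phi>: "biend S \<phi>" and w: "(u, m) \<in> maximal"
  shows "(vtx s u i, k) \<in> S \<Longrightarrow> i + k \<le> m \<Longrightarrow>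
    (\<forall>p\<le>k. \<forall>q\<le>k. \<phi> (bas (vtx s u i, k) p 1) (enc (vtx s u i, k) q) = \<phi> (bas (u, m) (p + i) 1) (enc (u, m) (q + i))) \<and>
    (\<forall>p q. p \<le> m \<longrightarrow> q < p \<longrightarrow> i \<le> p \<longrightarrow> q \<le> i + k \<longrightarrow> \<not> (i \<le> q \<and> p \<le> i + k) \<longrightarrow>
      \<phi> (bas (u, m) p 1) (enc (u, m) q) = 0)"
proof (induction "m - k" arbitrary: i k rule: less_induct)
  case less
  from balanced_extension[OF S w less.prems] show ?case
  proof (elim disjE exE conjE)
    assume "i = 0" "k = m"
    then show ?thesis by auto
  next
    fix k' assume k': "k < k'" "i + k' \<le> m" "(vtx s u i, k') \<in> S"
    let ?X = "(vtx s u i, k)" and ?Y = "(vtx s u i, k')"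
    have IH: "\<forall>p\<le>k'. \<forall>q\<le>k'. \<phi> (bas ?Y p 1) (enc ?Y q) = \<phi> (bas (u, m) (p + i) 1) (enc (u, m) (q + i))"
      "\<forall>p q. p \<le> m \<longrightarrow> q < p \<longrightarrow> i \<le> p \<longrightarrow> q \<le> i + k' \<longrightarrow> \<not> (i \<le> q \<and> p \<le> i + k') \<longrightarrow>
        \<phi> (bas (u, m) p 1) (enc (u, m) q) = 0"
      using less.hyps[of k' i] k' by auto
    \<comment> \<open>\<open>?X\<close> is a quotient of \<open>?Y\<close>. Positions of
      \<open>?Y\<close> beyond \<open>k\<close> die in \<open>?X\<close>, so \<open>\<phi>\<close>
      cannot lead from them back to a position up to \<open>k\<close>.\<close>
    have rel: "(if p \<le> k then \<phi> (bas ?X p 1) (enc ?X q) else 0) = \<phi> (bas ?Y p 1) (enc ?Y q)"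
      if "p \<le> k'" "q \<le> k" for p q
      using biend_shift[OF S(1) \<phi> k'(3) less.prems(1), of 0 p q] that k' by (cases "p \<le> k") simp_all
    show ?thesis
    proof (intro conjI allI impI)
      fix p q assume "p \<le> k" "q \<le> k"
      then show "\<phi> (bas ?X p 1) (enc ?X q) = \<phi> (bas (u, m) (p + i) 1) (enc (u, m) (q + i))"
        using rel[of p q] IH(1) k'(1) by simp
    next
      fix p q assume pq: "p \<le> m" "q < p" "i \<le> p" "q \<le> i + k" "\<not> (i \<le> q \<and> p \<le> i + k)"
      show "\<phi> (bas (u, m) p 1) (enc (u, m) q) = 0"
      proof (cases "i \<le> q \<and> p \<le> i + k'")
        case False
        then show ?thesis using IH(2) pq k'(1) by simp
      next
        case True
        then have "p - i \<le> k'" "q - i \<le> k" "\<not> p - i \<le> k" "q - i \<le> k'" using pq k' by auto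
        then have "\<phi> (bas ?Y (p - i) 1) (enc ?Y (q - i)) = 0" using rel[of "p - i" "q - i"] by simp
        then show ?thesis using IH(1) True \<open>p - i \<le> k'\<close> \<open>q - i \<le> k'\<close> pq by auto
      qed
    qed
  next
    fix j d assume d: "0 < d" "i = j + d" "(vtx s u j, d + k) \<in> S"
    let ?X = "(vtx s u i, k)" and ?Y = "(vtx s u j, d + k)"
    have IH: "\<forall>p\<le>d + k. \<forall>q\<le>d + k. \<phi> (bas ?Y p 1) (enc ?Y q) = \<phi> (bas (u, m) (p + j) 1) (enc (u, m) (q + j))"
      "\<forall>p q. p \<le> m \<longrightarrow> q < p \<longrightarrow> j \<le> p \<longrightarrow> q \<le> j + (d + k) \<longrightarrow> \<not> (j \<le> q \<and> p \<le> j + (d + k)) \<longrightarrow>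
        \<phi> (bas (u, m) p 1) (enc (u, m) q) = 0"
      using less.hyps[of "d + k" j] d less.prems(2) by auto
    \<comment> \<open>\<open>?X\<close> is the submodule of \<open>?Y\<close> from position
      \<open>d\<close> on, so \<open>\<phi>\<close> cannot lead from there to a position before
      \<open>d\<close>.\<close>
    have rel: "\<phi> (bas ?Y (p + d) 1) (enc ?Y q) = (if d \<le> q then \<phi> (bas ?X p 1) (enc ?X (q - d)) else 0)"
      if "p \<le> k" "q \<le> d + k" for p q
      using biend_shift[OF S(1) \<phi> less.prems(1) d(3), of d p q] that d by simp
    show ?thesis
    proof (intro conjI allI impI)
      fix p q assume pq: "p \<le> k" "q \<le> k"
      then have "\<phi> (bas ?X p 1) (enc ?X q) = \<phi> (bas ?Y (p + d) 1) (enc ?Y (q + d))"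
        using rel[of p "q + d"] by simp
      also have "\<dots> = \<phi> (bas (u, m) (p + d + j) 1) (enc (u, m) (q + d + j))" using IH(1) pq by simp
      also have "\<dots> = \<phi> (bas (u, m) (p + i) 1) (enc (u, m) (q + i))" unfolding d(2) by (simp add: ac_simps)
      finally show "\<phi> (bas ?X p 1) (enc ?X q) = \<phi> (bas (u, m) (p + i) 1) (enc (u, m) (q + i))" .
    next
      fix p q assume pq: "p \<le> m" "q < p" "i \<le> p" "q \<le> i + k" "\<not> (i \<le> q \<and> p \<le> i + k)"
      show "\<phi> (bas (u, m) p 1) (enc (u, m) q) = 0"
      proof (cases "j \<le> q \<and> p \<le> j + (d + k)")
        case False
        then show ?thesis using IH(2) pq d by simp
      next
        case True
        then have 1: "q < i" "p - i \<le> k" using pq d by auto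
        then have "\<phi> (bas ?Y (p - i + d) 1) (enc ?Y (q - j)) = 0"
        proof -
          have "\<not> d \<le> q - j" "q - j \<le> d + k" using 1 d True by auto
          then show ?thesis using rel[of "p - i" "q - j"] 1(2) by simp
        qed
        moreover have "p - i + d = p - j" using pq d by simp
        moreover have "p - j \<le> d + k" "q - j \<le> d + k" "p - j + j = p" "q - j + j = q" using 1 True pq d by auto
        ultimately show ?thesis using IH(1)[rule_format, of "p - j" "q - j"] by simp
      qed
    qed
  qed
qed

text \<open>The arrow between \<open>q\<close> and \<open>Suc q\<close> is the test. A member of
  \<open>S\<close> with top \<open>Suc q\<close> or socle \<open>q\<close> has a border just there,
  and \<open>biend_link\<close> gives the zero. If that member lies on another maximal path, the
  arrow is the last or the first one of \<open>(u, m)\<close>, and the homomorphism between the two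
  maximal path modules that takes a top to a socle is used.\<close>

lemma biend_triangular:
  assumes S: "S \<subseteq> W" "balanced S" and \<phi>: "biend S \<phi>" and w: "(u, m) \<in> maximal" and pq: "q < p" "p \<le> m"
  shows "\<phi> (bas (u, m) p 1) (enc (u, m) q) = 0"
proof -
  have B1: "maximal \<subseteq> S"
    and B3: "\<And>u. (u, 1) \<in> W \<Longrightarrow> (\<exists>m. (vtx s u 1, m) \<in> S) \<or> (\<exists>u' m. (u', m) \<in> S \<and> vtx s u' m = u)"
    using S(2) unfolding balanced_def by auto
  have wS: "(u, m) \<in> S" using B1 w by blast
  have "(vtx s u q, 1) \<in> W" using W_sub[OF maximalD(1)[OF w], of q 1] pq by simp
  from B3[OF this] show ?thesis
  proof (elim disjE exE conjE)
    fix k assume "(vtx s (vtx s u q) 1, k) \<in> S"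
    then have X: "(vtx s u (Suc q), k) \<in> S" by simp
    obtain a n j where a: "(a, n) \<in> maximal" "vtx s a j = vtx s u (Suc q)" "j + k \<le> n"
      using in_maximal X S(1) by blast
    from two_locations[OF w a(1), of "Suc q" j] a pq
    have "(u, m) = (a, n) \<and> Suc q = j \<or> Suc q = m \<and> j = 0" by auto
    then show ?thesis
    proof (elim disjE conjE)
      assume "(u, m) = (a, n)" "Suc q = j"
      then have "Suc q + k \<le> m" using a(3) by simp
      then show ?thesis using pq by (intro conjunct2[OF biend_link[OF S \<phi> w X], rule_format]) auto
    next
      assume *: "Suc q = m" "j = 0"
      have "vtx s u m = a" using a(2) * by simp
      moreover have "p = m" using * pq by simp
      ultimately show ?thesis
        using biend_shift[OF S(1) \<phi> _ wS, of a n m 0 q] B1 a(1) * by auto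
    qed
  next
    fix u' k assume X: "(u', k) \<in> S" "vtx s u' k = vtx s u q"
    have "(u', k) \<in> W" using X(1) S(1) by blast
    then obtain a n j where a: "(a, n) \<in> maximal" "vtx s a j = u'" "j + k \<le> n"
      using in_maximal by blast
    have "vtx s u q = vtx s a (j + k)" using a X by auto
    from two_locations[OF w a(1) this] a pq
    have "(u, m) = (a, n) \<and> q = j + k \<or> q = 0 \<and> j + k = n" by auto
    then show ?thesis
    proof (elim disjE conjE)
      assume *: "(u, m) = (a, n)" "q = j + k"
      then have "(vtx s u j, k) \<in> S" "j + k \<le> m" using X a by auto
      then show ?thesis using * pq by (intro conjunct2[OF biend_link[OF S \<phi> w], rule_format]) auto
    next
      assume *: "q = 0" "j + k = n"
      have "vtx s a n = u" using a X * by auto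
      then show ?thesis
        using biend_shift[OF S(1) \<phi> wS, of a n n p n] B1 a(1) * pq by auto
    qed
  qed
qed

text \<open>Only a trivial path at a common end can occur at two places. There the homomorphism from
  the top of one maximal path module to the socle of the other equates the two diagonal
  entries.\<close>

lemma biend_consistent:
  assumes S: "S \<subseteq> W" "balanced S" and \<phi>: "biend S \<phi>" and w: "(u1, m1) \<in> maximal" "(u2, m2) \<in> maximal"
    and loc: "vtx s u1 i = vtx s u2 j" "i + k \<le> m1" "j + k \<le> m2"
  shows "\<phi> (bas (u1, m1) i 1) (enc (u1, m1) (i + k)) = \<phi> (bas (u2, m2) j 1) (enc (u2, m2) (j + k))"
proof -
  have wS: "(u1, m1) \<in> S" "(u2, m2) \<in> S" using S(2) w unfolding balanced_def by auto
  from two_locations[OF w loc(1)] loc(2,3)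
  have "(u1, m1) = (u2, m2) \<and> i = j \<or> i = m1 \<and> j = 0 \<or> i = 0 \<and> j = m2" by auto
  then show ?thesis
  proof (elim disjE conjE)
    assume *: "i = m1" "j = 0"
    then have "vtx s u1 m1 = u2" "k = 0" using loc by auto
    then show ?thesis using biend_shift[OF S(1) \<phi> wS(2,1), of m1 0 m1] * by simp
  next
    assume *: "i = 0" "j = m2"
    then have "vtx s u2 m2 = u1" "k = 0" using loc by auto
    then show ?thesis using biend_shift[OF S(1) \<phi> wS, of m2 0 m2] * by simp
  qed simp
qed

text \<open>An algebra element thus is a triangular matrix on each summand, whose entry from
  \<open>t\<close> to \<open>q\<close> depends on the subpath between these positions only. These
  are the properties shown for biendomorphisms above.\<close>

lemma mdl_smult_bas:
  assumes "S \<subseteq> W" "w \<in> S" "q \<le> snd w"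
  shows "(a \<odot>\<^bsub>mdl S\<^esub> bas w t 1) (enc w q) = (if t \<le> q then co a (vtx s (fst w) t, q - t) else 0)"
proof -
  have "(a \<odot>\<^bsub>mdl S\<^esub> bas w t 1) (enc w q) = (\<Sum>r\<le>q. if r = t then co a (vtx s (fst w) t, q - t) else 0)"
  proof -
    have "(a \<odot>\<^bsub>mdl S\<^esub> bas w t 1) (enc w q) = (\<Sum>r\<le>q. co a (vtx s (fst w) r, q - r) * bas w t 1 (enc w r))"
      unfolding mdl_smult using assms(3) by (simp only: if_True)
    also have "\<dots> = (\<Sum>r\<le>q. if r = t then co a (vtx s (fst w) t, q - t) else 0)"
      by (rule sum.cong) auto
    finally show ?thesis .
  qed
  then show ?thesis by (simp add: sum.delta)
qed

lemma balanced_faithful: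
  assumes S: "S \<subseteq> W" "maximal \<subseteq> S" and ab: "a \<in> carrier A" "b \<in> carrier A"
    and eq: "\<And>x. x \<in> carrier (mdl S) \<Longrightarrow> a \<odot>\<^bsub>mdl S\<^esub> x = b \<odot>\<^bsub>mdl S\<^esub> x"
  shows "a = b"
proof (rule co_inj[OF ab])
  fix p assume p: "p \<in> W"
  obtain u k where uk: "p = (u, k)" by (cases p)
  obtain c m i where c: "(c, m) \<in> maximal" "vtx s c i = u" "i + k \<le> m" using in_maximal p uk by blast
  have cS: "(c, m) \<in> S" using c(1) S(2) by blast
  have "bas (c, m) i 1 \<in> carrier (mdl S)" using cS c(3) by (simp add: bas_carrier)
  from eq[OF this] have "(a \<odot>\<^bsub>mdl S\<^esub> bas (c, m) i 1) (enc (c, m) (i + k)) = (b \<odot>\<^bsub>mdl S\<^esub> bas (c, m) i 1) (enc (c, m) (i + k))" by simp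
  then show "co a p = co b p" using mdl_smult_bas[OF S(1) cS, of "i + k" _ i] c uk by simp
qed

theorem faithfully_balanced_mdl_if:
  assumes S: "S \<subseteq> W" "balanced S"
  shows "faithfully_balanced A (mdl S)"
proof -
  interpret M: left_module A "mdl S" by (rule left_module_mdl[OF S(1)])
  have B1: "maximal \<subseteq> S" using S(2) unfolding balanced_def by auto
  show ?thesis unfolding faithfully_balanced_iff[OF left_module_mdl[OF S(1)]]
  proof (intro conjI ballI impI)
    fix a b assume "a \<in> carrier A" "b \<in> carrier A" "\<forall>x\<in>carrier (mdl S). a \<odot>\<^bsub>mdl S\<^esub> x = b \<odot>\<^bsub>mdl S\<^esub> x"
    then show "a = b" by (intro balanced_faithful[OF S(1) B1]) auto
  next
    fix \<phi> assume "\<phi> \<in> carrier (End_ring (End_ring A (mdl S)) (End_module (mdl S)))"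
    then have \<phi>: "biend S \<phi>" unfolding biend_def .
    \<comment> \<open>The coefficient of a path is read off at any of its occurrences on maximal
      paths; by \<open>biend_consistent\<close> the choice does not matter.\<close>
    define c where "c p = (SOME v. \<exists>u m i. (u, m) \<in> maximal \<and> vtx s u i = fst p \<and> i + snd p \<le> m \<and>
      v = \<phi> (bas (u, m) i 1) (enc (u, m) (i + snd p)))" for p
    have c: "c (vtx s u i, k) = \<phi> (bas (u, m) i 1) (enc (u, m) (i + k))" if "(u, m) \<in> maximal" "i + k \<le> m" for u m i k
      unfolding c_def
    proof (rule some_equality)
      show "\<exists>u' m' i'. (u', m') \<in> maximal \<and> vtx s u' i' = fst (vtx s u i, k) \<and> i' + snd (vtx s u i, k) \<le> m' \<and>
        \<phi> (bas (u, m) i 1) (enc (u, m) (i + k)) = \<phi> (bas (u', m') i' 1) (enc (u', m') (i' + snd (vtx s u i, k)))"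
        using that by (intro exI[of _ u] exI[of _ m] exI[of _ i]) simp
    next
      fix v assume "\<exists>u' m' i'. (u', m') \<in> maximal \<and> vtx s u' i' = fst (vtx s u i, k) \<and> i' + snd (vtx s u i, k) \<le> m' \<and>
        v = \<phi> (bas (u', m') i' 1) (enc (u', m') (i' + snd (vtx s u i, k)))"
      then obtain u' m' i' where *: "(u', m') \<in> maximal" "vtx s u' i' = vtx s u i" "i' + k \<le> m'"
        "v = \<phi> (bas (u', m') i' 1) (enc (u', m') (i' + k))" by auto
      show "v = \<phi> (bas (u, m) i 1) (enc (u, m) (i + k))"
        unfolding *(4) by (rule biend_consistent[OF S \<phi> *(1) that(1) *(2,3) that(2)])
    qed
    define a where "a = el c"
    have a: "a \<in> carrier A" unfolding a_def by (rule el)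
    have on_bas: "\<phi> (bas X t 1) = a \<odot>\<^bsub>mdl S\<^esub> bas X t 1" if X: "X \<in> S" "t \<le> snd X" for X t
    proof (rule enc_ext)
      fix Y q
      have bX: "bas X t 1 \<in> carrier (mdl S)" using X by (simp add: bas_carrier)
      show "\<phi> (bas X t 1) (enc Y q) = (a \<odot>\<^bsub>mdl S\<^esub> bas X t 1) (enc Y q)"
      proof (cases "Y = X \<and> q \<le> snd X")
        case False
        have "\<phi> (bas X t 1) (enc Y q) = 0"
          using False biend_diagonal[OF S(1) \<phi> X, of Y q] mdl_D(2)[OF biendD(1)[OF \<phi> bX], of Y q] by (cases "Y = X") auto
        moreover have "(a \<odot>\<^bsub>mdl S\<^esub> bas X t 1) (enc Y q) = 0"
          using False by (cases "Y = X") (simp_all add: mdl_smult)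
        ultimately show ?thesis by simp
      next
        case True
        obtain b k where bk: "X = (b, k)" by (cases X)
        obtain u m i where u: "(u, m) \<in> maximal" "vtx s u i = b" "i + k \<le> m"
          using in_maximal[of b k] X(1) S(1) bk by blast
        have tq: "t \<le> k" "q \<le> k" using X True bk by auto
        have "\<phi> (bas X t 1) (enc X q) = \<phi> (bas (u, m) (t + i) 1) (enc (u, m) (q + i))"
          using biend_link[OF S \<phi> u(1), of i k] X(1) u tq bk by auto
        also have "\<dots> = (if t \<le> q then co a (vtx s b t, q - t) else 0)"
        proof (cases "t \<le> q")
          case True
          have "(vtx s b t, q - t) \<in> W" using W_sub[of b k t "q - t"] X(1) S(1) bk tq True by auto
          moreover have "vtx s b t = vtx s u (i + t)" using u(2) by auto
          ultimately show ?thesis using c[OF u(1), of "i + t" "q - t"] u tq True by (simp add: a_def el ac_simps)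
        next
          case False
          then show ?thesis using biend_triangular[OF S \<phi> u(1), of "q + i" "t + i"] u tq by simp
        qed
        also have "\<dots> = (a \<odot>\<^bsub>mdl S\<^esub> bas X t 1) (enc X q)"
          using mdl_smult_bas[OF S(1) X(1), of q a t] tq bk by simp
        finally show ?thesis using True by simp
      qed
    qed
    have "\<phi> x = a \<odot>\<^bsub>mdl S\<^esub> x" if x: "x \<in> carrier (mdl S)" for x
      using S(1) x
    proof (rule mdl_induct)
      show "\<phi> (\<lambda>i. 0) = a \<odot>\<^bsub>mdl S\<^esub> (\<lambda>i. 0)" using biend_zero[OF S(1) \<phi>] M.smult_zero[OF a] by simp
    next
      fix w t k assume w: "w \<in> S" "t \<le> snd w"
      have b: "bas w t 1 \<in> carrier (mdl S)" using w by (simp add: bas_carrier)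
      have b': "bas w t k = sc k \<odot>\<^bsub>mdl S\<^esub> bas w t 1" using sc_bas[OF S(1) w, of k 1] by simp
      have "\<phi> (sc k \<odot>\<^bsub>mdl S\<^esub> bas w t 1) = sc k \<odot>\<^bsub>mdl S\<^esub> \<phi> (bas w t 1)"
        using biendD(3)[OF \<phi> sc_hom[OF S(1), of k] b] b biendD(1)[OF \<phi> b] by simp
      also have "\<dots> = sc k \<odot>\<^bsub>mdl S\<^esub> (a \<odot>\<^bsub>mdl S\<^esub> bas w t 1)" unfolding on_bas[OF w] ..
      also have "\<dots> = a \<odot>\<^bsub>mdl S\<^esub> (sc k \<odot>\<^bsub>mdl S\<^esub> bas w t 1)"
        unfolding M.smult_assoc1[OF gens_closed(3) a b, symmetric] sc_central[OF a] by (rule M.smult_assoc1[OF a gens_closed(3) b])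
      finally show "\<phi> (bas w t k) = a \<odot>\<^bsub>mdl S\<^esub> bas w t k" unfolding b' .
    next
      fix x y assume "x \<in> carrier (mdl S)" "y \<in> carrier (mdl S)" "\<phi> x = a \<odot>\<^bsub>mdl S\<^esub> x" "\<phi> y = a \<odot>\<^bsub>mdl S\<^esub> y"
      then show "\<phi> (x \<oplus>\<^bsub>mdl S\<^esub> y) = a \<odot>\<^bsub>mdl S\<^esub> (x \<oplus>\<^bsub>mdl S\<^esub> y)"
        using biendD(2)[OF \<phi>] M.smult_r_distr[OF a] by (simp only:)
    qed
    then show "\<exists>a\<in>carrier A. \<forall>x\<in>carrier (mdl S). \<phi> x = a \<odot>\<^bsub>mdl S\<^esub> x" by (intro bexI[OF _ a] ballI)
  qed
qed

subsection \<open>Faithfully balanced modules give balanced sets\<close>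

text \<open>A nonzero path that contains a maximal path equals it. So a maximal path missing from
  \<open>S\<close> annihilates all summands, although it is a nonzero element of the
  algebra.\<close>

lemma faithful_maximal:
  assumes S: "S \<subseteq> W" and faithful: "\<And>a b. a \<in> carrier A \<Longrightarrow> b \<in> carrier A \<Longrightarrow>
      (\<And>x. x \<in> carrier (mdl S) \<Longrightarrow> a \<odot>\<^bsub>mdl S\<^esub> x = b \<odot>\<^bsub>mdl S\<^esub> x) \<Longrightarrow> a = b"
  shows "maximal \<subseteq> S"
proof (rule subrelI, rule ccontr)
  fix u m assume w: "(u, m) \<in> maximal" and nS: "(u, m) \<notin> S"
  interpret M: left_module A "mdl S" by (rule left_module_mdl[OF S])
  note M' = maximalD[OF w]
  have "aa m \<otimes> ee u = \<zero>"
  proof (rule faithful)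
    fix x assume x: "x \<in> carrier (mdl S)"
    have ex: "ee u \<odot>\<^bsub>mdl S\<^esub> x \<in> carrier (mdl S)" using x by (simp add: M.smult_closed)
    have "aa m \<odot>\<^bsub>mdl S\<^esub> (ee u \<odot>\<^bsub>mdl S\<^esub> x) = (\<lambda>i. 0)"
    proof (rule enc_ext)
      fix w' :: "nat \<times> nat" and t
      obtain a n where an: "w' = (a, n)" by (cases w')
      have "x (enc w' (t - m)) = 0" if *: "t \<le> n" "m \<le> t" "vtx s a (t - m) = u"
      proof (cases "(a, n) \<in> S")
        case True
        then have aW: "(a, n) \<in> W" using S by blast
        define i where "i = t - m"
        have i: "i + m \<le> n" "vtx s a i = u" using * by (auto simp: i_def)
        have "(u, n - i) \<in> W" using W_suffix[OF aW, of i] i by auto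
        then have "n - i \<le> m" by (rule maximal_start_unique[OF w])
        then have n: "n = i + m" using i by simp
        show ?thesis
        proof (cases i)
          case 0
          then show ?thesis using True nS n i by auto
        next
          case (Suc j)
          have "vtx s (vtx s a j) 1 = u" using i(2) Suc by simp
          moreover have "(vtx s a j, Suc m) \<in> W" using W_sub[OF aW, of j "Suc m"] n Suc by simp
          ultimately show ?thesis using M'(3) by blast
        qed
      next
        case False
        then show ?thesis using mdl_D(1)[OF x] an by simp
      qed
      then show "(aa m \<odot>\<^bsub>mdl S\<^esub> (ee u \<odot>\<^bsub>mdl S\<^esub> x)) (enc w' t) = 0"
        by (simp add: mdl_aa[OF S ex] mdl_ee[OF S x] an)
    qed
    then show "aa m \<otimes> ee u \<odot>\<^bsub>mdl S\<^esub> x = \<zero> \<odot>\<^bsub>mdl S\<^esub> x"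
      using x by (simp add: M.smult_assoc1)
  qed auto
  then have "co (aa m \<otimes> ee u) (u, m) = 0" using co_zero M'(1) by simp
  then show False using M'(1) by (simp add: co_simps)
qed

theorem faithfully_balanced_mdl_only_if:
  assumes S: "S \<subseteq> W" and fb: "faithfully_balanced A (mdl S)"
  shows "balanced S"
proof -
  interpret M: left_module A "mdl S" by (rule left_module_mdl[OF S])
  note fb' = fb[unfolded faithfully_balanced_iff[OF left_module_mdl[OF S]]]
  have B1: "maximal \<subseteq> S" by (rule faithful_maximal[OF S]) (use fb' in blast)
  have biend: "\<exists>a\<in>carrier A. \<forall>x\<in>carrier (mdl S). \<phi> x = a \<odot>\<^bsub>mdl S\<^esub> x"
    if \<phi>: "\<And>x. x \<in> carrier (mdl S) \<Longrightarrow> \<phi> x \<in> carrier (mdl S)"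
      "\<And>x y. x \<in> carrier (mdl S) \<Longrightarrow> y \<in> carrier (mdl S) \<Longrightarrow> \<phi> (x \<oplus>\<^bsub>mdl S\<^esub> y) = \<phi> x \<oplus>\<^bsub>mdl S\<^esub> \<phi> y"
      "\<And>e x. e \<in> mod_hom A (mdl S) (mdl S) \<Longrightarrow> x \<in> carrier (mdl S) \<Longrightarrow> \<phi> (e x) = e (\<phi> x)" for \<phi>
  proof -
    have "restrict \<phi> (carrier (mdl S)) \<in> carrier (End_ring (End_ring A (mdl S)) (End_module (mdl S)))"
      unfolding biendomorphism_iff
    proof (intro conjI ballI)
      show "restrict \<phi> (carrier (mdl S)) \<in> carrier (mdl S) \<rightarrow>\<^sub>E carrier (mdl S)" using \<phi>(1) by auto
      show "restrict \<phi> (carrier (mdl S)) (x \<oplus>\<^bsub>mdl S\<^esub> y) = restrict \<phi> (carrier (mdl S)) x \<oplus>\<^bsub>mdl S\<^esub> restrict \<phi> (carrier (mdl S)) y"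
        if "x \<in> carrier (mdl S)" "y \<in> carrier (mdl S)" for x y
        using \<phi>(2)[OF that] M.M.a_closed[OF that] that by (simp only: restrict_apply if_True)
      show "restrict \<phi> (carrier (mdl S)) (e x) = e (restrict \<phi> (carrier (mdl S)) x)"
        if "e \<in> mod_hom A (mdl S) (mdl S)" "x \<in> carrier (mdl S)" for e x
        using \<phi>(3)[OF that] mod_homD(1)[OF that] that by simp
    qed
    from bspec[OF conjunct2[OF fb'] this] show ?thesis by simp
  qed
  show ?thesis unfolding balanced_def
  proof (intro conjI allI impI)
    show "maximal \<subseteq> S" by (rule B1)
    fix u m assume X: "(u, m) \<in> S"
    show "(u, m) \<in> maximal \<or> (\<exists>m'>m. (u, m') \<in> S) \<or> (\<exists>u' d. 0 < d \<and> vtx s u' d = u \<and> (u', d + m) \<in> S)"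
    proof (rule ccontr)
      assume no: "\<not> ?thesis"
      let ?X = "(u, m)"
      \<comment> \<open>The map from the top of \<open>?X\<close> to its socle. It commutes with all
        endomorphisms when \<open>?X\<close> is neither a proper quotient nor a proper submodule of
        another member of \<open>S\<close>. An algebra element inducing it would have coefficient
        \<open>1\<close> at the path \<open>?X\<close>, but \<open>0\<close> when read off on a
        maximal path containing \<open>?X\<close>.\<close>
      define \<phi> where "\<phi> x = bas ?X m (x (enc ?X 0))" for x :: "nat \<Rightarrow> 'k"
      have "\<exists>a\<in>carrier A. \<forall>x\<in>carrier (mdl S). \<phi> x = a \<odot>\<^bsub>mdl S\<^esub> x"
      proof (rule biend)
        show "\<phi> x \<in> carrier (mdl S)" for x unfolding \<phi>_def using X by (simp add: bas_carrier)
        show "\<phi> (x \<oplus>\<^bsub>mdl S\<^esub> y) = \<phi> x \<oplus>\<^bsub>mdl S\<^esub> \<phi> y" for x y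
          unfolding \<phi>_def by (rule enc_ext) (simp add: mdl_add)
      next
        fix e x assume e: "e \<in> mod_hom A (mdl S) (mdl S)" and x: "x \<in> carrier (mdl S)"
        note eD = mod_homD[OF e]
        define z where "z = e (bas ?X 0 1)"
        have bX: "bas ?X 0 1 \<in> carrier (mdl S)" using X by (simp add: bas_carrier)
        have z: "z \<in> carrier (mdl S)" unfolding z_def by (rule eD(1)[OF bX])
        have e0: "e (\<lambda>i. 0) = (\<lambda>i. 0)"
          using mod_hom_zero[OF left_module_mdl[OF S] left_module_mdl[OF S] e] by simp
        have esc: "e (bas Y t c) = sc c \<odot>\<^bsub>mdl S\<^esub> e (bas Y t 1)" if "Y \<in> S" "t \<le> snd Y" for Y t c
          using eD(4)[OF gens_closed(3)[of c] bas_carrier[OF that, of 1]] sc_bas[OF S that, of c 1] by simp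
        have eaa: "e (bas Y t c) = aa t \<odot>\<^bsub>mdl S\<^esub> e (bas Y 0 c)" if "Y \<in> S" "t \<le> snd Y" for Y t c
          using eD(4)[OF gens_closed(1)[of t] bas_carrier[OF that(1), of 0 c]] aa_bas[OF S that(1), of 0 t c] that(2) by simp
        \<comment> \<open>The image of the generator of \<open>Y\<close> lives at the vertex where
          \<open>Y\<close> starts and is killed by every path sum longer than
          \<open>Y\<close>.\<close>
        have support: "e (bas Y 0 c) (enc Y' r) = 0"
          if Y: "Y \<in> S" and *: "vtx s (fst Y') r \<noteq> fst Y \<or> r + snd Y < snd Y'" for Y Y' r c
        proof -
          have bY: "bas Y 0 c \<in> carrier (mdl S)" using Y by (simp add: bas_carrier)
          have ebY: "e (bas Y 0 c) \<in> carrier (mdl S)" by (rule eD(1)[OF bY])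
          have "ee (fst Y) \<odot>\<^bsub>mdl S\<^esub> bas Y 0 c = bas Y 0 c"
            by (rule enc_ext) (auto simp: mdl_ee[OF S bY])
          then have 1: "e (bas Y 0 c) = ee (fst Y) \<odot>\<^bsub>mdl S\<^esub> e (bas Y 0 c)"
            using eD(4)[OF gens_closed(2)[of "fst Y"] bY] by simp
          have "aa (Suc (snd Y)) \<odot>\<^bsub>mdl S\<^esub> bas Y 0 c = (\<lambda>i. 0)"
            by (rule enc_ext) (auto simp: mdl_aa[OF S bY])
          then have 2: "aa (Suc (snd Y)) \<odot>\<^bsub>mdl S\<^esub> e (bas Y 0 c) = (\<lambda>i. 0)"
            using eD(4)[OF gens_closed(1)[of "Suc (snd Y)"] bY] e0 by simp
          from * show ?thesis
          proof
            assume "vtx s (fst Y') r \<noteq> fst Y"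
            then show ?thesis using mdl_ee[OF S ebY, of "fst Y" Y' r] 1 by simp
          next
            assume "r + snd Y < snd Y'"
            then show ?thesis using mdl_aa[OF S ebY, of "Suc (snd Y)" Y' "r + Suc (snd Y)"] 2 by simp
          qed
        qed
        \<comment> \<open>Neither another summand nor a later position of \<open>?X\<close> reaches
          the first position of \<open>?X\<close>, so \<open>e\<close> acts on the first coordinate
          by a scalar. By \<open>i\<close> below it acts on the socle of \<open>?X\<close> by the
          same scalar and maps it to no other summand.\<close>
        have ii: "e x (enc ?X 0) = x (enc ?X 0) * z (enc ?X 0)" if x: "x \<in> carrier (mdl S)" for x
          using S x
        proof (rule mdl_induct)
          show "e (\<lambda>i. 0) (enc ?X 0) = 0 * z (enc ?X 0)" unfolding e0 by simp
        next
          fix Y t c assume Y: "Y \<in> S" "t \<le> snd Y"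
          show "e (bas Y t c) (enc ?X 0) = bas Y t c (enc ?X 0) * z (enc ?X 0)"
          proof (cases "Y = ?X \<and> t = 0")
            case True
            then show ?thesis using esc[of ?X 0 c] X z_def mdl_sc[OF S z] by simp
          next
            case False
            have "e (bas Y t c) (enc ?X 0) = 0"
            proof (cases "t = 0")
              case False
              then show ?thesis
                using eaa[OF Y] mdl_aa[OF S eD(1)[OF bas_carrier[OF Y(1), of 0 c]], of t ?X 0] by simp
            next
              case True
              then have "Y \<noteq> ?X" using False by simp
              then have "vtx s (fst ?X) 0 \<noteq> fst Y \<or> 0 + snd Y < snd ?X"
                using no Y(1) by (cases Y) (auto simp: not_less_iff_gr_or_eq)
              from support[OF Y(1) this] True show ?thesis by simp
            qed
            then show ?thesis using False by auto
          qed
        next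
          fix x y assume xy: "x \<in> carrier (mdl S)" "y \<in> carrier (mdl S)"
            "e x (enc ?X 0) = x (enc ?X 0) * z (enc ?X 0)" "e y (enc ?X 0) = y (enc ?X 0) * z (enc ?X 0)"
          show "e (x \<oplus>\<^bsub>mdl S\<^esub> y) (enc ?X 0) = (x \<oplus>\<^bsub>mdl S\<^esub> y) (enc ?X 0) * z (enc ?X 0)"
            unfolding eD(3)[OF xy(1,2)] mdl_add using xy(3,4) by (simp add: distrib_right)
        qed
        have i: "e (bas ?X m c) = bas ?X m (c * z (enc ?X 0))" for c
        proof (rule enc_ext)
          fix Y t
          have ezc: "e (bas ?X 0 c) \<in> carrier (mdl S)" using eD(1)[OF bas_carrier[OF X, of 0 c]] by simp
          have zc: "e (bas ?X 0 c) (enc Y r) = c * z (enc Y r)" for Y r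
            using esc[OF X, of 0 c] mdl_sc[OF S z] z_def by simp
          have "e (bas ?X m c) (enc Y t) = (if t \<le> snd Y \<and> m \<le> t then c * z (enc Y (t - m)) else 0)"
            using eaa[OF X, of m c] mdl_aa[OF S ezc] zc by simp
          also have "\<dots> = (if Y = ?X \<and> t = m then c * z (enc ?X 0) else 0)"
          proof (cases "t \<le> snd Y \<and> m \<le> t")
            case False
            then show ?thesis by auto
          next
            case True
            show ?thesis
            proof (cases "Y = ?X \<and> t = m")
              case True
              then show ?thesis by simp
            next
              case False
              have "z (enc Y (t - m)) = 0"
              proof (cases "Y \<in> S")
                case YS: True
                have "vtx s (fst Y) (t - m) \<noteq> fst ?X \<or> (t - m) + snd ?X < snd Y"
                proof (rule ccontr)
                  assume "\<not> ?thesis"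
                  then have *: "vtx s (fst Y) (t - m) = u" "t = snd Y" using True by auto
                  show False
                  proof (cases "t = m")
                    case True
                    then show False using * False by (cases Y) auto
                  next
                    case False
                    then have "0 < t - m" "Y = (fst Y, t - m + m)" using True * by auto
                    then show False using no YS * by metis
                  qed
                qed
                then show ?thesis using support[OF X, of Y "t - m" 1] z_def by simp
              qed (use mdl_D(1)[OF z] in simp)
              then show ?thesis using False by auto
            qed
          qed
          finally show "e (bas ?X m c) (enc Y t) = bas ?X m (c * z (enc ?X 0)) (enc Y t)" by simp
        qed
        show "\<phi> (e x) = e (\<phi> x)" unfolding \<phi>_def i ii[OF x] ..
      qed
      then obtain a where a: "a \<in> carrier A" "\<And>x. x \<in> carrier (mdl S) \<Longrightarrow> \<phi> x = a \<odot>\<^bsub>mdl S\<^esub> x" by auto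
      obtain c n i where c: "(c, n) \<in> maximal" "vtx s c i = u" "i + m \<le> n" using in_maximal[OF subsetD[OF S X]] .
      have cS: "(c, n) \<in> S" using c(1) B1 by blast
      have ne: "(c, n) \<noteq> ?X" using no c(1) by auto
      have "\<phi> (bas (c, n) i 1) (enc (c, n) (i + m)) = 0"
      proof -
        have "bas ?X m v (enc (c, n) q) = 0" for v q using ne by auto
        then show ?thesis unfolding \<phi>_def .
      qed
      then have "co a (u, m) = 0"
        using a(2)[of "bas (c, n) i 1"] cS c mdl_smult_bas[OF S cS, of "i + m" a i] by (simp add: bas_carrier)
      moreover have "\<phi> (bas ?X 0 1) (enc ?X m) = 1" unfolding \<phi>_def by simp
      then have "co a (u, m) = 1"
        using a(2)[of "bas ?X 0 1"] X mdl_smult_bas[OF S X, of m a 0] by (simp add: bas_carrier)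
      ultimately show False by simp
    qed
  next
    fix u assume u: "(u, 1) \<in> W"
    show "(\<exists>m. (vtx s u 1, m) \<in> S) \<or> (\<exists>u' m. (u', m) \<in> S \<and> vtx s u' m = u)"
    proof (rule ccontr)
      assume "\<not> ?thesis"
      then have no1: "(vtx s u 1, m) \<notin> S" and no2: "(u', m) \<in> S \<Longrightarrow> vtx s u' m \<noteq> u" for m u' by auto
      let ?v = "vtx s u 1"
      \<comment> \<open>The candidate for the inverse of the arrow: since no member of
        \<open>S\<close> has top \<open>?v\<close> or socle \<open>u\<close>, each occurrence of
        \<open>?v\<close> is preceded by \<open>u\<close>, and each occurrence of \<open>u\<close>
        is followed by \<open>?v\<close>.\<close>
      define \<phi> where "\<phi> x = enc_fun (\<lambda>w t. if t < snd w \<and> vtx s (fst w) t = u then x (enc w (Suc t)) else 0)" for x :: "nat \<Rightarrow> 'k"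
      have \<phi>e: "\<phi> x (enc w t) = (if t < snd w \<and> vtx s (fst w) t = u then x (enc w (Suc t)) else 0)" for x w t
        by (simp add: \<phi>_def)
      have uV: "u \<in> V" using u W_vertex by blast
      have \<phi>c: "\<phi> x \<in> carrier (mdl S)" if "x \<in> carrier (mdl S)" for x
        unfolding mdl_carrier
      proof (intro allI impI)
        fix w t assume "\<phi> x (enc w t) \<noteq> 0"
        then have "t < snd w" "x (enc w (Suc t)) \<noteq> 0" unfolding \<phi>e by presburger+
        then show "w \<in> S \<and> t \<le> snd w" using that unfolding mdl_carrier by (blast intro: less_imp_le)
      qed
      have ex1: "ee u \<odot>\<^bsub>mdl S\<^esub> \<phi> x = \<phi> x" if "x \<in> carrier (mdl S)" for x
        by (rule enc_ext) (simp add: mdl_ee[OF S \<phi>c[OF that]] \<phi>e)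
      have ex2: "aa 1 \<odot>\<^bsub>mdl S\<^esub> \<phi> x = ee ?v \<odot>\<^bsub>mdl S\<^esub> x" if x: "x \<in> carrier (mdl S)" for x
      proof (rule enc_ext)
        fix w t
        show "(aa 1 \<odot>\<^bsub>mdl S\<^esub> \<phi> x) (enc w t) = (ee ?v \<odot>\<^bsub>mdl S\<^esub> x) (enc w t)"
        proof (cases "w \<in> S \<and> t \<le> snd w")
          case False
          then show ?thesis
            using mdl_D[OF x, of w] mdl_D[OF \<phi>c[OF x], of w] by (auto simp: mdl_aa[OF S \<phi>c[OF x]] mdl_ee[OF S x] not_le)
        next
          case True
          obtain a n where an: "w = (a, n)" by (cases w)
          show ?thesis
          proof (cases t)
            case 0
            then have "vtx s (fst w) t \<noteq> ?v" using no1 True an by auto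
            then show ?thesis using 0 by (simp add: mdl_aa[OF S \<phi>c[OF x]] mdl_ee[OF S x])
          next
            case (Suc r)
            have aW: "(a, n) \<in> W" using True S an by blast
            have "vtx s a r \<in> V" using W_tail[OF aW, of r] True Suc an by simp
            then have "vtx s a (Suc r) = ?v \<longleftrightarrow> vtx s a r = u"
              using vtx_inj[of "vtx s a r" u 1] uV by auto
            then show ?thesis using Suc True an by (simp add: mdl_aa[OF S \<phi>c[OF x]] mdl_ee[OF S x] \<phi>e)
          qed
        qed
      qed
      \<comment> \<open>The arrow acts injectively on the part at \<open>u\<close>, because no
        member of \<open>S\<close> has socle \<open>u\<close>. Hence \<open>\<phi> (e x)\<close> and
        \<open>e (\<phi> x)\<close> may be compared after applying the arrow.\<close>
      have uniq: "y = y'" if y: "y \<in> carrier (mdl S)" "y' \<in> carrier (mdl S)" "ee u \<odot>\<^bsub>mdl S\<^esub> y = y" "ee u \<odot>\<^bsub>mdl S\<^esub> y' = y'"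
        "aa 1 \<odot>\<^bsub>mdl S\<^esub> y = aa 1 \<odot>\<^bsub>mdl S\<^esub> y'" for y y'
      proof (rule enc_ext)
        fix w t
        show "y (enc w t) = y' (enc w t)"
        proof (cases "w \<in> S \<and> t < snd w \<and> vtx s (fst w) t = u")
          case True
          have "(aa 1 \<odot>\<^bsub>mdl S\<^esub> y) (enc w (Suc t)) = (aa 1 \<odot>\<^bsub>mdl S\<^esub> y') (enc w (Suc t))" using y(5) by simp
          then show ?thesis using True by (simp add: mdl_aa[OF S y(1)] mdl_aa[OF S y(2)])
        next
          case False
          have z: "y0 (enc w t) = 0" if y0: "y0 \<in> carrier (mdl S)" "ee u \<odot>\<^bsub>mdl S\<^esub> y0 = y0" for y0
          proof (rule ccontr)
            assume nz: "y0 (enc w t) \<noteq> 0"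
            then have "w \<in> S" "t \<le> snd w" using y0(1) unfolding mdl_carrier by blast+
            moreover have "vtx s (fst w) t = u" using nz mdl_ee[OF S y0(1), of u w t] y0(2) by (metis)
            ultimately have "t = snd w" using False by simp
            then show False using no2[of "fst w" "snd w"] \<open>w \<in> S\<close> \<open>vtx s (fst w) t = u\<close> by simp
          qed
          show ?thesis unfolding z[OF y(1,3)] z[OF y(2,4)] ..
        qed
      qed
      have "\<exists>a\<in>carrier A. \<forall>x\<in>carrier (mdl S). \<phi> x = a \<odot>\<^bsub>mdl S\<^esub> x"
      proof (rule biend[OF \<phi>c])
        show "\<phi> (x \<oplus>\<^bsub>mdl S\<^esub> y) = \<phi> x \<oplus>\<^bsub>mdl S\<^esub> \<phi> y" for x y
          by (rule enc_ext) (simp add: mdl_add \<phi>e)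
      next
        fix e x assume e: "e \<in> mod_hom A (mdl S) (mdl S)" and x: "x \<in> carrier (mdl S)"
        note eD = mod_homD[OF e]
        show "\<phi> (e x) = e (\<phi> x)"
        proof (rule uniq)
          show "\<phi> (e x) \<in> carrier (mdl S)" by (rule \<phi>c[OF eD(1)[OF x]])
          show "e (\<phi> x) \<in> carrier (mdl S)" by (rule eD(1)[OF \<phi>c[OF x]])
          show "ee u \<odot>\<^bsub>mdl S\<^esub> \<phi> (e x) = \<phi> (e x)" by (rule ex1[OF eD(1)[OF x]])
          show "ee u \<odot>\<^bsub>mdl S\<^esub> e (\<phi> x) = e (\<phi> x)"
            using eD(4)[OF gens_closed(2)[of u] \<phi>c[OF x]] ex1[OF x] by simp
          show "aa 1 \<odot>\<^bsub>mdl S\<^esub> \<phi> (e x) = aa 1 \<odot>\<^bsub>mdl S\<^esub> e (\<phi> x)"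
            using ex2[OF eD(1)[OF x]] ex2[OF x] eD(4)[OF gens_closed(1)[of 1] \<phi>c[OF x]]
              eD(4)[OF gens_closed(2)[of ?v] x] by simp
        qed
      qed
      then obtain a where a: "a \<in> carrier A" "\<And>x. x \<in> carrier (mdl S) \<Longrightarrow> \<phi> x = a \<odot>\<^bsub>mdl S\<^esub> x" by auto
      obtain c n i where c: "(c, n) \<in> maximal" "vtx s c i = u" "i + 1 \<le> n" using in_maximal[OF u] .
      have cS: "(c, n) \<in> S" using B1 c(1) by (rule subsetD)
      \<comment> \<open>On the maximal path containing the arrow, \<open>\<phi>\<close> leads from
        position \<open>Suc i\<close> back to \<open>i\<close>, which no algebra element
        does.\<close>
      have "\<phi> (bas (c, n) (Suc i) 1) (enc (c, n) i) = 1" unfolding \<phi>e using c by simp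
      moreover have "(a \<odot>\<^bsub>mdl S\<^esub> bas (c, n) (Suc i) 1) (enc (c, n) i) = 0"
        using mdl_smult_bas[OF S cS, of i a "Suc i"] c by simp
      ultimately show False using a(2)[of "bas (c, n) (Suc i) 1"] cS c by (simp add: bas_carrier)
    qed
  qed
qed

end

context nakayama_algebra
begin

section \<open>Projective and injective interval modules\<close>

lemma lm_interval: "p \<in> W \<Longrightarrow> left_module A (mdl {p})"
  by (rule left_module_mdl) simp

lemma bas0_carrier: "bas p 0 c \<in> carrier (mdl {p})"
  by (simp add: bas_carrier)

lemma bas_gen:
  assumes "p \<in> W" "t \<le> snd p"
  shows "bas p t c = sc c \<odot>\<^bsub>mdl {p}\<^esub> (aa t \<odot>\<^bsub>mdl {p}\<^esub> bas p 0 1)"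
proof -
  have pW: "{p} \<subseteq> W" using assms by simp
  have "aa t \<odot>\<^bsub>mdl {p}\<^esub> bas p 0 1 = bas p t 1" using aa_bas[OF pW, of p 0 t 1] assms by simp
  then show ?thesis using sc_bas[OF pW, of p t c 1] assms by simp
qed

lemma interval_hom_ext:
  assumes p: "p \<in> W" and N: "left_module A N" and f: "f \<in> mod_hom A (mdl {p}) N" and g: "g \<in> mod_hom A (mdl {p}) N"
    and eq: "f (bas p 0 1) = g (bas p 0 1)" and x: "x \<in> carrier (mdl {p})"
  shows "f x = g x"
proof -
  have pW: "{p} \<subseteq> W" using p by simp
  interpret I: left_module A "mdl {p}" by (rule left_module_mdl[OF pW])
  note b0 = bas0_carrier[of p 1]
  show ?thesis using pW x
  proof (rule mdl_induct)
    show "f (\<lambda>i. 0) = g (\<lambda>i. 0)"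
      using mod_hom_zero[OF lm_interval[OF p] N f] mod_hom_zero[OF lm_interval[OF p] N g] by simp
  next
    fix w t c assume "w \<in> {p}" "t \<le> snd w"
    then have w: "w = p" "t \<le> snd p" by auto
    have h: "h (bas w t c) = sc c \<odot>\<^bsub>N\<^esub> (aa t \<odot>\<^bsub>N\<^esub> h (bas p 0 1))" if "h \<in> mod_hom A (mdl {p}) N" for h
      unfolding w(1) bas_gen[OF p w(2)]
      using mod_homD(4)[OF that gens_closed(3) I.smult_closed[OF gens_closed(1) b0]] mod_homD(4)[OF that gens_closed(1) b0] by simp
    show "f (bas w t c) = g (bas w t c)" unfolding h[OF f] h[OF g] eq ..
  next
    fix x y assume "x \<in> carrier (mdl {p})" "y \<in> carrier (mdl {p})" "f x = g x" "f y = g y"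
    then show "f (x \<oplus>\<^bsub>mdl {p}\<^esub> y) = g (x \<oplus>\<^bsub>mdl {p}\<^esub> y)"
      using mod_homD(3)[OF f, of x y] mod_homD(3)[OF g, of x y] by simp
  qed
qed

lemma ee_bas0: "p \<in> W \<Longrightarrow> ee (fst p) \<odot>\<^bsub>mdl {p}\<^esub> bas p 0 c = bas p 0 c"
  by (rule enc_ext) (simp add: mdl_ee bas0_carrier)

lemma aa_bas0_zero: "p \<in> W \<Longrightarrow> snd p < k \<Longrightarrow> aa k \<odot>\<^bsub>mdl {p}\<^esub> bas p 0 c = (\<lambda>i. 0)"
  by (rule enc_ext) (auto simp: mdl_aa bas0_carrier)

text \<open>If the path cannot be prolonged at its end, then
  \<open>aa (Suc m) \<otimes> ee u\<close> is zero, and the generator may be sent to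
  \<open>ee u\<close> times any preimage \<open>z\<close>.\<close>

lemma projective_interval:
  assumes p: "(u, m) \<in> W" and no: "(u, Suc m) \<notin> W"
  shows "projective_module A (mdl {(u, m)})"
  unfolding projective_module_def
proof (intro allI ballI impI)
  fix M N :: "('a, nat \<Rightarrow> 'k) module" and f h
  assume f: "f \<in> mod_hom A M N" and h: "h \<in> mod_hom A (mdl {(u, m)}) N"
    and "fg_module A M \<and> fg_module A N \<and> f ` carrier M = carrier N"
  then have M: "left_module A M" and N: "left_module A N" and surj: "f ` carrier M = carrier N"
    unfolding fg_module_def by auto
  interpret M: left_module A M by fact
  let ?p = "(u, m)"
  note b0 = bas0_carrier[of ?p 1]
  have "h (bas ?p 0 1) \<in> f ` carrier M" using mod_homD(1)[OF h b0] surj by simp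
  then obtain z where z: "z \<in> carrier M" "h (bas ?p 0 1) = f z" by (elim imageE)
  have top: "aa (Suc m) \<odot>\<^bsub>M\<^esub> (ee u \<odot>\<^bsub>M\<^esub> z) = \<zero>\<^bsub>M\<^esub>"
    using aa_ee_nonpath[OF no] z(1) by (simp flip: M.smult_assoc1)
  let ?l = "restrict (from_interval M ?p z) (carrier (mdl {?p}))"
  have l: "?l \<in> mod_hom A (mdl {?p}) M" by (rule from_interval_hom[OF M p z(1) top])
  have lb: "?l (bas ?p 0 1) = ee u \<odot>\<^bsub>M\<^esub> z"
    using from_interval_bas[OF M p z(1) _ top, of 0] b0 z(1) by (simp add: aa_0 M.smult_one M.smult_closed)
  show "\<exists>l\<in>mod_hom A (mdl {?p}) M. \<forall>x\<in>carrier (mdl {?p}). f (l x) = h x"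
  proof (intro bexI[OF _ l] ballI)
    fix x assume x: "x \<in> carrier (mdl {?p})"
    let ?c = "compose (carrier (mdl {?p})) f ?l"
    have c: "?c \<in> mod_hom A (mdl {?p}) N" by (rule mod_hom_compose'[OF lm_interval[OF p] l f])
    have "?c (bas ?p 0 1) = h (bas ?p 0 1)"
    proof -
      have "?c (bas ?p 0 1) = ee u \<odot>\<^bsub>N\<^esub> f z" using b0 lb mod_homD(4)[OF f gens_closed(2) z(1)] by (simp add: compose_def)
      also have "\<dots> = h (ee u \<odot>\<^bsub>mdl {?p}\<^esub> bas ?p 0 1)" using mod_homD(4)[OF h gens_closed(2) b0] z(2) by simp
      also have "\<dots> = h (bas ?p 0 1)" using ee_bas0[OF p] by simp
      finally show ?thesis .
    qed
    from interval_hom_ext[OF p N c h this x] show "f (?l x) = h x" using x by (simp add: compose_def)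
  qed
qed

text \<open>The mirror image of \<open>aa_ee_nonpath\<close>: a nonzero path longer than
  \<open>m\<close> with the same end would contain \<open>(u, m)\<close> preceded by an
  arrow.\<close>

lemma ee_aa_zero:
  assumes p: "(u, m) \<in> W" and no: "\<And>u'. vtx s u' 1 = u \<Longrightarrow> (u', Suc m) \<notin> W" and j: "m < j"
  shows "ee (vtx s u m) \<otimes> aa j = \<zero>"
proof (rule co_inj)
  fix q assume q: "q \<in> W"
  obtain a k where ak: "q = (a, k)" by (cases q)
  have "\<not> (k = j \<and> vtx s a k = vtx s u m)"
  proof
    assume *: "k = j \<and> vtx s a k = vtx s u m"
    then obtain i where i: "k = Suc i + m" using j less_imp_Suc_add by (metis add.commute add_Suc_right)
    have "vtx s a (Suc i) = u"
    proof (rule vtx_inj)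
      show "vtx s a (Suc i) \<in> V" using W_tail[of a k "Suc i"] q ak i by simp
      show "u \<in> V" using p W_vertex by blast
      show "vtx s (vtx s a (Suc i)) m = vtx s u m" unfolding vtx_vtx using conjunct2[OF *] unfolding i .
    qed
    then have "vtx s (vtx s a i) 1 = u" by simp
    moreover have "(vtx s a i, Suc m) \<in> W" using W_sub[of a k i "Suc m"] q ak i by simp
    ultimately show False using no by blast
  qed
  then show "co (ee (vtx s u m) \<otimes> aa j) q = co \<zero> q" using q ak by (auto simp: co_simps W_suffix)
qed auto

text \<open>A homomorphism into the interval module is determined by its last coordinate
  \<open>f0\<close>, so it suffices to extend a linear functional from \<open>M\<close> to
  \<open>N\<close>. By \<open>ee_aa_zero\<close> the extension meets the vanishing condition of
  \<open>to_interval_hom\<close> automatically.\<close>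

lemma injective_interval:
  assumes p: "(u, m) \<in> W" and no: "\<And>u'. vtx s u' 1 = u \<Longrightarrow> (u', Suc m) \<notin> W"
  shows "injective_module A (mdl {(u, m)})"
  unfolding injective_module_def
proof (intro allI ballI impI)
  fix M N :: "('a, nat \<Rightarrow> 'k) module" and f h
  let ?p = "(u, m)"
  assume f: "f \<in> mod_hom A M N" and h: "h \<in> mod_hom A M (mdl {?p})"
    and "fg_module A M \<and> fg_module A N \<and> inj_on f (carrier M)"
  then have M: "left_module A M" and N: "left_module A N" and inj: "inj_on f (carrier M)"
    unfolding fg_module_def by auto
  interpret M: left_module A M by fact
  interpret N: left_module A N by fact
  have pW: "{?p} \<subseteq> W" using p by simp
  interpret I: left_module A "mdl {(u, m)}" by (rule left_module_mdl[OF pW])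
  note fD = mod_homD[OF f] and hD = mod_homD[OF h]
  define f0 where "f0 x = h x (enc ?p m)" for x
  have f0a: "f0 (x \<oplus>\<^bsub>M\<^esub> y) = f0 x + f0 y" if "x \<in> carrier M" "y \<in> carrier M" for x y
    unfolding f0_def hD(3)[OF that] by (simp add: mdl_add)
  have f0s: "f0 (sc c \<odot>\<^bsub>M\<^esub> x) = c * f0 x" if "x \<in> carrier M" for x c
    unfolding f0_def hD(4)[OF gens_closed(3) that] by (rule mdl_sc[OF pW hD(1)[OF that]])
  have h_f0: "h x (enc ?p t) = f0 (ee (vtx s u m) \<odot>\<^bsub>M\<^esub> (aa (m - t) \<odot>\<^bsub>M\<^esub> x))" if "x \<in> carrier M" "t \<le> m" for x t
  proof -
    have 1: "aa (m - t) \<odot>\<^bsub>M\<^esub> x \<in> carrier M" using that by (simp add: M.smult_closed)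
    have 2: "aa (m - t) \<odot>\<^bsub>mdl {?p}\<^esub> h x \<in> carrier (mdl {?p})" using hD(1)[OF that(1)] by (simp add: I.smult_closed)
    have "f0 (ee (vtx s u m) \<odot>\<^bsub>M\<^esub> (aa (m - t) \<odot>\<^bsub>M\<^esub> x)) = (ee (vtx s u m) \<odot>\<^bsub>mdl {?p}\<^esub> (aa (m - t) \<odot>\<^bsub>mdl {?p}\<^esub> h x)) (enc ?p m)"
      unfolding f0_def hD(4)[OF gens_closed(2) 1] hD(4)[OF gens_closed(1) that(1)] ..
    then show ?thesis using that by (simp add: mdl_ee[OF pW 2] mdl_aa[OF pW hD(1)[OF that(1)]])
  qed
  show "\<exists>l\<in>mod_hom A N (mdl {?p}). \<forall>x\<in>carrier M. l (f x) = h x"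
  proof (cases "\<forall>x\<in>carrier M. f0 x = 0")
    case True
    let ?l = "restrict (\<lambda>x. \<zero>\<^bsub>mdl {?p}\<^esub>) (carrier N)"
    have l: "?l \<in> mod_hom A N (mdl {?p})"
      by (rule mod_hom_restrictI[OF N]) (use I.M.zero_closed I.M.l_zero[OF I.M.zero_closed] I.smult_zero in simp_all)
    show ?thesis
    proof (intro bexI[OF _ l] ballI)
      fix x assume x: "x \<in> carrier M"
      have "h x = (\<lambda>i. 0)"
      proof (rule interval_eqI[OF hD(1)[OF x]])
        show "(\<lambda>i. 0) \<in> carrier (mdl {?p})" using I.M.zero_closed by simp
        show "h x (enc ?p t) = 0" if "t \<le> snd ?p" for t
          using h_f0[OF x] that True x by (simp add: M.smult_closed)
      qed
      then show "?l (f x) = h x" using fD(1)[OF x] by simp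
    qed
  next
    case False
    then obtain x1 where x1: "x1 \<in> carrier M" "f0 x1 \<noteq> 0" by auto
    define x2 where "x2 = sc (inverse (f0 x1)) \<odot>\<^bsub>M\<^esub> x1"
    have x2: "x2 \<in> carrier M" "f0 x2 = 1" using x1 by (simp_all add: x2_def M.smult_closed f0s)
    \<comment> \<open>A functional that kills this image and takes the value \<open>1\<close> at
      \<open>f x2\<close> agrees with \<open>f0\<close> on all of \<open>M\<close>, since
      \<open>x\<close> minus \<open>f0 x\<close> times \<open>x2\<close> lies in the kernel of
      \<open>f0\<close>.\<close>
    let ?H0 = "f ` {x \<in> carrier M. f0 x = 0}"
    have f00: "f0 \<zero>\<^bsub>M\<^esub> = 0"
      using f0s[OF M.M.zero_closed, of 0] by (simp add: sc_0)
    have H0: "subspace_of N ?H0" unfolding subspace_of_def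
    proof (intro conjI ballI allI)
      show "?H0 \<subseteq> carrier N" using fD(1) by auto
      show "\<zero>\<^bsub>N\<^esub> \<in> ?H0" using f00 mod_hom_zero[OF M N f] by (intro image_eqI[of _ _ "\<zero>\<^bsub>M\<^esub>"]) simp_all
      fix y y' assume "y \<in> ?H0" "y' \<in> ?H0"
      then obtain x x' where "x \<in> carrier M" "f0 x = 0" "y = f x" "x' \<in> carrier M" "f0 x' = 0" "y' = f x'" by auto
      then show "y \<oplus>\<^bsub>N\<^esub> y' \<in> ?H0" by (intro image_eqI[of _ _ "x \<oplus>\<^bsub>M\<^esub> x'"]) (simp_all add: fD(3) f0a)
    next
      fix c y assume "y \<in> ?H0"
      then obtain x where "x \<in> carrier M" "f0 x = 0" "y = f x" by auto
      then show "sc c \<odot>\<^bsub>N\<^esub> y \<in> ?H0"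
        by (intro image_eqI[of _ _ "sc c \<odot>\<^bsub>M\<^esub> x"]) (simp_all add: fD(4) f0s M.smult_closed)
    qed
    have fx2: "f x2 \<in> carrier N" by (rule fD(1)[OF x2(1)])
    have "f x2 \<notin> ?H0"
    proof
      assume "f x2 \<in> ?H0"
      then obtain x where "x \<in> carrier M" "f0 x = 0" "f x2 = f x" by auto
      then show False using inj x2 by (metis inj_onD zero_neq_one)
    qed
    from functional_exists[OF N H0 fx2 this] obtain g
      where g: "functional N g" "\<forall>x\<in>?H0. g x = 0" "g (f x2) = 1" by (elim exE conjE) (rule that)
    have ga: "g (x \<oplus>\<^bsub>N\<^esub> y) = g x + g y" if "x \<in> carrier N" "y \<in> carrier N" for x y
      using g(1) that unfolding functional_def by simp
    have gs: "g (sc c \<odot>\<^bsub>N\<^esub> x) = c * g x" if "x \<in> carrier N" for x c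
      using g(1) that unfolding functional_def by simp
    have gf: "g (f x) = f0 x" if x: "x \<in> carrier M" for x
    proof -
      define y where "y = x \<oplus>\<^bsub>M\<^esub> sc (- f0 x) \<odot>\<^bsub>M\<^esub> x2"
      have s: "sc c \<odot>\<^bsub>M\<^esub> x2 \<in> carrier M" for c using x2(1) by (simp add: M.smult_closed)
      have y: "y \<in> carrier M" "f0 y = 0" using x s x2 by (simp_all add: y_def f0a f0s)
      then have "g (f y) = 0" using g(2) by simp
      moreover have "f y = f x \<oplus>\<^bsub>N\<^esub> sc (- f0 x) \<odot>\<^bsub>N\<^esub> f x2"
        unfolding y_def fD(3)[OF x s] fD(4)[OF gens_closed(3) x2(1)] ..
      ultimately have "g (f x) + (- f0 x) * g (f x2) = 0"
        using ga[OF fD(1)[OF x] N.smult_closed[OF gens_closed(3) fx2]] gs[OF fx2] by simp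
      then show ?thesis using g(3) by simp
    qed
    let ?l = "restrict (to_interval N ?p g) (carrier N)"
    have l: "?l \<in> mod_hom A N (mdl {?p})"
    proof (rule to_interval_hom[OF N p g(1)])
      fix j x assume "m < j" "x \<in> carrier N"
      then have "ee (vtx s u m) \<odot>\<^bsub>N\<^esub> (aa j \<odot>\<^bsub>N\<^esub> x) = \<zero>\<^bsub>N\<^esub>"
        using ee_aa_zero[OF p no, of j] by (simp flip: N.smult_assoc1)
      then show "g (ee (vtx s u m) \<odot>\<^bsub>N\<^esub> (aa j \<odot>\<^bsub>N\<^esub> x)) = 0" using functional_zero[OF N g(1)] by simp
    qed
    show ?thesis
    proof (intro bexI[OF _ l] ballI)
      fix x assume x: "x \<in> carrier M"
      show "?l (f x) = h x"
      proof (rule interval_eqI[OF mod_homD(1)[OF l fD(1)[OF x]] hD(1)[OF x]])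
        fix t assume t: "t \<le> snd ?p"
        have "ee (vtx s u m) \<odot>\<^bsub>N\<^esub> (aa (m - t) \<odot>\<^bsub>N\<^esub> f x) = f (ee (vtx s u m) \<odot>\<^bsub>M\<^esub> (aa (m - t) \<odot>\<^bsub>M\<^esub> x))"
          using x by (simp add: fD(4) M.smult_closed)
        then have "to_interval N ?p g (f x) (enc ?p t) = f0 (ee (vtx s u m) \<odot>\<^bsub>M\<^esub> (aa (m - t) \<odot>\<^bsub>M\<^esub> x))"
          using t x by (simp add: to_interval_enc gf M.smult_closed)
        then show "?l (f x) (enc ?p t) = h x (enc ?p t)" using h_f0[OF x, of t] t fD(1)[OF x] by simp
      qed
    qed
  qed
qed

text \<open>Otherwise the interval module of \<open>(u, Suc m)\<close> maps onto that of
  \<open>(u, m)\<close>. A lift has an image killed by \<open>aa (Suc m)\<close>; but in the longer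
  module this forces the first coordinate to vanish, and the generator is not reached.\<close>

lemma projective_interval_only:
  fixes P :: "('a, nat \<Rightarrow> 'k) module"
  assumes p: "(u, m) \<in> W" and P: "left_module A P" "projective_module A P" and iso: "mod_iso A P (mdl {(u, m)})"
  shows "(u, Suc m) \<notin> W"
proof
  assume q: "(u, Suc m) \<in> W"
  let ?p = "(u, m)" and ?q = "(u, Suc m)"
  have pW: "{?p} \<subseteq> W" and qW: "{?q} \<subseteq> W" using p q by auto
  note lp = lm_interval[OF p] and lq = lm_interval[OF q]
  interpret Ip: left_module A "mdl {(u, m)}" by (rule lp)
  interpret Iq: left_module A "mdl {(u, Suc m)}" by (rule lq)
  obtain h where h: "h \<in> mod_hom A P (mdl {?p})" "bij_betw h (carrier P) (carrier (mdl {?p}))"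
    using iso unfolding mod_iso_def by auto
  note b0 = bas0_carrier[of ?p 1]
  have ez: "ee u \<odot>\<^bsub>mdl {?p}\<^esub> bas ?p 0 1 = bas ?p 0 1" using ee_bas0[OF p, of 1] by simp
  let ?f = "restrict (from_interval (mdl {?p}) ?q (bas ?p 0 1)) (carrier (mdl {?q}))"
  have top: "aa (Suc (Suc m)) \<odot>\<^bsub>mdl {?p}\<^esub> (ee u \<odot>\<^bsub>mdl {?p}\<^esub> bas ?p 0 1) = \<zero>\<^bsub>mdl {?p}\<^esub>"
    unfolding ez using aa_bas0_zero[OF p, of "Suc (Suc m)" 1] by simp
  have f: "?f \<in> mod_hom A (mdl {?q}) (mdl {?p})" by (rule from_interval_hom[OF lp q b0 top])
  have f0: "?f z (enc ?p 0) = z (enc ?q 0)" if "z \<in> carrier (mdl {?q})" for z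
    using that W_head[OF p, of 0] by (simp add: from_interval_def ez mdl_smult el)
  have fs: "?f ` carrier (mdl {?q}) = carrier (mdl {?p})"
  proof (rule submodule_interval_top[OF p])
    show "submodule (?f ` carrier (mdl {?q})) A (mdl {?p})"
      by (rule submodule_image[OF lq lp f Iq.carrier_submodule])
    show "?f (bas ?q 0 1) \<in> ?f ` carrier (mdl {?q})" by (rule imageI[OF bas0_carrier])
    show "?f (bas ?q 0 1) (enc ?p 0) \<noteq> 0" unfolding f0[OF bas0_carrier] by simp
  qed
  have "\<exists>l\<in>mod_hom A P (mdl {?q}). \<forall>x\<in>carrier P. ?f (l x) = h x"
    by (rule P(2)[unfolded projective_module_def, rule_format, OF f h(1)])
       (intro conjI fg_module_mdl[OF pW] fg_module_mdl[OF qW] fs)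
  then obtain l where l: "l \<in> mod_hom A P (mdl {?q})" "\<forall>x\<in>carrier P. ?f (l x) = h x"
    by (elim bexE) (rule that)
  have "bas ?p 0 1 \<in> h ` carrier P" using h(2) b0 by (simp add: bij_betw_def)
  then obtain y where y: "y \<in> carrier P" "bas ?p 0 1 = h y" by (elim imageE)
  interpret P: left_module A P by fact
  have "h (aa (Suc m) \<odot>\<^bsub>P\<^esub> y) = \<zero>\<^bsub>mdl {?p}\<^esub>"
    using mod_homD(4)[OF h(1) gens_closed(1) y(1)] aa_bas0_zero[OF p, of "Suc m" 1] y(2) by simp
  then have "aa (Suc m) \<odot>\<^bsub>P\<^esub> y = \<zero>\<^bsub>P\<^esub>"
    using h(2) mod_hom_inj_iff[OF P(1) lp h(1)] y(1) by (simp add: bij_betw_def P.smult_closed)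
  then have "aa (Suc m) \<odot>\<^bsub>mdl {?q}\<^esub> l y = (\<lambda>i. 0)"
    using mod_homD(4)[OF l(1) gens_closed(1) y(1), of "Suc m"] mod_hom_zero[OF P(1) lq l(1)] by simp
  then have "l y (enc ?q 0) = 0"
    using mdl_aa[OF qW mod_homD(1)[OF l(1) y(1)], of "Suc m" ?q "Suc m"] by simp
  moreover have "?f (l y) (enc ?p 0) = 1" using bspec[OF l(2) y(1)] y(2)[symmetric] by simp
  ultimately show False using f0[OF mod_homD(1)[OF l(1) y(1)]] by simp
qed

text \<open>Otherwise the module of \<open>(u, m)\<close> is the radical of that of
  \<open>(u', Suc m)\<close>. Extending the isomorphism to the longer module would express the socle
  as \<open>aa (Suc m)\<close> times an element of \<open>P\<close>, and \<open>aa (Suc m)\<close>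
  kills \<open>P\<close>.\<close>

lemma injective_interval_only:
  fixes P :: "('a, nat \<Rightarrow> 'k) module"
  assumes p: "(u, m) \<in> W" and P: "left_module A P" "injective_module A P" and iso: "mod_iso A P (mdl {(u, m)})"
    and u': "vtx s u' 1 = u"
  shows "(u', Suc m) \<notin> W"
proof
  assume q: "(u', Suc m) \<in> W"
  let ?p = "(u, m)" and ?q = "(u', Suc m)"
  have pW: "{?p} \<subseteq> W" and qW: "{?q} \<subseteq> W" using p q by auto
  note lp = lm_interval[OF p] and lq = lm_interval[OF q]
  interpret Ip: left_module A "mdl {(u, m)}" by (rule lp)
  interpret Iq: left_module A "mdl {(u', Suc m)}" by (rule lq)
  interpret P: left_module A P by fact
  obtain k where k: "k \<in> mod_hom A P (mdl {?p})" "bij_betw k (carrier P) (carrier (mdl {?p}))"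
    using iso unfolding mod_iso_def by auto
  obtain h where h: "h \<in> mod_hom A (mdl {?p}) P" "bij_betw h (carrier (mdl {?p})) (carrier P)"
    using mod_iso_sym[OF P(1) lp iso] unfolding mod_iso_def by auto
  let ?b = "bas ?q (Suc 0) 1"
  have b: "?b \<in> carrier (mdl {?q})" by (simp add: bas_carrier)
  have eb: "ee u \<odot>\<^bsub>mdl {?q}\<^esub> ?b = ?b" by (rule enc_ext) (use u' in \<open>simp add: mdl_ee[OF qW b]\<close>)
  have top: "aa (Suc m) \<odot>\<^bsub>mdl {?q}\<^esub> (ee u \<odot>\<^bsub>mdl {?q}\<^esub> ?b) = \<zero>\<^bsub>mdl {?q}\<^esub>"
    unfolding eb by (simp, rule enc_ext) (auto simp: mdl_aa[OF qW b])
  let ?i = "restrict (from_interval (mdl {?q}) ?p ?b) (carrier (mdl {?p}))"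
  have i: "?i \<in> mod_hom A (mdl {?p}) (mdl {?q})" by (rule from_interval_hom[OF lq p b top])
  have bm: "bas ?p m 1 \<in> carrier (mdl {?p})" by (simp add: bas_carrier)
  have ib: "?i (bas ?p m 1) = bas ?q (Suc m) 1"
    using from_interval_bas[OF lq p b _ top, of m] bm aa_bas[OF qW, of ?q "Suc 0" m 1] unfolding eb by simp
  have inj: "inj_on ?i (carrier (mdl {?p}))"
  proof (rule ccontr)
    assume "\<not> ?thesis"
    then obtain x where x: "x \<in> carrier (mdl {?p})" "?i x = \<zero>\<^bsub>mdl {?q}\<^esub>" "x \<noteq> \<zero>\<^bsub>mdl {?p}\<^esub>"
      using mod_hom_inj_iff[OF lp lq i] by auto
    let ?K = "{x \<in> carrier (mdl {?p}). ?i x = \<zero>\<^bsub>mdl {?q}\<^esub>}"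
    have "bas ?p (snd ?p) 1 \<in> ?K"
    proof (rule submodule_interval_nonzero[OF p])
      show "submodule ?K A (mdl {?p})" by (rule submodule_kernel[OF lp lq i])
      have xK: "x \<in> ?K" by (intro CollectI conjI x(1,2))
      show "?K \<noteq> {\<lambda>i. 0}"
      proof
        assume "?K = {\<lambda>i. 0}"
        with xK have "x = (\<lambda>i. 0)" by (simp only: singleton_iff)
        then show False using x(3) by simp
      qed
    qed
    then have "?i (bas ?p m 1) = (\<lambda>i. 0)" by (simp only: mem_Collect_eq snd_conv mdl_zero)
    then have "bas ?q (Suc m) (1::'k) = (\<lambda>i. 0)" by (simp only: ib)
    then show False using bas_nonzero[of 1 ?q "Suc m"] by simp
  qed
  have "\<exists>l\<in>mod_hom A (mdl {?q}) P. \<forall>x\<in>carrier (mdl {?p}). l (?i x) = h x"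
    by (rule P(2)[unfolded injective_module_def, rule_format, OF i h(1)])
       (intro conjI fg_module_mdl[OF pW] fg_module_mdl[OF qW] inj)
  then obtain l where l: "l \<in> mod_hom A (mdl {?q}) P" "\<forall>x\<in>carrier (mdl {?p}). l (?i x) = h x"
    by (elim bexE) (rule that)
  have b0: "bas ?q 0 1 \<in> carrier (mdl {?q})" by (rule bas0_carrier)
  have "bas ?q (Suc m) 1 = aa (Suc m) \<odot>\<^bsub>mdl {?q}\<^esub> bas ?q 0 1" using aa_bas[OF qW, of ?q 0 "Suc m" 1] by simp
  then have hb: "h (bas ?p m 1) = aa (Suc m) \<odot>\<^bsub>P\<^esub> l (bas ?q 0 1)"
    using bspec[OF l(2) bm] unfolding ib using mod_homD(4)[OF l(1) gens_closed(1) b0] by simp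
  note kc = mod_homD(1)[OF k(1) mod_homD(1)[OF l(1) b0]]
  have "k (h (bas ?p m 1)) = aa (Suc m) \<odot>\<^bsub>mdl {?p}\<^esub> k (l (bas ?q 0 1))"
    unfolding hb by (rule mod_homD(4)[OF k(1) gens_closed(1) mod_homD(1)[OF l(1) b0]])
  also have "\<dots> = (\<lambda>i. 0)"
  proof (rule enc_ext)
    fix w t
    show "(aa (Suc m) \<odot>\<^bsub>mdl {?p}\<^esub> k (l (bas ?q 0 1))) (enc w t) = 0"
    proof (cases "w = ?p")
      case True
      then show ?thesis by (auto simp: mdl_aa[OF pW kc])
    next
      case False
      have z: "k (l (bas ?q 0 1)) (enc w r) = 0" for r using mdl_D(1)[OF kc, of w r] False by blast
      show ?thesis by (simp only: mdl_aa[OF pW kc] z if_cancel)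
    qed
  qed
  finally have kh: "k (h (bas ?p m 1)) = \<zero>\<^bsub>mdl {?p}\<^esub>" by simp
  have inj_k: "\<forall>x\<in>carrier P. k x = \<zero>\<^bsub>mdl {?p}\<^esub> \<longrightarrow> x = \<zero>\<^bsub>P\<^esub>"
    using k(2) unfolding mod_hom_inj_iff[OF P(1) lp k(1), symmetric] bij_betw_def by (rule conjunct1)
  have inj_h: "\<forall>x\<in>carrier (mdl {?p}). h x = \<zero>\<^bsub>P\<^esub> \<longrightarrow> x = \<zero>\<^bsub>mdl {?p}\<^esub>"
    using h(2) unfolding mod_hom_inj_iff[OF lp P(1) h(1), symmetric] bij_betw_def by (rule conjunct1)
  have "h (bas ?p m 1) = \<zero>\<^bsub>P\<^esub>" by (rule mp[OF bspec[OF inj_k mod_homD(1)[OF h(1) bm]] kh])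
  then have "bas ?p m 1 = \<zero>\<^bsub>mdl {?p}\<^esub>" by (rule mp[OF bspec[OF inj_h bm]])
  then show False using bas_nonzero[of 1 ?p m] by simp
qed

theorem projective_injective_maximal:
  fixes P :: "('a, nat \<Rightarrow> 'k) module"
  assumes "p \<in> W" "left_module A P" "projective_module A P" "injective_module A P" "mod_iso A P (mdl {p})"
  shows "p \<in> maximal"
  using projective_interval_only[of "fst p" "snd p" P] injective_interval_only[of "fst p" "snd p" P] assms
  unfolding maximal_def by auto

theorem maximal_projective_injective:
  assumes "p \<in> maximal"
  shows "projective_module A (mdl {p})" "injective_module A (mdl {p})"
proof -
  obtain u m where p: "p = (u, m)" by (cases p)
  note M = maximalD[OF assms[unfolded p]]
  show "projective_module A (mdl {p})" unfolding p by (rule projective_interval[OF M(1,2)])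
  show "injective_module A (mdl {p})" unfolding p by (rule injective_interval[OF M(1)]) (rule M(3))
qed

section \<open>Simple modules, lengths, socles and tops\<close>

lemma simple_indecomposable:
  assumes "left_module A N" "simple_module A N"
  shows "indecomposable A N"
proof -
  interpret N: left_module A N by fact
  show ?thesis unfolding indecomposable_def
  proof (intro conjI allI impI)
    show "carrier N \<noteq> {\<zero>\<^bsub>N\<^esub>}" using assms(2) unfolding simple_module_def by simp
    fix U X assume *: "submodule U A N \<and> submodule X A N \<and> U \<inter> X = {\<zero>\<^bsub>N\<^esub>} \<and> U <+>\<^bsub>N\<^esub> X = carrier N"
    have "U = {\<zero>\<^bsub>N\<^esub>} \<or> U = carrier N" using assms(2) * unfolding simple_module_def by simp
    moreover have "X = {\<zero>\<^bsub>N\<^esub>}" if "U = carrier N"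
      using * that N.left_submoduleD(1)[of X] by auto
    ultimately show "U = {\<zero>\<^bsub>N\<^esub>} \<or> X = {\<zero>\<^bsub>N\<^esub>}" by auto
  qed
qed

lemma simple_classification:
  assumes "left_module A N" "simple_module A N"
  shows "\<exists>v\<in>V. mod_iso A N (mdl {(v, 0)})"
proof -
  obtain p where p: "p \<in> W" "mod_iso A N (mdl {p})"
    using indecomposable_classification[OF assms(1) simple_indecomposable[OF assms]] by auto
  have "simple_module A (mdl {p})" by (rule simple_module_iso[OF assms(1) lm_interval[OF p(1)] p(2) assms(2)])
  then have p0: "snd p = 0" using simple_interval_iff[OF p(1)] by simp
  obtain v k where vk: "p = (v, k)" by (cases p)
  have "p = (v, 0)" using vk p0 by simp
  then show ?thesis using p W_vertex[of v 0] by (intro bexI[of _ v]) simp_all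
qed

lemma simple_mdl: "v \<in> V \<Longrightarrow> simple_module A (mdl {(v, 0)})"
  using simple_interval_iff[OF W_trivial, of v] by simp

lemma simple_aa:
  assumes "left_module A N" "simple_module A N" "x \<in> carrier N"
  shows "aa 1 \<odot>\<^bsub>N\<^esub> x = \<zero>\<^bsub>N\<^esub>"
proof -
  interpret N: left_module A N by fact
  obtain v where v: "v \<in> V" "mod_iso A N (mdl {(v, 0)})" using simple_classification[OF assms(1,2)] by auto
  have vW: "{(v, 0)} \<subseteq> W" using W_trivial[OF v(1)] by simp
  note lv = left_module_mdl[OF vW]
  obtain h where h: "h \<in> mod_hom A N (mdl {(v, 0)})" "bij_betw h (carrier N) (carrier (mdl {(v, 0)}))"
    using v(2) unfolding mod_iso_def by auto
  have hx: "h x \<in> carrier (mdl {(v, 0)})" by (rule mod_homD(1)[OF h(1) assms(3)])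
  have "aa 1 \<odot>\<^bsub>mdl {(v, 0)}\<^esub> h x = (\<lambda>i. 0)"
  proof (rule enc_ext)
    fix w t
    show "(aa 1 \<odot>\<^bsub>mdl {(v, 0)}\<^esub> h x) (enc w t) = 0"
      using mdl_D(1)[OF hx, of w] by (cases "w = (v, 0)"; cases t) (simp_all add: mdl_aa[OF vW hx])
  qed
  then have "h (aa 1 \<odot>\<^bsub>N\<^esub> x) = \<zero>\<^bsub>mdl {(v, 0)}\<^esub>" using mod_homD(4)[OF h(1) gens_closed(1) assms(3)] by simp
  then show ?thesis
    using h(2) mod_hom_inj_iff[OF assms(1) lv h(1)] assms(3) by (simp add: bij_betw_def N.smult_closed)
qed

lemma simple_smult:
  assumes "v \<in> V"
  shows "a \<odot>\<^bsub>mdl {(v, 0)}\<^esub> bas (v, 0) 0 c = bas (v, 0) 0 (co a (v, 0) * c)"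
proof (rule enc_ext)
  fix w t
  show "(a \<odot>\<^bsub>mdl {(v, 0)}\<^esub> bas (v, 0) 0 c) (enc w t) = bas (v, 0) 0 (co a (v, 0) * c) (enc w t)"
  proof (cases "w = (v, 0)")
    case True
    then show ?thesis by (cases t) (simp_all add: mdl_smult)
  next
    case False
    then have "bas (v, 0) 0 c (enc w r) = 0" for r by (subst bas_enc) simp
    then show ?thesis using False by (simp add: mdl_smult)
  qed
qed

lemma simple_element:
  assumes "x \<in> carrier (mdl {(v, 0)})"
  shows "x = bas (v, 0) 0 (x (enc (v, 0) 0))"
  by (rule interval_eqI[OF assms bas0_carrier]) simp

end

text \<open>Lengths, socles and tops are taken of modules merely isomorphic to an interval module;
  the fixed isomorphism transports the filtration of the latter.\<close>

locale interval_copy = nakayama_algebra V s W A co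
  for V s W and A :: "('a, 'b) ring_scheme" (structure) and co :: "'a \<Rightarrow> nat \<times> nat \<Rightarrow> 'k::field" +
  fixes P :: "('a, 'm) module" and u m :: nat and f
  assumes p: "(u, m) \<in> W" and P: "left_module A P" and f: "f \<in> mod_hom A P (mdl {(u, m)})"
    and bij: "bij_betw f (carrier P) (carrier (mdl {(u, m)}))"
begin

sublocale P: left_module A P by (rule P)

definition pre :: "nat \<Rightarrow> 'm set" where
  "pre k = {x \<in> carrier P. f x \<in> flt (u, m) k}"

lemmas fD = mod_homD[OF f]
lemmas lm = lm_interval[OF p]

lemma f_surj: "y \<in> carrier (mdl {(u, m)}) \<Longrightarrow> \<exists>x\<in>carrier P. f x = y"
  using bij unfolding bij_betw_def by (metis imageE)

lemma f_zero_iff: "x \<in> carrier P \<Longrightarrow> f x = (\<lambda>i. 0) \<longleftrightarrow> x = \<zero>\<^bsub>P\<^esub>"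
  using mod_hom_inj_iff[OF P lm f] mod_hom_zero[OF P lm f] bij by (auto simp: bij_betw_def)

lemma pre_submodule: "submodule (pre k) A P"
  unfolding pre_def by (rule submodule_preimage[OF P lm f flt_submodule[OF p]])

lemma pre_0: "pre 0 = carrier P"
  unfolding pre_def flt_0 using fD(1) by auto

lemma pre_Suc_m: "pre (Suc m) = {\<zero>\<^bsub>P\<^esub>}"
  using flt_Suc[of "(u, m)"] f_zero_iff unfolding pre_def by auto

lemma submodule_pre:
  assumes "submodule U A P"
  shows "\<exists>k\<le>Suc m. U = pre k"
proof -
  have "submodule (f ` U) A (mdl {(u, m)})" by (rule submodule_image[OF P lm f assms])
  from submodule_interval[OF p this] obtain k where k: "k \<le> Suc m" "f ` U = flt (u, m) k" by auto
  have U: "x \<in> carrier P" if "x \<in> U" for x using P.left_submoduleD(1)[OF assms] that by (rule subsetD)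
  have "U = pre k"
  proof (rule equalityI; rule subsetI)
    fix x assume "x \<in> U"
    then show "x \<in> pre k" using U k(2) unfolding pre_def by auto
  next
    fix x assume x: "x \<in> pre k"
    then have "f x \<in> f ` U" using k(2) unfolding pre_def by simp
    then obtain y where y: "y \<in> U" "f x = f y" by (elim imageE)
    then show "x \<in> U" using bij U x unfolding bij_betw_def pre_def by (auto dest: inj_onD)
  qed
  then show ?thesis using k(1) by auto
qed

lemma pre_mono: "j \<le> k \<Longrightarrow> pre k \<subseteq> pre j"
  unfolding pre_def flt_def by auto

lemma pre_strict:
  assumes "t \<le> m"
  shows "\<exists>x\<in>pre t. \<forall>k>t. x \<notin> pre k"
proof -
  obtain x where x: "x \<in> carrier P" "f x = bas (u, m) t 1"
    using f_surj[of "bas (u, m) t 1"] assms by (auto simp: bas_carrier)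
  then show ?thesis using bas_flt_iff[of t "(u, m)"] assms unfolding pre_def by (intro bexI[of _ x]) auto
qed

lemma pre_subset_iff:
  assumes "j \<le> m"
  shows "pre j \<subseteq> pre k \<longleftrightarrow> k \<le> j"
  using pre_strict[OF assms] pre_mono[of k j] by (meson not_le subsetD)

text \<open>On the \<open>r\<close>-th filtration step all earlier coordinates vanish, so the
  coordinate at \<open>r\<close> only receives the contribution of the trivial path.\<close>

lemma layer_hom:
  assumes r: "r \<le> m"
  shows "restrict (\<lambda>x. bas (vtx s u r, 0) 0 (f x (enc (u, m) r))) (pre r)
    \<in> mod_hom A (P\<lparr>carrier := pre r\<rparr>) (mdl {(vtx s u r, 0)})" (is "restrict ?g _ \<in> _")
proof -
  let ?v = "vtx s u r" and ?P = "P\<lparr>carrier := pre r\<rparr>"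
  have vV: "?v \<in> V" by (rule W_tail[OF p r])
  have pP: "x \<in> carrier P" "f x \<in> carrier (mdl {(u, m)})" "i < r \<Longrightarrow> f x (enc (u, m) i) = 0" if "x \<in> pre r" for x i
    using that unfolding pre_def flt_def by auto
  have "restrict ?g (carrier ?P) \<in> mod_hom A ?P (mdl {(?v, 0)})"
  proof (rule mod_hom_restrictI[OF P.submodule_left_module[OF pre_submodule]])
    show "?g x \<in> carrier (mdl {(?v, 0)})" for x by (rule bas0_carrier)
    fix x y assume "x \<in> carrier ?P" "y \<in> carrier ?P"
    then have "f (x \<oplus>\<^bsub>P\<^esub> y) = f x \<oplus>\<^bsub>mdl {(u, m)}\<^esub> f y" using pP fD(3) by simp
    then show "?g (x \<oplus>\<^bsub>?P\<^esub> y) = ?g x \<oplus>\<^bsub>mdl {(?v, 0)}\<^esub> ?g y"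
      by (intro enc_ext) (simp add: mdl_add)
  next
    fix a x assume a: "a \<in> carrier A" and "x \<in> carrier ?P"
    then have x: "x \<in> pre r" by simp
    have "f (a \<odot>\<^bsub>P\<^esub> x) (enc (u, m) r) = (\<Sum>i\<le>r. co a (vtx s u i, r - i) * f x (enc (u, m) i))"
      unfolding fD(4)[OF a pP(1)[OF x]] using r by (simp add: mdl_smult)
    also have "\<dots> = (\<Sum>i\<le>r. if i = r then co a (?v, 0) * f x (enc (u, m) r) else 0)"
      by (rule sum.cong) (use pP(3)[OF x] in auto)
    also have "\<dots> = co a (?v, 0) * f x (enc (u, m) r)" by (simp add: sum.delta)
    finally show "?g (a \<odot>\<^bsub>?P\<^esub> x) = a \<odot>\<^bsub>mdl {(?v, 0)}\<^esub> ?g x" by (simp add: simple_smult[OF vV])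
  qed
  then show ?thesis by simp
qed

lemma layer_surj:
  assumes r: "r \<le> m"
  shows "restrict (\<lambda>x. bas (vtx s u r, 0) 0 (f x (enc (u, m) r))) (pre r) ` pre r = carrier (mdl {(vtx s u r, 0)})"
    (is "restrict ?g _ ` _ = _")
proof (rule equalityI; rule subsetI)
  fix y assume "y \<in> restrict ?g (pre r) ` pre r"
  then show "y \<in> carrier (mdl {(vtx s u r, 0)})" using bas0_carrier by auto
next
  fix y assume y: "y \<in> carrier (mdl {(vtx s u r, 0)})"
  let ?c = "y (enc (vtx s u r, 0) 0)"
  obtain x where x: "x \<in> carrier P" "f x = bas (u, m) r ?c"
    using f_surj[of "bas (u, m) r ?c"] r by (auto simp: bas_carrier)
  have "x \<in> pre r" unfolding pre_def flt_def using x fD(1)[OF x(1)] by auto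
  moreover have "?g x = y" using x(2) simple_element[OF y] by simp
  ultimately show "y \<in> restrict ?g (pre r) ` pre r" by (intro image_eqI[of _ _ x]) simp_all
qed

lemma layer_kernel:
  assumes r: "r \<le> m"
  shows "pre (Suc r) = {x \<in> pre r. restrict (\<lambda>x. bas (vtx s u r, 0) 0 (f x (enc (u, m) r))) (pre r) x = (\<lambda>i. 0)}"
    (is "_ = {x \<in> pre r. restrict ?g _ x = _}")
proof -
  have g: "?g x = (\<lambda>i. 0) \<longleftrightarrow> f x (enc (u, m) r) = 0" for x
  proof
    assume "?g x = (\<lambda>i. 0)"
    then show "f x (enc (u, m) r) = 0" using bas_nonzero[of "f x (enc (u, m) r)"] by blast
  next
    assume 0: "f x (enc (u, m) r) = 0"
    show "?g x = (\<lambda>i. 0)" unfolding 0 by (rule enc_ext) simp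
  qed
  have "{x \<in> pre r. restrict ?g (pre r) x = (\<lambda>i. 0)} = {x \<in> pre r. ?g x = (\<lambda>i. 0)}" by auto
  also have "\<dots> = pre (Suc r)" unfolding g unfolding pre_def flt_def by (auto simp: less_Suc_eq)
  finally show ?thesis ..
qed

lemma layer_iso:
  assumes r: "r \<le> m"
  shows "mod_iso A (quotient_module (P\<lparr>carrier := pre r\<rparr>) (pre (Suc r))) (mdl {(vtx s u r, 0)})"
proof (rule first_isomorphism[OF P.submodule_left_module[OF pre_submodule] _ layer_hom[OF r]])
  show "left_module A (mdl {(vtx s u r, 0)})" by (rule lm_interval[OF W_trivial[OF W_tail[OF p r]]])
qed (use layer_surj[OF r] layer_kernel[OF r] in simp_all)

lemma submodule_in_submodule:
  assumes "submodule X A P" "submodule U A P" "U \<subseteq> X"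
  shows "submodule U A (P\<lparr>carrier := X\<rparr>)"
proof -
  interpret X: left_module A "P\<lparr>carrier := X\<rparr>" by (rule P.submodule_left_module[OF assms(1)])
  show ?thesis by (rule X.left_submoduleI) (use P.left_submoduleD[OF assms(2)] assms(3) in simp_all)
qed

lemma composition_series_exists: "composition_series A P (Suc m) (\<lambda>k. pre (Suc m - k))"
  unfolding composition_series_def
proof (intro conjI allI impI)
  show "pre (Suc m - 0) = {\<zero>\<^bsub>P\<^esub>}" using pre_Suc_m by simp
  show "pre (Suc m - Suc m) = carrier P" using pre_0 by simp
  show "submodule (pre (Suc m - i)) A P" for i by (rule pre_submodule)
  fix i assume i: "i < Suc m"
  show "pre (Suc m - i) \<subseteq> pre (Suc m - Suc i)" by (rule pre_mono) simp
  define r where "r = m - i"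
  have r: "r \<le> m" "Suc m - i = Suc r" "Suc m - Suc i = r" using i by (auto simp: r_def)
  have vV: "vtx s u r \<in> V" by (rule W_tail[OF p r(1)])
  interpret X: left_module A "P\<lparr>carrier := pre r\<rparr>" by (rule P.submodule_left_module[OF pre_submodule])
  have "submodule (pre (Suc r)) A (P\<lparr>carrier := pre r\<rparr>)"
    by (rule submodule_in_submodule[OF pre_submodule pre_submodule pre_mono]) simp
  note lq = X.left_module_quotient_module[OF this]
  note lv = lm_interval[OF W_trivial[OF vV]]
  show "simple_module A (quotient_module (P\<lparr>carrier := pre (Suc m - Suc i)\<rparr>) (pre (Suc m - i)))"
    unfolding r(2,3) by (rule simple_module_iso[OF lv lq mod_iso_sym[OF lq lv layer_iso[OF r(1)]] simple_mdl[OF vV]])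
qed

text \<open>Takes the place of the Jordan-Hoelder theorem: \<open>aa 1\<close> kills simple modules,
  hence \<open>aa l\<close> kills a module with a series of length \<open>l\<close>, whereas
  \<open>aa m\<close> does not kill \<open>P\<close>.\<close>

lemma composition_series_length:
  assumes "composition_series A P l U"
  shows "Suc m \<le> l"
proof (rule ccontr)
  assume "\<not> Suc m \<le> l"
  then have lm: "l \<le> m" by simp
  have U0: "U 0 = {\<zero>\<^bsub>P\<^esub>}" and Ul: "U l = carrier P" and sub: "\<And>i. i \<le> l \<Longrightarrow> submodule (U i) A P"
    and inc: "\<And>i. i < l \<Longrightarrow> U i \<subseteq> U (Suc i)"
    and simple: "\<And>i. i < l \<Longrightarrow> simple_module A (quotient_module (P\<lparr>carrier := U (Suc i)\<rparr>) (U i))"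
    using assms unfolding composition_series_def by auto
  have step: "aa 1 \<odot>\<^bsub>P\<^esub> x \<in> U i" if i: "i < l" and x: "x \<in> U (Suc i)" for i x
  proof -
    let ?X = "P\<lparr>carrier := U (Suc i)\<rparr>"
    have sX: "submodule (U (Suc i)) A P" and sU: "submodule (U i) A P" using sub i by auto
    interpret X: left_module A ?X by (rule P.submodule_left_module[OF sX])
    have sUX: "submodule (U i) A ?X" by (rule submodule_in_submodule[OF sX sU inc[OF i]])
    have xc: "x \<in> carrier ?X" using x by simp
    have "aa 1 \<odot>\<^bsub>quotient_module ?X (U i)\<^esub> (U i +>\<^bsub>?X\<^esub> x) = \<zero>\<^bsub>quotient_module ?X (U i)\<^esub>"
      by (rule simple_aa[OF X.left_module_quotient_module[OF sUX] simple[OF i] X.coset_in_quotient[OF xc]])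
    then have eq: "U i +>\<^bsub>?X\<^esub> (aa 1 \<odot>\<^bsub>?X\<^esub> x) = U i"
      unfolding X.smult_coset[OF sUX gens_closed(1) xc] by (simp add: quotient_module_def)
    interpret U: abelian_subgroup "U i" ?X by (rule X.submodule_abelian_subgroup[OF sUX])
    have "aa 1 \<odot>\<^bsub>?X\<^esub> x \<in> U i +>\<^bsub>?X\<^esub> (aa 1 \<odot>\<^bsub>?X\<^esub> x)"
      by (rule U.a_rcos_self[OF X.smult_closed[OF gens_closed(1) xc]])
    then show ?thesis unfolding eq by simp
  qed
  have pow: "aa k \<odot>\<^bsub>P\<^esub> x \<in> U (l - k)" if "k \<le> l" "x \<in> carrier P" for k x
    using that(1)
  proof (induction k)
    case 0
    then show ?case using that(2) Ul by (simp add: aa_0 P.smult_one)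
  next
    case (Suc k)
    have "aa 1 \<odot>\<^bsub>P\<^esub> (aa k \<odot>\<^bsub>P\<^esub> x) \<in> U (l - Suc k)"
      by (rule step) (use Suc in \<open>simp_all add: Suc_diff_Suc\<close>)
    then show ?case using that(2) aa_add[of 1 k] by (simp flip: P.smult_assoc1)
  qed
  obtain x where x: "x \<in> carrier P" "f x = bas (u, m) 0 1" using f_surj[OF bas0_carrier] by auto
  have "aa l \<odot>\<^bsub>P\<^esub> x = \<zero>\<^bsub>P\<^esub>" using pow[OF order_refl x(1)] U0 by simp
  then have "aa l \<odot>\<^bsub>mdl {(u, m)}\<^esub> bas (u, m) 0 1 = (\<lambda>i. 0)"
    using fD(4)[OF gens_closed(1) x(1), of l] x(2) mod_hom_zero[OF P lm_interval[OF p] f] by simp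
  moreover have "aa l \<odot>\<^bsub>mdl {(u, m)}\<^esub> bas (u, m) 0 1 = bas (u, m) l 1"
    using aa_bas[of "{(u, m)}" "(u, m)" 0 l 1] p lm by simp
  ultimately show False using bas_nonzero[of 1 "(u, m)" l] by simp
qed

theorem module_length_interval: "module_length A P = Suc m"
  unfolding module_length_def
proof (rule Least_equality)
  show "\<exists>U. composition_series A P (Suc m) U" by (rule exI[of _ "\<lambda>k. pre (Suc m - k)"]) (rule composition_series_exists)
qed (use composition_series_length in auto)

text \<open>Every submodule is some \<open>pre k\<close>, and every nonzero one contains
  \<open>pre m\<close>, which is the last layer. So \<open>pre m\<close> is the only simple
  submodule.\<close>

theorem socle_interval: "mod_iso A (socle A P) (mdl {(vtx s u m, 0)})" "left_module A (socle A P)"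
proof -
  have vV: "vtx s u m \<in> V" by (rule W_tail[OF p order_refl])
  note lv = lm_interval[OF W_trivial[OF vV]]
  note lZ = P.submodule_left_module[OF pre_submodule[of m]]
  let ?G = "restrict (\<lambda>x. bas (vtx s u m, 0) 0 (f x (enc (u, m) m))) (pre m)"
  have "inj_on ?G (carrier (P\<lparr>carrier := pre m\<rparr>))"
    unfolding mod_hom_inj_iff[OF lZ lv layer_hom[OF order_refl]]
  proof (intro ballI impI)
    fix x assume x: "x \<in> carrier (P\<lparr>carrier := pre m\<rparr>)" "?G x = \<zero>\<^bsub>mdl {(vtx s u m, 0)}\<^esub>"
    then have "x \<in> pre (Suc m)" unfolding layer_kernel[OF order_refl] by simp
    then show "x = \<zero>\<^bsub>P\<lparr>carrier := pre m\<rparr>\<^esub>" using pre_Suc_m by simp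
  qed
  moreover have "?G ` carrier (P\<lparr>carrier := pre m\<rparr>) = carrier (mdl {(vtx s u m, 0)})"
    using layer_surj[OF order_refl] by simp
  ultimately have isoZ: "mod_iso A (P\<lparr>carrier := pre m\<rparr>) (mdl {(vtx s u m, 0)})"
    unfolding mod_iso_def bij_betw_def by (intro bexI[OF _ layer_hom[OF order_refl]] conjI)
  have simpZ: "simple_module A (P\<lparr>carrier := pre m\<rparr>)"
    by (rule simple_module_iso[OF lv lZ mod_iso_sym[OF lZ lv isoZ] simple_mdl[OF vV]])
  have only: "U \<subseteq> pre m" if U: "submodule U A P" "simple_module A (P\<lparr>carrier := U\<rparr>)" for U
  proof -
    obtain k where k: "k \<le> Suc m" "U = pre k" using submodule_pre[OF U(1)] by auto
    have "k \<noteq> Suc m" using U(2) pre_Suc_m k(2) unfolding simple_module_def by auto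
    then have km: "k \<le> m" using k(1) by simp
    have "submodule (pre m) A (P\<lparr>carrier := U\<rparr>)"
      by (rule submodule_in_submodule[OF U(1) pre_submodule]) (use k(2) pre_mono[OF km] in simp)
    then have "pre m = {\<zero>\<^bsub>P\<^esub>} \<or> pre m = U" using U(2) unfolding simple_module_def by auto
    moreover have "pre m \<noteq> {\<zero>\<^bsub>P\<^esub>}" using simpZ unfolding simple_module_def by simp
    ultimately show ?thesis by simp
  qed
  have "\<Inter>{X. submodule X A P \<and> (\<forall>U. submodule U A P \<and> simple_module A (P\<lparr>carrier := U\<rparr>) \<longrightarrow> U \<subseteq> X)} = pre m"
  proof (rule equalityI)
    show "\<Inter>{X. submodule X A P \<and> (\<forall>U. submodule U A P \<and> simple_module A (P\<lparr>carrier := U\<rparr>) \<longrightarrow> U \<subseteq> X)} \<subseteq> pre m"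
      by (rule Inter_lower) (use pre_submodule only in auto)
    show "pre m \<subseteq> \<Inter>{X. submodule X A P \<and> (\<forall>U. submodule U A P \<and> simple_module A (P\<lparr>carrier := U\<rparr>) \<longrightarrow> U \<subseteq> X)}"
      by (rule Inter_greatest) (use pre_submodule simpZ in auto)
  qed
  then have eq: "socle A P = P\<lparr>carrier := pre m\<rparr>" unfolding socle_def by simp
  show "mod_iso A (socle A P) (mdl {(vtx s u m, 0)})" "left_module A (socle A P)" unfolding eq by (rule isoZ, rule lZ)
qed

text \<open>By uniseriality \<open>pre 1\<close> is the only maximal submodule, hence the radical,
  and the quotient by it is the layer with \<open>r = 0\<close>.\<close>

theorem top_interval: "mod_iso A (top_module A P) (mdl {(u, 0)})" "left_module A (top_module A P)"
proof -
  have ne: "pre 1 \<noteq> carrier P" using pre_subset_iff[of 0 1] pre_0 by auto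
  have max1: "U = pre 1 \<or> U = carrier P" if "submodule U A P" "pre 1 \<subseteq> U" for U
  proof -
    have "\<exists>k\<le>Suc m. U = pre k" by (rule submodule_pre[OF that(1)])
    then obtain k where k: "k \<le> Suc m" "U = pre k" by auto
    show ?thesis
    proof (cases "k \<le> 1")
      case True
      then have "k = 0 \<or> k = 1" by auto
      then show ?thesis using k(2) pre_0 by auto
    next
      case False
      then have "U = pre 1" using that(2) pre_mono[of 1 k] k(2) by auto
      then show ?thesis ..
    qed
  qed
  have only: "X = pre 1" if X: "submodule X A P" "X \<noteq> carrier P" "\<forall>U. submodule U A P \<and> X \<subseteq> U \<longrightarrow> U = X \<or> U = carrier P" for X
  proof -
    obtain k where k: "k \<le> Suc m" "X = pre k" using submodule_pre[OF X(1)] by auto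
    have "1 \<le> k" using X(2) k(2) pre_0 by (cases k) auto
    then have "X \<subseteq> pre 1" using pre_mono k(2) by simp
    then have "pre 1 = X \<or> pre 1 = carrier P" using X(3) pre_submodule[of 1] by simp
    then show ?thesis using ne by simp
  qed
  have "{X. submodule X A P \<and> X \<noteq> carrier P \<and> (\<forall>U. submodule U A P \<and> X \<subseteq> U \<longrightarrow> U = X \<or> U = carrier P)} = {pre 1}"
    (is "?L = _")
  proof (rule equalityI; rule subsetI)
    fix X assume "X \<in> ?L"
    then show "X \<in> {pre 1}" using only[of X] by simp
  next
    fix X assume "X \<in> {pre 1}"
    then have "X = pre 1" by simp
    then show "X \<in> ?L" using pre_submodule[of 1] ne max1 by simp
  qed
  then have "radical A P = carrier P \<inter> pre 1" unfolding radical_def by simp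
  then have rad: "radical A P = pre 1" using P.left_submoduleD(1)[OF pre_submodule[of 1]] by auto
  show "mod_iso A (top_module A P) (mdl {(u, 0)})" "left_module A (top_module A P)"
    unfolding top_module_def rad
    using layer_iso[of 0] P.left_module_quotient_module[OF pre_submodule[of 1]] by (simp_all add: pre_0)
qed

end

section \<open>Simple modules generated by the injectives or cogenerated by the projectives\<close>

context nakayama_algebra
begin

abbreviation dual :: "('a, 'a \<Rightarrow> 'k) module" where "dual \<equiv> dual_module sc A"

lemma dualI:
  assumes "\<And>x y. x \<in> carrier A \<Longrightarrow> y \<in> carrier A \<Longrightarrow> \<xi> (x \<oplus> y) = \<xi> x + \<xi> y"
    and "\<And>c x. x \<in> carrier A \<Longrightarrow> \<xi> (sc c \<otimes> x) = c * \<xi> x"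
  shows "restrict \<xi> (carrier A) \<in> carrier dual"
  using assms by (simp add: dual_module_def)

lemma dualD:
  assumes "\<xi> \<in> carrier dual"
  shows "x \<in> carrier A \<Longrightarrow> y \<in> carrier A \<Longrightarrow> \<xi> (x \<oplus> y) = \<xi> x + \<xi> y"
    and "x \<in> carrier A \<Longrightarrow> \<xi> (sc c \<otimes> x) = c * \<xi> x"
    and "x \<notin> carrier A \<Longrightarrow> \<xi> x = undefined"
  using assms by (auto simp: dual_module_def extensional_def)

lemma dual_add: "\<xi> \<oplus>\<^bsub>dual\<^esub> \<eta> = restrict (\<lambda>x. \<xi> x + \<eta> x) (carrier A)"
  by (simp add: dual_module_def)

lemma dual_smult: "a \<odot>\<^bsub>dual\<^esub> \<xi> = restrict (\<lambda>x. \<xi> (x \<otimes> a)) (carrier A)"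
  by (simp add: dual_module_def)

lemma dual_add_closed:
  assumes "\<xi> \<in> carrier dual" "\<eta> \<in> carrier dual"
  shows "\<xi> \<oplus>\<^bsub>dual\<^esub> \<eta> \<in> carrier dual"
  unfolding dual_add by (rule dualI) (simp_all add: dualD[OF assms(1)] dualD[OF assms(2)] algebra_simps)

lemma dual_smult_closed:
  assumes "a \<in> carrier A" "\<xi> \<in> carrier dual"
  shows "a \<odot>\<^bsub>dual\<^esub> \<xi> \<in> carrier dual"
  unfolding dual_smult by (rule dualI) (simp_all add: dualD[OF assms(2)] assms(1) A.l_distr A.m_assoc)

lemma power_carrier: "\<xi> \<in> carrier (power_module n X) \<longleftrightarrow> \<xi> \<in> {..<n} \<rightarrow>\<^sub>E carrier X"
  by (simp add: power_module_def)

lemma power_add: "\<xi> \<oplus>\<^bsub>power_module n X\<^esub> \<eta> = (\<lambda>i\<in>{..<n}. \<xi> i \<oplus>\<^bsub>X\<^esub> \<eta> i)"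
  by (simp add: power_module_def)

lemma power_smult: "a \<odot>\<^bsub>power_module n X\<^esub> \<xi> = (\<lambda>i\<in>{..<n}. a \<odot>\<^bsub>X\<^esub> \<xi> i)"
  by (simp add: power_module_def)

text \<open>The path cannot be prolonged at its start, so a right factor acts by its coefficient at
  the trivial path there. Evaluation of functionals at the maximal path is therefore a homomorphism
  from the dual module to a simple module.\<close>

lemma mult_maximal_start:
  assumes m: "(v, m) \<in> maximal" and a: "a \<in> carrier A"
  shows "(aa m \<otimes> ee v) \<otimes> a = sc (co a (v, 0)) \<otimes> (aa m \<otimes> ee v)"
proof (rule co_inj)
  fix q assume q: "q \<in> W"
  obtain u k where uk: "q = (u, k)" by (cases q)
  have "k = m \<and> u = v" if "m \<le> k" "vtx s u (k - m) = v"
  proof -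
    have "k = m"
    proof (rule ccontr)
      assume "k \<noteq> m"
      define i where "i = k - Suc m"
      have i: "k = Suc i + m" using \<open>k \<noteq> m\<close> that(1) unfolding i_def by simp
      have "(vtx s u i, Suc m) \<in> W" using W_sub[of u k i "Suc m"] q uk i by simp
      moreover have "vtx s (vtx s u i) 1 = v" using that(2) i by simp
      ultimately show False using maximalD(3)[OF m, of "vtx s u i"] by simp
    qed
    then show ?thesis using that(2) by simp
  qed
  moreover have kW: "(u, k) \<in> W" "(u, k - m) \<in> W" using q uk W_head[of u k "k - m"] by simp_all
  have vW: "(v, 0) \<in> W" by (rule W_trivial[OF W_vertex[OF maximalD(1)[OF m]]])
  have "co ((aa m \<otimes> ee v) \<otimes> a) (u, k) = (if m \<le> k \<and> vtx s u (k - m) = v then co a (u, k - m) else 0)"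
    using a kW by (simp add: A.m_assoc co_aa_mult co_ee_mult)
  moreover have "co (sc (co a (v, 0)) \<otimes> (aa m \<otimes> ee v)) (u, k) = (if m \<le> k \<and> u = v \<and> k \<le> m then co a (v, 0) else 0)"
    using a kW vW by (simp add: co_sc_mult co_aa_mult co_gens)
  ultimately show "co ((aa m \<otimes> ee v) \<otimes> a) q = co (sc (co a (v, 0)) \<otimes> (aa m \<otimes> ee v)) q"
    unfolding uk by auto
qed (use a in simp_all)

text \<open>The mirror image at the other end: a maximal path spans a simple submodule of the
  regular module.\<close>

lemma mult_maximal_end:
  assumes m: "(u, m) \<in> maximal" and a: "a \<in> carrier A"
  shows "a \<otimes> (aa m \<otimes> ee u) = sc (co a (vtx s u m, 0)) \<otimes> (aa m \<otimes> ee u)"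
proof (rule co_inj)
  fix q assume q: "q \<in> W"
  obtain w k where wk: "q = (w, k)" by (cases q)
  have "k = m" if "m \<le> k" "w = u"
    using W_head[of u k "Suc m"] q wk that maximalD(2)[OF m] by (cases "k = m") auto
  then show "co (a \<otimes> (aa m \<otimes> ee u)) q = co (sc (co a (vtx s u m, 0)) \<otimes> (aa m \<otimes> ee u)) q"
    using q a wk W_end[OF maximalD(1)[OF m]] by (auto simp: A.m_assoc[symmetric] co_simps)
qed (use a in simp_all)

lemma simple_aa_zero:
  assumes v: "v \<in> V" and x: "x \<in> carrier (mdl {(v, 0)})"
  shows "aa 1 \<odot>\<^bsub>mdl {(v, 0)}\<^esub> x = (\<lambda>i. 0)"
  using simple_aa[OF lm_interval[OF W_trivial[OF v]] simple_mdl[OF v] x] by simp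

text \<open>If \<open>v\<close> starts a maximal path, evaluation at it maps the dual module onto
  the simple one. Otherwise the longest path starting at \<open>v\<close>, and with it each path
  starting at \<open>v\<close>, is prolonged by an arrow into \<open>v\<close>. Then the part of the
  dual module at \<open>v\<close> consists of multiples of \<open>aa 1\<close>, which vanish under
  any homomorphism to a simple module.\<close>

theorem simple_in_gen:
  assumes v: "v \<in> V"
  shows "in_gen A dual (mdl {(v, 0)}) \<longleftrightarrow> (\<exists>m. (v, m) \<in> maximal)"
proof
  let ?S = "mdl {(v, 0)}"
  assume "\<exists>m. (v, m) \<in> maximal"
  then obtain m where m: "(v, m) \<in> maximal" by auto
  let ?z = "aa m \<otimes> ee v" and ?D = "power_module 1 dual"
  let ?f = "\<lambda>\<xi>. if \<xi> \<in> carrier ?D then bas (v, 0) 0 (\<xi> 0 ?z) else undefined"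
  have z: "?z \<in> carrier A" by simp
  have D: "\<xi> 0 \<in> carrier dual" if "\<xi> \<in> carrier ?D" for \<xi>
    using that unfolding power_carrier by auto
  have "?f \<in> mod_hom A ?D ?S"
  proof (rule mod_homI)
    show "?f \<xi> \<in> carrier ?S" if "\<xi> \<in> carrier ?D" for \<xi> using that bas0_carrier by simp
    show "?f \<xi> = undefined" if "\<xi> \<notin> carrier ?D" for \<xi> using that by simp
  next
    fix \<xi> \<eta> assume *: "\<xi> \<in> carrier ?D" "\<eta> \<in> carrier ?D"
    have "\<xi> \<oplus>\<^bsub>?D\<^esub> \<eta> \<in> carrier ?D"
      unfolding power_add power_carrier using D[OF *(1)] D[OF *(2)] dual_add_closed by auto
    moreover have "(\<xi> \<oplus>\<^bsub>?D\<^esub> \<eta>) 0 ?z = \<xi> 0 ?z + \<eta> 0 ?z" using z by (simp add: power_add dual_add)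
    ultimately show "?f (\<xi> \<oplus>\<^bsub>?D\<^esub> \<eta>) = ?f \<xi> \<oplus>\<^bsub>?S\<^esub> ?f \<eta>"
      using * by (intro enc_ext) simp
  next
    fix a \<xi> assume *: "a \<in> carrier A" "\<xi> \<in> carrier ?D"
    have "a \<odot>\<^bsub>?D\<^esub> \<xi> \<in> carrier ?D"
      unfolding power_smult power_carrier using * D[OF *(2)] dual_smult_closed by auto
    moreover have "(a \<odot>\<^bsub>?D\<^esub> \<xi>) 0 ?z = co a (v, 0) * \<xi> 0 ?z"
    proof -
      have "(a \<odot>\<^bsub>?D\<^esub> \<xi>) 0 ?z = \<xi> 0 (?z \<otimes> a)" using z by (simp add: power_smult dual_smult)
      also have "\<dots> = co a (v, 0) * \<xi> 0 ?z"
        unfolding mult_maximal_start[OF m *(1)] by (rule dualD(2)[OF D[OF *(2)] z])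
      finally show ?thesis .
    qed
    ultimately show "?f (a \<odot>\<^bsub>?D\<^esub> \<xi>) = a \<odot>\<^bsub>?S\<^esub> ?f \<xi>"
      using *(2) by (simp add: simple_smult[OF v])
  qed
  moreover have "?f ` carrier ?D = carrier ?S"
  proof (rule equalityI; rule subsetI)
    fix y assume "y \<in> ?f ` carrier ?D"
    then show "y \<in> carrier ?S" using bas0_carrier by auto
  next
    fix y assume y: "y \<in> carrier ?S"
    let ?c = "y (enc (v, 0) 0)"
    define \<xi> where "\<xi> = (\<lambda>i\<in>{..<1::nat}. restrict (\<lambda>x. ?c * co x (v, m)) (carrier A))"
    have "restrict (\<lambda>x. ?c * co x (v, m)) (carrier A) \<in> carrier dual"
      by (rule dualI) (simp_all add: co_simps maximalD(1)[OF m] algebra_simps)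
    then have \<xi>: "\<xi> \<in> carrier ?D" unfolding power_carrier \<xi>_def by auto
    have "\<xi> 0 ?z = ?c" using v W_trivial[OF v] by (simp add: \<xi>_def co_simps maximalD(1)[OF m])
    then have "?f \<xi> = y" using \<xi> simple_element[OF y] by simp
    then show "y \<in> ?f ` carrier ?D" using \<xi> by (intro image_eqI[of _ _ \<xi>]) simp_all
  qed
  ultimately show "in_gen A dual ?S" unfolding in_gen_def by (intro exI[of _ 1] bexI[of _ ?f] conjI)
next
  let ?S = "mdl {(v, 0)}"
  assume "in_gen A dual ?S"
  then obtain n f where f: "f \<in> mod_hom A (power_module n dual) ?S"
    and surj: "f ` carrier (power_module n dual) = carrier ?S" unfolding in_gen_def by blast
  let ?D = "power_module n dual" and ?b = "bas (v, 0) 0 (1::'k)"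
  show "\<exists>m. (v, m) \<in> maximal"
  proof (rule ccontr)
    assume no: "\<nexists>m. (v, m) \<in> maximal"
    have fin: "finite {k. (v, k) \<in> W}"
      by (rule finite_subset[OF _ finite_imageI[OF finite_W, of snd]]) force
    define k0 where "k0 = Max {k. (v, k) \<in> W}"
    have k0: "(v, k0) \<in> W" using Max_in[OF fin] W_trivial[OF v] unfolding k0_def by auto
    have le: "k \<le> k0" if "(v, k) \<in> W" for k using Max_ge[OF fin] that unfolding k0_def by simp
    have "(v, Suc k0) \<notin> W" using le[of "Suc k0"] by auto
    then obtain u0 where u0: "vtx s u0 1 = v" "(u0, Suc k0) \<in> W" using no k0 unfolding maximal_def by auto
    have up: "(u0, Suc k) \<in> W" if "(v, k) \<in> W" for k using W_head[OF u0(2), of "Suc k"] le[OF that] by simp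
    \<comment> \<open>Strips the arrow from \<open>u0\<close> to \<open>v\<close> off the start of a
      path and drops all other paths, so by \<open>Dl_aa\<close> it undoes right multiplication by
      this arrow.\<close>
    define Dl where "Dl x = el (\<lambda>(a, k). if a = v then co x (u0, Suc k) else 0)" for x
    have Dl: "Dl x \<in> carrier A" "p \<in> W \<Longrightarrow> co (Dl x) p = (if fst p = v then co x (u0, Suc (snd p)) else 0)" for x p
      unfolding Dl_def by (rule el) (cases p; simp add: el)
    have Dl_add: "Dl (x \<oplus> y) = Dl x \<oplus> Dl y" if "x \<in> carrier A" "y \<in> carrier A" for x y
      using that up by (intro co_inj) (auto simp: Dl co_add)
    have Dl_sc: "Dl (sc c \<otimes> x) = sc c \<otimes> Dl x" if "x \<in> carrier A" for c x
    proof (rule co_inj)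
      fix p assume p: "p \<in> W"
      then show "co (Dl (sc c \<otimes> x)) p = co (sc c \<otimes> Dl x) p"
        using that up by (cases p) (auto simp: Dl co_sc_mult)
    qed (use that Dl(1) in simp_all)
    have Dl_aa: "Dl (x \<otimes> aa 1) = x \<otimes> ee v" if "x \<in> carrier A" for x
    proof (rule co_inj)
      fix p assume p: "p \<in> W"
      then show "co (Dl (x \<otimes> aa 1)) p = co (x \<otimes> ee v) p"
        using that up u0(1) by (cases p) (auto simp: Dl co_mult_aa co_mult_ee)
    qed (use that Dl(1) in simp_all)
    have "?b \<in> f ` carrier ?D" unfolding surj by (rule bas0_carrier)
    then obtain \<Xi> where \<Xi>: "?b = f \<Xi>" "\<Xi> \<in> carrier ?D" by (elim imageE)
    have \<Xi>i: "\<Xi> i \<in> carrier dual" if "i < n" for i using \<Xi>(2) that unfolding power_carrier by auto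
    define H where "H = (\<lambda>i\<in>{..<n}. restrict (\<lambda>x. \<Xi> i (Dl x)) (carrier A))"
    have Hi: "restrict (\<lambda>x. \<Xi> i (Dl x)) (carrier A) \<in> carrier dual" if "i < n" for i
      by (rule dualI) (simp_all add: Dl_add Dl_sc dualD[OF \<Xi>i[OF that]] Dl(1))
    have H: "H \<in> carrier ?D" unfolding power_carrier H_def using Hi by auto
    have "aa 1 \<odot>\<^bsub>?D\<^esub> H = ee v \<odot>\<^bsub>?D\<^esub> \<Xi>"
      unfolding power_smult dual_smult H_def by (intro restrict_ext) (simp add: Dl_aa[unfolded One_nat_def])
    then have "aa 1 \<odot>\<^bsub>?S\<^esub> f H = ee v \<odot>\<^bsub>?S\<^esub> ?b"
      using mod_homD(4)[OF f gens_closed(1) H, of 1] mod_homD(4)[OF f gens_closed(2) \<Xi>(2), of v] \<Xi>(1) by simp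
    then have "?b = (\<lambda>i. 0)"
      using simple_aa_zero[OF v mod_homD(1)[OF f H]] ee_bas0[OF W_trivial[OF v], of 1] by simp
    then show False using bas_nonzero[of 1 "(v, 0)" 0] by simp
  qed
qed

text \<open>A maximal path ending at \<open>v\<close> spans a copy of the simple module. Conversely
  the generator of a copy has a nonzero component \<open>x\<close> with
  \<open>ee v \<otimes> x = x\<close> and \<open>aa 1 \<otimes> x = \<zero>\<close>: every path in
  the support of \<open>x\<close> ends at \<open>v\<close> and cannot be prolonged there, so a
  maximal path through it ends at \<open>v\<close> as well.\<close>

theorem simple_in_cogen:
  assumes v: "v \<in> V"
  shows "in_cogen A (regular_module A) (mdl {(v, 0)}) \<longleftrightarrow> (\<exists>u m. (u, m) \<in> maximal \<and> vtx s u m = v)"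
proof
  let ?S = "mdl {(v, 0)}"
  assume "\<exists>u m. (u, m) \<in> maximal \<and> vtx s u m = v"
  then obtain u m where m: "(u, m) \<in> maximal" "vtx s u m = v" by auto
  let ?z = "aa m \<otimes> ee u" and ?R = "power_module 1 (regular_module A)"
  let ?f = "\<lambda>x. \<lambda>i\<in>{..<1::nat}. sc (x (enc (v, 0) 0)) \<otimes> ?z"
  have R: "carrier (regular_module A) = carrier A" "add (regular_module A) = add A" "smult (regular_module A) = mult A"
    by (simp_all add: regular_module_def)
  have "restrict ?f (carrier ?S) \<in> mod_hom A ?S ?R"
  proof (rule mod_hom_restrictI[OF lm_interval[OF W_trivial[OF v]]])
    show "?f x \<in> carrier ?R" for x unfolding power_carrier R by auto
    show "?f (x \<oplus>\<^bsub>?S\<^esub> y) = ?f x \<oplus>\<^bsub>?R\<^esub> ?f y" for x y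
      unfolding power_add R by (rule restrict_ext) (simp add: sc_add A.l_distr)
  next
    fix a x assume *: "a \<in> carrier A" "x \<in> carrier ?S"
    have "sc c \<otimes> (a \<otimes> ?z) = a \<otimes> (sc c \<otimes> ?z)" for c
      using *(1) by (simp add: sc_central A.m_assoc)
    then have "a \<otimes> (sc c \<otimes> ?z) = sc (co a (v, 0) * c) \<otimes> ?z" for c
      using mult_maximal_end[OF m(1) *(1)] m(2) by (simp add: sc_mult A.m_assoc mult.commute)
    then show "?f (a \<odot>\<^bsub>?S\<^esub> x) = a \<odot>\<^bsub>?R\<^esub> ?f x"
      unfolding power_smult R by (intro restrict_ext) (simp add: mdl_smult)
  qed
  moreover have "inj_on (restrict ?f (carrier ?S)) (carrier ?S)"
  proof (rule inj_onI)
    fix x y assume xy: "x \<in> carrier ?S" "y \<in> carrier ?S" "restrict ?f (carrier ?S) x = restrict ?f (carrier ?S) y"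
    then have eq: "sc (x (enc (v, 0) 0)) \<otimes> ?z = sc (y (enc (v, 0) 0)) \<otimes> ?z"
      by (auto dest: fun_cong[where x = 0])
    have uW: "(u, m) \<in> W" "(u, 0) \<in> W" using maximalD(1)[OF m(1)] W_vertex W_trivial by auto
    have "co (sc c \<otimes> ?z) (u, m) = c" for c using uW by (simp add: co_simps)
    then have "x (enc (v, 0) 0) = y (enc (v, 0) 0)" using eq by metis
    then show "x = y" using simple_element[OF xy(1)] simple_element[OF xy(2)] by simp
  qed
  ultimately show "in_cogen A (regular_module A) ?S" unfolding in_cogen_def by (intro exI[of _ 1] bexI[of _ "restrict ?f (carrier ?S)"])
next
  let ?S = "mdl {(v, 0)}"
  assume "in_cogen A (regular_module A) ?S"
  then obtain n f where f: "f \<in> mod_hom A ?S (power_module n (regular_module A))"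
    and inj: "inj_on f (carrier ?S)" unfolding in_cogen_def by blast
  let ?R = "power_module n (regular_module A)" and ?b = "bas (v, 0) 0 (1::'k)"
  have vW: "{(v, 0)} \<subseteq> W" using W_trivial[OF v] by simp
  have b: "?b \<in> carrier ?S" by (rule bas0_carrier)
  have fb: "f ?b \<in> {..<n} \<rightarrow>\<^sub>E carrier A" using mod_homD(1)[OF f b] by (simp add: power_module_def regular_module_def)
  have act: "f (a \<odot>\<^bsub>?S\<^esub> ?b) = (\<lambda>i\<in>{..<n}. a \<otimes> f ?b i)" if "a \<in> carrier A" for a
    using mod_homD(4)[OF f that b] by (simp add: power_smult regular_module_def)
  have zero: "f (\<lambda>i. 0) = (\<lambda>i\<in>{..<n}. \<zero>)"
  proof -
    have "sc 0 \<odot>\<^bsub>?S\<^esub> ?b = (\<lambda>i. 0)" by (rule enc_ext) (simp add: mdl_sc[OF vW b])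
    then have "f (\<lambda>i. 0) = (\<lambda>i\<in>{..<n}. sc 0 \<otimes> f ?b i)" using act[of "sc 0"] by simp
    also have "\<dots> = (\<lambda>i\<in>{..<n}. \<zero>)" by (rule restrict_ext) (use PiE_mem[OF fb] in \<open>simp add: sc_0\<close>)
    finally show ?thesis .
  qed
  have "\<exists>i<n. f ?b i \<noteq> \<zero>"
  proof (rule ccontr)
    assume "\<not> ?thesis"
    then have "f ?b = (\<lambda>i\<in>{..<n}. \<zero>)" using fb by (intro ext) (auto simp: PiE_def extensional_def)
    then have "f ?b = f (\<lambda>i. 0)" using zero by simp
    moreover have "(\<lambda>i. 0) \<in> carrier ?S" by (simp add: mdl_carrier)
    ultimately have "?b = (\<lambda>i. 0)" using inj b by (auto dest: inj_onD)
    then show False using bas_nonzero[of 1 "(v, 0)" 0] by simp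
  qed
  then obtain i where i: "i < n" "f ?b i \<noteq> \<zero>" by auto
  define x where "x = f ?b i"
  have x: "x \<in> carrier A" "x \<noteq> \<zero>" using fb i unfolding x_def by auto
  have ex: "ee v \<otimes> x = x"
    using fun_cong[OF act[OF gens_closed(2), of v], of i] ee_bas0[OF W_trivial[OF v], of 1] i(1) by (simp add: x_def)
  have ax: "aa 1 \<otimes> x = \<zero>"
    using fun_cong[OF act[OF gens_closed(1), of 1], of i] simple_aa_zero[OF v b] zero i(1) by (simp add: x_def)
  have "\<exists>p\<in>W. co x p \<noteq> 0"
  proof (rule ccontr)
    assume "\<not> ?thesis"
    then have "x = \<zero>" using x(1) by (intro co_inj) (auto simp: co_zero)
    then show False using x(2) by simp
  qed
  then obtain p where p: "p \<in> W" "co x p \<noteq> 0" by auto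
  obtain u k where uk: "p = (u, k)" by (cases p)
  have uW: "(u, k) \<in> W" using p uk by simp
  have vk: "vtx s u k = v" using co_ee_mult[OF x(1) uW, of v] ex p(2) uk by (auto split: if_splits)
  have nk: "(u, Suc k) \<notin> W"
  proof
    assume *: "(u, Suc k) \<in> W"
    then show False using co_aa_mult[OF x(1) *, of 1] ax co_zero[OF *] p(2) uk by simp
  qed
  obtain a m j where m: "(a, m) \<in> maximal" "vtx s a j = u" "j + k \<le> m" by (rule in_maximal[OF uW])
  have "m = j + k"
  proof (rule ccontr)
    assume "m \<noteq> j + k"
    then have "(vtx s a j, Suc k) \<in> W" using W_sub[OF maximalD(1)[OF m(1)], of j "Suc k"] m(3) by simp
    then show False using nk m(2) by simp
  qed
  then have "vtx s a m = v" using m(2) vk vtx_vtx[of s a j k] by simp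
  then show "\<exists>u m. (u, m) \<in> maximal \<and> vtx s u m = v" using m(1) by blast
qed

lemma simple_in_gen_cogen:
  assumes "left_module A N" "v \<in> V" "mod_iso A N (mdl {(v, 0)})"
  shows "in_gen A dual N \<and> in_cogen A (regular_module A) N \<longleftrightarrow> v \<in> shared"
proof -
  have lv: "left_module A (mdl {(v, 0)})" by (rule lm_interval[OF W_trivial[OF assms(2)]])
  have sym: "mod_iso A (mdl {(v, 0)}) N" by (rule mod_iso_sym[OF assms(1) lv assms(3)])
  have "in_gen A dual N \<longleftrightarrow> in_gen A dual (mdl {(v, 0)})"
    using in_gen_iso[OF _ assms(3) dual_add_closed dual_smult_closed] in_gen_iso[OF _ sym dual_add_closed dual_smult_closed] by blast
  moreover have "in_cogen A (regular_module A) N \<longleftrightarrow> in_cogen A (regular_module A) (mdl {(v, 0)})"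
    using in_cogen_iso[OF assms(1) _ assms(3)] in_cogen_iso[OF lv _ sym] by blast
  ultimately have "in_gen A dual N \<and> in_cogen A (regular_module A) N \<longleftrightarrow>
      (\<exists>m. (v, m) \<in> maximal) \<and> (\<exists>u m. (u, m) \<in> maximal \<and> vtx s u m = v)"
    using simple_in_gen[OF assms(2)] simple_in_cogen[OF assms(2)] by (simp only:)
  then show ?thesis unfolding shared_def by (simp only: mem_Collect_eq)
qed

end

section \<open>Path algebras and their monomial ideals\<close>

definition single :: "('v, 'e) qpath \<Rightarrow> 'k \<Rightarrow> ('v, 'e) qpath \<Rightarrow> 'k::field" where
  "single y c = (\<lambda>x. if x = y then c else 0)"

lemma path_elem_single: "path_elem y = single y 1"
  by (simp add: path_elem_def single_def)

context wf_digraph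
begin

lemma paths_iff: "(u, p) \<in> paths G \<longleftrightarrow> awalk u p (awlast u p)"
  unfolding paths_def by auto

lemma paths_append: "(u, p @ q) \<in> paths G \<longleftrightarrow> (u, p) \<in> paths G \<and> (awlast u p, q) \<in> paths G"
  unfolding paths_iff awlast_append by simp

lemma paths_Nil: "(u, []) \<in> paths G \<longleftrightarrow> u \<in> verts G"
  unfolding paths_iff by (simp add: awalk_def)

lemma awlast_path: "(u, p) \<in> paths G \<Longrightarrow> awlast u p \<in> verts G"
  unfolding paths_iff by auto

abbreviation KG :: "(('a, 'b) qpath \<Rightarrow> 'k::field) ring" where "KG \<equiv> path_algebra G"

lemma KG_carrier: "f \<in> carrier KG \<longleftrightarrow> finite {x. f x \<noteq> 0} \<and> {x. f x \<noteq> 0} \<subseteq> paths G"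
  by (simp add: path_algebra_def)

lemma KG_carrier_finiteI:
  assumes "finite X" "X \<subseteq> paths G" "\<And>x. f x \<noteq> 0 \<Longrightarrow> x \<in> X"
  shows "f \<in> carrier KG"
proof -
  have "{x. f x \<noteq> 0} \<subseteq> X" using assms(3) by auto
  then show ?thesis unfolding KG_carrier using assms(1,2) finite_subset by blast
qed

lemma KG_zero: "\<zero>\<^bsub>KG\<^esub> = (\<lambda>x. 0)"
  by (simp add: path_algebra_def)

lemma KG_add: "(f \<oplus>\<^bsub>KG\<^esub> g) x = f x + g x"
  by (simp add: path_algebra_def)

lemma KG_one: "\<one>\<^bsub>KG\<^esub> (u, p) = (if u \<in> verts G \<and> p = [] then 1 else 0)"
  by (simp add: path_algebra_def)

lemma KG_mult: "(f \<otimes>\<^bsub>KG\<^esub> g) (u, p) = (\<Sum>i\<le>length p. f (awlast u (take i p), drop i p) * g (u, take i p))"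
  by (simp add: path_algebra_def)

lemma KG_mult_nonzero:
  assumes "(f \<otimes>\<^bsub>KG\<^esub> g) (u, p) \<noteq> 0"
  obtains q r where "p = r @ q" "f (awlast u r, q) \<noteq> 0" "g (u, r) \<noteq> 0"
proof -
  from assms obtain i where "f (awlast u (take i p), drop i p) * g (u, take i p) \<noteq> 0"
    unfolding KG_mult by (rule sum.not_neutral_contains_not_neutral)
  then show ?thesis by (intro that[of "take i p" "drop i p"]) auto
qed

lemma KG_add_closed:
  assumes "f \<in> carrier KG" "g \<in> carrier KG"
  shows "f \<oplus>\<^bsub>KG\<^esub> g \<in> carrier KG"
proof (rule KG_carrier_finiteI)
  show "finite ({x. f x \<noteq> 0} \<union> {x. g x \<noteq> 0})" "{x. f x \<noteq> 0} \<union> {x. g x \<noteq> 0} \<subseteq> paths G"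
    using assms unfolding KG_carrier by auto
qed (auto simp: KG_add)

lemma KG_mult_closed:
  assumes "f \<in> carrier KG" "g \<in> carrier KG"
  shows "f \<otimes>\<^bsub>KG\<^esub> g \<in> carrier KG"
proof (rule KG_carrier_finiteI)
  let ?c = "\<lambda>((v, q), (u, r)). (u, r @ q)"
  let ?P = "{xy \<in> {x. f x \<noteq> 0} \<times> {x. g x \<noteq> 0}. fst (fst xy) = awlast (fst (snd xy)) (snd (snd xy))}"
  have "finite ({x. f x \<noteq> 0} \<times> {x. g x \<noteq> 0})" using assms unfolding KG_carrier by simp
  then show "finite (?c ` ?P)" by simp
  show "?c ` ?P \<subseteq> paths G"
  proof
    fix z assume "z \<in> ?c ` ?P"
    then obtain v q u r where z: "z = (u, r @ q)" "v = awlast u r" "f (v, q) \<noteq> 0" "g (u, r) \<noteq> 0" by auto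
    then show "z \<in> paths G" using assms unfolding KG_carrier by (auto simp: paths_append)
  qed
  fix x assume *: "(f \<otimes>\<^bsub>KG\<^esub> g) x \<noteq> 0"
  obtain u p where x: "x = (u, p)" by (cases x)
  obtain q r where qr: "p = r @ q" "f (awlast u r, q) \<noteq> 0" "g (u, r) \<noteq> 0"
    by (rule KG_mult_nonzero[OF *[unfolded x]])
  show "x \<in> ?c ` ?P" by (rule image_eqI[of _ _ "((awlast u r, q), (u, r))"]) (use x qr in simp_all)
qed

lemma KG_one_closed: "finite (verts G) \<Longrightarrow> \<one>\<^bsub>KG\<^esub> \<in> carrier KG"
proof (rule KG_carrier_finiteI)
  assume "finite (verts G)"
  then show "finite ((\<lambda>u. (u, [])) ` verts G)" by simp
  show "(\<lambda>u. (u, [])) ` verts G \<subseteq> paths G" by (auto simp: paths_Nil)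
  show "x \<in> (\<lambda>u. (u, [])) ` verts G" if "\<one>\<^bsub>KG\<^esub> x \<noteq> 0" for x
    using that by (cases x) (auto simp: KG_one split: if_splits)
qed

lemma KG_assoc: "(f \<otimes>\<^bsub>KG\<^esub> g) \<otimes>\<^bsub>KG\<^esub> h = f \<otimes>\<^bsub>KG\<^esub> (g \<otimes>\<^bsub>KG\<^esub> h)"
proof (rule ext)
  fix x :: "('a, 'b) qpath"
  obtain u p where x: "x = (u, p)" by (cases x)
  let ?n = "length p"
  define F where "F q r = f (awlast u (take q p), drop q p) * (g (awlast u (take r p), drop r (take q p)) * h (u, take r p))" for q r
  have "(f \<otimes>\<^bsub>KG\<^esub> (g \<otimes>\<^bsub>KG\<^esub> h)) (u, p) = (\<Sum>q\<le>?n. \<Sum>r\<le>q. F q r)"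
    unfolding KG_mult[of f]
  proof (rule sum.cong[OF refl])
    fix q assume "q \<in> {..?n}"
    then have l: "length (take q p) = q" by simp
    show "f (awlast u (take q p), drop q p) * (g \<otimes>\<^bsub>KG\<^esub> h) (u, take q p) = (\<Sum>r\<le>q. F q r)"
      unfolding KG_mult l sum_distrib_left F_def by (rule sum.cong[OF refl]) (simp add: min_absorb1)
  qed
  also have "\<dots> = (\<Sum>r\<le>?n. \<Sum>i\<le>?n - r. F (r + i) r)" by (rule sum_triangle_shift)
  also have "\<dots> = (\<Sum>r\<le>?n. \<Sum>i\<le>?n - r. f (awlast (awlast u (take r p)) (take i (drop r p)), drop i (drop r p)) *
      g (awlast u (take r p), take i (drop r p)) * h (u, take r p))"
  proof (intro sum.cong refl)
    fix r i
    have "awlast u (take (r + i) p) = awlast (awlast u (take r p)) (take i (drop r p))"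
      unfolding take_add awlast_append ..
    then show "F (r + i) r = f (awlast (awlast u (take r p)) (take i (drop r p)), drop i (drop r p)) *
      g (awlast u (take r p), take i (drop r p)) * h (u, take r p)"
      unfolding F_def by (simp add: drop_take add.commute mult.assoc)
  qed
  also have "\<dots> = ((f \<otimes>\<^bsub>KG\<^esub> g) \<otimes>\<^bsub>KG\<^esub> h) (u, p)"
    by (simp add: KG_mult sum_distrib_right)
  finally show "((f \<otimes>\<^bsub>KG\<^esub> g) \<otimes>\<^bsub>KG\<^esub> h) x = (f \<otimes>\<^bsub>KG\<^esub> (g \<otimes>\<^bsub>KG\<^esub> h)) x" unfolding x by simp
qed

lemma KG_l_one:
  assumes "f \<in> carrier KG"
  shows "\<one>\<^bsub>KG\<^esub> \<otimes>\<^bsub>KG\<^esub> f = f"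
proof (rule ext)
  fix x :: "('a, 'b) qpath"
  obtain u p where x: "x = (u, p)" by (cases x)
  have "(\<one>\<^bsub>KG\<^esub> \<otimes>\<^bsub>KG\<^esub> f) (u, p) = (\<Sum>i\<le>length p. if i = length p then \<one>\<^bsub>KG\<^esub> (awlast u p, []) * f (u, p) else 0)"
    unfolding KG_mult by (rule sum.cong) (auto simp: KG_one)
  also have "\<dots> = \<one>\<^bsub>KG\<^esub> (awlast u p, []) * f (u, p)" by (simp add: sum.delta)
  also have "\<dots> = f (u, p)"
  proof (cases "f (u, p) = 0")
    case False
    then have "awlast u p \<in> verts G" using assms awlast_path unfolding KG_carrier by auto
    then show ?thesis by (simp add: KG_one)
  qed simp
  finally show "(\<one>\<^bsub>KG\<^esub> \<otimes>\<^bsub>KG\<^esub> f) x = f x" unfolding x .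
qed

lemma KG_r_one:
  assumes "f \<in> carrier KG"
  shows "f \<otimes>\<^bsub>KG\<^esub> \<one>\<^bsub>KG\<^esub> = f"
proof (rule ext)
  fix x :: "('a, 'b) qpath"
  obtain u p where x: "x = (u, p)" by (cases x)
  have "(f \<otimes>\<^bsub>KG\<^esub> \<one>\<^bsub>KG\<^esub>) (u, p) = (\<Sum>i\<le>length p. if i = 0 then f (u, p) * \<one>\<^bsub>KG\<^esub> (u, []) else 0)"
    unfolding KG_mult by (rule sum.cong) (auto simp: KG_one)
  also have "\<dots> = f (u, p) * \<one>\<^bsub>KG\<^esub> (u, [])" by (simp add: sum.delta)
  also have "\<dots> = f (u, p)"
  proof (cases "f (u, p) = 0")
    case False
    then have "(u, p) \<in> paths G" using assms unfolding KG_carrier by auto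
    then have "u \<in> verts G" unfolding paths_iff by (auto simp: awalk_def)
    then show ?thesis by (simp add: KG_one)
  qed simp
  finally show "(f \<otimes>\<^bsub>KG\<^esub> \<one>\<^bsub>KG\<^esub>) x = f x" unfolding x .
qed

lemma ring_KG:
  assumes "finite (verts G)"
  shows "ring (KG :: (('a, 'b) qpath \<Rightarrow> 'k::field) ring)"
proof (rule ringI)
  show "abelian_group (KG :: (('a, 'b) qpath \<Rightarrow> 'k) ring)"
  proof (rule abelian_groupI)
    show "\<zero>\<^bsub>KG\<^esub> \<in> carrier (KG :: (('a, 'b) qpath \<Rightarrow> 'k) ring)" by (simp add: KG_carrier KG_zero)
    fix f :: "('a, 'b) qpath \<Rightarrow> 'k" assume f: "f \<in> carrier KG"
    show "\<exists>g\<in>carrier KG. g \<oplus>\<^bsub>KG\<^esub> f = \<zero>\<^bsub>KG\<^esub>"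
      by (rule bexI[of _ "\<lambda>x. - f x"]) (use f in \<open>simp_all add: fun_eq_iff KG_add KG_zero KG_carrier\<close>)
  qed (simp_all add: KG_add_closed fun_eq_iff KG_add KG_zero algebra_simps)
  show "monoid (KG :: (('a, 'b) qpath \<Rightarrow> 'k) ring)"
    by (rule monoidI) (simp_all add: KG_mult_closed KG_one_closed[OF assms] KG_assoc KG_l_one KG_r_one)
  fix f g h :: "('a, 'b) qpath \<Rightarrow> 'k"
  show "(f \<oplus>\<^bsub>KG\<^esub> g) \<otimes>\<^bsub>KG\<^esub> h = f \<otimes>\<^bsub>KG\<^esub> h \<oplus>\<^bsub>KG\<^esub> g \<otimes>\<^bsub>KG\<^esub> h"
    by (rule ext, rename_tac x, case_tac x) (simp add: KG_add KG_mult algebra_simps sum.distrib)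
  show "h \<otimes>\<^bsub>KG\<^esub> (f \<oplus>\<^bsub>KG\<^esub> g) = h \<otimes>\<^bsub>KG\<^esub> f \<oplus>\<^bsub>KG\<^esub> h \<otimes>\<^bsub>KG\<^esub> g"
    by (rule ext, rename_tac x, case_tac x) (simp add: KG_add KG_mult algebra_simps sum.distrib)
qed

section \<open>Ideals generated by paths\<close>

lemma single_closed: "y \<in> paths G \<Longrightarrow> single y c \<in> carrier KG"
  by (rule KG_carrier_finiteI[of "{y}"]) (auto simp: single_def split: if_splits)

lemma single_mult:
  assumes "awlast u r = v"
  shows "single (v, q) c \<otimes>\<^bsub>KG\<^esub> single (u, r) d = single (u, r @ q) (c * d)"
proof (rule ext)
  fix x :: "('a, 'b) qpath"
  obtain w p where x: "x = (w, p)" by (cases x)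
  have "(single (v, q) c \<otimes>\<^bsub>KG\<^esub> single (u, r) d) (w, p) =
      (\<Sum>i\<le>length p. if i = length r then (if w = u \<and> p = r @ q then c * d else 0) else 0)"
    unfolding KG_mult
  proof (rule sum.cong[OF refl])
    fix i assume "i \<in> {..length p}"
    then have i: "i \<le> length p" by simp
    have eq: "take i p = r \<and> drop i p = q \<longleftrightarrow> i = length r \<and> p = r @ q"
      using i append_take_drop_id[of i p] by (auto simp: min_def)
    have "single (v, q) c (awlast w (take i p), drop i p) * single (u, r) d (w, take i p) =
        (if w = u \<and> take i p = r \<and> drop i p = q then c * d else 0)"
      using assms by (auto simp: single_def)
    then show "single (v, q) c (awlast w (take i p), drop i p) * single (u, r) d (w, take i p) =
        (if i = length r then if w = u \<and> p = r @ q then c * d else 0 else 0)" unfolding eq by simp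
  qed
  also have "\<dots> = (if w = u \<and> p = r @ q then c * d else 0)" by (simp add: sum.delta)
  finally show "(single (v, q) c \<otimes>\<^bsub>KG\<^esub> single (u, r) d) x = single (u, r @ q) (c * d) x"
    unfolding x by (simp add: single_def)
qed

definition meets :: "('a, 'b) qpath set \<Rightarrow> ('a, 'b) qpath \<Rightarrow> bool" where
  "meets S y \<longleftrightarrow> (\<exists>x\<in>S. \<exists>p q. snd y = p @ snd x @ q \<and> awlast (fst y) p = fst x)"

text \<open>The elements supported on paths with a subpath in \<open>S\<close> form an ideal, and
  each such path is a product of the subpath with paths on both sides. Membership in the ideal can
  thus be decided coefficient by coefficient.\<close>

lemma genideal_paths:
  assumes fin: "finite (verts G)" and S: "S \<subseteq> paths G"
  shows "Idl\<^bsub>KG\<^esub> (path_elem ` S) = {f \<in> carrier (KG :: (('a, 'b) qpath \<Rightarrow> 'k::field) ring). \<forall>y. f y \<noteq> 0 \<longrightarrow> meets S y}"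
    (is "?I = ?J")
proof -
  let ?R = "KG :: (('a, 'b) qpath \<Rightarrow> 'k) ring"
  interpret R: ring ?R by (rule ring_KG[OF fin])
  have gens: "path_elem ` S \<subseteq> carrier ?R" unfolding path_elem_single using S single_closed by auto
  interpret I: ideal ?I ?R by (rule R.genideal_ideal[OF gens])
  have neg: "\<ominus>\<^bsub>?R\<^esub> f = (\<lambda>x. - f x)" if f: "f \<in> carrier ?R" for f
  proof (rule R.minus_equality)
    show "(\<lambda>x. - f x) \<oplus>\<^bsub>?R\<^esub> f = \<zero>\<^bsub>?R\<^esub>" by (simp add: fun_eq_iff KG_add KG_zero)
  qed (use f in \<open>simp_all add: KG_carrier\<close>)
  have JD: "meets S y" if "f \<in> ?J" "f y \<noteq> 0" for f y
  proof -
    from CollectD[OF that(1)] have "\<forall>y. f y \<noteq> 0 \<longrightarrow> meets S y" by (rule conjunct2)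
    then have "f y \<noteq> 0 \<longrightarrow> meets S y" by (rule spec)
    then show ?thesis using that(2) by (rule mp)
  qed
  have "ideal ?J ?R"
  proof (rule idealI[OF R.ring_axioms])
    show "subgroup ?J (add_monoid ?R)"
    proof (rule R.add.subgroupI)
      show "?J \<noteq> {}" using R.zero_closed by (auto simp: KG_zero)
      fix f assume "f \<in> ?J"
      then show "\<ominus>\<^bsub>?R\<^esub> f \<in> ?J" using neg[of f] R.a_inv_closed[of f] by simp
    next
      fix f g assume fg: "f \<in> ?J" "g \<in> ?J"
      show "f \<oplus>\<^bsub>?R\<^esub> g \<in> ?J"
      proof (intro CollectI conjI allI impI)
        show "f \<oplus>\<^bsub>?R\<^esub> g \<in> carrier ?R" using fg by simp
        fix y assume "(f \<oplus>\<^bsub>?R\<^esub> g) y \<noteq> 0"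
        then have "f y \<noteq> 0 \<or> g y \<noteq> 0" unfolding KG_add by auto
        then show "meets S y" using JD[OF fg(1)] JD[OF fg(2)] by (elim disjE)
      qed
    qed auto
  next
    fix f g assume f: "f \<in> ?J" and g: "g \<in> carrier ?R"
    show "g \<otimes>\<^bsub>?R\<^esub> f \<in> ?J"
    proof (intro CollectI conjI allI impI)
      show "g \<otimes>\<^bsub>?R\<^esub> f \<in> carrier ?R" using f g by simp
      fix y assume *: "(g \<otimes>\<^bsub>?R\<^esub> f) y \<noteq> 0"
      obtain u p where y: "y = (u, p)" by (cases y)
      obtain q r where qr: "p = r @ q" "f (u, r) \<noteq> 0" by (rule KG_mult_nonzero[OF *[unfolded y]])
      then have "meets S (u, r)" using f by simp
      then obtain x p1 p2 where "x \<in> S" "r = p1 @ snd x @ p2" "awlast u p1 = fst x" unfolding meets_def by auto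
      then show "meets S y" unfolding meets_def y qr(1)
        by (intro bexI[of _ x] exI[of _ p1] exI[of _ "p2 @ q"]) simp_all
    qed
    show "f \<otimes>\<^bsub>?R\<^esub> g \<in> ?J"
    proof (intro CollectI conjI allI impI)
      show "f \<otimes>\<^bsub>?R\<^esub> g \<in> carrier ?R" using f g by simp
      fix y assume *: "(f \<otimes>\<^bsub>?R\<^esub> g) y \<noteq> 0"
      obtain u p where y: "y = (u, p)" by (cases y)
      obtain q r where qr: "p = r @ q" "f (awlast u r, q) \<noteq> 0" by (rule KG_mult_nonzero[OF *[unfolded y]])
      then have "meets S (awlast u r, q)" using f by simp
      then obtain x p1 p2 where "x \<in> S" "q = p1 @ snd x @ p2" "awlast (awlast u r) p1 = fst x" unfolding meets_def by auto
      then show "meets S y" unfolding meets_def y qr(1)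
        by (intro bexI[of _ x] exI[of _ "r @ p1"] exI[of _ p2]) (simp_all add: awlast_append)
    qed
  qed
  moreover have "path_elem ` S \<subseteq> ?J"
  proof
    fix f assume "f \<in> (path_elem ` S :: (('a, 'b) qpath \<Rightarrow> 'k) set)"
    then obtain x where x: "x \<in> S" "f = path_elem x" by auto
    have "meets S x" unfolding meets_def by (intro bexI[OF _ x(1)] exI[of _ "[]"]) simp
    then show "f \<in> ?J" using gens x by (auto simp: path_elem_def split: if_splits)
  qed
  ultimately have sub: "?I \<subseteq> ?J" by (rule R.genideal_minimal)
  have fin_support: "f \<in> ?I" if "finite X" "f \<in> ?J" "\<And>x. f x \<noteq> 0 \<Longrightarrow> x \<in> X" for f X
    using that
  proof (induction X arbitrary: f rule: finite_induct)
    case empty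
    have "f = \<zero>\<^bsub>?R\<^esub>"
    proof (rule ext)
      fix x show "f x = \<zero>\<^bsub>?R\<^esub> x" using empty.prems(2)[of x] by (auto simp: KG_zero)
    qed
    then show ?case using I.zero_closed by simp
  next
    case (insert y X)
    have "(f(y := 0)) \<in> ?J" using insert.prems(1) by (auto simp: KG_carrier elim: rev_finite_subset)
    moreover have "x \<in> X" if "(f(y := 0)) x \<noteq> 0" for x using insert.prems(2)[of x] that by (auto split: if_splits)
    ultimately have 1: "f(y := 0) \<in> ?I" by (rule insert.IH)
    have 2: "single y (f y) \<in> ?I"
    proof (cases "f y = 0")
      case True
      then have "single y (f y) = \<zero>\<^bsub>?R\<^esub>" by (simp add: single_def KG_zero)
      then show ?thesis using I.zero_closed by simp
    next
      case False
      then have "meets S y" "y \<in> paths G" using JD[OF insert.prems(1) False] insert.prems(1) unfolding KG_carrier by auto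
      then obtain u x p q where x: "x \<in> S" "y = (u, p @ snd x @ q)" "awlast u p = fst x"
        unfolding meets_def by (cases y) auto
      obtain v r where vr: "x = (v, r)" by (cases x)
      have pq: "(u, p) \<in> paths G" "(awlast v r, q) \<in> paths G"
        using \<open>y \<in> paths G\<close> x vr by (simp_all add: paths_append)
      have "single (awlast v r, q) (f y) \<otimes>\<^bsub>?R\<^esub> (path_elem x \<otimes>\<^bsub>?R\<^esub> single (u, p) 1) = single y (f y)"
        using x vr by (simp add: path_elem_single single_mult awlast_append)
      moreover have "path_elem x \<in> ?I" using R.genideal_self[OF gens] x(1) by auto
      from I.I_l_closed[OF I.I_r_closed[OF this single_closed[OF pq(1), of 1]] single_closed[OF pq(2), of "f y"]]
      have "single (awlast v r, q) (f y) \<otimes>\<^bsub>?R\<^esub> (path_elem x \<otimes>\<^bsub>?R\<^esub> single (u, p) 1) \<in> ?I" .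
      ultimately show ?thesis by (simp only:)
    qed
    have "f(y := 0) \<oplus>\<^bsub>?R\<^esub> single y (f y) = f" by (rule ext) (simp add: KG_add single_def)
    then show ?case using I.a_closed[OF 1 2] by (simp only:)
  qed
  have "?J \<subseteq> ?I"
  proof
    fix f assume f: "f \<in> ?J"
    then have "finite {x. f x \<noteq> 0}" unfolding KG_carrier by simp
    then show "f \<in> ?I" using f by (rule fin_support) simp
  qed
  with sub show ?thesis by (rule equalityI)
qed

text \<open>Together with admissibility this puts paths of some fixed length into the ideal, which
  bounds the length of nonzero paths.\<close>

lemma path_in_arrow_ideal_power:
  assumes "finite (verts G)" "(u, p) \<in> paths G"
  shows "(path_elem (u, p) :: ('a, 'b) qpath \<Rightarrow> 'k::field) \<in> arrow_ideal_power G (length p)"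
  using assms(2)
proof (induction p rule: rev_induct)
  case Nil
  then show ?case unfolding path_elem_single arrow_ideal_power_def by (simp add: single_closed)
next
  case (snoc e p)
  let ?R = "KG :: (('a, 'b) qpath \<Rightarrow> 'k) ring"
  interpret R: ring ?R by (rule ring_KG[OF assms(1)])
  have P: "(u, p) \<in> paths G" "(awlast u p, [e]) \<in> paths G" using snoc.prems by (simp_all add: paths_append)
  have "path_elem ` {x \<in> paths G. length (snd x) = 1} \<subseteq> carrier ?R"
    unfolding path_elem_single using single_closed by auto
  from R.genideal_self[OF this] have "path_elem (awlast u p, [e]) \<in> (arrow_ideal G :: (('a, 'b) qpath \<Rightarrow> 'k) set)"
    unfolding arrow_ideal_def using P(2) by auto
  then have "path_elem (awlast u p, [e]) \<otimes>\<^bsub>?R\<^esub> path_elem (u, p) \<in> ideal_prod ?R (arrow_ideal G) (arrow_ideal_power G (length p))"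
    using snoc.IH[OF P(1)] by (rule ideal_prod.prod)
  then show ?case unfolding path_elem_single by (simp add: single_mult arrow_ideal_power_def)
qed

end

section \<open>Quadratic Nakayama algebras in coordinates\<close>

text \<open>
  In the quivers considered here every vertex starts at most one arrow, which has the same name as
  the vertex; so a path is determined by its starting vertex and its length.
\<close>

locale functional_quiver = wf_digraph Q for Q :: "(nat, nat) pre_digraph" +
  assumes finite_verts: "finite (verts Q)"
    and tail_id: "tail Q e = e"
    and head_inj: "u \<in> verts Q \<Longrightarrow> u' \<in> verts Q \<Longrightarrow> vtx (head Q) u i = vtx (head Q) u' i \<Longrightarrow> u = u'"
    and arrow_near: "v \<in> verts Q \<Longrightarrow> v \<in> arcs Q \<or> (\<exists>u\<in>arcs Q. head Q u = v)"
begin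

abbreviation nth_vertex :: "nat \<Rightarrow> nat \<Rightarrow> nat" where "nth_vertex \<equiv> vtx (head Q)"

definition pth :: "nat \<Rightarrow> nat \<Rightarrow> (nat, nat) qpath" where
  "pth u m = (u, map (nth_vertex u) [0..<m])"

lemma nth_vertex_Suc: "nth_vertex u (Suc i) = head Q (nth_vertex u i)"
  by (simp add: vtx_def)

lemma arcs_verts: "e \<in> arcs Q \<Longrightarrow> e \<in> verts Q"
  using tail_in_verts[of e] by (simp add: tail_id)

lemma awlast_pth: "awlast u (map (nth_vertex u) [0..<m]) = nth_vertex u m"
  by (induction m) (simp_all add: awlast_append nth_vertex_Suc)

lemma single_arrow_path: "(w, [e]) \<in> paths Q \<longleftrightarrow> e \<in> arcs Q \<and> w = e"
  unfolding paths_def by (auto simp: awalk_def tail_id arcs_verts)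

lemma paths_pth: "(u, p) \<in> paths Q \<longleftrightarrow>
    u \<in> verts Q \<and> p = map (nth_vertex u) [0..<length p] \<and> (\<forall>i<length p. nth_vertex u i \<in> arcs Q)"
proof (induction p rule: rev_induct)
  case Nil
  then show ?case by (simp add: paths_Nil)
next
  case (snoc e p)
  show ?case
  proof (cases "p = map (nth_vertex u) [0..<length p]")
    case True
    then have "awlast u p = nth_vertex u (length p)" using awlast_pth[of u "length p"] by simp
    then have "(u, p @ [e]) \<in> paths Q \<longleftrightarrow> (u, p) \<in> paths Q \<and> e \<in> arcs Q \<and> nth_vertex u (length p) = e"
      by (simp add: paths_append single_arrow_path)
    then show ?thesis using snoc True by (auto simp: less_Suc_eq)
  next
    case False
    then have "(u, p @ [e]) \<notin> paths Q" using snoc by (simp add: paths_append)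
    then show ?thesis using False by simp
  qed
qed

lemma pth_path: "pth u m \<in> paths Q \<longleftrightarrow> u \<in> verts Q \<and> (\<forall>i<m. nth_vertex u i \<in> arcs Q)"
  unfolding pth_def by (simp add: paths_pth)

lemma take_pth: "i \<le> m \<Longrightarrow> take i (map (nth_vertex u) [0..<m]) = map (nth_vertex u) [0..<i]"
  by (simp add: take_map)

lemma drop_pth: "i \<le> m \<Longrightarrow> drop i (map (nth_vertex u) [0..<m]) = map (nth_vertex (nth_vertex u i)) [0..<m - i]"
  by (rule nth_equalityI) (simp_all add: add.commute)

end

text \<open>\<open>S\<close> is the set of relations and \<open>M\<close> an exponent supplied by
  admissibility.\<close>

locale nakayama_ideal = functional_quiver +
  fixes S :: "(nat, nat) qpath set" and I :: "((nat, nat) qpath \<Rightarrow> 'k::field) set" and M :: nat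
  assumes S: "S \<subseteq> {x \<in> paths Q. length (snd x) = 2}"
    and I: "I = Idl\<^bsub>path_algebra Q\<^esub> (path_elem ` S)"
    and long_paths: "arrow_ideal_power Q M \<subseteq> I"
begin

abbreviation R :: "((nat, nat) qpath \<Rightarrow> 'k) ring" where "R \<equiv> path_algebra Q"

sublocale R: ring R by (rule ring_KG[OF finite_verts])

lemma I_iff: "f \<in> I \<longleftrightarrow> f \<in> carrier R \<and> (\<forall>y. f y \<noteq> 0 \<longrightarrow> meets S y)"
proof -
  have "S \<subseteq> paths Q" using S by auto
  then show ?thesis unfolding I by (simp only: genideal_paths[OF finite_verts] mem_Collect_eq)
qed

lemma I_meets:
  assumes "f \<in> I" "f y \<noteq> 0"
  shows "meets S y"
proof -
  from iffD1[OF I_iff assms(1)] have "\<forall>y. f y \<noteq> 0 \<longrightarrow> meets S y" by (rule conjunct2)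
  then have "f y \<noteq> 0 \<longrightarrow> meets S y" by (rule spec)
  then show ?thesis using assms(2) by (rule mp)
qed

sublocale I: ideal I R
  unfolding I by (rule R.genideal_ideal) (use S single_closed in \<open>auto simp: path_elem_single\<close>)

definition W :: "(nat \<times> nat) set" where
  "W = {(u, m). pth u m \<in> paths Q \<and> \<not> meets S (pth u m)}"

lemma meets_pth: "meets S (pth u m) \<longleftrightarrow> (\<exists>i. Suc (Suc i) \<le> m \<and> pth (nth_vertex u i) 2 \<in> S)"
proof
  assume "meets S (pth u m)"
  then obtain x p q where x: "x \<in> S" "snd (pth u m) = p @ snd x @ q" "awlast (fst (pth u m)) p = fst x"
    unfolding meets_def by auto
  obtain a r where ar: "x = (a, r)" by (cases x)
  have r: "length r = 2" "(a, r) \<in> paths Q" using S x(1) ar by auto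
  then have "r = map (nth_vertex a) [0..<2]" using paths_pth[of a r] by simp
  then have xp: "x = pth a 2" unfolding ar pth_def by simp
  let ?i = "length p"
  have eq: "map (nth_vertex u) [0..<m] = p @ r @ q" using x(2) ar by (simp add: pth_def)
  from arg_cong[OF this, of length] have le: "Suc (Suc ?i) \<le> m" using r(1) by simp
  have "p = map (nth_vertex u) [0..<?i]"
    using arg_cong[OF eq, of "take ?i"] take_pth[of ?i m u] le by simp
  then have "awlast u p = nth_vertex u ?i" using awlast_pth[of u ?i] by simp
  then have "a = nth_vertex u ?i" using x(3) ar by (simp add: pth_def)
  then show "\<exists>i. Suc (Suc i) \<le> m \<and> pth (nth_vertex u i) 2 \<in> S" using le x(1) xp by auto
next
  assume "\<exists>i. Suc (Suc i) \<le> m \<and> pth (nth_vertex u i) 2 \<in> S"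
  then obtain i where i: "Suc (Suc i) \<le> m" "pth (nth_vertex u i) 2 \<in> S" by auto
  have "map (nth_vertex u) [0..<m] = take i (map (nth_vertex u) [0..<m]) @ take 2 (drop i (map (nth_vertex u) [0..<m]))
      @ drop 2 (drop i (map (nth_vertex u) [0..<m]))" by (simp only: append_take_drop_id)
  moreover have "take 2 (drop i (map (nth_vertex u) [0..<m])) = map (nth_vertex (nth_vertex u i)) [0..<2]"
    using i(1) by (simp add: drop_pth take_pth)
  moreover have "take i (map (nth_vertex u) [0..<m]) = map (nth_vertex u) [0..<i]"
    using i(1) by (simp add: take_pth)
  ultimately have "map (nth_vertex u) [0..<m] = map (nth_vertex u) [0..<i] @ map (nth_vertex (nth_vertex u i)) [0..<2]
      @ drop 2 (drop i (map (nth_vertex u) [0..<m]))" by (simp only:)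
  then show "meets S (pth u m)" unfolding meets_def
    by (intro bexI[OF _ i(2)] exI[of _ "map (nth_vertex u) [0..<i]"]
        exI[of _ "drop 2 (drop i (map (nth_vertex u) [0..<m]))"] conjI)
      (simp_all add: pth_def awlast_pth del: drop_drop)
qed

lemma W_iff: "(u, m) \<in> W \<longleftrightarrow> u \<in> verts Q \<and> (\<forall>i<m. nth_vertex u i \<in> arcs Q) \<and>
    (\<forall>i. Suc (Suc i) \<le> m \<longrightarrow> pth (nth_vertex u i) 2 \<notin> S)"
  unfolding W_def by (simp add: meets_pth pth_path)

lemma W_prefix: "(u, m) \<in> W \<Longrightarrow> j \<le> m \<Longrightarrow> (u, j) \<in> W"
  unfolding W_iff by auto

lemma W_bound:
  assumes "(u, m) \<in> W"
  shows "m < M"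
proof (rule ccontr)
  assume "\<not> m < M"
  then have uM: "(u, M) \<in> W" using W_prefix[OF assms, of M] by simp
  have "(path_elem (pth u M) :: (nat, nat) qpath \<Rightarrow> 'k) \<in> arrow_ideal_power Q M"
    using path_in_arrow_ideal_power[OF finite_verts, of u "map (nth_vertex u) [0..<M]"] uM
    unfolding W_def pth_def by simp
  then have "(path_elem (pth u M) :: (nat, nat) qpath \<Rightarrow> 'k) \<in> I" using long_paths by auto
  then have "meets S (pth u M)" by (rule I_meets) (simp add: path_elem_def)
  then show False using uM unfolding W_def by simp
qed

lemma nth_vertex_verts:
  assumes "u \<in> verts Q" "\<And>j. j < i \<Longrightarrow> nth_vertex u j \<in> arcs Q"
  shows "nth_vertex u i \<in> verts Q"
  using assms by (cases i) (simp_all add: nth_vertex_Suc)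

lemma nakayama_quiver: "nakayama_quiver (verts Q) (head Q) W"
proof
  show "finite W"
  proof (rule finite_subset)
    show "W \<subseteq> verts Q \<times> {..<M}"
    proof
      fix p assume "p \<in> W"
      then show "p \<in> verts Q \<times> {..<M}" using W_bound[of "fst p" "snd p"] W_iff[of "fst p" "snd p"] by (cases p) simp
    qed
    show "finite (verts Q \<times> {..<M})" using finite_verts by simp
  qed
next
  fix u m assume "(u, m) \<in> W"
  then show "u \<in> verts Q" by (simp add: W_iff)
next
  fix v assume "v \<in> verts Q"
  then show "(v, 0) \<in> W" by (simp add: W_iff)
next
  fix u m i j assume *: "(u, m) \<in> W" "i + j \<le> m"
  have "nth_vertex u i \<in> verts Q" by (rule nth_vertex_verts) (use * in \<open>auto simp: W_iff\<close>)
  then show "(nth_vertex u i, j) \<in> W" using * unfolding W_iff by simp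
next
  fix u i j assume 1: "(u, Suc i) \<in> W" and 2: "(nth_vertex u i, Suc j) \<in> W"
  \<comment> \<open>A relation consists of two consecutive arrows, so it lies inside one of two
    paths that overlap in an arrow.\<close>
  show "(u, Suc (i + j)) \<in> W" unfolding W_iff
  proof (intro conjI allI impI)
    show "u \<in> verts Q" using 1 by (simp add: W_iff)
    fix k assume k: "k < Suc (i + j)"
    show "nth_vertex u k \<in> arcs Q"
    proof (cases "k < i")
      case True
      then show ?thesis using 1 by (simp add: W_iff)
    next
      case False
      then obtain k' where "k = i + k'" using le_Suc_ex[of i k] by auto
      then show ?thesis using 2 k by (auto simp: W_iff)
    qed
  next
    fix k assume k: "Suc (Suc k) \<le> Suc (i + j)"
    show "pth (nth_vertex u k) 2 \<notin> S"
    proof (cases "k < i")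
      case True
      then show ?thesis using 1 by (simp add: W_iff)
    next
      case False
      then obtain k' where "k = i + k'" using le_Suc_ex[of i k] by auto
      then show ?thesis using 2 k by (auto simp: W_iff)
    qed
  qed
next
  fix u u' i assume "u \<in> verts Q" "u' \<in> verts Q" "nth_vertex u i = nth_vertex u' i"
  then show "u = u'" by (rule head_inj)
next
  fix v assume v: "v \<in> verts Q"
  then show "(v, 1) \<in> W \<or> (\<exists>u. (u, 1) \<in> W \<and> nth_vertex u 1 = v)"
    using arrow_near[OF v] arcs_verts by (auto simp: W_iff nth_vertex_Suc)
qed

text \<open>The coefficient of a chosen representative. Elements of \<open>I\<close> have
  coefficient zero at the paths in \<open>W\<close>, so at these the value depends on the coset
  alone.\<close>

definition co :: "((nat, nat) qpath \<Rightarrow> 'k) set \<Rightarrow> nat \<times> nat \<Rightarrow> 'k" where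
  "co X p = (SOME f. f \<in> X) (pth (fst p) (snd p))"

lemma co_coset:
  assumes f: "f \<in> carrier R" and p: "(u, m) \<in> W"
  shows "co (I +>\<^bsub>R\<^esub> f) (u, m) = f (pth u m)"
proof -
  let ?g = "SOME g. g \<in> I +>\<^bsub>R\<^esub> f"
  have "?g \<in> I +>\<^bsub>R\<^esub> f" using I.a_rcos_self[OF f] by (rule someI[of "\<lambda>g. g \<in> I +>\<^bsub>R\<^esub> f"])
  then obtain h where h: "h \<in> I" "?g = h \<oplus>\<^bsub>R\<^esub> f" unfolding a_r_coset_def' by auto
  have "h (pth u m) = 0" using I_meets[OF h(1), of "pth u m"] p unfolding W_def by auto
  then show ?thesis unfolding co_def h(2) by (simp add: KG_add)
qed

lemma coset_cases:
  assumes "X \<in> carrier (R Quot I)"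
  obtains f where "f \<in> carrier R" "X = I +>\<^bsub>R\<^esub> f"
  using assms unfolding FactRing_def A_RCOSETS_def' by auto

lemma coset_closed: "f \<in> carrier R \<Longrightarrow> I +>\<^bsub>R\<^esub> f \<in> carrier (R Quot I)"
  unfolding FactRing_def A_RCOSETS_def' by auto

lemma coset_mult: "f \<in> carrier R \<Longrightarrow> g \<in> carrier R \<Longrightarrow>
    (I +>\<^bsub>R\<^esub> f) \<otimes>\<^bsub>R Quot I\<^esub> (I +>\<^bsub>R\<^esub> g) = I +>\<^bsub>R\<^esub> (f \<otimes>\<^bsub>R\<^esub> g)"
  by (simp add: FactRing_def I.rcoset_mult_add)

lemma coset_add: "f \<in> carrier R \<Longrightarrow> g \<in> carrier R \<Longrightarrow>
    (I +>\<^bsub>R\<^esub> f) \<oplus>\<^bsub>R Quot I\<^esub> (I +>\<^bsub>R\<^esub> g) = I +>\<^bsub>R\<^esub> (f \<oplus>\<^bsub>R\<^esub> g)"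
  by (simp add: FactRing_def I.a_rcos_sum)

lemma coset_one: "\<one>\<^bsub>R Quot I\<^esub> = I +>\<^bsub>R\<^esub> \<one>\<^bsub>R\<^esub>"
  by (simp add: FactRing_def)

lemma coset_eqI:
  assumes f: "f \<in> carrier R" and g: "g \<in> carrier R" and eq: "\<And>u m. (u, m) \<in> W \<Longrightarrow> f (pth u m) = g (pth u m)"
  shows "I +>\<^bsub>R\<^esub> f = I +>\<^bsub>R\<^esub> g"
proof -
  define h where "h = f \<ominus>\<^bsub>R\<^esub> g"
  have h: "h \<in> carrier R" using f g by (simp add: h_def)
  have "h \<oplus>\<^bsub>R\<^esub> g = f" unfolding h_def using f g by (simp add: a_minus_def R.a_assoc R.l_neg)
  then have fg: "h y + g y = f y" for y by (metis KG_add)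
  have "h \<in> I" unfolding I_iff
  proof (intro conjI allI impI h)
    fix y assume nz: "h y \<noteq> 0"
    then have "y \<in> paths Q" using h unfolding KG_carrier by auto
    moreover obtain u p where "y = (u, p)" by (cases y)
    ultimately have y: "y = pth u (length p)" unfolding pth_def using paths_pth[of u p] by simp
    show "meets S y"
    proof (rule ccontr)
      assume "\<not> meets S y"
      then have "(u, length p) \<in> W" using y \<open>y \<in> paths Q\<close> unfolding W_def by simp
      then show False using eq[of u "length p"] fg[of y] nz y by simp
    qed
  qed
  then show ?thesis using R.quotient_eq_iff_same_a_r_cos[OF I.ideal_axioms f g] unfolding h_def by simp
qed

lemma coset_surj: "\<exists>f\<in>carrier R. \<forall>u m. (u, m) \<in> W \<longrightarrow> f (pth u m) = c (u, m)"
proof -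
  interpret nakayama_quiver "verts Q" "head Q" W by (rule nakayama_quiver)
  let ?X = "(\<lambda>p. pth (fst p) (snd p)) ` W"
  let ?f = "\<lambda>y. if y \<in> ?X then c (fst y, length (snd y)) else 0"
  have "?f \<in> carrier R"
  proof (rule KG_carrier_finiteI)
    show "finite ?X" using finite_W by simp
    show "?X \<subseteq> paths Q" by (auto simp: W_def)
  qed (simp split: if_splits)
  moreover have "?f (pth u m) = c (u, m)" if "(u, m) \<in> W" for u m
  proof -
    have "pth u m \<in> ?X" using that by (intro image_eqI[of _ _ "(u, m)"]) simp_all
    then show ?thesis by (simp add: pth_def)
  qed
  ultimately show ?thesis by (intro bexI[of _ ?f]) simp_all
qed

sublocale N: nakayama_algebra "verts Q" "head Q" W "R Quot I" co
proof (intro nakayama_algebra.intro nakayama_quiver I.quotient_is_ring nakayama_algebra_axioms.intro)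
  fix X Y assume "X \<in> carrier (R Quot I)" "Y \<in> carrier (R Quot I)" and eq: "\<And>p. p \<in> W \<Longrightarrow> co X p = co Y p"
  then obtain f g where fg: "f \<in> carrier R" "X = I +>\<^bsub>R\<^esub> f" "g \<in> carrier R" "Y = I +>\<^bsub>R\<^esub> g"
    by (elim coset_cases) (rule that)
  show "X = Y" unfolding fg(2,4)
  proof (rule coset_eqI[OF fg(1,3)])
    fix u m assume "(u, m) \<in> W"
    then show "f (pth u m) = g (pth u m)" using eq[of "(u, m)"] co_coset fg by simp
  qed
next
  fix c :: "nat \<times> nat \<Rightarrow> 'k"
  obtain f where f: "f \<in> carrier R" "\<And>u m. (u, m) \<in> W \<Longrightarrow> f (pth u m) = c (u, m)"
    using coset_surj[of c] by blast
  have "co (I +>\<^bsub>R\<^esub> f) p = c p" if "p \<in> W" for p using that f co_coset by (cases p) simp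
  then show "\<exists>X\<in>carrier (R Quot I). \<forall>p\<in>W. co X p = c p" using coset_closed[OF f(1)] by blast
next
  fix X Y p assume "X \<in> carrier (R Quot I)" "Y \<in> carrier (R Quot I)" and p: "p \<in> W"
  then obtain f g where fg: "f \<in> carrier R" "X = I +>\<^bsub>R\<^esub> f" "g \<in> carrier R" "Y = I +>\<^bsub>R\<^esub> g"
    by (elim coset_cases) (rule that)
  show "co (X \<oplus>\<^bsub>R Quot I\<^esub> Y) p = co X p + co Y p"
    using p fg by (cases p) (simp add: coset_add co_coset KG_add)
next
  fix u m assume "(u, m) \<in> W"
  then show "co \<one>\<^bsub>R Quot I\<^esub> (u, m) = (if m = 0 then 1 else 0)"
    unfolding coset_one by (auto simp: co_coset pth_def KG_one W_iff)
next
  fix X Y u m assume "X \<in> carrier (R Quot I)" "Y \<in> carrier (R Quot I)" and p: "(u, m) \<in> W"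
  then obtain f g where fg: "f \<in> carrier R" "X = I +>\<^bsub>R\<^esub> f" "g \<in> carrier R" "Y = I +>\<^bsub>R\<^esub> g"
    by (elim coset_cases) (rule that)
  have "co (X \<otimes>\<^bsub>R Quot I\<^esub> Y) (u, m) = (f \<otimes>\<^bsub>R\<^esub> g) (pth u m)"
    unfolding fg(2,4) coset_mult[OF fg(1,3)] by (rule co_coset) (use fg p in simp_all)
  also have "\<dots> = (\<Sum>i\<le>m. f (pth (nth_vertex u i) (m - i)) * g (pth u i))"
    unfolding pth_def KG_mult by (rule sum.cong) (simp_all add: take_pth drop_pth awlast_pth)
  also have "\<dots> = (\<Sum>i\<le>m. co X (nth_vertex u i, m - i) * co Y (u, i))"
  proof (rule sum.cong[OF refl])
    fix i assume "i \<in> {..m}"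
    then have "(nth_vertex u i, m - i) \<in> W" "(u, i) \<in> W"
      using nakayama_quiver.W_sub[OF nakayama_quiver p, of i "m - i"] W_prefix[OF p, of i] by simp_all
    then show "f (pth (nth_vertex u i) (m - i)) * g (pth u i) = co X (nth_vertex u i, m - i) * co Y (u, i)"
      using fg co_coset by simp
  qed
  finally show "co (X \<otimes>\<^bsub>R Quot I\<^esub> Y) (u, m) = (\<Sum>i\<le>m. co X (nth_vertex u i, m - i) * co Y (u, i))" .
qed

text \<open>Identifies the scalars used in \<open>in_G\<close> with those of the abstract algebra,
  hence also the two forms of the dual module.\<close>

lemma scalar_sc: "scalar Q I = N.sc"
proof (rule ext)
  fix c :: 'k
  let ?f = "\<lambda>x. c * \<one>\<^bsub>R\<^esub> x"
  have f: "?f \<in> carrier R"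
  proof (rule KG_carrier_finiteI)
    show "finite {x. \<one>\<^bsub>R\<^esub> x \<noteq> 0}" "{x. \<one>\<^bsub>R\<^esub> x \<noteq> 0} \<subseteq> paths Q"
      using R.one_closed unfolding KG_carrier by simp_all
  qed simp
  show "scalar Q I c = N.sc c" unfolding scalar_def
  proof (rule N.co_inj[OF coset_closed[OF f]])
    fix p assume p: "p \<in> W"
    then show "co (I +>\<^bsub>R\<^esub> ?f) p = co (N.sc c) p"
      by (cases p) (auto simp: co_coset[OF f] N.co_gens pth_def KG_one W_iff)
  qed simp
qed

end

section \<open>Linear and cyclic quivers\<close>

lemma functional_linear_quiver:
  assumes "arcs (linear_quiver n) \<noteq> {}"
  shows "functional_quiver (linear_quiver n)"
proof
  \<comment> \<open>An arrow forces a second vertex, and then every vertex touches an arrow.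
    Injectivity is that of adding \<open>i\<close>, since \<open>head\<close> is \<open>Suc\<close>
    on all numbers.\<close>
  have n: "2 \<le> n" using assms by (auto simp: linear_quiver_def)
  show "v \<in> arcs (linear_quiver n) \<or> (\<exists>u\<in>arcs (linear_quiver n). head (linear_quiver n) u = v)"
    if "v \<in> verts (linear_quiver n)" for v
    using that n by (cases v) (auto simp: linear_quiver_def)
qed (auto simp: linear_quiver_def vtx_def)

lemma functional_cyclic_quiver:
  assumes "arcs (cyclic_quiver n) \<noteq> {}"
  shows "functional_quiver (cyclic_quiver n)"
proof
  have n: "0 < n" using assms by (auto simp: cyclic_quiver_def)
  \<comment> \<open>In this closed form injectivity becomes cancellation of \<open>i\<close> modulo
    \<open>n\<close>.\<close>
  have v: "vtx (\<lambda>i. Suc i mod n) u i = (u + i) mod n" if "u < n" for u i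
    unfolding vtx_def using that by (induction i) (simp_all add: mod_Suc_eq)
  show "u = u'" if "u \<in> verts (cyclic_quiver n)" "u' \<in> verts (cyclic_quiver n)"
    "vtx (head (cyclic_quiver n)) u i = vtx (head (cyclic_quiver n)) u' i" for u u' i
  proof -
    have u: "u < n" "u' < n" using that by (simp_all add: cyclic_quiver_def)
    have "(u + i) mod n = (u' + i) mod n" using that(3) v u by (simp add: cyclic_quiver_def)
    have "a = b" if "a \<le> b" "b < n" "(a + i) mod n = (b + i) mod n" for a b
    proof -
      have "n dvd b - a" using mod_eq_dvd_iff_nat[of "a + i" "b + i" n] that by simp
      then show ?thesis using that(1,2) dvd_imp_le[of n "b - a"] by (cases "a = b") simp_all
    qed
    then show ?thesis using u \<open>(u + i) mod n = (u' + i) mod n\<close> by (metis nat_le_linear)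
  qed
qed (auto simp: cyclic_quiver_def)

section \<open>Counting basic faithfully balanced modules\<close>

context nakayama_algebra
begin

text \<open>Applied with two predicates \<open>C\<close>, membership in gen and cogen and occurrence
  as a socle and a top; as both single out the same vertices, the two descriptions of
  \<open>g\<close> agree.\<close>

lemma card_simple_classes:
  assumes "X \<subseteq> V"
    and C: "\<And>(N :: ('a, nat \<Rightarrow> 'k) module) v. left_module A N \<Longrightarrow> v \<in> V \<Longrightarrow> mod_iso A N (mdl {(v, 0)}) \<Longrightarrow> C N \<longleftrightarrow> v \<in> X"
  shows "card (iso_classes A {N :: ('a, nat \<Rightarrow> 'k) module. fg_module A N \<and> simple_module A N \<and> C N}) = card X"
proof (rule card_iso_classes[where rep = "\<lambda>v. mdl {(v, 0)}"])
  fix N :: "('a, nat \<Rightarrow> 'k) module" assume "N \<in> {N. fg_module A N \<and> simple_module A N \<and> C N}"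
  then have N: "left_module A N" "simple_module A N" "C N" by (auto simp: fg_module_def)
  show "left_module A N" by (rule N(1))
  obtain v where v: "v \<in> V" "mod_iso A N (mdl {(v, 0)})" using simple_classification[OF N(1,2)] by auto
  then show "\<exists>v\<in>X. mod_iso A N (mdl {(v, 0)})" using C[OF N(1) v] N(3) by auto
next
  fix v assume "v \<in> X"
  then have v: "v \<in> V" "v \<in> X" using assms(1) by auto
  have W: "(v, 0) \<in> W" by (rule W_trivial[OF v(1)])
  show "mdl {(v, 0)} \<in> {N. fg_module A N \<and> simple_module A N \<and> C N}"
    using fg_module_mdl[of "{(v, 0)}"] W simple_mdl[OF v(1)]
      C[OF lm_interval[OF W] v(1) mod_iso_refl[OF lm_interval[OF W]]] v(2) by simp
next
  fix v w assume *: "v \<in> X" "w \<in> X" "mod_iso A (mdl {(v, 0)}) (mdl {(w, 0)})"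
  have "{(v, 0)} \<subseteq> W" "{(w, 0)} \<subseteq> W" using * assms(1) W_trivial by auto
  from mdl_iso_unique[OF this *(3)] show "v = w" by simp
qed

lemma card_faithfully_balanced:
  "card (iso_classes A {N :: ('a, nat \<Rightarrow> 'k) module. fg_module A N \<and> basic_module A N \<and> faithfully_balanced A N}) =
    card {S. S \<subseteq> W \<and> balanced S}"
proof (rule card_iso_classes[where rep = mdl])
  fix N :: "('a, nat \<Rightarrow> 'k) module"
  assume "N \<in> {N. fg_module A N \<and> basic_module A N \<and> faithfully_balanced A N}"
  then have N: "fg_module A N" "basic_module A N" "faithfully_balanced A N" by simp_all
  then show lN: "left_module A N" by (simp add: fg_module_def)
  obtain S where S: "S \<subseteq> W" "mod_iso A (mdl S) N" using basic_classification[OF lN N(2)] by auto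
  note lS = left_module_mdl[OF S(1)]
  have iso: "mod_iso A N (mdl S)" by (rule mod_iso_sym[OF lS lN S(2)])
  have "balanced S" by (rule faithfully_balanced_mdl_only_if[OF S(1) faithfully_balanced_iso[OF lN lS iso N(3)]])
  then show "\<exists>S\<in>{S. S \<subseteq> W \<and> balanced S}. mod_iso A N (mdl S)" using S(1) iso by blast
next
  fix S assume "S \<in> {S. S \<subseteq> W \<and> balanced S}"
  then have S: "S \<subseteq> W" "balanced S" by auto
  show "mdl S \<in> {N. fg_module A N \<and> basic_module A N \<and> faithfully_balanced A N}"
    using fg_module_mdl[OF S(1)] basic_mdl[OF S(1)] faithfully_balanced_mdl_if[OF S] by simp
next
  fix S T assume "S \<in> {S. S \<subseteq> W \<and> balanced S}" "T \<in> {S. S \<subseteq> W \<and> balanced S}" "mod_iso A (mdl S) (mdl T)"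
  then show "S = T" using mdl_iso_unique by blast
qed

lemma interval_copyI:
  assumes "w \<in> W" "left_module A P" "mod_iso A P (mdl {w})"
  obtains f where "interval_copy V s W A co P (fst w) (snd w) f"
proof -
  obtain f where "f \<in> mod_hom A P (mdl {w})" "bij_betw f (carrier P) (carrier (mdl {w}))"
    using assms(3) unfolding mod_iso_def by auto
  then show ?thesis
    by (intro that[of f] interval_copy.intro nakayama_algebra_axioms interval_copy_axioms.intro) (use assms(1,2) in simp_all)
qed

theorem count_faithfully_balanced:
  fixes P :: "nat \<Rightarrow> ('a, nat \<Rightarrow> 'k) module" and n k :: "nat \<Rightarrow> nat"
  assumes P: "\<forall>i\<in>{1..t}. fg_module A (P i) \<and> indecomposable A (P i) \<and> projective_module A (P i) \<and> injective_module A (P i)"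
    and distinct: "\<forall>i\<in>{1..t}. \<forall>j\<in>{1..t}. i \<noteq> j \<longrightarrow> \<not> mod_iso A (P i) (P j)"
    and complete: "\<forall>N :: ('a, nat \<Rightarrow> 'k) module.
      fg_module A N \<and> indecomposable A N \<and> projective_module A N \<and> injective_module A N \<longrightarrow> (\<exists>i\<in>{1..t}. mod_iso A N (P i))"
    and n: "\<forall>i\<in>{1..t}. n i = module_length A (P i)"
    and g: "g = card (iso_classes A {N :: ('a, nat \<Rightarrow> 'k) module. fg_module A N \<and> simple_module A N \<and>
      (in_gen A dual N \<and> in_cogen A (regular_module A) N)})"
    and k: "\<forall>i\<in>{1..t}. k i =
      (if (in_gen A dual (socle A (P i)) \<and> in_cogen A (regular_module A) (socle A (P i))) \<and>
          (in_gen A dual (top_module A (P i)) \<and> in_cogen A (regular_module A) (top_module A (P i))) then 2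
       else if (in_gen A dual (socle A (P i)) \<and> in_cogen A (regular_module A) (socle A (P i))) \<or>
          (in_gen A dual (top_module A (P i)) \<and> in_cogen A (regular_module A) (top_module A (P i))) then 1
       else 0)"
  shows "g = card (iso_classes A {N :: ('a, nat \<Rightarrow> 'k) module. fg_module A N \<and> simple_module A N \<and>
        (\<exists>i\<in>{1..t}. mod_iso A N (socle A (P i))) \<and> (\<exists>j\<in>{1..t}. mod_iso A N (top_module A (P j)))}) \<and>
      card (iso_classes A {N :: ('a, nat \<Rightarrow> 'k) module. fg_module A N \<and> basic_module A N \<and> faithfully_balanced A N}) =
      2 ^ g * (\<Prod>i=1..t. Nk (k i) (n i))"
proof -
  have lP: "left_module A (P i)" if "i \<in> {1..t}" for i using P that by (simp add: fg_module_def)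
  have "\<exists>w\<in>maximal. mod_iso A (P i) (mdl {w})" if i: "i \<in> {1..t}" for i
  proof -
    have Pi: "indecomposable A (P i)" "projective_module A (P i)" "injective_module A (P i)" using P i by auto
    obtain p where p: "p \<in> W" "mod_iso A (P i) (mdl {p})"
      using indecomposable_classification[OF lP[OF i] Pi(1)] by auto
    then show ?thesis using projective_injective_maximal[OF p(1) lP[OF i] Pi(2,3) p(2)] by auto
  qed
  then obtain w where w: "\<And>i. i \<in> {1..t} \<Longrightarrow> w i \<in> maximal" "\<And>i. i \<in> {1..t} \<Longrightarrow> mod_iso A (P i) (mdl {w i})"
    by metis
  have wW: "w i \<in> W" if "i \<in> {1..t}" for i by (rule maximal_W[OF w(1)[OF that]])
  have sym: "mod_iso A (mdl {w i}) (P i)" if "i \<in> {1..t}" for i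
    by (rule mod_iso_sym[OF lP[OF that] lm_interval[OF wW[OF that]] w(2)[OF that]])
  \<comment> \<open>The modules \<open>P i\<close> being pairwise non-isomorphic gives injectivity.
    Completeness gives surjectivity, because the interval module of a maximal path is itself an
    indecomposable projective-injective module of the required type.\<close>
  have bij: "bij_betw w {1..t} maximal"
    unfolding bij_betw_def
  proof (intro conjI inj_onI equalityI subsetI)
    fix i j assume ij: "i \<in> {1..t}" "j \<in> {1..t}" "w i = w j"
    have "mod_iso A (P i) (P j)"
      using mod_iso_trans[OF lP[OF ij(1)] w(2)[OF ij(1)]] sym[OF ij(2)] ij(3) by simp
    then show "i = j" using distinct ij(1,2) by blast
  next
    fix p assume p: "p \<in> maximal"
    then have pW: "p \<in> W" by (rule maximal_W)
    have "fg_module A (mdl {p})" by (rule fg_module_mdl) (use pW in simp)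
    then obtain i where i: "i \<in> {1..t}" "mod_iso A (mdl {p}) (P i)"
      using complete indecomposable_interval[OF pW] maximal_projective_injective[OF p] by blast
    have "{p} = {w i}"
      by (rule mdl_iso_unique[OF _ _ mod_iso_trans[OF lm_interval[OF pW] i(2) w(2)[OF i(1)]]]) (use pW wW[OF i(1)] in simp_all)
    then show "p \<in> w ` {1..t}" using i(1) by auto
  qed (use w(1) in auto)
  \<comment> \<open>The length of the module is the number of vertices of the path, one more than
    its number of arrows.\<close>
  have len: "n i = Suc (snd (w i))"
    and soc: "mod_iso A (socle A (P i)) (mdl {(vtx s (fst (w i)) (snd (w i)), 0)})" "left_module A (socle A (P i))"
    and top: "mod_iso A (top_module A (P i)) (mdl {(fst (w i), 0)})" "left_module A (top_module A (P i))"
    if i: "i \<in> {1..t}" for i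
  proof -
    obtain f where "interval_copy V s W A co (P i) (fst (w i)) (snd (w i)) f"
      by (rule interval_copyI[OF wW[OF i] lP[OF i] w(2)[OF i]])
    then interpret interval_copy V s W A co "P i" "fst (w i)" "snd (w i)" f .
    show "n i = Suc (snd (w i))" using n i module_length_interval by simp
    show "mod_iso A (socle A (P i)) (mdl {(vtx s (fst (w i)) (snd (w i)), 0)})" "left_module A (socle A (P i))"
      by (rule socle_interval)+
    show "mod_iso A (top_module A (P i)) (mdl {(fst (w i), 0)})" "left_module A (top_module A (P i))"
      by (rule top_interval)+
  qed
  have wV: "fst (w i) \<in> V" "vtx s (fst (w i)) (snd (w i)) \<in> V" if "i \<in> {1..t}" for i
    using wW[OF that] W_vertex[of "fst (w i)" "snd (w i)"] W_tail[of "fst (w i)" "snd (w i)" "snd (w i)"] by simp_all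
  have ki: "k i = (if fst (w i) \<in> shared \<and> vtx s (fst (w i)) (snd (w i)) \<in> shared then 2
      else if fst (w i) \<in> shared \<or> vtx s (fst (w i)) (snd (w i)) \<in> shared then 1 else 0)" if i: "i \<in> {1..t}" for i
    using bspec[OF k i] unfolding simple_in_gen_cogen[OF soc(2)[OF i] wV(2)[OF i] soc(1)[OF i]]
      simple_in_gen_cogen[OF top(2)[OF i] wV(1)[OF i] top(1)[OF i]] by (simp only: conj_commute disj_commute)
  have sV: "shared \<subseteq> V" using W_vertex[OF maximal_W] unfolding shared_def by auto
  have g_shared: "g = card shared"
    unfolding g by (rule card_simple_classes[OF sV]) (rule simple_in_gen_cogen)
  \<comment> \<open>\<open>L\<close> has a carrier type of its own, since the tops are quotient
    modules and their elements are cosets.\<close>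
  have simple_iso: "mod_iso A N L \<longleftrightarrow> v = u"
    if N: "left_module A N" "mod_iso A N (mdl {(v, 0)})" "v \<in> V"
      and L: "left_module A L" "mod_iso A L (mdl {(u, 0)})" "u \<in> V" for N :: "('a, nat \<Rightarrow> 'k) module" and L :: "('a, 'l) module" and u v
  proof
    have lv: "left_module A (mdl {(v, 0)})" by (rule lm_interval[OF W_trivial[OF N(3)]])
    assume "mod_iso A N L"
    then have "mod_iso A N (mdl {(u, 0)})" using mod_iso_trans[OF N(1) _ L(2)] by blast
    then have "mod_iso A (mdl {(v, 0)}) (mdl {(u, 0)})"
      by (rule mod_iso_trans[OF lv mod_iso_sym[OF N(1) lv N(2)]])
    moreover have "{(v, 0)} \<subseteq> W" "{(u, 0)} \<subseteq> W" using N(3) L(3) W_trivial by auto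
    ultimately have "{(v, 0)} = {(u, 0)}" using mdl_iso_unique[of "{(v, 0)}" "{(u, 0)}"] by blast
    then show "v = u" by simp
  next
    assume vu: "v = u"
    have lu: "left_module A (mdl {(u, 0)})" by (rule lm_interval[OF W_trivial[OF L(3)]])
    show "mod_iso A N L"
      by (rule mod_iso_trans[OF N(1) N(2)[unfolded vu] mod_iso_sym[OF L(1) lu L(2)]])
  qed
  have "card (iso_classes A {N :: ('a, nat \<Rightarrow> 'k) module. fg_module A N \<and> simple_module A N \<and>
        (\<exists>i\<in>{1..t}. mod_iso A N (socle A (P i))) \<and> (\<exists>j\<in>{1..t}. mod_iso A N (top_module A (P j)))}) = card shared"
  proof (rule card_simple_classes[OF sV])
    fix N :: "('a, nat \<Rightarrow> 'k) module" and v
    assume N: "left_module A N" "v \<in> V" "mod_iso A N (mdl {(v, 0)})"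
    have 1: "mod_iso A N (socle A (P i)) \<longleftrightarrow> v = vtx s (fst (w i)) (snd (w i))" if i: "i \<in> {1..t}" for i
      by (rule simple_iso[OF N(1,3,2) soc(2)[OF i] soc(1)[OF i] wV(2)[OF i]])
    have 2: "mod_iso A N (top_module A (P i)) \<longleftrightarrow> v = fst (w i)" if i: "i \<in> {1..t}" for i
      by (rule simple_iso[OF N(1,3,2) top(2)[OF i] top(1)[OF i] wV(1)[OF i]])
    have im: "maximal = w ` {1..t}" using bij by (simp add: bij_betw_def)
    have "(\<exists>i\<in>{1..t}. mod_iso A N (socle A (P i))) \<longleftrightarrow> (\<exists>p\<in>maximal. vtx s (fst p) (snd p) = v)"
      unfolding im using 1 by auto
    moreover have "(\<exists>i\<in>{1..t}. mod_iso A N (top_module A (P i))) \<longleftrightarrow> (\<exists>p\<in>maximal. fst p = v)"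
      unfolding im using 2 by auto
    moreover have "(\<exists>p\<in>maximal. fst p = v) \<longleftrightarrow> (\<exists>m. (v, m) \<in> maximal)"
      "(\<exists>p\<in>maximal. vtx s (fst p) (snd p) = v) \<longleftrightarrow> (\<exists>u m. (u, m) \<in> maximal \<and> vtx s u m = v)"
      by force+
    ultimately show "(\<exists>i\<in>{1..t}. mod_iso A N (socle A (P i))) \<and> (\<exists>j\<in>{1..t}. mod_iso A N (top_module A (P j))) \<longleftrightarrow> v \<in> shared"
      unfolding shared_def by (simp only: mem_Collect_eq conj_commute)
  qed
  moreover have "(\<Prod>i=1..t. Nk (k i) (n i)) = (\<Prod>p\<in>maximal. Nk (if fst p \<in> shared \<and> vtx s (fst p) (snd p) \<in> shared then 2
      else if fst p \<in> shared \<or> vtx s (fst p) (snd p) \<in> shared then 1 else 0) (Suc (snd p)))"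
    unfolding prod.reindex_bij_betw[OF bij, symmetric] by (rule prod.cong) (simp_all only: ki len)
  ultimately show ?thesis using card_faithfully_balanced card_balanced g_shared by (simp only:)
qed

end

theorem theorem7p2:
  fixes Q :: "(nat, nat) pre_digraph"
    and I :: "((nat, nat) qpath \<Rightarrow> 'k::field) set"
    and \<Lambda> :: "((nat, nat) qpath \<Rightarrow> 'k) set ring"
    and t g :: nat
    and P :: "nat \<Rightarrow> (((nat, nat) qpath \<Rightarrow> 'k) set, nat \<Rightarrow> 'k) module"
    and n k :: "nat \<Rightarrow> nat"
  assumes "quadratic_nakayama Q I"
    and "arcs Q \<noteq> {}"
    and "\<Lambda> = path_algebra Q Quot I"
    and "\<forall>i\<in>{1..t}. fg_module \<Lambda> (P i) \<and> indecomposable \<Lambda> (P i) \<and>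
           projective_module \<Lambda> (P i) \<and> injective_module \<Lambda> (P i)"
    and "\<forall>i\<in>{1..t}. \<forall>j\<in>{1..t}. i \<noteq> j \<longrightarrow> \<not> mod_iso \<Lambda> (P i) (P j)"
    and "\<forall>M::(((nat, nat) qpath \<Rightarrow> 'k) set, nat \<Rightarrow> 'k) module.
           fg_module \<Lambda> M \<and> indecomposable \<Lambda> M \<and> projective_module \<Lambda> M \<and> injective_module \<Lambda> M
           \<longrightarrow> (\<exists>i\<in>{1..t}. mod_iso \<Lambda> M (P i))"
    and "\<forall>i\<in>{1..t}. n i = module_length \<Lambda> (P i)"
    and "g = card (iso_classes \<Lambda>
           {S::(((nat, nat) qpath \<Rightarrow> 'k) set, nat \<Rightarrow> 'k) module.
              fg_module \<Lambda> S \<and> simple_module \<Lambda> S \<and> in_G Q I S})"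
    and "\<forall>i\<in>{1..t}. k i =
           (if in_G Q I (socle \<Lambda> (P i)) \<and> in_G Q I (top_module \<Lambda> (P i)) then 2
            else if in_G Q I (socle \<Lambda> (P i)) \<or> in_G Q I (top_module \<Lambda> (P i)) then 1
            else 0)"
  shows "g = card (iso_classes \<Lambda>
           {S::(((nat, nat) qpath \<Rightarrow> 'k) set, nat \<Rightarrow> 'k) module.
              fg_module \<Lambda> S \<and> simple_module \<Lambda> S \<and>
              (\<exists>i\<in>{1..t}. mod_iso \<Lambda> S (socle \<Lambda> (P i))) \<and>
              (\<exists>j\<in>{1..t}. mod_iso \<Lambda> S (top_module \<Lambda> (P j)))}) \<and>
         card (iso_classes \<Lambda>
           {M::(((nat, nat) qpath \<Rightarrow> 'k) set, nat \<Rightarrow> 'k) module.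
              fg_module \<Lambda> M \<and> basic_module \<Lambda> M \<and> faithfully_balanced \<Lambda> M}) =
         2 ^ g * (\<Prod>i=1..t. Nk (k i) (n i))"
proof -
  obtain r where r: "Q = linear_quiver r \<or> Q = cyclic_quiver r"
    using assms(1) unfolding quadratic_nakayama_def by auto
  obtain S where S: "S \<subseteq> {x \<in> paths Q. length (snd x) = 2}" "I = Idl\<^bsub>path_algebra Q\<^esub> (path_elem ` S)"
    using assms(1) unfolding quadratic_nakayama_def by auto
  obtain M where M: "arrow_ideal_power Q M \<subseteq> I"
    using assms(1) unfolding quadratic_nakayama_def admissible_def by auto
  \<comment> \<open>The existence of an arrow enters here, through the property that every vertex
    touches one.\<close>
  have "functional_quiver Q"
    using r functional_linear_quiver[of r] functional_cyclic_quiver[of r] assms(2) by auto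
  then interpret nakayama_ideal Q S I M
    by (rule nakayama_ideal.intro) (rule nakayama_ideal_axioms.intro[OF S M])
  show ?thesis
    using assms(4-) unfolding assms(3) in_G_def scalar_sc by (rule N.count_faithfully_balanced)
qed

end
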